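(* Let $\sigma \in \mathbb{R}\setminus\{0\}$ and $N\ge 1$. Given two functions $(\phi^0, \phi^1) \in H_{\sin}^1(\mathbb{R}^N) \times L^2(\mathbb{R}^N)$, there exists a unique solution $\phi \in C^0(\mathbb{R}, \phi^0 + H^1(\mathbb{R}^N))$, with $\partial_t \phi \in C^0(\mathbb{R}, L^2(\mathbb{R}^N))$, to the Sine-Gordon equation $$\partial_{tt} \phi - \Delta \phi + \frac{\sigma}{2} \sin(2 \phi) = 0$$ with initial conditions $\phi(\cdot,0)=\phi^0$, $\partial_t\phi(\cdot,0)=\phi^1$. Moreover, this solution satisfies the following statements. (i) For any positive number $T$, there exists a positive number $A$, depending only on $\sigma$ and $T$, such that the flow map $(\phi^0, \phi^1) \mapsto (\phi, \partial_t \phi)$ satisfies $$d_{\sin}^1 \big( \phi(\cdot, t), \tilde{\phi}(\cdot, t) \big) + \| \partial_t \phi(\cdot, t) - \partial_t \tilde{\phi}(\cdot, t) \|_{L^2} \leq A \Big( d_{\sin}^1 ( \phi^0, \tilde{\phi}^0 ) + \| \phi^1 - \tilde{\phi}^1 \|_{L^2} \Big),$$ for any $t \in [- T, T]$, where $\tilde{\phi}$ is the unique solution to the Sine-Gordon equation with initial conditions $(\tilde{\phi}^0, \tilde{\phi}^1)\in H_{\sin}^1(\mathbb{R}^N) \times L^2(\mathbb{R}^N)$. (ii) When $\phi^0 \in H_{\sin}^2(\mathbb{R}^N)$ and $\phi^1 \in H^1(\mathbb{R}^N)$, the solution $\phi$ belongs to $C^0(\mathbb{R}, \phi^0 + H^2(\mathbb{R}^N))$,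 with $\partial_t \phi \in C^0(\mathbb{R}, H^1(\mathbb{R}^N))$ and $\partial_{tt} \phi \in C^0(\mathbb{R}, L^2(\mathbb{R}^N))$. (iii) The Sine-Gordon energy $$E_{\rm SG}(\phi) := \frac{1}{2} \int_{\mathbb{R}^N} \big( (\partial_t \phi)^2 + |\nabla \phi|^2 + \sigma \sin(\phi)^2 \big)$$ is conserved along the flow.
   Context: For an integer $k \geq 1$, $H_{\sin}^k(\mathbb{R}^N) := \{ v \in L^1_{\rm loc}(\mathbb{R}^N,\mathbb{R}) : \nabla v \in H^{k - 1}(\mathbb{R}^N), \ \sin(v) \in L^2(\mathbb{R}^N) \}$, with the pseudometric $d_{\sin}^k(v_1, v_2) := ( \| \sin(v_1 - v_2) \|_{L^2}^2 + \| \nabla v_1 - \nabla v_2 \|_{H^{k - 1}}^2 )^{1/2}$ (where $H^0=L^2$). *)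

theory Defs
  imports "HOL-Analysis.Analysis"
begin

text \<open>
  The dimension is a natural number rather than an index type, so that a statement can ask for
  constants that do not depend on it. A point of \<open>R^N\<close> is an extensional function on \<open>{..<N}\<close>, and
  an \<open>L^p\<close> class is given by a Borel representative.
\<close>

type_synonym point = "nat \<Rightarrow> real"

definition RN :: "nat \<Rightarrow> point measure" where
  "RN N = PiM {..<N} (\<lambda>_. lborel)"

definition L2 :: "nat \<Rightarrow> (point \<Rightarrow> real) set" where
  "L2 N = {f \<in> borel_measurable (RN N). integrable (RN N) (\<lambda>x. (f x)\<^sup>2)}"

definition L2_norm :: "nat \<Rightarrow> (point \<Rightarrow> real) \<Rightarrow> real" where
  "L2_norm N f = sqrt (LINT x|RN N. (f x)\<^sup>2)"

definition L1_loc :: "nat \<Rightarrow> (point \<Rightarrow> real) set" where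
  "L1_loc N = {f \<in> borel_measurable (RN N).
     \<forall>K. compact K \<and> K \<subseteq> space (RN N) \<longrightarrow> set_integrable (RN N) K f}"

definition partial :: "nat \<Rightarrow> (point \<Rightarrow> real) \<Rightarrow> point \<Rightarrow> real" where
  "partial i f x = deriv (\<lambda>s. f (x(i := s))) (x i)"

primrec partials :: "nat list \<Rightarrow> (point \<Rightarrow> real) \<Rightarrow> point \<Rightarrow> real" where
  "partials [] f = f"
| "partials (i # is) f = partial i (partials is f)"

definition smooth :: "nat \<Rightarrow> (point \<Rightarrow> real) \<Rightarrow> bool" where
  "smooth N f \<longleftrightarrow>
     (\<forall>is. set is \<subseteq> {..<N} \<longrightarrow>
        continuous_on (space (RN N)) (partials is f) \<and>
        (\<forall>i<N. \<forall>x\<in>space (RN N). (\<lambda>s. partials is f (x(i := s))) differentiable (at (x i))))"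

definition test_fun :: "nat \<Rightarrow> (point \<Rightarrow> real) set" where
  "test_fun N = {\<psi>. smooth N \<psi> \<and>
     (\<exists>K. compact K \<and> K \<subseteq> space (RN N) \<and> (\<forall>x\<in>space (RN N) - K. \<psi> x = 0))}"

definition has_weak_deriv ::
  "nat \<Rightarrow> nat list \<Rightarrow> (point \<Rightarrow> real) \<Rightarrow> (point \<Rightarrow> real) \<Rightarrow> bool" where
  "has_weak_deriv N is u g \<longleftrightarrow> u \<in> L1_loc N \<and> g \<in> L1_loc N \<and>
     (\<forall>\<psi>\<in>test_fun N.
        (LINT x|RN N. u x * partials is \<psi> x) = (-1) ^ length is * (LINT x|RN N. g x * \<psi> x))"

text \<open>Weak derivatives are unique almost everywhere, so the choice below does not matter.\<close>

definition weak_deriv :: "nat \<Rightarrow> nat list \<Rightarrow> (point \<Rightarrow> real) \<Rightarrow> point \<Rightarrow> real" where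
  "weak_deriv N is u = (if is = [] then u else (SOME g. has_weak_deriv N is u g))"

text \<open>A multi-index is a sorted list of directions: \<open>[0, 0, 2]\<close> stands for \<open>(2, 0, 1)\<close>.\<close>

definition multi_indices :: "nat \<Rightarrow> nat \<Rightarrow> nat list set" where
  "multi_indices N k = {is. sorted is \<and> set is \<subseteq> {..<N} \<and> length is \<le> k}"

definition Sob :: "nat \<Rightarrow> nat \<Rightarrow> (point \<Rightarrow> real) set" where
  "Sob N k = {u \<in> L2 N. \<forall>is\<in>multi_indices N k. \<exists>g\<in>L2 N. has_weak_deriv N is u g}"

definition Sob_norm :: "nat \<Rightarrow> nat \<Rightarrow> (point \<Rightarrow> real) \<Rightarrow> real" where
  "Sob_norm N k u = sqrt (\<Sum>is\<in>multi_indices N k. (L2_norm N (weak_deriv N is u))\<^sup>2)"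

definition Hsin :: "nat \<Rightarrow> nat \<Rightarrow> (point \<Rightarrow> real) set" where
  "Hsin N k = {v \<in> L1_loc N.
     (\<forall>i<N. \<exists>g\<in>Sob N (k - 1). has_weak_deriv N [i] v g) \<and> (\<lambda>x. sin (v x)) \<in> L2 N}"

definition d_sin :: "nat \<Rightarrow> nat \<Rightarrow> (point \<Rightarrow> real) \<Rightarrow> (point \<Rightarrow> real) \<Rightarrow> real" where
  "d_sin N k v1 v2 =
     sqrt ((L2_norm N (\<lambda>x. sin (v1 x - v2 x)))\<^sup>2 +
       (\<Sum>i<N. (Sob_norm N (k - 1) (\<lambda>x. weak_deriv N [i] v1 x - weak_deriv N [i] v2 x))\<^sup>2))"

definition C0_L2 :: "nat \<Rightarrow> (real \<Rightarrow> point \<Rightarrow> real) \<Rightarrow> bool" where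
  "C0_L2 N u \<longleftrightarrow> (\<forall>t. u t \<in> L2 N) \<and>
     (\<forall>t. ((\<lambda>s. L2_norm N (\<lambda>x. u s x - u t x)) \<longlongrightarrow> 0) (at t))"

definition C0_Sob :: "nat \<Rightarrow> nat \<Rightarrow> (real \<Rightarrow> point \<Rightarrow> real) \<Rightarrow> bool" where
  "C0_Sob N k u \<longleftrightarrow> (\<forall>t. u t \<in> Sob N k) \<and>
     (\<forall>t. ((\<lambda>s. Sob_norm N k (\<lambda>x. u s x - u t x)) \<longlongrightarrow> 0) (at t))"

text \<open>
  The time derivative is the limit in \<open>L^2\<close> of the difference quotients. The functions \<open>u t\<close> need not
  be in \<open>L^2\<close> themselves, only their differences.
\<close>

definition has_time_deriv ::
  "nat \<Rightarrow> (real \<Rightarrow> point \<Rightarrow> real) \<Rightarrow> (real \<Rightarrow> point \<Rightarrow> real) \<Rightarrow> bool" where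
  "has_time_deriv N u u' \<longleftrightarrow>
     (\<forall>s t. (\<lambda>x. u s x - u t x) \<in> L2 N) \<and> (\<forall>t. u' t \<in> L2 N) \<and>
     (\<forall>t. ((\<lambda>s. L2_norm N (\<lambda>x. (u s x - u t x) / (s - t) - u' t x)) \<longlongrightarrow> 0) (at t))"

text \<open>
  The equation holds in the sense of distributions on space-time: the test functions live on
  \<open>R^(N+1)\<close>, coordinate \<open>N\<close> is time, and \<open>x(N := t)\<close> is the space-time point \<open>(x, t)\<close>.
\<close>

definition sine_Gordon :: "nat \<Rightarrow> real \<Rightarrow> (real \<Rightarrow> point \<Rightarrow> real) \<Rightarrow> bool" where
  "sine_Gordon N \<sigma> \<phi> \<longleftrightarrow>
     (\<forall>\<eta>\<in>test_fun (Suc N).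
        (LINT t|lborel. LINT x|RN N.
           \<phi> t x * (partials [N, N] \<eta> (x(N := t)) - (\<Sum>i<N. partials [i, i] \<eta> (x(N := t)))) +
           \<sigma> / 2 * sin (2 * \<phi> t x) * \<eta> (x(N := t))) = 0)"

definition SG_solution ::
  "nat \<Rightarrow> real \<Rightarrow> (point \<Rightarrow> real) \<Rightarrow> (point \<Rightarrow> real) \<Rightarrow>
   (real \<Rightarrow> point \<Rightarrow> real) \<Rightarrow> (real \<Rightarrow> point \<Rightarrow> real) \<Rightarrow> bool" where
  "SG_solution N \<sigma> \<phi>0 \<phi>1 \<phi> \<phi>t \<longleftrightarrow>
     C0_Sob N 1 (\<lambda>t x. \<phi> t x - \<phi>0 x) \<and>
     has_time_deriv N \<phi> \<phi>t \<and> C0_L2 N \<phi>t \<and>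
     sine_Gordon N \<sigma> \<phi> \<and>
     (AE x in RN N. \<phi> 0 x = \<phi>0 x) \<and> (AE x in RN N. \<phi>t 0 x = \<phi>1 x)"

definition SG_energy :: "nat \<Rightarrow> real \<Rightarrow> (point \<Rightarrow> real) \<Rightarrow> (point \<Rightarrow> real) \<Rightarrow> real" where
  "SG_energy N \<sigma> u v =
     1 / 2 * (LINT x|RN N. (v x)\<^sup>2 + (\<Sum>i<N. (weak_deriv N [i] u x)\<^sup>2) + \<sigma> * (sin (u x))\<^sup>2)"

end

(*
  The equation is read as a first-order system for p_i = d_i phi and v = d_t phi in a Hilbert space on
  which the translations along the coordinate axes act isometrically:
  p_i(t) - p_i(0) = d_i \<integral> v and v(t) - v(0) = sum_i d_i \<integral> p_i + \<integral> f, with the derivatives outside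
  the time integrals taken weakly. Replacing d_i by the central difference quotients, which are bounded
  and skew-adjoint, turns the linear problem into an ODE with a conserved energy, whose solutions
  converge as the step tends to 0; smooth data give the convergence and density the general case.
  Averaging over translations makes a weak solution strong, so d/dt (|v|^2 + |p|^2) = 2 <f, v> holds
  for every weak solution.

  The nonlinearity is globally Lipschitz on phi^0 + L^2, so the solution map of the linear
  problem contracts in the weighted norm sup_t exp (- lambda |t|) |.| for large lambda, which gives a
  global solution. For two solutions, the quantity
  |sin(phi - phi')|^2 + |v - v'|^2 + |p - p'|^2 satisfies |X'| <= (1 + |sigma|) X, because
  |sin 2a - sin 2b| <= 2 |sin (a - b)|; Gronwall's inequality gives the Lipschitz estimate and
  uniqueness. Regularity follows by applying the linear theory to the difference quotients in space of
  a solution: their limit solves the wave system with the right-hand side d_j f.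
*)
theory Submission
  imports Defs
begin

text \<open>A solution \<open>\<phi> t\<close> need not lie in L^2: only its increments in time and
  under translation do. Time integration and translation, which see increments only, therefore
  replace direct differentiation, and \<open>sin (\<phi> t x - \<phi>' t x)\<close> rather than
  \<open>\<phi> t x - \<phi>' t x\<close> measures the distance of two solutions. Uniqueness has to
  start from an arbitrary distributional solution, which has no strong second derivatives; hence the
  energy identity is needed for weak solutions, and the distributional equation is first converted,
  by a du Bois-Reymond argument in time, into the integrated system. The conserved energy itself
  cannot give stability, because for negative \<open>\<sigma>\<close> it is not coercive; the
  functional of the Gronwall argument carries |sin|^2 with weight 1 instead. Spatial regularity and
  the chain rules require differentiating the nonlinearity in L^2. This is done only along
  differentiable curves: the derivative is multiplication by a bounded function, and the remainder
  is controlled by truncating the L^2 factor.\<close>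

section \<open>Antiderivatives and differential inequalities\<close>

text \<open>The oriented integral from 0 to t. The flow runs in both time directions, and
  \<open>integral {0..t}\<close> is 0 for negative t.\<close>

definition Iint :: "(real \<Rightarrow> 'a::banach) \<Rightarrow> real \<Rightarrow> 'a" where
  "Iint f t = (if 0 \<le> t then integral {0..t} f else - integral {t..0} f)"

lemma Iint_0 [simp]: "Iint f 0 = 0"
  by (simp add: Iint_def)

lemma Iint_deriv:
  assumes "continuous_on UNIV f"
  shows "(Iint f has_vector_derivative f t) (at t)"
proof -
  define R where "R = \<bar>t\<bar> + 1"
  have io: "f integrable_on {a..b}" for a b
    using assms by (intro integrable_continuous_real) (auto intro: continuous_on_subset)
  \<comment> \<open>Near t both branches equal the integral from -R up to the same constant, so t =
    0 needs no separate treatment.\<close>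
  have eq: "Iint f u = integral {-R..u} f - integral {-R..0} f" if "u \<in> {-R<..<R}" for u
  proof (cases "0 \<le> u")
    case True
    then have "integral {-R..0} f + integral {0..u} f = integral {-R..u} f"
      using that by (intro Henstock_Kurzweil_Integration.integral_combine io) auto
    then show ?thesis using True by (simp add: Iint_def algebra_simps)
  next
    case False
    then have "integral {-R..u} f + integral {u..0} f = integral {-R..0} f"
      using that by (intro Henstock_Kurzweil_Integration.integral_combine io) auto
    then show ?thesis using False by (simp add: Iint_def algebra_simps)
  qed
  have tR: "t \<in> {-R<..<R}" by (auto simp: R_def)
  have "((\<lambda>u. integral {-R..u} f) has_vector_derivative f t) (at t within {-R..R})"
    using tR by (intro integral_has_vector_derivative continuous_on_subset[OF assms]) auto
  then have "((\<lambda>u. integral {-R..u} f) has_vector_derivative f t) (at t within {-R<..<R})"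
    by (rule has_vector_derivative_within_subset) auto
  then have "((\<lambda>u. integral {-R..u} f) has_vector_derivative f t) (at t)"
    unfolding at_within_open[OF tR open_greaterThanLessThan] .
  then have "((\<lambda>u. integral {-R..u} f - integral {-R..0} f) has_vector_derivative f t) (at t)"
    by (auto intro!: derivative_eq_intros)
  then show ?thesis
    by (rule has_vector_derivative_transform_within_open[OF _ open_greaterThanLessThan tR]) (simp add: eq)
qed

lemma deriv_imp_continuous:
  assumes "\<And>t. (F has_vector_derivative f t) (at t)"
  shows "continuous_on UNIV F"
  using assms by (auto intro!: continuous_at_imp_continuous_on has_vector_derivative_continuous)

lemma continuous_on_Iint: "continuous_on UNIV f \<Longrightarrow> continuous_on A (Iint f)"
  using deriv_imp_continuous[OF Iint_deriv] continuous_on_subset by blast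

text \<open>A mean value inequality for both time directions: for negative t the one-sided
  inequality is applied on {t..0}, and the absolute value of the increment of \<open>G\<close>
  absorbs the orientation.\<close>

lemma norm_diff_bound:
  fixes F :: "real \<Rightarrow> 'a::real_normed_vector" and G :: "real \<Rightarrow> real"
  assumes F: "\<And>s. (F has_vector_derivative f s) (at s)"
    and G: "\<And>s. (G has_real_derivative g s) (at s)"
    and le: "\<And>s. \<bar>s\<bar> \<le> \<bar>t\<bar> \<Longrightarrow> norm (f s) \<le> g s"
  shows "norm (F t - F 0) \<le> \<bar>G t - G 0\<bar>"
proof -
  have G': "(G has_vector_derivative g s) (at s)" for s
    using G by (simp add: has_real_derivative_iff_has_vector_derivative)
  note cont = continuous_on_subset[OF deriv_imp_continuous[OF F] subset_UNIV]
    continuous_on_subset[OF deriv_imp_continuous[OF G'] subset_UNIV]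
  consider "t = 0" | "t > 0" | "t < 0" by linarith
  then show ?thesis
  proof cases
    case 2
    have "norm (F t - F 0) \<le> G t - G 0"
      by (rule differentiable_bound_general[OF 2 cont F G']) (use 2 le in auto)
    then show ?thesis by linarith
  next
    case 3
    have "norm (F 0 - F t) \<le> G 0 - G t"
      by (rule differentiable_bound_general[OF 3 cont F G']) (use 3 le in auto)
    then show ?thesis by (simp add: norm_minus_commute)
  qed auto
qed

text \<open>The difference with \<open>Iint f\<close> has derivative zero. The calculus rules for
  \<open>Iint\<close> are obtained from this by differentiating both sides and comparing at
  0.\<close>

lemma Iint_unique:
  assumes f: "continuous_on UNIV f" and F: "\<And>t. (F has_vector_derivative f t) (at t)"
  shows "F t - F 0 = Iint f t"
proof -
  have "((\<lambda>t. F t - Iint f t) has_vector_derivative f s - f s) (at s)" for s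
    by (intro has_vector_derivative_diff F Iint_deriv f)
  from norm_diff_bound[OF this, of "\<lambda>_. 0" "\<lambda>_. 0" t] show ?thesis
    by (simp add: algebra_simps)
qed

lemma bounded_linear_Iint:
  assumes L: "bounded_linear L" and f: "continuous_on UNIV f"
  shows "L (Iint f t) = Iint (\<lambda>s. L (f s)) t"
proof -
  have "L (Iint f t) - L (Iint f 0) = Iint (\<lambda>s. L (f s)) t"
    by (intro Iint_unique[where F="\<lambda>t. L (Iint f t)"] bounded_linear.has_vector_derivative[OF L] Iint_deriv f
        bounded_linear.continuous_on[OF L])
  then show ?thesis by (simp add: linear_0[OF bounded_linear.linear[OF L]])
qed

lemma Iint_add:
  assumes "continuous_on UNIV f" "continuous_on UNIV g"
  shows "Iint (\<lambda>s. f s + g s) t = Iint f t + Iint g t"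
proof -
  have "(Iint f t + Iint g t) - (Iint f 0 + Iint g 0) = Iint (\<lambda>s. f s + g s) t"
    by (intro Iint_unique[where F="\<lambda>t. Iint f t + Iint g t"] continuous_on_add has_vector_derivative_add Iint_deriv assms)
  then show ?thesis by simp
qed

lemma Iint_diff:
  assumes "continuous_on UNIV f" "continuous_on UNIV g"
  shows "Iint (\<lambda>s. f s - g s) t = Iint f t - Iint g t"
proof -
  have "(Iint f t - Iint g t) - (Iint f 0 - Iint g 0) = Iint (\<lambda>s. f s - g s) t"
    by (intro Iint_unique[where F="\<lambda>t. Iint f t - Iint g t"] continuous_on_diff has_vector_derivative_diff Iint_deriv assms)
  then show ?thesis by simp
qed

lemma Iint_sum:
  assumes "\<And>i. i \<in> I \<Longrightarrow> continuous_on UNIV (f i)"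
  shows "Iint (\<lambda>s. \<Sum>i\<in>I. f i s) t = (\<Sum>i\<in>I. Iint (f i) t)"
proof -
  have "(\<Sum>i\<in>I. Iint (f i) t) - (\<Sum>i\<in>I. Iint (f i) 0) = Iint (\<lambda>s. \<Sum>i\<in>I. f i s) t"
    by (intro Iint_unique[where F="\<lambda>t. \<Sum>i\<in>I. Iint (f i) t"] continuous_on_sum has_vector_derivative_sum Iint_deriv assms)
  then show ?thesis by simp
qed

lemma Iint_deriv_real:
  fixes f :: "real \<Rightarrow> real"
  shows "continuous_on UNIV f \<Longrightarrow> (Iint f has_real_derivative f t) (at t)"
  by (simp add: has_real_derivative_iff_has_vector_derivative Iint_deriv)

lemma norm_Iint_le:
  assumes f: "continuous_on UNIV f" and g: "continuous_on UNIV g"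
    and "\<And>s. \<bar>s\<bar> \<le> \<bar>t\<bar> \<Longrightarrow> norm (f s) \<le> g s"
  shows "norm (Iint f t) \<le> \<bar>Iint g t\<bar>"
  using norm_diff_bound[OF Iint_deriv[OF f] Iint_deriv_real[OF g] assms(3)] by simp

lemma abs_Iint_le_integral:
  fixes g :: "real \<Rightarrow> real"
  assumes g: "continuous_on UNIV g" and "\<And>s. 0 \<le> g s" and "\<bar>t\<bar> \<le> T"
  shows "\<bar>Iint g t\<bar> \<le> integral {-T..T} g"
proof -
  have io: "g integrable_on {a..b}" for a b
    using g by (intro integrable_continuous_real) (auto intro: continuous_on_subset)
  have nn: "0 \<le> integral {a..b} g" for a b
    by (intro integral_nonneg io assms)
  have "integral {0..t} g \<le> integral {-T..T} g" "integral {t..0} g \<le> integral {-T..T} g"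
    using assms by (intro integral_subset_le io; auto)+
  then show ?thesis using nn by (simp add: Iint_def)
qed

section \<open>Contraction in exponentially weighted norms\<close>

lemma Iint_exp_le:
  assumes "lam > 0"
  shows "\<bar>Iint (\<lambda>s. exp (lam * \<bar>s\<bar>)) t\<bar> \<le> exp (lam * \<bar>t\<bar>) / lam"
proof -
  have "\<bar>Iint (\<lambda>s. exp (lam * \<bar>s\<bar>)) t\<bar> = (exp (lam * \<bar>t\<bar>) - 1) / lam"
  proof (cases "0 \<le> t")
    case True
    have "((\<lambda>s. exp (lam * s) / lam) has_vector_derivative exp (lam * s)) (at s within {0..t})" for s
      unfolding has_real_derivative_iff_has_vector_derivative[symmetric]
      using assms by (auto intro!: derivative_eq_intros)
    from fundamental_theorem_of_calculus[OF True this]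
    have "((\<lambda>s. exp (lam * s)) has_integral (exp (lam * t) / lam - exp (lam * 0) / lam)) {0..t}"
      by simp
    then have "((\<lambda>s. exp (lam * \<bar>s\<bar>)) has_integral (exp (lam * t) / lam - exp (lam * 0) / lam)) {0..t}"
      by (rule has_integral_eq[rotated]) simp
    then have "Iint (\<lambda>s. exp (lam * \<bar>s\<bar>)) t = (exp (lam * t) - 1) / lam"
      using True by (simp add: Iint_def integral_unique diff_divide_distrib)
    then show ?thesis using True assms by simp
  next
    case False
    then have t: "t \<le> 0" by simp
    have "((\<lambda>s. - exp (- lam * s) / lam) has_vector_derivative exp (- lam * s)) (at s within {t..0})" for s
      unfolding has_real_derivative_iff_has_vector_derivative[symmetric]
      using assms by (auto intro!: derivative_eq_intros)
    from fundamental_theorem_of_calculus[OF t this]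
    have "((\<lambda>s. exp (- lam * s)) has_integral (- exp (- lam * 0) / lam - - exp (- lam * t) / lam)) {t..0}"
      by simp
    then have "((\<lambda>s. exp (lam * \<bar>s\<bar>)) has_integral (- exp (- lam * 0) / lam - - exp (- lam * t) / lam)) {t..0}"
      by (rule has_integral_eq[rotated]) simp
    then have "Iint (\<lambda>s. exp (lam * \<bar>s\<bar>)) t = - ((exp (- lam * t) - 1) / lam)"
      using False by (simp add: Iint_def integral_unique diff_divide_distrib)
    moreover have "1 \<le> exp (- lam * t)" using t assms by (simp add: mult_nonneg_nonpos)
    ultimately show ?thesis using False assms by (simp add: abs_minus_commute)
  qed
  then show ?thesis using assms by (simp add: divide_right_mono)
qed

text \<open>Each time integration gains a factor 1 / lam in the weighted norm; all contraction
  constants come from this gain.\<close>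

lemma weighted_Iint_le:
  assumes f: "continuous_on UNIV f" and "lam > 0"
    and le: "\<And>s. \<bar>s\<bar> \<le> \<bar>t\<bar> \<Longrightarrow> norm (f s) \<le> K * exp (lam * \<bar>s\<bar>)"
  shows "norm (Iint f t) \<le> K / lam * exp (lam * \<bar>t\<bar>)"
proof -
  have "0 \<le> norm (f 0)" by simp
  also have "\<dots> \<le> K" using le[of 0] by simp
  finally have K: "0 \<le> K" .
  have c: "continuous_on UNIV (\<lambda>s. exp (lam * \<bar>s\<bar>))" by (intro continuous_intros)
  have "norm (Iint f t) \<le> \<bar>Iint (\<lambda>s. K * exp (lam * \<bar>s\<bar>)) t\<bar>"
    by (intro norm_Iint_le f le continuous_intros)
  also have "Iint (\<lambda>s. K * exp (lam * \<bar>s\<bar>)) t = K * Iint (\<lambda>s. exp (lam * \<bar>s\<bar>)) t"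
    using bounded_linear_Iint[OF bounded_linear_mult_right c, of K] by simp
  also have "\<bar>\<dots>\<bar> \<le> K * (exp (lam * \<bar>t\<bar>) / lam)"
    unfolding abs_mult using K Iint_exp_le[OF \<open>lam > 0\<close>, of t] by (intro mult_mono) auto
  finally show ?thesis by simp
qed

text \<open>Banach's fixed point theorem without a Banach space: a function continuous on the whole
  line need not have a finite weighted sup norm. The hypothesis therefore compares bounds on each
  interval [-T, T] separately, and the iterates from 0 converge locally uniformly.\<close>

lemma local_fixed_point:
  fixes \<Phi> :: "(real \<Rightarrow> 'a::banach) \<Rightarrow> real \<Rightarrow> 'a"
  assumes cont: "\<And>x. continuous_on UNIV x \<Longrightarrow> continuous_on UNIV (\<Phi> x)"
    and "lam > 0"
    and contr: "\<And>x y K T. continuous_on UNIV x \<Longrightarrow> continuous_on UNIV y \<Longrightarrow>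
      (\<And>t. \<bar>t\<bar> \<le> T \<Longrightarrow> norm (x t - y t) \<le> K * exp (lam * \<bar>t\<bar>)) \<Longrightarrow>
      (\<And>t. \<bar>t\<bar> \<le> T \<Longrightarrow> norm (\<Phi> x t - \<Phi> y t) \<le> K / 2 * exp (lam * \<bar>t\<bar>))"
  shows "\<exists>x. continuous_on UNIV x \<and> (\<forall>t. \<Phi> x t = x t)"
proof -
  define X where "X n = (\<Phi> ^^ n) (\<lambda>_. 0)" for n
  have X0: "X 0 = (\<lambda>_. 0)" and XS: "X (Suc n) = \<Phi> (X n)" for n
    by (simp_all add: X_def)
  have cX: "continuous_on UNIV (X n)" for n
    by (induction n) (auto simp: X0 XS cont)
  have "\<exists>K. \<forall>t. \<bar>t\<bar> \<le> T \<longrightarrow> norm (X 1 t) \<le> K" for T :: real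
  proof -
    have "compact (X 1 ` {-T..T})"
      by (intro compact_continuous_image continuous_on_subset[OF cX]) auto
    then have "bounded (X 1 ` {-T..T})" by (rule compact_imp_bounded)
    then obtain K where "\<forall>t\<in>{-T..T}. norm (X 1 t) \<le> K" by (auto simp: bounded_iff)
    then show ?thesis by (intro exI[of _ K]) (auto simp: abs_le_iff)
  qed
  then obtain K where K: "\<And>T t. \<bar>t\<bar> \<le> T \<Longrightarrow> norm (X 1 t) \<le> K T" by metis
  \<comment> \<open>Induction with the constant K T (1/2)^n: the contraction hypothesis looks only
    at the interval on which the bound is already known.\<close>
  have step: "\<bar>t\<bar> \<le> T \<Longrightarrow> norm (X (Suc n) t - X n t) \<le> K T * (1/2)^n * exp (lam * \<bar>t\<bar>)" for n t T
  proof (induction n arbitrary: t)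
    case 0
    have "norm (X 1 t) \<le> K T" using 0 K by blast
    moreover from this have "0 \<le> K T" using norm_ge_zero order_trans by blast
    moreover have "1 \<le> exp (lam * \<bar>t\<bar>)" using \<open>lam > 0\<close> by simp
    ultimately have "norm (X 1 t) \<le> K T * exp (lam * \<bar>t\<bar>)"
      by (metis mult.right_neutral mult_left_mono order_trans)
    then show ?case by (simp add: X0)
  next
    case (Suc n)
    have "norm (\<Phi> (X (Suc n)) t - \<Phi> (X n) t) \<le> (K T * (1/2)^n) / 2 * exp (lam * \<bar>t\<bar>)"
      by (rule contr[OF cX cX _ Suc.prems]) (rule Suc.IH)
    then show ?case by (simp add: XS)
  qed
  define x where "x t = (\<Sum>n. X (Suc n) t - X n t)" for t
  have tel: "(\<Sum>i<n. X (Suc i) t - X i t) = X n t" for n t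
    by (induction n) (auto simp: X0)
  have ul: "uniform_limit {-T..T} X x sequentially" for T
  proof -
    have "uniform_limit {-T..T} (\<lambda>n t. \<Sum>i<n. X (Suc i) t - X i t) (\<lambda>t. suminf (\<lambda>i. X (Suc i) t - X i t)) sequentially"
    proof (rule Weierstrass_m_test)
      show "summable (\<lambda>n. K T * exp (lam * T) * (1/2)^n)" by (intro summable_mult summable_geometric) auto
      fix n t assume "t \<in> {-T..T}"
      then have t: "\<bar>t\<bar> \<le> T" by auto
      have KT: "0 \<le> K T" using K[OF t] norm_ge_zero order_trans by blast
      have "norm (X (Suc n) t - X n t) \<le> K T * (1/2)^n * exp (lam * \<bar>t\<bar>)" by (rule step[OF t])
      also have "\<dots> \<le> K T * (1/2)^n * exp (lam * T)"
        using t \<open>lam > 0\<close> KT by (intro mult_left_mono) auto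
      finally show "norm (X (Suc n) t - X n t) \<le> K T * exp (lam * T) * (1/2)^n" by (simp add: mult_ac)
    qed
    then show ?thesis unfolding tel x_def[symmetric] by simp
  qed
  have cx: "continuous_on UNIV x"
  proof (rule continuous_at_imp_continuous_on, rule ballI)
    fix t :: real
    have "continuous_on {-(\<bar>t\<bar>+1)..\<bar>t\<bar>+1} x"
      by (rule uniform_limit_theorem[OF _ ul]) (auto intro!: always_eventually continuous_on_subset[OF cX])
    then show "isCont x t"
      by (rule continuous_on_interior) (auto simp: abs_le_iff)
  qed
  have "\<Phi> x t = x t" for t
  proof -
    have lim: "(\<lambda>n. X n t) \<longlonglongrightarrow> x t"
      by (rule tendsto_uniform_limitI[OF ul, of _ "\<bar>t\<bar>"]) (simp; linarith)
    \<comment> \<open>Continuity of \<open>\<Phi>\<close> is read off the contraction hypothesis,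
      applied to \<open>X n\<close> and \<open>x\<close> with the constant e.\<close>
    have "(\<lambda>n. \<Phi> (X n) t) \<longlonglongrightarrow> \<Phi> x t"
    proof (rule LIMSEQ_I)
      fix r :: real assume "r > 0"
      define e where "e = r / exp (lam * \<bar>t\<bar>)"
      have e: "e > 0" "e / 2 * exp (lam * \<bar>t\<bar>) < r" using \<open>r > 0\<close> by (auto simp: e_def)
      obtain N where N: "\<And>n s. n \<ge> N \<Longrightarrow> s \<in> {-\<bar>t\<bar>..\<bar>t\<bar>} \<Longrightarrow> dist (X n s) (x s) < e"
        using uniform_limitD[OF ul e(1)] unfolding eventually_sequentially by blast
      have "norm (\<Phi> (X n) t - \<Phi> x t) < r" if "n \<ge> N" for n
      proof -
        have "norm (\<Phi> (X n) t - \<Phi> x t) \<le> e / 2 * exp (lam * \<bar>t\<bar>)"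
        proof (rule contr[OF cX cx])
          fix s assume s: "\<bar>s\<bar> \<le> \<bar>t\<bar>"
          have "norm (X n s - x s) \<le> e * 1"
            using N[OF that, of s] s by (auto simp: dist_norm abs_le_iff)
          also have "\<dots> \<le> e * exp (lam * \<bar>s\<bar>)" using e(1) \<open>lam > 0\<close> by (intro mult_left_mono) auto
          finally show "norm (X n s - x s) \<le> e * exp (lam * \<bar>s\<bar>)" .
        qed simp
        then show ?thesis using e(2) by simp
      qed
      then show "\<exists>no. \<forall>n\<ge>no. norm (\<Phi> (X n) t - \<Phi> x t) < r" by blast
    qed
    then have "(\<lambda>n. X (Suc n) t) \<longlonglongrightarrow> \<Phi> x t" by (simp add: XS)
    with LIMSEQ_Suc[OF lim] show ?thesis using LIMSEQ_unique by blast
  qed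
  with cx show ?thesis by blast
qed

section \<open>Differential inequalities for energies\<close>

text \<open>Formally (sqrt E)' = E' / (2 sqrt E) \<le> b. The square root is not differentiable
  where E vanishes, so E + \<epsilon> is used and the error is made arbitrarily small.\<close>

lemma sqrt_energy_bound:
  fixes E :: "real \<Rightarrow> real"
  assumes nn: "\<And>t. 0 \<le> E t" and E: "\<And>t. (E has_real_derivative E' t) (at t)"
    and b: "continuous_on UNIV b"
    and le: "\<And>s. \<bar>s\<bar> \<le> \<bar>t\<bar> \<Longrightarrow> \<bar>E' s\<bar> \<le> 2 * b s * sqrt (E s)"
    and b0: "\<And>s. 0 \<le> b s"
  shows "sqrt (E t) \<le> sqrt (E 0) + \<bar>Iint b t\<bar>"
proof (rule field_le_epsilon)
  fix r :: real assume r: "r > 0"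
  \<comment> \<open>With this choice sqrt (E 0 + \<epsilon>) exceeds sqrt (E 0) by at most
    r.\<close>
  define \<epsilon> where "\<epsilon> = r\<^sup>2"
  have \<epsilon>: "\<epsilon> > 0" using r by (simp add: \<epsilon>_def)
  have pos: "E s + \<epsilon> > 0" for s using nn[of s] \<epsilon> by linarith
  have d: "((\<lambda>s. sqrt (E s + \<epsilon>)) has_real_derivative E' s * (inverse (sqrt (E s + \<epsilon>)) / 2)) (at s)" for s
    using pos[of s] by (auto intro!: derivative_eq_intros E)
  have bd: "norm (E' s * (inverse (sqrt (E s + \<epsilon>)) / 2)) \<le> b s" if "\<bar>s\<bar> \<le> \<bar>t\<bar>" for s
  proof -
    have "\<bar>E' s\<bar> \<le> 2 * b s * sqrt (E s + \<epsilon>)"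
      using le[OF that] mult_left_mono[of "sqrt (E s)" "sqrt (E s + \<epsilon>)" "2 * b s"] \<epsilon> b0[of s] by simp
    then show ?thesis using pos[of s] by (simp add: abs_mult field_simps)
  qed
  have "norm (sqrt (E t + \<epsilon>) - sqrt (E 0 + \<epsilon>)) \<le> \<bar>Iint b t - Iint b 0\<bar>"
    by (rule norm_diff_bound[OF d[unfolded has_real_derivative_iff_has_vector_derivative] Iint_deriv_real[OF b] bd])
  then have "sqrt (E t + \<epsilon>) \<le> sqrt (E 0 + \<epsilon>) + \<bar>Iint b t\<bar>" by (simp add: abs_le_iff)
  moreover have "sqrt (E t) \<le> sqrt (E t + \<epsilon>)" using \<epsilon> by simp
  moreover have "sqrt (E 0 + \<epsilon>) \<le> sqrt (E 0) + r"
    using sqrt_add_le_add_sqrt[OF nn[of 0], of \<epsilon>] \<epsilon> r by (simp add: \<epsilon>_def)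
  ultimately show "sqrt (E t) \<le> sqrt (E 0) + \<bar>Iint b t\<bar> + r" by linarith
qed

text \<open>X exp (- C t) is nonincreasing for t \<ge> 0 and X exp (C t) nondecreasing for t \<le>
  0; the bound on |X'| gives both.\<close>

lemma Gronwall_two_sided:
  fixes X :: "real \<Rightarrow> real"
  assumes X: "\<And>t. (X has_real_derivative X' t) (at t)" and le: "\<And>t. \<bar>X' t\<bar> \<le> C * X t"
  shows "X t \<le> X 0 * exp (C * \<bar>t\<bar>)"
proof -
  have up: "(\<lambda>s. X s * exp (- C * s)) t \<le> (\<lambda>s. X s * exp (- C * s)) 0" if "t \<ge> 0"
  proof (rule DERIV_nonpos_imp_nonincreasing[OF that])
    fix s
    have "((\<lambda>s. X s * exp (- C * s)) has_real_derivative (X' s - C * X s) * exp (- C * s)) (at s)"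
      by (auto intro!: derivative_eq_intros X simp: algebra_simps)
    moreover have "(X' s - C * X s) * exp (- C * s) \<le> 0"
      using le[of s] by (intro mult_nonpos_nonneg) auto
    ultimately show "\<exists>y. ((\<lambda>s. X s * exp (- C * s)) has_real_derivative y) (at s) \<and> y \<le> 0"
      by blast
  qed
  have dn: "(\<lambda>s. X s * exp (C * s)) t \<le> (\<lambda>s. X s * exp (C * s)) 0" if "t \<le> 0"
  proof (rule DERIV_nonneg_imp_nondecreasing[OF that])
    fix s
    have "((\<lambda>s. X s * exp (C * s)) has_real_derivative (X' s + C * X s) * exp (C * s)) (at s)"
      by (auto intro!: derivative_eq_intros X simp: algebra_simps)
    moreover have "0 \<le> (X' s + C * X s) * exp (C * s)"
      using le[of s] by (intro mult_nonneg_nonneg) auto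
    ultimately show "\<exists>y. ((\<lambda>s. X s * exp (C * s)) has_real_derivative y) (at s) \<and> 0 \<le> y"
      by blast
  qed
  show ?thesis
  proof (cases "t \<ge> 0")
    case True
    have "X t = X t * exp (- C * t) * exp (C * t)" by (simp flip: exp_add)
    also have "\<dots> \<le> X 0 * exp (C * t)" using up[OF True] by (intro mult_right_mono) auto
    finally show ?thesis using True by simp
  next
    case False
    have "X t = X t * exp (C * t) * exp (- C * t)" by (simp flip: exp_add)
    also have "\<dots> \<le> X 0 * exp (- C * t)" using dn False by (intro mult_right_mono) auto
    finally show ?thesis using False by simp
  qed
qed

lemma Iint_const: "Iint (\<lambda>_. c) t = t *\<^sub>R c"
proof -
  have "t *\<^sub>R c - 0 *\<^sub>R c = Iint (\<lambda>_. c) t"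
    by (rule Iint_unique[where F="\<lambda>t. t *\<^sub>R c"]) (auto intro!: derivative_eq_intros)
  then show ?thesis by simp
qed

lemma Iint_shift:
  assumes "continuous_on UNIV f"
  shows "Iint (\<lambda>s. f (r + s)) d = Iint f (r + d) - Iint f r"
proof -
  have "((\<lambda>t. Iint f (r + t)) has_vector_derivative f (r + t)) (at t)" for t
  proof -
    have "((\<lambda>t. r + t) has_vector_derivative 1) (at t)" by (auto intro!: derivative_eq_intros)
    from vector_diff_chain_at[OF this Iint_deriv[OF assms]] show ?thesis by (simp add: o_def)
  qed
  moreover have "continuous_on UNIV (\<lambda>s. f (r + s))"
    by (rule continuous_on_compose2[OF assms]) (auto intro!: continuous_intros)
  ultimately have "Iint f (r + d) - Iint f (r + 0) = Iint (\<lambda>s. f (r + s)) d"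
    by (intro Iint_unique[where F="\<lambda>t. Iint f (r + t)"])
  then show ?thesis by simp
qed

lemma Iint_dominated:
  fixes f :: "nat \<Rightarrow> real \<Rightarrow> real"
  assumes f: "\<And>n. continuous_on UNIV (f n)" and h: "continuous_on UNIV h"
    and le: "\<And>n s. \<bar>f n s\<bar> \<le> h s" and lim: "\<And>s. (\<lambda>n. f n s) \<longlonglongrightarrow> g s"
  shows "(\<lambda>n. Iint (f n) t) \<longlonglongrightarrow> Iint g t"
    and "(\<lambda>n. integral {a..b} (f n)) \<longlonglongrightarrow> integral {a..b} g"
proof -
  have io: "k integrable_on {a..b}" if "continuous_on UNIV k" for a b and k :: "real \<Rightarrow> real"
    using that by (intro integrable_continuous_real) (auto intro: continuous_on_subset)
  have *: "(\<lambda>n. integral {a..b} (f n)) \<longlonglongrightarrow> integral {a..b} g" for a b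
    by (rule dominated_convergence(2)[where h=h]) (auto intro!: io f h lim simp: le)
  then show "(\<lambda>n. integral {a..b} (f n)) \<longlonglongrightarrow> integral {a..b} g" .
  show "(\<lambda>n. Iint (f n) t) \<longlonglongrightarrow> Iint g t"
    by (cases "0 \<le> t") (auto simp: Iint_def intro!: * tendsto_minus)
qed

lemma has_vector_derivative_iff_quotient:
  "(f has_vector_derivative D) (at x) \<longleftrightarrow> ((\<lambda>y. (f y - f x) /\<^sub>R (y - x)) \<longlongrightarrow> D) (at x)"
proof -
  have eq: "norm (f y - f x - (y - x) *\<^sub>R D) / \<bar>y - x\<bar> = norm ((f y - f x) /\<^sub>R (y - x) - D)"
    if "y \<noteq> x" for y
  proof -
    have "(f y - f x) /\<^sub>R (y - x) - D = (f y - f x - (y - x) *\<^sub>R D) /\<^sub>R (y - x)"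
      using that by (simp add: scaleR_diff_right)
    then show ?thesis by (simp add: divide_inverse mult.commute)
  qed
  have "(f has_vector_derivative D) (at x) \<longleftrightarrow>
      ((\<lambda>y. norm (f y - f x - (y - x) *\<^sub>R D) / \<bar>y - x\<bar>) \<longlongrightarrow> 0) (at x)"
    by (simp add: has_vector_derivative_def has_derivative_iff_norm bounded_linear_scaleR_left)
  also have "\<dots> \<longleftrightarrow> ((\<lambda>y. norm ((f y - f x) /\<^sub>R (y - x) - D)) \<longlongrightarrow> 0) (at x)"
    by (intro tendsto_cong) (use eq in \<open>auto simp: eventually_at_filter intro!: always_eventually\<close>)
  also have "\<dots> \<longleftrightarrow> ((\<lambda>y. (f y - f x) /\<^sub>R (y - x)) \<longlongrightarrow> D) (at x)"
    by (simp only: tendsto_norm_zero_iff LIM_zero_iff)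
  finally show ?thesis .
qed

section \<open>Translation groups and weak wave systems\<close>

text \<open>Commuting strongly continuous groups of linear isometries of a Hilbert space, kept
  abstract so that the wave theory never mentions functions of x.\<close>

locale transl =
  fixes tau :: "nat \<Rightarrow> real \<Rightarrow> 'a::{real_inner,banach} \<Rightarrow> 'a"
  assumes tau_linear: "linear (tau i s)"
    and tau_norm: "norm (tau i s x) = norm x"
    and tau_0: "tau i 0 x = x"
    and tau_add: "tau i s (tau i t x) = tau i (s + t) x"
    and tau_commute: "tau i s (tau j t x) = tau j t (tau i s x)"
    and tau_cont: "continuous_on UNIV (\<lambda>s. tau i s x)"
begin

lemma tau_bl: "bounded_linear (tau i s)"
proof (rule bounded_linear_intro[where K=1])
  show "tau i s (x + y) = tau i s x + tau i s y" for x y by (rule linear_add[OF tau_linear])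
  show "tau i s (r *\<^sub>R x) = r *\<^sub>R tau i s x" for r x by (rule linear_scale[OF tau_linear])
qed (simp add: tau_norm)

lemmas tau_simps = linear_add[OF tau_linear] linear_scale[OF tau_linear] linear_diff[OF tau_linear]
  linear_0[OF tau_linear]

text \<open>Polarisation turns the isometry into invariance of the inner product.\<close>

lemma tau_inner: "inner (tau i s x) (tau i s y) = inner x y"
  by (simp add: dot_norm tau_norm flip: tau_simps)

lemma tau_adjoint: "inner (tau i s x) y = inner x (tau i (- s) y)"
  using tau_inner[of i s x "tau i (- s) y"] by (simp add: tau_add tau_0)

text \<open>The infinitesimal generator of \<open>tau i\<close> as a relation: it is in general
  unbounded, and \<open>gen i x y\<close> says both that x lies in its domain and that y is its
  value.\<close>

definition gen :: "nat \<Rightarrow> 'a \<Rightarrow> 'a \<Rightarrow> bool" where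
  "gen i x y \<longleftrightarrow> ((\<lambda>s. tau i s x) has_vector_derivative y) (at 0)"

lemma gen_unique: "gen i x y \<Longrightarrow> gen i x z \<Longrightarrow> y = z"
  unfolding gen_def by (rule vector_derivative_unique_at)

lemma gen_quotient: "gen i x y \<longleftrightarrow> ((\<lambda>s. (tau i s x - x) /\<^sub>R s) \<longlongrightarrow> y) (at 0)"
  by (simp add: gen_def has_vector_derivative_iff_quotient tau_0)

text \<open>The group law carries differentiability of the orbit from 0 to every s.\<close>

lemma gen_at:
  assumes "gen i x y"
  shows "((\<lambda>s. tau i s x) has_vector_derivative tau i s y) (at s)"
proof -
  have "((\<lambda>r. r - s) has_vector_derivative 1) (at s)" by (auto intro!: derivative_eq_intros)
  moreover have "((\<lambda>s. tau i s x) has_vector_derivative y) (at (s - s))"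
    using assms by (simp add: gen_def)
  ultimately have "((\<lambda>s. tau i s x) \<circ> (\<lambda>r. r - s) has_vector_derivative 1 *\<^sub>R y) (at s)"
    by (rule vector_diff_chain_at)
  then have "((\<lambda>r. tau i s (tau i (r - s) x)) has_vector_derivative tau i s y) (at s)"
    by (intro bounded_linear.has_vector_derivative[OF tau_bl]) (simp add: o_def)
  then show ?thesis unfolding tau_add by simp
qed

lemma gen_bl:
  assumes L: "bounded_linear L" and comm: "\<And>s z. L (tau i s z) = tau i s (L z)" and g: "gen i x y"
  shows "gen i (L x) (L y)"
  using bounded_linear.has_vector_derivative[OF L g[unfolded gen_def]] by (simp add: gen_def comm)

lemma gen_diff: "gen i x y \<Longrightarrow> gen i x' y' \<Longrightarrow> gen i (x - x') (y - y')"
  by (simp add: gen_def tau_simps has_vector_derivative_diff)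

text \<open>The inner product of two equally translated vectors is constant; its derivative at 0 is
  the claim.\<close>

lemma gen_skew:
  assumes "gen i x x'" "gen i y y'"
  shows "inner x' y = - inner x y'"
proof -
  have "((\<lambda>s. inner (tau i s x) (tau i s y)) has_vector_derivative
      inner (tau i 0 x) y' + inner x' (tau i 0 y)) (at 0)"
    using assms unfolding gen_def
    by (rule bounded_bilinear.has_vector_derivative[OF bounded_bilinear_inner])
  then have "((\<lambda>s. inner x y) has_vector_derivative inner x y' + inner x' y) (at 0)"
    by (simp add: tau_inner tau_0)
  moreover have "((\<lambda>s. inner x y) has_vector_derivative 0) (at (0::real))" by simp
  ultimately have "inner x y' + inner x' y = 0" by (rule vector_derivative_unique_at)
  then show ?thesis by simp
qed

text \<open>Mean value inequality along the orbit, whose velocity \<open>tau i s y\<close> has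
  constant norm.\<close>

lemma gen_bound: "gen i x y \<Longrightarrow> norm (tau i h x - x) \<le> \<bar>h\<bar> * norm y"
proof -
  assume g: "gen i x y"
  have "((\<lambda>t. t * norm y) has_real_derivative norm y) (at s)" for s
    by (auto intro!: derivative_eq_intros)
  from norm_diff_bound[OF gen_at[OF g] this, of h] show ?thesis
    by (simp add: tau_0 tau_norm abs_mult)
qed

section \<open>Central difference quotients\<close>

text \<open>The symmetric quotient is exactly skew-adjoint, because the adjoint of a translation is
  the opposite one; a one-sided quotient would not be. At h = 0 the value is 0.\<close>

definition Dh :: "nat \<Rightarrow> real \<Rightarrow> 'a \<Rightarrow> 'a" where
  "Dh i h x = (tau i h x - tau i (- h) x) /\<^sub>R (2 * h)"

lemma Dh_bl: "bounded_linear (Dh i h)"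
  unfolding Dh_def[abs_def] by (intro bounded_linear_intros tau_bl)

lemma Dh_skew: "inner (Dh i h x) y = - inner x (Dh i h y)"
  by (simp add: Dh_def inner_diff_left inner_diff_right tau_adjoint[of i h] tau_adjoint[of i "- h"]
      algebra_simps)

lemma Dh_commute: "Dh i h (Dh j k x) = Dh j k (Dh i h x)"
  by (simp add: Dh_def tau_simps scaleR_diff_right tau_commute[of i _ j] mult.commute algebra_simps)

lemma Dh_bound:
  assumes "gen i x y"
  shows "norm (Dh i h x) \<le> norm y"
proof (cases "h = 0")
  case False
  have "norm (tau i h x - tau i (- h) x) \<le> norm (tau i h x - x) + norm (tau i (- h) x - x)"
    by (metis diff_diff_eq2 diff_add_cancel norm_triangle_ineq4 add_diff_cancel_right diff_add_eq_diff_diff_swap)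
  also have "\<dots> \<le> 2 * \<bar>h\<bar> * norm y"
    using gen_bound[OF assms, of h] gen_bound[OF assms, of "-h"] by simp
  finally have "norm (tau i h x - tau i (- h) x) / (2 * \<bar>h\<bar>) \<le> norm y"
    using False by (simp add: divide_le_eq mult_ac)
  moreover have "\<bar>inverse (2 * h)\<bar> = 1 / (2 * \<bar>h\<bar>)" by (simp add: abs_mult inverse_eq_divide)
  ultimately show ?thesis unfolding Dh_def norm_scaleR by simp
qed (simp add: Dh_def)

text \<open>The central quotient is the mean of the forward and the backward quotient, and both
  converge to y.\<close>

lemma Dh_tendsto:
  assumes g: "gen i x y" and h: "filterlim h (at 0) F"
  shows "((\<lambda>n. Dh i (h n) x) \<longlongrightarrow> y) F"
proof -
  have q: "((\<lambda>s. (tau i s x - x) /\<^sub>R s) \<longlongrightarrow> y) (at 0)" using g by (simp add: gen_quotient)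
  have "((\<lambda>s::real. - s) \<longlongrightarrow> 0) (at 0)" using tendsto_minus[OF tendsto_ident_at, of 0 UNIV] by simp
  then have "filterlim (\<lambda>s. - s) (at 0) (at (0::real))"
    by (rule filterlim_atI) (simp add: eventually_at_filter)
  from filterlim_compose[OF q this]
  have q': "((\<lambda>s. (tau i (- s) x - x) /\<^sub>R (- s)) \<longlongrightarrow> y) (at 0)" by simp
  have "((\<lambda>s. (1/2) *\<^sub>R ((tau i s x - x) /\<^sub>R s + (tau i (- s) x - x) /\<^sub>R (- s))) \<longlongrightarrow> (1/2) *\<^sub>R (y + y)) (at 0)"
    by (intro tendsto_intros q q')
  moreover have "(1/2) *\<^sub>R ((tau i s x - x) /\<^sub>R s + (tau i (- s) x - x) /\<^sub>R (- s)) = Dh i s x" for s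
    by (simp add: Dh_def scaleR_diff_right algebra_simps)
  moreover have "(1/2) *\<^sub>R (y + y) = y" by (metis scaleR_half_double)
  ultimately have "((\<lambda>s. Dh i s x) \<longlongrightarrow> y) (at 0)" by simp
  from filterlim_compose[OF this h] show ?thesis .
qed

section \<open>Averages over translations\<close>

text \<open>The mean of the orbit between 0 and d. It does not increase norms, commutes with
  translations, and maps every vector into the domain of the generator in direction i. At d = 0 it
  is 0, not the identity.\<close>

definition Avg :: "nat \<Rightarrow> real \<Rightarrow> 'a \<Rightarrow> 'a" where
  "Avg i d x = Iint (\<lambda>s. tau i s x) d /\<^sub>R d"

lemma Avg_norm: "norm (Avg i d x) \<le> norm x"
proof (cases "d = 0")
  case False
  have "norm (Iint (\<lambda>s. tau i s x) d) \<le> \<bar>Iint (\<lambda>_. norm x) d\<bar>"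
    by (rule norm_Iint_le) (auto simp: tau_norm tau_cont)
  also have "\<dots> = \<bar>d\<bar> * norm x" by (simp add: Iint_const abs_mult)
  finally show ?thesis using False by (simp add: Avg_def field_simps)
qed (simp add: Avg_def)

lemma Avg_bl: "bounded_linear (Avg i d)"
proof (rule bounded_linear_intro[where K=1])
  show "Avg i d (x + y) = Avg i d x + Avg i d y" for x y
    by (simp add: Avg_def tau_simps Iint_add tau_cont scaleR_add_right)
  show "Avg i d (r *\<^sub>R x) = r *\<^sub>R Avg i d x" for r x
    unfolding Avg_def tau_simps bounded_linear_Iint[OF bounded_linear_scaleR_right tau_cont, symmetric]
    by (simp add: mult.commute)
qed (simp add: Avg_norm)

lemma Avg_commute:
  assumes L: "bounded_linear L" and comm: "\<And>s z. L (tau i s z) = tau i s (L z)"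
  shows "L (Avg i d x) = Avg i d (L x)"
proof -
  interpret bounded_linear L by fact
  show ?thesis unfolding Avg_def scaleR bounded_linear_Iint[OF L tau_cont] comm ..
qed

text \<open>Translating the average shifts both limits of integration, so its derivative consists of
  the two endpoint values.\<close>

lemma Avg_gen: "gen i (Avg i d x) ((tau i d x - x) /\<^sub>R d)"
proof -
  have "tau i r (Avg i d x) = (Iint (\<lambda>s. tau i s x) (r + d) - Iint (\<lambda>s. tau i s x) r) /\<^sub>R d" for r
    by (simp add: Avg_def tau_simps bounded_linear_Iint[OF tau_bl tau_cont] tau_add Iint_shift[OF tau_cont])
  moreover have "((\<lambda>r. Iint (\<lambda>s. tau i s x) (r + d)) has_vector_derivative tau i d x) (at 0)"
  proof -
    have "((\<lambda>r. r + d) has_vector_derivative 1) (at 0)" by (auto intro!: derivative_eq_intros)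
    from vector_diff_chain_at[OF this Iint_deriv[OF tau_cont]] show ?thesis by (simp add: o_def)
  qed
  moreover have "((\<lambda>r. Iint (\<lambda>s. tau i s x) r) has_vector_derivative x) (at 0)"
    using Iint_deriv[OF tau_cont, of i x 0] by (simp add: tau_0)
  ultimately show ?thesis
    unfolding gen_def
    by (auto intro!: bounded_linear.has_vector_derivative[OF bounded_linear_scaleR_right] has_vector_derivative_diff)
qed

lemma Avg_tendsto:
  assumes d: "filterlim d (at 0) F"
  shows "((\<lambda>n. Avg i (d n) x) \<longlongrightarrow> x) F"
proof -
  have "((\<lambda>r. Iint (\<lambda>s. tau i s x) r) has_vector_derivative x) (at 0)"
    using Iint_deriv[OF tau_cont, of i x 0] by (simp add: tau_0)
  then have "((\<lambda>r. Avg i r x) \<longlongrightarrow> x) (at 0)"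
    by (simp add: has_vector_derivative_iff_quotient Avg_def)
  from filterlim_compose[OF this d] show ?thesis .
qed

definition Reg :: "real \<Rightarrow> nat list \<Rightarrow> 'a \<Rightarrow> 'a" where
  "Reg d js = foldr (\<lambda>j. Avg j d) js"

lemma Reg_simps [simp]: "Reg d [] x = x" "Reg d (j # js) x = Avg j d (Reg d js x)"
  by (simp_all add: Reg_def)

lemma Reg_bl: "bounded_linear (Reg d js)"
proof (induction js)
  case Nil
  have "Reg d [] = (\<lambda>x. x)" by (simp add: fun_eq_iff)
  then show ?case by (simp add: bounded_linear_ident)
next
  case (Cons j js)
  have "Reg d (j # js) = (\<lambda>x. Avg j d (Reg d js x))" by (simp add: fun_eq_iff)
  then show ?case using bounded_linear_compose[OF Avg_bl Cons] by simp
qed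

lemma Reg_norm: "norm (Reg d js x) \<le> norm x"
  by (induction js) (auto intro: order_trans[OF Avg_norm])

lemma Avg_tau: "tau i s (Avg j d x) = Avg j d (tau i s x)"
  by (rule Avg_commute[OF tau_bl]) (rule tau_commute)

text \<open>The derivative after smoothing is a bounded operator of the original vector, which is
  what lets it pass through time integrals. When the outermost average is in another direction, it
  commutes with the derivative already found inside.\<close>

lemma Reg_gen:
  assumes "i \<in> set js"
  shows "\<exists>C. bounded_linear C \<and> (\<forall>x. gen i (Reg d js x) (C x))"
  using assms
proof (induction js)
  case (Cons j js)
  show ?case
  proof (cases "i = j")
    case True
    then show ?thesis
      by (intro exI[of _ "\<lambda>x. (tau j d (Reg d js x) - Reg d js x) /\<^sub>R d"] conjI
          bounded_linear_compose[OF bounded_linear_scaleR_right bounded_linear_sub]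
          bounded_linear_compose[OF tau_bl] Reg_bl) (simp add: Avg_gen)
  next
    case False
    then obtain C where C: "bounded_linear C" "\<And>x. gen i (Reg d js x) (C x)"
      using Cons by auto
    then show ?thesis
      by (intro exI[of _ "\<lambda>x. Avg j d (C x)"] conjI bounded_linear_compose[OF Avg_bl])
        (auto intro!: gen_bl[OF Avg_bl] simp: Avg_tau)
  qed
qed simp

text \<open>An average does not increase norms, so the error of the inner averages is not amplified
  by the outer one.\<close>

lemma Reg_tendsto:
  assumes d: "filterlim d (at 0) F"
  shows "((\<lambda>n. Reg (d n) js x) \<longlongrightarrow> x) F"
proof (induction js)
  case (Cons j js)
  have "((\<lambda>n. norm (Reg (d n) js x - x) + norm (Avg j (d n) x - x)) \<longlongrightarrow> 0 + 0) F"
    using Cons Avg_tendsto[OF d] by (intro tendsto_add) (simp_all add: LIM_zero_iff tendsto_norm_zero_iff)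
  moreover have "norm (Reg (d n) (j # js) x - x) \<le> norm (Reg (d n) js x - x) + norm (Avg j (d n) x - x)" for n
  proof -
    interpret A: bounded_linear "Avg j (d n)" by (rule Avg_bl)
    have "norm (Reg (d n) (j # js) x - x) = norm (Avg j (d n) (Reg (d n) js x - x) + (Avg j (d n) x - x))"
      by (simp add: A.diff)
    also have "\<dots> \<le> norm (Avg j (d n) (Reg (d n) js x - x)) + norm (Avg j (d n) x - x)"
      by (rule norm_triangle_ineq)
    finally show ?thesis using Avg_norm[of j "d n" "Reg (d n) js x - x"] by linarith
  qed
  ultimately have "((\<lambda>n. Reg (d n) (j # js) x - x) \<longlongrightarrow> 0) F"
    using Lim_null_comparison[of "\<lambda>n. Reg (d n) (j # js) x - x" "\<lambda>n. norm (Reg (d n) js x - x) + norm (Avg j (d n) x - x)" F]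
    by (simp only: always_eventually add_0_right simp_thms)
  then show ?case by (rule LIM_zero_cancel)
qed simp

end

lemma filterlim_inverse_Suc: "filterlim (\<lambda>n. 1 / real (Suc n)) (at 0) sequentially"
  unfolding filterlim_at using LIMSEQ_inverse_real_of_nat by (auto simp: inverse_eq_divide)

text \<open>The core plays the role of the test functions: vectors in the domain of every generator,
  stable under translation, and numerous enough to detect zero.\<close>

locale transl_core = transl tau for tau :: "nat \<Rightarrow> real \<Rightarrow> 'a::{real_inner,banach} \<Rightarrow> 'a" +
  fixes core :: "'a set" and D :: "nat \<Rightarrow> 'a \<Rightarrow> 'a"
  assumes core_gen: "\<psi> \<in> core \<Longrightarrow> gen i \<psi> (D i \<psi>)"
    and core_tau: "\<psi> \<in> core \<Longrightarrow> tau i s \<psi> \<in> core"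
    and core_total: "(\<And>\<psi>. \<psi> \<in> core \<Longrightarrow> inner x \<psi> = 0) \<Longrightarrow> x = 0"
begin

lemma D_tau: "\<psi> \<in> core \<Longrightarrow> D i (tau j s \<psi>) = tau j s (D i \<psi>)"
  by (rule gen_unique[OF core_gen[OF core_tau] gen_bl[OF tau_bl _ core_gen]]) (auto simp: tau_commute)

section \<open>Weak divergence\<close>

text \<open>y is the sum of the derivatives D_i x_i over I, with each D_i moved onto a core vector.
  A singleton I gives a weak partial derivative, {..<N} a weak divergence, so one notion serves both
  equations of the system.\<close>

definition wdiv :: "nat set \<Rightarrow> (nat \<Rightarrow> 'a) \<Rightarrow> 'a \<Rightarrow> bool" where
  "wdiv I x y \<longleftrightarrow> (\<forall>\<psi>\<in>core. inner y \<psi> = - (\<Sum>i\<in>I. inner (x i) (D i \<psi>)))"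

lemma wdiv_tau:
  assumes "wdiv I x y"
  shows "wdiv I (\<lambda>i. tau j s (x i)) (tau j s y)"
  using assms by (simp add: wdiv_def tau_adjoint core_tau flip: D_tau)

lemma wdiv_diff: "wdiv I x y \<Longrightarrow> wdiv I x' y' \<Longrightarrow> wdiv I (\<lambda>i. x i - x' i) (y - y')"
  by (simp add: wdiv_def inner_diff_left sum_subtractf)

lemma wdiv_scale: "wdiv I x y \<Longrightarrow> wdiv I (\<lambda>i. c *\<^sub>R x i) (c *\<^sub>R y)"
  by (simp add: wdiv_def sum_distrib_left)

text \<open>The relation holds for every translate; it is integrated over the translation
  parameter.\<close>

lemma wdiv_Avg:
  assumes w: "wdiv I x y"
  shows "wdiv I (\<lambda>i. Avg j d (x i)) (Avg j d y)"
  unfolding wdiv_def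
proof
  fix \<psi> assume \<psi>: "\<psi> \<in> core"
  have c: "continuous_on UNIV (\<lambda>s. inner (tau j s z) ch)" for z ch
    by (intro continuous_intros tau_cont)
  have I: "Iint (\<lambda>s. inner (tau j s z) ch) d = d * inner (Avg j d z) ch" for z ch
    by (cases "d = 0") (simp_all add: Avg_def bounded_linear_Iint[OF bounded_linear_inner_left tau_cont])
  have "inner (tau j s y) \<psi> + (\<Sum>i\<in>I. inner (tau j s (x i)) (D i \<psi>)) = 0" for s
    using wdiv_tau[OF w, of j s] \<psi> by (simp add: wdiv_def)
  then have "Iint (\<lambda>s. inner (tau j s y) \<psi> + (\<Sum>i\<in>I. inner (tau j s (x i)) (D i \<psi>))) d = 0"
    by (simp add: Iint_const)
  then have "d * (inner (Avg j d y) \<psi> + (\<Sum>i\<in>I. inner (Avg j d (x i)) (D i \<psi>))) = 0"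
    by (simp add: Iint_add Iint_sum c continuous_on_sum I distrib_left sum_distrib_left)
  then show "inner (Avg j d y) \<psi> = - (\<Sum>i\<in>I. inner (Avg j d (x i)) (D i \<psi>))"
    by (cases "d = 0") (simp_all add: Avg_def)
qed

lemma wdiv_Reg: "wdiv I x y \<Longrightarrow> wdiv I (\<lambda>i. Reg d js (x i)) (Reg d js y)"
  by (induction js) (auto intro: wdiv_Avg)

text \<open>On the domains of the generators the weak and the strong divergence agree:
  skew-adjointness shows that the strong one qualifies, totality of the core that no other vector
  does.\<close>

lemma wdiv_gen:
  assumes "\<And>i. i \<in> I \<Longrightarrow> gen i (x i) (z i)"
  shows "wdiv I x y \<longleftrightarrow> y = (\<Sum>i\<in>I. z i)"
proof -
  have *: "inner (z i) \<psi> = - inner (x i) (D i \<psi>)" if "i \<in> I" "\<psi> \<in> core" for i \<psi>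
    using gen_skew[OF assms core_gen] that by blast
  have "(\<Sum>i\<in>I. inner (z i) \<psi>) = (\<Sum>i\<in>I. - inner (x i) (D i \<psi>))" if "\<psi> \<in> core" for \<psi>
    by (intro sum.cong refl * that)
  then have "wdiv I x (\<Sum>i\<in>I. z i)"
    by (simp add: wdiv_def inner_sum_left sum_negf)
  moreover have "y = y'" if "wdiv I x y" "wdiv I x y'" for y'
  proof -
    have "y - y' = 0" by (rule core_total) (use that in \<open>simp add: wdiv_def inner_diff_left\<close>)
    then show ?thesis by simp
  qed
  ultimately show ?thesis by blast
qed

text \<open>
  The weak form of \<open>\<partial>\<^sub>t p\<^sub>i = D\<^sub>i v\<close>, \<open>\<partial>\<^sub>t v = (\<Sum>i<N. D\<^sub>i p\<^sub>i) + f\<close>, integrated in time so that no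
  derivative of \<open>p\<close> or \<open>v\<close> is needed.
\<close>

definition wave :: "nat \<Rightarrow> (nat \<Rightarrow> real \<Rightarrow> 'a) \<Rightarrow> (real \<Rightarrow> 'a) \<Rightarrow> (real \<Rightarrow> 'a) \<Rightarrow> bool" where
  "wave N p v f \<longleftrightarrow> (\<forall>i<N. continuous_on UNIV (p i)) \<and> continuous_on UNIV v \<and> continuous_on UNIV f \<and>
     (\<forall>t. \<forall>i<N. wdiv {i} (\<lambda>_. Iint v t) (p i t - p i 0)) \<and>
     (\<forall>t. wdiv {..<N} (\<lambda>i. Iint (p i) t) (v t - v 0 - Iint f t))"

lemma waveD:
  assumes "wave N p v f"
  shows "i < N \<Longrightarrow> continuous_on UNIV (p i)" "continuous_on UNIV v" "continuous_on UNIV f"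
    "i < N \<Longrightarrow> wdiv {i} (\<lambda>_. Iint v t) (p i t - p i 0)"
    "wdiv {..<N} (\<lambda>i. Iint (p i) t) (v t - v 0 - Iint f t)"
  using assms by (auto simp: wave_def)

definition energy :: "nat \<Rightarrow> (nat \<Rightarrow> real \<Rightarrow> 'a) \<Rightarrow> (real \<Rightarrow> 'a) \<Rightarrow> real \<Rightarrow> real" where
  "energy N p v t = (norm (v t))\<^sup>2 + (\<Sum>i<N. (norm (p i t))\<^sup>2)"

lemma energy_nonneg: "0 \<le> energy N p v t"
  by (simp add: energy_def sum_nonneg)

lemma norm_le_energy: "norm (v t) \<le> sqrt (energy N p v t)" "i < N \<Longrightarrow> norm (p i t) \<le> sqrt (energy N p v t)"
proof -
  show "norm (v t) \<le> sqrt (energy N p v t)"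
    by (rule real_le_rsqrt) (simp add: energy_def sum_nonneg)
  assume "i < N"
  then have "(norm (p i t))\<^sup>2 \<le> (\<Sum>i<N. (norm (p i t))\<^sup>2)"
    by (intro member_le_sum) auto
  then show "norm (p i t) \<le> sqrt (energy N p v t)"
    by (intro real_le_rsqrt) (simp add: energy_def add_increasing)
qed

lemma inner_self_deriv:
  assumes "(u has_vector_derivative u') (at t)"
  shows "((\<lambda>t. (norm (u t))\<^sup>2) has_real_derivative 2 * inner (u t) u') (at t)"
  using bounded_bilinear.has_vector_derivative[OF bounded_bilinear_inner assms assms]
  by (simp add: power2_norm_eq_inner has_real_derivative_iff_has_vector_derivative inner_commute)

text \<open>Formally the cross terms in the derivative of |v|^2 + |p|^2 cancel by skew-adjointness,
  but v and p need be neither differentiable in time nor in the domains of the generators. The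
  averages \<open>B n\<close> repair both; the time-integrated identity survives the limit in n and
  is differentiated again at the end.\<close>

theorem wave_energy:
  assumes w: "wave N p v f"
  shows "(energy N p v has_real_derivative 2 * inner (f t) (v t)) (at t)"
proof -
  note W = waveD[OF w]
  define B where "B n = Reg (1 / real (Suc n)) [0..<N]" for n
  have Bbl: "bounded_linear (B n)" for n unfolding B_def by (rule Reg_bl)
  have Bn: "norm (B n x) \<le> norm x" for n x unfolding B_def by (rule Reg_norm)
  have Bt: "(\<lambda>n. B n x) \<longlonglongrightarrow> x" for x
    unfolding B_def by (rule Reg_tendsto[OF filterlim_inverse_Suc])
  have cB: "continuous_on UNIV (\<lambda>s. B n (g s))" if "continuous_on UNIV g" for n g
    using bounded_linear.continuous_on[OF Bbl that] .
  have *: "energy N (\<lambda>i t. B n (p i t)) (\<lambda>t. B n (v t)) t - energy N (\<lambda>i t. B n (p i t)) (\<lambda>t. B n (v t)) 0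
      = Iint (\<lambda>s. 2 * inner (B n (f s)) (B n (v s))) t" for n t
  proof -
    have "\<forall>i. \<exists>C. i < N \<longrightarrow> bounded_linear C \<and> (\<forall>x. gen i (B n x) (C x))"
      using Reg_gen[of _ "[0..<N]"] unfolding B_def by fastforce
    then obtain C where C: "\<And>i. i < N \<Longrightarrow> bounded_linear (C i)" "\<And>i x. i < N \<Longrightarrow> gen i (B n x) (C i x)"
      by metis
    interpret B: bounded_linear "B n" by (rule Bbl)
    \<comment> \<open>After smoothing, the weak relation becomes an equation with a bounded
      operator, hence a formula for \<open>B n (p i t)\<close> that can be differentiated in
      t.\<close>
    have eqp: "B n (p i t) = B n (p i 0) + C i (Iint v t)" if "i < N" for i t
    proof -
      have "wdiv {i} (\<lambda>_. B n (Iint v t)) (B n (p i t - p i 0))"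
        unfolding B_def by (rule wdiv_Reg[OF W(4)[OF that]])
      then have "B n (p i t - p i 0) = (\<Sum>j\<in>{i}. C j (Iint v t))"
        by (subst (asm) wdiv_gen[where z="\<lambda>j. C j (Iint v t)"]) (use that C in auto)
      then show ?thesis by (simp add: B.diff algebra_simps)
    qed
    have dp: "((\<lambda>t. B n (p i t)) has_vector_derivative C i (v t)) (at t)" if i: "i < N" for i t
    proof -
      have "((\<lambda>t. B n (p i 0) + C i (Iint v t)) has_vector_derivative 0 + C i (v t)) (at t)"
        using bounded_linear.has_vector_derivative[OF C(1)[OF i] Iint_deriv[OF W(2)]]
        by (rule has_vector_derivative_add[OF has_vector_derivative_const])
      then show ?thesis unfolding eqp[OF i, symmetric] by simp
    qed
    have eqv: "B n (v t) = B n (v 0) + B n (Iint f t) + (\<Sum>i<N. C i (Iint (p i) t))" for t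
    proof -
      have "wdiv {..<N} (\<lambda>i. B n (Iint (p i) t)) (B n (v t - v 0 - Iint f t))"
        unfolding B_def by (rule wdiv_Reg[OF W(5)])
      then have "B n (v t - v 0 - Iint f t) = (\<Sum>i<N. C i (Iint (p i) t))"
        by (subst (asm) wdiv_gen[where z="\<lambda>i. C i (Iint (p i) t)"]) (use C in auto)
      then have "B n (v t) - B n (v 0) - B n (Iint f t) = (\<Sum>i<N. C i (Iint (p i) t))"
        by (simp only: B.diff)
      then show ?thesis by (simp add: algebra_simps)
    qed
    have "((\<lambda>t. B n (v 0) + B n (Iint f t) + (\<Sum>i<N. C i (Iint (p i) t))) has_vector_derivative
        0 + B n (f t) + (\<Sum>i<N. C i (p i t))) (at t)" for t
      by (intro has_vector_derivative_add has_vector_derivative_const has_vector_derivative_sum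
          bounded_linear.has_vector_derivative[OF Bbl] bounded_linear.has_vector_derivative[OF C(1)]
          Iint_deriv W) auto
    then have dv: "((\<lambda>t. B n (v t)) has_vector_derivative B n (f t) + (\<Sum>i<N. C i (p i t))) (at t)" for t
      unfolding eqv[symmetric] by simp
    have "(energy N (\<lambda>i t. B n (p i t)) (\<lambda>t. B n (v t)) has_real_derivative
       2 * inner (B n (v t)) (B n (f t) + (\<Sum>i<N. C i (p i t))) +
       (\<Sum>i<N. 2 * inner (B n (p i t)) (C i (v t)))) (at t)" for t
      unfolding energy_def[abs_def]
      by (intro DERIV_add DERIV_sum inner_self_deriv dv dp) auto
    \<comment> \<open>The terms with \<open>C i\<close> cancel by \<open>gen_skew\<close>, and only
      the forcing remains.\<close>
    moreover have "2 * inner (B n (v t)) (B n (f t) + (\<Sum>i<N. C i (p i t))) +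
       (\<Sum>i<N. 2 * inner (B n (p i t)) (C i (v t))) = 2 * inner (B n (f t)) (B n (v t))" for t
    proof -
      have "inner (B n (p i t)) (C i (v t)) = - inner (B n (v t)) (C i (p i t))" if "i < N" for i
        using gen_skew[OF C(2)[OF that] C(2)[OF that], of "v t" "p i t"] by (simp add: inner_commute)
      then have "(\<Sum>i<N. inner (B n (p i t)) (C i (v t))) = - inner (B n (v t)) (\<Sum>i<N. C i (p i t))"
        by (simp add: inner_sum_right sum_negf)
      then show ?thesis
        by (simp add: inner_add_right inner_commute flip: sum_distrib_left)
    qed
    ultimately have "(energy N (\<lambda>i t. B n (p i t)) (\<lambda>t. B n (v t)) has_vector_derivative
       2 * inner (B n (f t)) (B n (v t))) (at t)" for t
      by (simp add: has_real_derivative_iff_has_vector_derivative)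
    then show ?thesis
      by (intro Iint_unique continuous_intros cB W)
  qed
  \<comment> \<open>Dominated convergence in the time integral; the majorant uses that
    \<open>B n\<close> does not increase norms.\<close>
  have E: "energy N p v t - energy N p v 0 = Iint (\<lambda>s. 2 * inner (f s) (v s)) t" for t
  proof -
    have "(\<lambda>n. Iint (\<lambda>s. 2 * inner (B n (f s)) (B n (v s))) t) \<longlonglongrightarrow> Iint (\<lambda>s. 2 * inner (f s) (v s)) t"
    proof (rule Iint_dominated(1)[where h="\<lambda>s. 2 * (norm (f s) * norm (v s))"])
      fix n s
      have "\<bar>inner (B n (f s)) (B n (v s))\<bar> \<le> norm (B n (f s)) * norm (B n (v s))"
        by (rule Cauchy_Schwarz_ineq2)
      also have "\<dots> \<le> norm (f s) * norm (v s)" by (intro mult_mono Bn) auto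
      finally show "\<bar>2 * inner (B n (f s)) (B n (v s))\<bar> \<le> 2 * (norm (f s) * norm (v s))" by simp
    qed (intro continuous_intros cB W tendsto_intros Bt)+
    moreover have "(\<lambda>n. energy N (\<lambda>i t. B n (p i t)) (\<lambda>t. B n (v t)) t) \<longlonglongrightarrow> energy N p v t" for t
      unfolding energy_def by (intro tendsto_intros Bt)
    then have "(\<lambda>n. energy N (\<lambda>i t. B n (p i t)) (\<lambda>t. B n (v t)) t - energy N (\<lambda>i t. B n (p i t)) (\<lambda>t. B n (v t)) 0)
        \<longlonglongrightarrow> energy N p v t - energy N p v 0"
      by (intro tendsto_diff)
    ultimately show ?thesis unfolding * using LIMSEQ_unique by blast
  qed
  have eq: "energy N p v = (\<lambda>t. energy N p v 0 + Iint (\<lambda>s. 2 * inner (f s) (v s)) t)"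
  proof
    show "energy N p v t = energy N p v 0 + Iint (\<lambda>s. 2 * inner (f s) (v s)) t" for t
      using E[of t] by linarith
  qed
  have "continuous_on UNIV (\<lambda>s. 2 * inner (f s) (v s))" by (intro continuous_intros W)
  from DERIV_add[OF DERIV_const Iint_deriv_real[OF this]] show ?thesis
    by (subst eq) simp
qed

corollary wave_energy_bound:
  assumes w: "wave N p v f"
  shows "sqrt (energy N p v t) \<le> sqrt (energy N p v 0) + \<bar>Iint (\<lambda>s. norm (f s)) t\<bar>"
proof (rule sqrt_energy_bound[OF energy_nonneg wave_energy[OF w]])
  show "continuous_on UNIV (\<lambda>s. norm (f s))" by (intro continuous_intros waveD[OF w])
  fix s
  have "\<bar>inner (f s) (v s)\<bar> \<le> norm (f s) * norm (v s)" by (rule Cauchy_Schwarz_ineq2)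
  also have "\<dots> \<le> norm (f s) * sqrt (energy N p v s)" by (intro mult_left_mono norm_le_energy) auto
  finally show "\<bar>2 * inner (f s) (v s)\<bar> \<le> 2 * norm (f s) * sqrt (energy N p v s)" by simp
qed simp

end

section \<open>Existence and regularity for wave systems\<close>

lemma locally_uniform_Cauchy_limit:
  fixes X :: "nat \<Rightarrow> real \<Rightarrow> 'a::banach"
  assumes c: "\<And>n. continuous_on UNIV (X n)"
    and cauchy: "\<And>T e. e > 0 \<Longrightarrow> \<exists>M. \<forall>m\<ge>M. \<forall>n\<ge>M. \<forall>t. \<bar>t\<bar> \<le> T \<longrightarrow> norm (X m t - X n t) < e"
  shows "\<exists>x. continuous_on UNIV x \<and> (\<forall>T. uniform_limit {-T..T} X x sequentially)"
proof -
  have uc: "uniformly_convergent_on {-T..T} X" for T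
  proof (rule Cauchy_uniformly_convergent, unfold uniformly_Cauchy_on_def, intro allI impI)
    fix e :: real assume "e > 0"
    from cauchy[OF this, of T] obtain M where M:
      "\<And>m n t. m \<ge> M \<Longrightarrow> n \<ge> M \<Longrightarrow> \<bar>t\<bar> \<le> T \<Longrightarrow> norm (X m t - X n t) < e" by blast
    show "\<exists>M. \<forall>x\<in>{-T..T}. \<forall>m\<ge>M. \<forall>n\<ge>M. dist (X m x) (X n x) < e"
      by (rule exI[of _ M]) (auto simp: dist_norm intro!: M)
  qed
  \<comment> \<open>A pointwise definition, so that the limits on different intervals [-T, T] are
    the same function.\<close>
  define x where "x t = lim (\<lambda>n. X n t)" for t
  have ul: "uniform_limit {-T..T} X x sequentially" for T
  proof -
    from uc[of T] obtain l where l: "uniform_limit {-T..T} X l sequentially"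
      by (auto simp: uniformly_convergent_on_def)
    have "x t = l t" if "t \<in> {-T..T}" for t
      using tendsto_uniform_limitI[OF l that] by (simp add: x_def limI)
    then have "uniform_limit {-T..T} X x sequentially = uniform_limit {-T..T} X l sequentially"
      by (intro uniform_limit_cong') auto
    then show ?thesis using l by simp
  qed
  have "continuous_on UNIV x"
  proof (rule continuous_at_imp_continuous_on, rule ballI)
    fix t :: real
    have "continuous_on {-(\<bar>t\<bar>+1)..\<bar>t\<bar>+1} x"
      by (rule uniform_limit_theorem[OF _ ul]) (auto intro!: always_eventually continuous_on_subset[OF c])
    then show "isCont x t"
      by (rule continuous_on_interior) (simp; linarith)
  qed
  with ul show ?thesis by blast
qed

lemma uniform_limit_Iint:
  fixes X :: "nat \<Rightarrow> real \<Rightarrow> 'a::banach"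
  assumes c: "\<And>n. continuous_on UNIV (X n)" "continuous_on UNIV x"
    and ul: "uniform_limit {-\<bar>t\<bar>..\<bar>t\<bar>} X x sequentially"
  shows "(\<lambda>n. Iint (X n) t) \<longlonglongrightarrow> Iint x t"
proof (rule LIMSEQ_I)
  fix r :: real assume "r > 0"
  then have e: "r / (\<bar>t\<bar> + 1) > 0" by simp
  obtain M where M: "\<And>n s. n \<ge> M \<Longrightarrow> s \<in> {-\<bar>t\<bar>..\<bar>t\<bar>} \<Longrightarrow> dist (X n s) (x s) < r / (\<bar>t\<bar> + 1)"
    using uniform_limitD[OF ul e] unfolding eventually_sequentially by blast
  have "norm (Iint (X n) t - Iint x t) < r" if "n \<ge> M" for n
  proof -
    have "norm (Iint (\<lambda>s. X n s - x s) t) \<le> \<bar>Iint (\<lambda>s. r / (\<bar>t\<bar> + 1)) t\<bar>"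
    proof (rule norm_Iint_le)
      fix s assume "\<bar>s\<bar> \<le> \<bar>t\<bar>"
      then have "s \<in> {-\<bar>t\<bar>..\<bar>t\<bar>}" by simp linarith
      from M[OF that this] show "norm (X n s - x s) \<le> r / (\<bar>t\<bar> + 1)" by (simp add: dist_norm)
    qed (intro continuous_intros c)+
    also have "\<dots> = \<bar>t\<bar> * r / (\<bar>t\<bar> + 1)" using \<open>r > 0\<close> by (simp add: Iint_const abs_mult)
    also have "\<dots> < r" using \<open>r > 0\<close> by (simp add: field_simps)
    finally show ?thesis by (simp add: Iint_diff c)
  qed
  then show "\<exists>no. \<forall>n\<ge>no. norm (Iint (X n) t - Iint x t) < r" by blast
qed

section \<open>The approximating system with central differences\<close>

context transl_core
begin

lemma sqrt_energy_le: "sqrt (energy N p v t) \<le> norm (v t) + (\<Sum>i<N. norm (p i t))"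
proof -
  have "(\<Sum>i<N. (norm (p i t))\<^sup>2) \<le> (\<Sum>i<N. norm (p i t))\<^sup>2"
    by (induction N) (auto simp: power2_sum sum_nonneg add_increasing2)
  then have "energy N p v t \<le> (norm (v t) + (\<Sum>i<N. norm (p i t)))\<^sup>2"
    by (simp add: energy_def power2_sum sum_nonneg add_increasing2)
  then show ?thesis by (intro real_le_lsqrt) (auto simp: sum_nonneg)
qed

text \<open>Skew-adjointness removes \<open>Dh\<close> from the energy balance, so only
  \<open>a\<close> and \<open>g\<close> contribute. They are zero and the forcing in
  \<open>hsys_energy_bound\<close>, and the consistency errors when solutions with two different
  steps are compared.\<close>

lemma perturbed_energy_bound:
  assumes dp: "\<And>i t. i < N \<Longrightarrow> (p i has_vector_derivative Dh i h (v t) + a i t) (at t)"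
    and dv: "\<And>t. (v has_vector_derivative (\<Sum>i<N. Dh i h (p i t)) + g t) (at t)"
    and ca: "\<And>i. i < N \<Longrightarrow> continuous_on UNIV (a i)" and cg: "continuous_on UNIV g"
  shows "sqrt (energy N p v t) \<le> sqrt (energy N p v 0) + \<bar>Iint (\<lambda>s. norm (g s) + (\<Sum>i<N. norm (a i s))) t\<bar>"
proof (rule sqrt_energy_bound[OF energy_nonneg])
  fix t
  show "(energy N p v has_real_derivative
       2 * inner (v t) ((\<Sum>i<N. Dh i h (p i t)) + g t) +
       (\<Sum>i<N. 2 * inner (p i t) (Dh i h (v t) + a i t))) (at t)"
    unfolding energy_def[abs_def]
    by (intro DERIV_add DERIV_sum inner_self_deriv dv dp) auto
next
  show "continuous_on UNIV (\<lambda>s. norm (g s) + (\<Sum>i<N. norm (a i s)))"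
    by (intro continuous_intros cg ca) auto
next
  fix t
  have "2 * inner (v t) ((\<Sum>i<N. Dh i h (p i t)) + g t) + (\<Sum>i<N. 2 * inner (p i t) (Dh i h (v t) + a i t))
     = 2 * (inner (v t) (g t) + (\<Sum>i<N. inner (p i t) (a i t)))"
  proof -
    have "inner (p i t) (Dh i h (v t)) = - inner (v t) (Dh i h (p i t))" for i
      by (metis Dh_skew inner_commute)
    then show ?thesis
      by (simp add: inner_add_right inner_sum_right sum.distrib sum_subtractf sum_negf sum_distrib_left distrib_left)
  qed
  moreover have "\<bar>inner (v t) (g t) + (\<Sum>i<N. inner (p i t) (a i t))\<bar>
      \<le> sqrt (energy N p v t) * norm (g t) + (\<Sum>i<N. sqrt (energy N p v t) * norm (a i t))"
    by (intro order_trans[OF abs_triangle_ineq] add_mono order_trans[OF sum_abs] sum_mono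
        order_trans[OF Cauchy_Schwarz_ineq2] mult_right_mono norm_le_energy) auto
  moreover have "sqrt (energy N p v t) * norm (g t) + (\<Sum>i<N. sqrt (energy N p v t) * norm (a i t))
     = (norm (g t) + (\<Sum>i<N. norm (a i t))) * sqrt (energy N p v t)"
    by (simp add: sum_distrib_left algebra_simps)
  ultimately show "\<bar>2 * inner (v t) ((\<Sum>i<N. Dh i h (p i t)) + g t) + (\<Sum>i<N. 2 * inner (p i t) (Dh i h (v t) + a i t))\<bar>
     \<le> 2 * (norm (g t) + (\<Sum>i<N. norm (a i t))) * sqrt (energy N p v t)"
    by (simp only: abs_mult abs_numeral mult.assoc) (simp only: mult_le_cancel_left_pos zero_less_numeral)
qed (auto intro!: add_nonneg_nonneg sum_nonneg)

definition hsys :: "nat \<Rightarrow> real \<Rightarrow> (nat \<Rightarrow> real \<Rightarrow> 'a) \<Rightarrow> (real \<Rightarrow> 'a) \<Rightarrow> (real \<Rightarrow> 'a) \<Rightarrow> bool" where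
  "hsys N h p v f \<longleftrightarrow> continuous_on UNIV f \<and>
     (\<forall>i<N. \<forall>t. (p i has_vector_derivative Dh i h (v t)) (at t)) \<and>
     (\<forall>t. (v has_vector_derivative (\<Sum>i<N. Dh i h (p i t)) + f t) (at t))"

lemma hsysD:
  assumes "hsys N h p v f"
  shows "continuous_on UNIV f" "i < N \<Longrightarrow> (p i has_vector_derivative Dh i h (v t)) (at t)"
    "(v has_vector_derivative (\<Sum>i<N. Dh i h (p i t)) + f t) (at t)"
    "continuous_on UNIV v" "i < N \<Longrightarrow> continuous_on UNIV (p i)"
proof -
  show "continuous_on UNIV f" and p: "i < N \<Longrightarrow> (p i has_vector_derivative Dh i h (v t)) (at t)"
    and v: "(v has_vector_derivative (\<Sum>i<N. Dh i h (p i t)) + f t) (at t)" for i t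
    using assms by (auto simp: hsys_def)
  show "continuous_on UNIV v" by (rule deriv_imp_continuous[OF v])
  show "continuous_on UNIV (p i)" if "i < N" by (rule deriv_imp_continuous[OF p[OF that]])
qed

text \<open>The bound does not involve h; this uniformity is what all limits of vanishing step rest
  on.\<close>

lemma hsys_energy_bound:
  assumes h: "hsys N h p v f" and t: "\<bar>t\<bar> \<le> T"
  shows "sqrt (energy N p v t) \<le> norm (v 0) + (\<Sum>i<N. norm (p i 0)) + integral {-T..T} (\<lambda>s. norm (f s))"
proof -
  note H = hsysD[OF h]
  have "sqrt (energy N p v t) \<le> sqrt (energy N p v 0) + \<bar>Iint (\<lambda>s. norm (f s) + (\<Sum>i<N. norm ((\<lambda>_ _. 0::'a) i s))) t\<bar>"
    by (rule perturbed_energy_bound) (use H in auto)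
  moreover have "\<bar>Iint (\<lambda>s. norm (f s)) t\<bar> \<le> integral {-T..T} (\<lambda>s. norm (f s))"
    by (intro abs_Iint_le_integral t continuous_intros H) auto
  ultimately show ?thesis using sqrt_energy_le[of N p v 0] by simp
qed

lemma hsys_diff:
  assumes "hsys N h p v f" "hsys N h p' v' f'"
  shows "hsys N h (\<lambda>i t. p i t - p' i t) (\<lambda>t. v t - v' t) (\<lambda>t. f t - f' t)"
proof -
  interpret D: bounded_linear "Dh i h" for i by (rule Dh_bl)
  have "((\<lambda>t. p i t - p' i t) has_vector_derivative Dh i h (v t - v' t)) (at t)" if "i < N" for i t
    unfolding D.diff by (intro has_vector_derivative_diff hsysD[OF assms(1)] hsysD[OF assms(2)] that)
  moreover have "((\<lambda>t. v t - v' t) has_vector_derivative (\<Sum>i<N. Dh i h (p i t - p' i t)) + (f t - f' t)) (at t)" for t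
    using has_vector_derivative_diff[OF hsysD(3)[OF assms(1)] hsysD(3)[OF assms(2)], of t]
    by (simp add: D.diff sum_subtractf algebra_simps)
  ultimately show ?thesis
    using hsysD(1)[OF assms(1)] hsysD(1)[OF assms(2)] by (simp add: hsys_def continuous_on_diff)
qed

text \<open>Used with \<open>L\<close> the difference of two central quotients, which commutes with
  every \<open>Dh\<close>.\<close>

lemma hsys_bl:
  assumes h: "hsys N h p v f" and L: "bounded_linear L" and comm: "\<And>i x. L (Dh i h x) = Dh i h (L x)"
  shows "hsys N h (\<lambda>i t. L (p i t)) (\<lambda>t. L (v t)) (\<lambda>t. L (f t))"
proof -
  interpret L: bounded_linear L by (rule L)
  note H = hsysD[OF h]
  have "((\<lambda>t. L (p i t)) has_vector_derivative Dh i h (L (v t))) (at t)" if "i < N" for i t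
    using bounded_linear.has_vector_derivative[OF L H(2)[OF that]] by (simp add: comm)
  moreover have "((\<lambda>t. L (v t)) has_vector_derivative (\<Sum>i<N. Dh i h (L (p i t))) + L (f t)) (at t)" for t
    using bounded_linear.has_vector_derivative[OF L H(3)] by (simp add: L.add L.sum comm)
  ultimately show ?thesis using bounded_linear.continuous_on[OF L H(1)] by (simp add: hsys_def)
qed

text \<open>Integrating the first equation gives p i = q i + Dh i h (Iint v). Substituted into the
  second, it leaves a Volterra equation for v alone with a bounded operator.\<close>

lemma hsys_exists:
  assumes f: "continuous_on UNIV f"
  shows "\<exists>p v. hsys N h p v f \<and> (\<forall>i. p i 0 = q i) \<and> v 0 = v0"
proof -
  define L where "L y = (\<Sum>i<N. Dh i h (Dh i h y))" for y
  have L: "bounded_linear L"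
    unfolding L_def[abs_def] by (intro bounded_linear_sum bounded_linear_compose[OF Dh_bl] Dh_bl)
  interpret L: bounded_linear L by (rule L)
  obtain M where M: "M > 0" "\<And>x. norm (L x) \<le> norm x * M" using L.pos_bounded by blast
  define g where "g s = (\<Sum>i<N. Dh i h (q i)) + f s" for s
  define \<Phi> where "\<Phi> x t = v0 + Iint (\<lambda>s. L (Iint x s) + g s) t" for x t
  have g: "continuous_on UNIV g" unfolding g_def by (intro continuous_intros f)
  have cL: "continuous_on UNIV (\<lambda>s. L (Iint x s))" if "continuous_on UNIV x" for x
    by (rule bounded_linear.continuous_on[OF L continuous_on_Iint[OF that]])
  \<comment> \<open>Two time integrations gain 1 / lam^2, so lam^2 = 2 M gives the contraction
    factor 1/2.\<close>
  define lam where "lam = sqrt (2 * M)"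
  have lam: "lam > 0" "lam * lam = 2 * M" using M(1) by (auto simp: lam_def)
  have "\<exists>v. continuous_on UNIV v \<and> (\<forall>t. \<Phi> v t = v t)"
  proof (rule local_fixed_point[OF _ lam(1)])
    show "continuous_on UNIV (\<Phi> x)" if "continuous_on UNIV x" for x
      unfolding \<Phi>_def[abs_def] by (intro continuous_intros continuous_on_Iint cL[OF that] g)
  next
    fix x y :: "real \<Rightarrow> 'a" and K T t :: real
    assume x: "continuous_on UNIV x" and y: "continuous_on UNIV y"
      and le: "\<And>t. \<bar>t\<bar> \<le> T \<Longrightarrow> norm (x t - y t) \<le> K * exp (lam * \<bar>t\<bar>)" and t: "\<bar>t\<bar> \<le> T"
    have "\<Phi> x t - \<Phi> y t = Iint (\<lambda>s. L (Iint (\<lambda>r. x r - y r) s)) t"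
      using Iint_diff[of "\<lambda>s. L (Iint x s) + g s" "\<lambda>s. L (Iint y s) + g s" t] x y g
      by (simp add: \<Phi>_def Iint_diff L.diff cL continuous_on_add)
    also have "norm \<dots> \<le> (K / lam * M) / lam * exp (lam * \<bar>t\<bar>)"
    proof (rule weighted_Iint_le[OF cL lam(1)])
      fix s assume s: "\<bar>s\<bar> \<le> \<bar>t\<bar>"
      have "norm (Iint (\<lambda>r. x r - y r) s) \<le> K / lam * exp (lam * \<bar>s\<bar>)"
        by (rule weighted_Iint_le) (use x y lam(1) s t le in \<open>auto intro!: continuous_intros\<close>)
      then have "norm (Iint (\<lambda>r. x r - y r) s) * M \<le> K / lam * exp (lam * \<bar>s\<bar>) * M"
        using M(1) by (intro mult_right_mono) auto
      then show "norm (L (Iint (\<lambda>r. x r - y r) s)) \<le> (K / lam * M) * exp (lam * \<bar>s\<bar>)"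
        using M(2)[of "Iint (\<lambda>r. x r - y r) s"] by (simp add: mult_ac)
    qed (intro continuous_intros x y)
    also have "(K / lam * M) / lam = K / 2" using lam M(1) by (simp add: field_simps)
    finally show "norm (\<Phi> x t - \<Phi> y t) \<le> K / 2 * exp (lam * \<bar>t\<bar>)" .
  qed
  then obtain v where v: "continuous_on UNIV v" "\<And>t. \<Phi> v t = v t" by blast
  define p where "p i t = q i + Dh i h (Iint v t)" for i t
  interpret D: bounded_linear "Dh i h" for i by (rule Dh_bl)
  have "((\<lambda>t. q i + Dh i h (Iint v t)) has_vector_derivative 0 + Dh i h (v t)) (at t)" for i t
    by (intro has_vector_derivative_add has_vector_derivative_const
        bounded_linear.has_vector_derivative[OF Dh_bl] Iint_deriv v)
  then have "(p i has_vector_derivative Dh i h (v t)) (at t)" for i t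
    by (simp add: p_def[abs_def])
  moreover have "(\<Phi> v has_vector_derivative 0 + (L (Iint v t) + g t)) (at t)" for t
    unfolding \<Phi>_def[abs_def]
    by (intro has_vector_derivative_add has_vector_derivative_const Iint_deriv continuous_on_add cL v g)
  then have "(v has_vector_derivative (\<Sum>i<N. Dh i h (p i t)) + f t) (at t)" for t
    using v(2) by (simp add: p_def g_def L_def D.add sum.distrib fun_eq_iff[THEN iffD2, of "\<Phi> v" v] algebra_simps)
  moreover have "p i 0 = q i" for i by (simp add: p_def D.zero)
  moreover have "v 0 = v0" using v(2)[of 0] by (simp add: \<Phi>_def)
  ultimately show ?thesis using f by (auto simp: hsys_def)
qed

lemma Dh_diff_bl: "bounded_linear (\<lambda>x. Dh j h x - Dh j k x)"
  by (intro bounded_linear_sub Dh_bl)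

text \<open>The difference of two solutions solves the system with step \<open>h m\<close> up to the
  error \<open>L i\<close> applied to the n-th solution, \<open>L i\<close> being the difference of
  the two central quotients. As \<open>L i\<close> commutes with \<open>Dh\<close>, this error
  solves the n-th system itself, and the energy bound reduces it to \<open>L i\<close> applied to
  the data, which is small because the data lie in the domains of the generators.\<close>

lemma hsys_Cauchy_regular:
  assumes S: "\<And>n. hsys N (1 / real (Suc n)) (p n) (v n) f"
    and ip: "\<And>n i. i < N \<Longrightarrow> p n i 0 = q i" and iv: "\<And>n. v n 0 = v0"
    and gq: "\<And>i j. i < N \<Longrightarrow> j < N \<Longrightarrow> gen j (q i) (q' j i)"
    and gv: "\<And>j. j < N \<Longrightarrow> gen j v0 (v0' j)"
    and gf: "\<And>j s. j < N \<Longrightarrow> gen j (f s) (f' j s)"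
    and cf': "\<And>j. j < N \<Longrightarrow> continuous_on UNIV (f' j)"
    and e: "e > 0"
  shows "\<exists>M. \<forall>m\<ge>M. \<forall>n\<ge>M. \<forall>t. \<bar>t\<bar> \<le> T \<longrightarrow>
    sqrt (energy N (\<lambda>i t. p m i t - p n i t) (\<lambda>t. v m t - v n t) t) < e"
proof -
  define h where "h n = 1 / real (Suc n)" for n
  note S = S[folded h_def]
  note h0 = filterlim_inverse_Suc[folded h_def]
  have cf: "continuous_on UNIV f" using hsysD(1)[OF S] .
  \<comment> \<open>How far the central quotients of the data are from the true derivatives; by the
    triangle inequality \<open>c j m + c j n\<close> bounds \<open>L j\<close> on the data.\<close>
  define c where "c j n = norm (Dh j (h n) v0 - v0' j) + (\<Sum>i<N. norm (Dh j (h n) (q i) - q' j i)) +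
    integral {-T..T} (\<lambda>s. norm (Dh j (h n) (f s) - f' j s))" for j n
  have c0: "(\<lambda>n. c j n) \<longlonglongrightarrow> 0" if j: "j < N" for j
  proof -
    have z: "(\<lambda>n. norm (Dh j (h n) x - y)) \<longlonglongrightarrow> 0" if "gen j x y" for x y
      using Dh_tendsto[OF that h0] by (simp add: tendsto_norm_zero_iff LIM_zero_iff)
    \<comment> \<open>The majorant comes from \<open>Dh_bound\<close>: a quotient never exceeds the
      derivative in norm.\<close>
    have "(\<lambda>n. integral {-T..T} (\<lambda>s. norm (Dh j (h n) (f s) - f' j s))) \<longlonglongrightarrow> integral {-T..T} (\<lambda>s. 0)"
    proof (rule Iint_dominated(2)[where h="\<lambda>s. 2 * norm (f' j s)"])
      fix n s
      show "\<bar>norm (Dh j (h n) (f s) - f' j s)\<bar> \<le> 2 * norm (f' j s)"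
        using norm_triangle_ineq4[of "Dh j (h n) (f s)" "f' j s"] Dh_bound[OF gf[OF j], of "h n" s] by simp
    qed (intro continuous_intros bounded_linear.continuous_on[OF Dh_bl] cf cf' j z gf)+
    then have "(\<lambda>n. c j n) \<longlonglongrightarrow> 0 + (\<Sum>i<N. 0) + integral {-T..T} (\<lambda>s. 0)"
      unfolding c_def by (intro tendsto_add tendsto_sum z gq gv j) auto
    then show ?thesis by simp
  qed
  have main: "sqrt (energy N (\<lambda>i t. p m i t - p n i t) (\<lambda>t. v m t - v n t) t) \<le> T * (2 * (\<Sum>j<N. c j m + c j n))"
    if t: "\<bar>t\<bar> \<le> T" for m n t
  proof -
    define L where "L j x = Dh j (h m) x - Dh j (h n) x" for j x
    have Lbl: "bounded_linear (L j)" for j unfolding L_def[abs_def] by (rule Dh_diff_bl)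
    have comm: "L j (Dh i (h n) x) = Dh i (h n) (L j x)" for i j x
      by (simp add: L_def Dh_commute linear_diff[OF bounded_linear.linear[OF Dh_bl]])
    have cL: "continuous_on UNIV (\<lambda>s. L j (g s))" if "continuous_on UNIV g" for j g
      by (rule bounded_linear.continuous_on[OF Lbl that])
    have Le: "sqrt (energy N (\<lambda>i t. L j (p n i t)) (\<lambda>t. L j (v n t)) s) \<le> c j m + c j n"
      if j: "j < N" and s: "\<bar>s\<bar> \<le> T" for j s
    proof -
      have tri: "norm (L j x) \<le> norm (Dh j (h m) x - y) + norm (Dh j (h n) x - y)" for x y
        unfolding L_def using norm_triangle_ineq4[of "Dh j (h m) x - y" "Dh j (h n) x - y"] by simp
      have cd: "continuous_on UNIV (\<lambda>s. norm (Dh j (h k) (f s) - f' j s))" for k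
        by (intro continuous_intros bounded_linear.continuous_on[OF Dh_bl] cf cf' j)
      have io: "k integrable_on {-T..T}" if "continuous_on UNIV k" for k :: "real \<Rightarrow> real"
        using that by (intro integrable_continuous_real) (auto intro: continuous_on_subset)
      have "sqrt (energy N (\<lambda>i t. L j (p n i t)) (\<lambda>t. L j (v n t)) s)
         \<le> norm (L j v0) + (\<Sum>i<N. norm (L j (q i))) + integral {-T..T} (\<lambda>s. norm (L j (f s)))"
        using hsys_energy_bound[OF hsys_bl[OF S Lbl comm] s] by (simp add: ip iv)
      also have "\<dots> \<le> (norm (Dh j (h m) v0 - v0' j) + norm (Dh j (h n) v0 - v0' j)) +
          (\<Sum>i<N. norm (Dh j (h m) (q i) - q' j i) + norm (Dh j (h n) (q i) - q' j i)) +
          integral {-T..T} (\<lambda>s. norm (Dh j (h m) (f s) - f' j s) + norm (Dh j (h n) (f s) - f' j s))"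
        by (intro add_mono sum_mono integral_le tri io continuous_intros cL cf cd)
      also have "\<dots> = c j m + c j n"
        by (simp add: c_def sum.distrib Henstock_Kurzweil_Integration.integral_add io cd)
      finally show ?thesis .
    qed
    interpret D: bounded_linear "Dh i k" for i k by (rule Dh_bl)
    have "sqrt (energy N (\<lambda>i t. p m i t - p n i t) (\<lambda>t. v m t - v n t) t) \<le>
       sqrt (energy N (\<lambda>i t. p m i t - p n i t) (\<lambda>t. v m t - v n t) 0) +
       \<bar>Iint (\<lambda>s. norm (\<Sum>i<N. L i (p n i s)) + (\<Sum>i<N. norm (L i (v n s)))) t\<bar>"
    proof (rule perturbed_energy_bound[where h="h m"])
      fix i t assume i: "i < N"
      show "((\<lambda>t. p m i t - p n i t) has_vector_derivative Dh i (h m) (v m t - v n t) + L i (v n t)) (at t)"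
      proof -
        have "((\<lambda>t. p m i t - p n i t) has_vector_derivative Dh i (h m) (v m t) - Dh i (h n) (v n t)) (at t)"
          by (intro has_vector_derivative_diff hsysD(2)[OF S] i)
        then show ?thesis by (simp add: D.diff L_def)
      qed
      show "continuous_on UNIV (\<lambda>s. L i (v n s))" by (intro cL hsysD[OF S])
    next
      fix t
      show "((\<lambda>t. v m t - v n t) has_vector_derivative
          (\<Sum>i<N. Dh i (h m) (p m i t - p n i t)) + (\<Sum>i<N. L i (p n i t))) (at t)"
      proof -
        have "((\<lambda>t. v m t - v n t) has_vector_derivative ((\<Sum>i<N. Dh i (h m) (p m i t)) + f t)
          - ((\<Sum>i<N. Dh i (h n) (p n i t)) + f t)) (at t)"
          by (intro has_vector_derivative_diff hsysD(3)[OF S])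
        then show ?thesis by (simp add: D.diff L_def sum_subtractf)
      qed
    next
      show "continuous_on UNIV (\<lambda>s. \<Sum>i<N. L i (p n i s))"
        by (intro continuous_intros cL hsysD[OF S]) auto
    qed
    also have "energy N (\<lambda>i t. p m i t - p n i t) (\<lambda>t. v m t - v n t) 0 = 0"
      by (simp add: energy_def ip iv)
    also have "\<bar>Iint (\<lambda>s. norm (\<Sum>i<N. L i (p n i s)) + (\<Sum>i<N. norm (L i (v n s)))) t\<bar>
       \<le> \<bar>Iint (\<lambda>s. 2 * (\<Sum>j<N. c j m + c j n)) t\<bar>"
    proof (subst real_norm_def[symmetric], rule norm_Iint_le)
      fix s assume s: "\<bar>s\<bar> \<le> \<bar>t\<bar>"
      have b: "norm (L i (p n i s)) \<le> c i m + c i n" "norm (L i (v n s)) \<le> c i m + c i n" if "i < N" for i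
        using norm_le_energy(1)[of "\<lambda>t. L i (v n t)" s N "\<lambda>k t. L i (p n k t)"]
          norm_le_energy(2)[OF that, of "\<lambda>k t. L i (p n k t)" s "\<lambda>t. L i (v n t)"] Le[OF that, of s] s t
        by auto
      have "norm (\<Sum>i<N. L i (p n i s)) \<le> (\<Sum>i<N. c i m + c i n)"
        by (intro order_trans[OF norm_sum] sum_mono b) auto
      moreover have "(\<Sum>i<N. norm (L i (v n s))) \<le> (\<Sum>i<N. c i m + c i n)"
        by (intro sum_mono b) auto
      moreover have "0 \<le> norm (\<Sum>i<N. L i (p n i s)) + (\<Sum>i<N. norm (L i (v n s)))"
        by (intro add_nonneg_nonneg sum_nonneg) auto
      ultimately show "norm (norm (\<Sum>i<N. L i (p n i s)) + (\<Sum>i<N. norm (L i (v n s)))) \<le> 2 * (\<Sum>j<N. c j m + c j n)"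
        by simp
    next
      show "continuous_on UNIV (\<lambda>s. norm (\<Sum>i<N. L i (p n i s)) + (\<Sum>i<N. norm (L i (v n s))))"
        by (intro continuous_intros cL hsysD[OF S]) auto
    qed (rule continuous_on_const)
    also have "\<dots> \<le> T * (2 * (\<Sum>j<N. c j m + c j n))"
    proof -
      have "0 \<le> c j m + c j n" if "j < N" for j
        using Le[OF that, of 0] t energy_nonneg real_sqrt_ge_zero order_trans by (metis abs_ge_zero abs_zero order_trans)
      then have "0 \<le> (\<Sum>j<N. c j m + c j n)" by (intro sum_nonneg) auto
      then show ?thesis unfolding Iint_const real_scaleR_def abs_mult using t by (intro mult_mono) auto
    qed
    finally show ?thesis by simp
  qed
  define C where "C n = T * (2 * (\<Sum>j<N. c j n))" for n
  have "C \<longlonglongrightarrow> T * (2 * (\<Sum>j<N. 0))"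
    unfolding C_def[abs_def] by (intro tendsto_intros c0) auto
  then have "C \<longlonglongrightarrow> 0" by simp
  from order_tendstoD(2)[OF this, of "e / 2"] e obtain M where M: "\<And>n. n \<ge> M \<Longrightarrow> C n < e / 2"
    by (auto simp: eventually_sequentially)
  have "T * (2 * (\<Sum>j<N. c j m + c j n)) = C m + C n" for m n
    by (simp add: C_def sum.distrib algebra_simps)
  then have "sqrt (energy N (\<lambda>i t. p m i t - p n i t) (\<lambda>t. v m t - v n t) t) < e"
    if "m \<ge> M" "n \<ge> M" "\<bar>t\<bar> \<le> T" for m n t
    using main[OF that(3), of m n] M[OF that(1)] M[OF that(2)] by simp
  then show ?thesis by blast
qed

text \<open>General data are smoothed by \<open>B k\<close> first. The energy bound controls the
  resulting change uniformly in the step, so one k serves all n, and a third of e is spent on each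
  of three differences.\<close>

lemma hsys_Cauchy:
  assumes f: "continuous_on UNIV f"
    and S: "\<And>n. hsys N (1 / real (Suc n)) (p n) (v n) f"
    and ip: "\<And>n i. p n i 0 = q i" and iv: "\<And>n. v n 0 = v0"
    and e: "e > 0"
  shows "\<exists>M. \<forall>m\<ge>M. \<forall>n\<ge>M. \<forall>t. \<bar>t\<bar> \<le> T \<longrightarrow> norm (v m t - v n t) < e \<and> (\<forall>i<N. norm (p m i t - p n i t) < e)"
proof -
  define B where "B k = Reg (1 / real (Suc k)) [0..<N]" for k
  have Bbl: "bounded_linear (B k)" for k unfolding B_def by (rule Reg_bl)
  have Bt: "(\<lambda>k. B k x) \<longlonglongrightarrow> x" for x
    unfolding B_def by (rule Reg_tendsto[OF filterlim_inverse_Suc])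
  have cB: "continuous_on UNIV (\<lambda>s. B k (f s))" for k
    by (rule bounded_linear.continuous_on[OF Bbl f])
  define c where "c k = norm (v0 - B k v0) + (\<Sum>i<N. norm (q i - B k (q i))) +
    integral {-T..T} (\<lambda>s. norm (f s - B k (f s)))" for k
  have "c \<longlonglongrightarrow> norm (v0 - v0) + (\<Sum>i<N. norm (q i - q i)) + integral {-T..T} (\<lambda>s. norm (f s - f s))"
    unfolding c_def[abs_def]
  proof (intro tendsto_add tendsto_sum tendsto_norm tendsto_diff tendsto_const Bt)
    show "(\<lambda>k. integral {-T..T} (\<lambda>s. norm (f s - B k (f s)))) \<longlonglongrightarrow> integral {-T..T} (\<lambda>s. norm (f s - f s))"
    proof (rule Iint_dominated(2)[where h="\<lambda>s. 2 * norm (f s)"])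
      fix k s
      show "\<bar>norm (f s - B k (f s))\<bar> \<le> 2 * norm (f s)"
        using norm_triangle_ineq4[of "f s" "B k (f s)"] Reg_norm[of "1 / real (Suc k)" "[0..<N]" "f s"]
        by (simp add: B_def)
    qed (intro continuous_intros cB f tendsto_intros Bt)+
  qed
  then have "c \<longlonglongrightarrow> 0" by simp
  from order_tendstoD(2)[OF this, of "e / 3"] e obtain k where k: "c k < e / 3"
    by (auto simp: eventually_sequentially)
  have "\<forall>n. \<exists>P V. hsys N (1 / real (Suc n)) P V (\<lambda>s. B k (f s)) \<and> (\<forall>i. P i 0 = B k (q i)) \<and> V 0 = B k v0"
    using hsys_exists[OF cB[of k], of N _ "\<lambda>i. B k (q i)" "B k v0"] by blast
  then obtain P V where PV: "\<And>n. hsys N (1 / real (Suc n)) (P n) (V n) (\<lambda>s. B k (f s))"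
    "\<And>n i. P n i 0 = B k (q i)" "\<And>n. V n 0 = B k v0" by metis
  have "\<exists>C. j < N \<longrightarrow> bounded_linear C \<and> (\<forall>x. gen j (B k x) (C x))" for j
    using Reg_gen[of j "[0..<N]"] unfolding B_def by fastforce
  then obtain C where C: "\<And>j. j < N \<Longrightarrow> bounded_linear (C j)" "\<And>j x. j < N \<Longrightarrow> gen j (B k x) (C j x)"
    by metis
  have "\<exists>M. \<forall>m\<ge>M. \<forall>n\<ge>M. \<forall>t. \<bar>t\<bar> \<le> T \<longrightarrow>
    sqrt (energy N (\<lambda>i t. P m i t - P n i t) (\<lambda>t. V m t - V n t) t) < e / 3"
    by (rule hsys_Cauchy_regular[OF PV, where q'="\<lambda>j i. C j (q i)" and v0'="\<lambda>j. C j v0" and f'="\<lambda>j s. C j (f s)"])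
      (use C e bounded_linear.continuous_on[OF C(1) f] in auto)
  then obtain M where M: "\<And>m n t. m \<ge> M \<Longrightarrow> n \<ge> M \<Longrightarrow> \<bar>t\<bar> \<le> T \<Longrightarrow>
    sqrt (energy N (\<lambda>i t. P m i t - P n i t) (\<lambda>t. V m t - V n t) t) < e / 3" by blast
  have near: "sqrt (energy N (\<lambda>i t. p n i t - P n i t) (\<lambda>t. v n t - V n t) t) < e / 3" if "\<bar>t\<bar> \<le> T" for n t
    using hsys_energy_bound[OF hsys_diff[OF S PV(1)] that, of n] k by (simp add: ip iv PV c_def)
  have tri: "norm (a - b) < e" if "norm (a - a') < e / 3" "norm (a' - b') < e / 3" "norm (b - b') < e / 3"
    for a b a' b' :: 'a
  proof -
    have "a - b = (a - a') + (a' - b') - (b - b')" by simp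
    then have "norm (a - b) = norm ((a - a') + (a' - b') - (b - b'))" by (rule arg_cong)
    then have "norm (a - b) \<le> norm (a - a') + norm (a' - b') + norm (b - b')"
      using norm_triangle_ineq4[of "(a - a') + (a' - b')" "b - b'"] norm_triangle_ineq[of "a - a'" "a' - b'"]
      by linarith
    then show ?thesis using that by simp
  qed
  have "norm (v m t - v n t) < e \<and> (\<forall>i<N. norm (p m i t - p n i t) < e)"
    if "m \<ge> M" "n \<ge> M" and t: "\<bar>t\<bar> \<le> T" for m n t
  proof (intro conjI allI impI)
    show "norm (v m t - v n t) < e"
    proof (rule tri[of _ "V m t" "V n t"])
      show "norm (v k t - V k t) < e / 3" for k
        using norm_le_energy(1)[of "\<lambda>t. v k t - V k t"] near[OF t, of k] by (rule order.strict_trans1)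
      then show "norm (v n t - V n t) < e / 3" .
      show "norm (V m t - V n t) < e / 3"
        using norm_le_energy(1)[of "\<lambda>t. V m t - V n t"] M[OF that(1,2) t] by (rule order.strict_trans1)
    qed
    show "norm (p m i t - p n i t) < e" if i: "i < N" for i
    proof (rule tri[of _ "P m i t" "P n i t"])
      show "norm (p k i t - P k i t) < e / 3" for k
        using norm_le_energy(2)[OF i, of "\<lambda>i t. p k i t - P k i t"] near[OF t, of k] by (rule order.strict_trans1)
      then show "norm (p n i t - P n i t) < e / 3" .
      show "norm (P m i t - P n i t) < e / 3"
        using norm_le_energy(2)[OF i, of "\<lambda>i t. P m i t - P n i t"] M[OF \<open>m \<ge> M\<close> \<open>n \<ge> M\<close> t]
        by (rule order.strict_trans1)
    qed
  qed
  then show ?thesis by blast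
qed

text \<open>The quotients are moved onto the core vector by skew-adjointness, where they converge in
  norm.\<close>

lemma wdiv_Dh_limit:
  assumes h: "filterlim h (at 0) sequentially" and x: "\<And>i. i \<in> I \<Longrightarrow> (\<lambda>n. x n i) \<longlonglongrightarrow> x' i"
    and y: "(\<lambda>n. \<Sum>i\<in>I. Dh i (h n) (x n i)) \<longlonglongrightarrow> y"
  shows "wdiv I x' y"
  unfolding wdiv_def
proof
  fix \<psi> assume \<psi>: "\<psi> \<in> core"
  have "(\<lambda>n. - (\<Sum>i\<in>I. inner (x n i) (Dh i (h n) \<psi>))) \<longlonglongrightarrow> - (\<Sum>i\<in>I. inner (x' i) (D i \<psi>))"
    by (intro tendsto_intros x Dh_tendsto[OF core_gen[OF \<psi>] h])
  moreover have "(\<lambda>n. inner (\<Sum>i\<in>I. Dh i (h n) (x n i)) \<psi>) \<longlonglongrightarrow> inner y \<psi>"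
    by (intro tendsto_intros y)
  moreover have "inner (\<Sum>i\<in>I. Dh i (h n) (x n i)) \<psi> = - (\<Sum>i\<in>I. inner (x n i) (Dh i (h n) \<psi>))" for n
    by (simp add: inner_sum_left Dh_skew sum_negf)
  ultimately show "inner y \<psi> = - (\<Sum>i\<in>I. inner (x' i) (D i \<psi>))"
    using LIMSEQ_unique by simp
qed

section \<open>Weak solutions of linear and nonlinear wave systems\<close>

theorem wave_exists:
  assumes f: "continuous_on UNIV f"
  shows "\<exists>p v. wave N p v f \<and> (\<forall>i<N. p i 0 = q i) \<and> v 0 = v0"
proof -
  define h where "h n = 1 / real (Suc n)" for n
  note h0 = filterlim_inverse_Suc[folded h_def]
  have "\<forall>n. \<exists>P V. hsys N (h n) P V f \<and> (\<forall>i. P i 0 = q i) \<and> V 0 = v0"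
    using hsys_exists[OF f] by blast
  then obtain P V where S: "\<And>n. hsys N (h n) (P n) (V n) f" and iP: "\<And>n i. P n i 0 = q i" and iV: "\<And>n. V n 0 = v0"
    by metis
  note H = hsysD[OF S]
  note Cau = hsys_Cauchy[OF f S[unfolded h_def] iP iV]
  have "\<exists>x. continuous_on UNIV x \<and> (\<forall>T. uniform_limit {-T..T} V x sequentially)"
    by (rule locally_uniform_Cauchy_limit[OF H(4)]) (use Cau in meson)
  then obtain v where v: "continuous_on UNIV v" "\<And>T. uniform_limit {-T..T} V v sequentially" by blast
  have "\<exists>x. i < N \<longrightarrow> continuous_on UNIV x \<and> (\<forall>T. uniform_limit {-T..T} (\<lambda>n. P n i) x sequentially)" for i
  proof (cases "i < N")
    case True
    have "\<exists>x. continuous_on UNIV x \<and> (\<forall>T. uniform_limit {-T..T} (\<lambda>n. P n i) x sequentially)"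
      by (rule locally_uniform_Cauchy_limit[OF H(5)[OF True]]) (use Cau True in meson)
    then show ?thesis by blast
  qed simp
  then obtain p where p: "\<And>i. i < N \<Longrightarrow> continuous_on UNIV (p i)"
    "\<And>i T. i < N \<Longrightarrow> uniform_limit {-T..T} (\<lambda>n. P n i) (p i) sequentially" by metis
  have in_abs: "t \<in> {-\<bar>t\<bar>..\<bar>t\<bar>}" for t :: real by simp linarith
  have lv: "(\<lambda>n. V n t) \<longlonglongrightarrow> v t" for t by (rule tendsto_uniform_limitI[OF v(2) in_abs])
  have lp: "(\<lambda>n. P n i t) \<longlonglongrightarrow> p i t" if "i < N" for i t by (rule tendsto_uniform_limitI[OF p(2)[OF that] in_abs])
  have lIv: "(\<lambda>n. Iint (V n) t) \<longlonglongrightarrow> Iint v t" for t by (rule uniform_limit_Iint[OF H(4) v])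
  have lIp: "(\<lambda>n. Iint (P n i) t) \<longlonglongrightarrow> Iint (p i) t" if "i < N" for i t
    by (rule uniform_limit_Iint[OF H(5)[OF that] p[OF that]])
  have p0: "p i 0 = q i" if "i < N" for i
    using LIMSEQ_unique[OF lp[OF that, of 0] ] iP by simp
  have v0: "v 0 = v0" using LIMSEQ_unique[OF lv[of 0]] iV by simp
  have wp: "wdiv {i} (\<lambda>_. Iint v t) (p i t - p i 0)" if i: "i < N" for i t
  proof (rule wdiv_Dh_limit[OF h0, where x="\<lambda>n _. Iint (V n) t"])
    have "P n i t - P n i 0 = Dh i (h n) (Iint (V n) t)" for n
      unfolding bounded_linear_Iint[OF Dh_bl H(4)]
      by (rule Iint_unique[OF bounded_linear.continuous_on[OF Dh_bl H(4)] H(2)[OF i]])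
    then show "(\<lambda>n. \<Sum>i\<in>{i}. Dh i (h n) (Iint (V n) t)) \<longlonglongrightarrow> p i t - p i 0"
      using tendsto_diff[OF lp[OF i, of t] lp[OF i, of 0]] by simp
  qed (rule lIv)
  have wv: "wdiv {..<N} (\<lambda>i. Iint (p i) t) (v t - v 0 - Iint f t)" for t
  proof (rule wdiv_Dh_limit[OF h0, where x="\<lambda>n i. Iint (P n i) t"])
    have cD: "continuous_on UNIV (\<lambda>s. Dh i (h n) (P n i s))" if "i < N" for i n
      by (rule bounded_linear.continuous_on[OF Dh_bl H(5)[OF that]])
    have "V n t - V n 0 - Iint f t = (\<Sum>i<N. Dh i (h n) (Iint (P n i) t))" for n
    proof -
      have "V n t - V n 0 = Iint (\<lambda>s. (\<Sum>i<N. Dh i (h n) (P n i s)) + f s) t"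
        by (rule Iint_unique[OF _ H(3)]) (intro continuous_on_add continuous_on_sum cD f; simp)
      also have "\<dots> = (\<Sum>i<N. Iint (\<lambda>s. Dh i (h n) (P n i s)) t) + Iint f t"
        by (subst Iint_add[OF continuous_on_sum f], intro cD, simp, subst Iint_sum, intro cD, simp_all)
      also have "(\<Sum>i<N. Iint (\<lambda>s. Dh i (h n) (P n i s)) t) = (\<Sum>i<N. Dh i (h n) (Iint (P n i) t))"
        by (intro sum.cong refl bounded_linear_Iint[OF Dh_bl H(5), symmetric]) simp
      finally show ?thesis by simp
    qed
    then show "(\<lambda>n. \<Sum>i<N. Dh i (h n) (Iint (P n i) t)) \<longlonglongrightarrow> v t - v 0 - Iint f t"
      using tendsto_diff[OF tendsto_diff[OF lv[of t] lv[of 0]] tendsto_const[of "Iint f t"]] by simp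
  qed (simp add: lIp)
  have "wave N p v f" using p v f wp wv by (simp add: wave_def)
  then show ?thesis using p0 v0 by blast
qed

lemma wave_diff:
  assumes w: "wave N p v f" and w': "wave N p' v' f'"
  shows "wave N (\<lambda>i t. p i t - p' i t) (\<lambda>t. v t - v' t) (\<lambda>t. f t - f' t)"
proof -
  note W = waveD[OF w] and W' = waveD[OF w']
  have "wdiv {i} (\<lambda>_. Iint (\<lambda>t. v t - v' t) t) (p i t - p' i t - (p i 0 - p' i 0))" if "i < N" for i t
    using wdiv_diff[OF W(4)[OF that] W'(4)[OF that], of t t] by (simp add: Iint_diff W W' algebra_simps)
  moreover have "wdiv {..<N} (\<lambda>i. Iint (\<lambda>t. p i t - p' i t) t)
     (v t - v' t - (v 0 - v' 0) - Iint (\<lambda>t. f t - f' t) t)" for t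
  proof -
    have "wdiv {..<N} (\<lambda>i. Iint (p i) t - Iint (p' i) t)
       (v t - v' t - (v 0 - v' 0) - Iint (\<lambda>t. f t - f' t) t)"
      using wdiv_diff[OF W(5) W'(5), of t t] by (simp add: Iint_diff W W' algebra_simps)
    then show ?thesis unfolding wdiv_def by (simp add: Iint_diff W W')
  qed
  ultimately show ?thesis by (auto simp: wave_def intro!: continuous_on_diff W W')
qed

text \<open>The system has constant coefficients, so translations, and with them their linear
  combinations, map solutions to solutions.\<close>

lemma wave_quotient:
  assumes w: "wave N p v f"
  shows "wave N (\<lambda>i t. (tau j h (p i t) - p i t) /\<^sub>R h) (\<lambda>t. (tau j h (v t) - v t) /\<^sub>R h)
     (\<lambda>t. (tau j h (f t) - f t) /\<^sub>R h)"
proof -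
  note W = waveD[OF w]
  define L where "L x = (tau j h x - x) /\<^sub>R h" for x
  have L: "bounded_linear L"
    unfolding L_def[abs_def]
    by (rule bounded_linear_compose[OF bounded_linear_scaleR_right bounded_linear_sub[OF tau_bl bounded_linear_ident]])
  interpret L: bounded_linear L by (rule L)
  have wL: "wdiv I (\<lambda>i. L (x i)) (L y)" if "wdiv I x y" for I x y
    unfolding L_def by (intro wdiv_scale wdiv_diff wdiv_tau that)
  have "wdiv {i} (\<lambda>_. Iint (\<lambda>t. L (v t)) t) (L (p i t) - L (p i 0))" if "i < N" for i t
    using wL[OF W(4)[OF that]] by (simp add: bounded_linear_Iint[OF L] W L.diff)
  moreover have "wdiv {..<N} (\<lambda>i. Iint (\<lambda>t. L (p i t)) t) (L (v t) - L (v 0) - Iint (\<lambda>t. L (f t)) t)" for t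
    using wL[OF W(5), of t] unfolding wdiv_def by (simp add: bounded_linear_Iint[OF L] W L.diff)
  ultimately have "wave N (\<lambda>i t. L (p i t)) (\<lambda>t. L (v t)) (\<lambda>t. L (f t))"
    by (auto simp: wave_def intro!: bounded_linear.continuous_on[OF L] W)
  then show ?thesis by (simp add: L_def)
qed

text \<open>The fixed point is sought for the displacement w = Iint v, because the forcing depends
  on v through w only. Two time integrals lie between w and its image, one from the energy bound and
  one from the velocity to the displacement.\<close>

theorem wave_nonlinear_exists:
  assumes "L > 0" and lip: "\<And>x y. norm (F x - F y) \<le> L * norm (x - y)"
  shows "\<exists>p v. wave N p v (\<lambda>t. F (Iint v t)) \<and> (\<forall>i<N. p i 0 = q i) \<and> v 0 = v0"
proof -
  have cF: "continuous_on UNIV (\<lambda>t. F (w t))" if w: "continuous_on UNIV w" for w :: "real \<Rightarrow> 'a"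
  proof -
    have "continuous_on UNIV F"
    proof (rule continuous_onI, simp add: dist_norm)
      fix x and e :: real assume "e > 0"
      show "\<exists>d>0. \<forall>y. norm (y - x) < d \<longrightarrow> norm (F y - F x) \<le> e"
      proof (intro exI[of _ "e / L"] conjI allI impI)
        fix y assume "norm (y - x) < e / L"
        then have "L * norm (y - x) \<le> e" using \<open>L > 0\<close> by (simp add: field_simps)
        then show "norm (F y - F x) \<le> e" using lip[of y x] by linarith
      qed (use \<open>e > 0\<close> \<open>L > 0\<close> in simp)
    qed
    then show ?thesis by (rule continuous_on_compose2[OF _ w]) simp
  qed
  have "\<exists>p v. continuous_on UNIV w \<longrightarrow> wave N p v (\<lambda>t. F (w t)) \<and> (\<forall>i<N. p i 0 = q i) \<and> v 0 = v0" for w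
    using wave_exists[OF cF] by blast
  then obtain P V where PV: "\<And>w. continuous_on UNIV w \<Longrightarrow> wave N (P w) (V w) (\<lambda>t. F (w t))"
    "\<And>w i. continuous_on UNIV w \<Longrightarrow> i < N \<Longrightarrow> P w i 0 = q i" "\<And>w. continuous_on UNIV w \<Longrightarrow> V w 0 = v0"
    by metis
  \<comment> \<open>With two integrations the contraction factor is L / lam^2 = 1/2.\<close>
  define lam where "lam = sqrt (2 * L)"
  have lam: "lam > 0" "lam * lam = 2 * L" using \<open>L > 0\<close> by (auto simp: lam_def)
  have "\<exists>w. continuous_on UNIV w \<and> (\<forall>t. Iint (V w) t = w t)"
  proof (rule local_fixed_point[OF _ lam(1)])
    show "continuous_on UNIV (Iint (V w))" if "continuous_on UNIV w" for w
      by (intro continuous_on_Iint waveD[OF PV(1)[OF that]])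
  next
    fix x y :: "real \<Rightarrow> 'a" and K T t :: real
    assume x: "continuous_on UNIV x" and y: "continuous_on UNIV y"
      and le: "\<And>t. \<bar>t\<bar> \<le> T \<Longrightarrow> norm (x t - y t) \<le> K * exp (lam * \<bar>t\<bar>)" and t: "\<bar>t\<bar> \<le> T"
    note W = wave_diff[OF PV(1)[OF x] PV(1)[OF y]]
    have "norm (Iint (\<lambda>s. V x s - V y s) t) \<le> L * K / lam / lam * exp (lam * \<bar>t\<bar>)"
    proof (rule weighted_Iint_le[OF waveD(2)[OF W] lam(1)])
      fix s assume s: "\<bar>s\<bar> \<le> \<bar>t\<bar>"
      have e0: "energy N (\<lambda>i t. P x i t - P y i t) (\<lambda>t. V x t - V y t) 0 = 0"
        by (simp add: energy_def PV(2,3) x y)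
      have "norm (V x s - V y s) \<le> \<bar>Iint (\<lambda>r. norm (F (x r) - F (y r))) s\<bar>"
        using wave_energy_bound[OF W, of s] norm_le_energy(1)[of "\<lambda>t. V x t - V y t" s N "\<lambda>i t. P x i t - P y i t"]
        by (simp add: e0)
      also have "\<dots> = norm (Iint (\<lambda>r. norm (F (x r) - F (y r))) s)" by simp
      also have "\<dots> \<le> L * K / lam * exp (lam * \<bar>s\<bar>)"
      proof (rule weighted_Iint_le[OF _ lam(1)])
        show "continuous_on UNIV (\<lambda>r. norm (F (x r) - F (y r)))"
          by (intro continuous_on_norm continuous_on_diff cF x y)
        fix r assume "\<bar>r\<bar> \<le> \<bar>s\<bar>"
        then have "norm (x r - y r) \<le> K * exp (lam * \<bar>r\<bar>)" using s t by (intro le) simp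
        then have "L * norm (x r - y r) \<le> L * (K * exp (lam * \<bar>r\<bar>))" using \<open>L > 0\<close> by simp
        then show "norm (norm (F (x r) - F (y r))) \<le> L * K * exp (lam * \<bar>r\<bar>)"
          using lip[of "x r" "y r"] by simp
      qed
      finally show "norm (V x s - V y s) \<le> L * K / lam * exp (lam * \<bar>s\<bar>)" .
    qed
    also have "L * K / lam / lam = K / 2" using lam \<open>L > 0\<close> by (simp add: field_simps)
    finally show "norm (Iint (V x) t - Iint (V y) t) \<le> K / 2 * exp (lam * \<bar>t\<bar>)"
      by (simp add: Iint_diff waveD(2)[OF PV(1)] x y)
  qed
  then obtain w where w: "continuous_on UNIV w" "\<And>t. Iint (V w) t = w t" by blast
  have "wave N (P w) (V w) (\<lambda>t. F (Iint (V w) t))" using PV(1)[OF w(1)] by (simp add: w(2))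
  then show ?thesis using PV(2,3)[OF w(1)] by blast
qed

text \<open>The candidate (P, V) is the weak solution for the differentiated data. The difference
  quotients of (p, v) solve the same system with data that converge to these, so the energy bound
  forces them to converge to (P, V).\<close>

theorem wave_regular:
  assumes w: "wave N p v f" and gp: "\<And>i. i < N \<Longrightarrow> gen j (p i 0) (p' i)" and gv: "gen j (v 0) v'"
    and gf: "\<And>t. gen j (f t) (f' t)" and cf': "continuous_on UNIV f'"
  shows "\<exists>P V. wave N P V f' \<and> (\<forall>t. \<forall>i<N. gen j (p i t) (P i t)) \<and> (\<forall>t. gen j (v t) (V t))"
proof -
  obtain P V where PV: "wave N P V f'" "\<And>i. i < N \<Longrightarrow> P i 0 = p' i" "V 0 = v'"
    using wave_exists[OF cf', of N p' v'] by blast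
  define Q where "Q h x = (tau j h x - x) /\<^sub>R h" for h x
  have Qbl: "bounded_linear (Q h)" for h
    unfolding Q_def[abs_def]
    by (rule bounded_linear_compose[OF bounded_linear_scaleR_right bounded_linear_sub[OF tau_bl bounded_linear_ident]])
  have cf: "continuous_on UNIV f" by (rule waveD(3)[OF w])
  have Qbound: "norm (Q h x) \<le> norm y" if "gen j x y" for h x y
  proof (cases "h = 0")
    case False
    then show ?thesis using gen_bound[OF that, of h]
      by (simp add: Q_def divide_inverse_commute[symmetric] divide_le_eq mult.commute)
  qed (simp add: Q_def)
  \<comment> \<open>The limit is checked along sequences, as \<open>Iint_dominated\<close> is about
    sequences.\<close>
  have lim: "((\<lambda>h. sqrt (energy N (\<lambda>i t. Q h (p i t) - P i t) (\<lambda>t. Q h (v t) - V t) t)) \<longlongrightarrow> 0) (at 0)" for t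
    unfolding tendsto_at_iff_sequentially
  proof (intro allI impI)
    fix X :: "nat \<Rightarrow> real" assume X: "\<forall>i. X i \<in> UNIV - {0}" "X \<longlonglongrightarrow> 0"
    then have X0: "filterlim X (at 0) sequentially" by (intro filterlim_atI) auto
    have Qlim: "(\<lambda>n. Q (X n) x) \<longlonglongrightarrow> y" if "gen j x y" for x y
      using filterlim_compose[OF that[unfolded gen_quotient] X0] by (simp add: Q_def)
    have b: "sqrt (energy N (\<lambda>i t. Q h (p i t) - P i t) (\<lambda>t. Q h (v t) - V t) t)
      \<le> norm (Q h (v 0) - v') + (\<Sum>i<N. norm (Q h (p i 0) - p' i)) + \<bar>Iint (\<lambda>s. norm (Q h (f s) - f' s)) t\<bar>" for h
    proof -
      have "wave N (\<lambda>i t. Q h (p i t) - P i t) (\<lambda>t. Q h (v t) - V t) (\<lambda>t. Q h (f t) - f' t)"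
        unfolding Q_def by (intro wave_diff wave_quotient w PV)
      from wave_energy_bound[OF this, of t]
        sqrt_energy_le[of N "\<lambda>i t. Q h (p i t) - P i t" "\<lambda>t. Q h (v t) - V t" 0]
      show ?thesis by (simp add: PV)
    qed
    have "(\<lambda>n. Iint (\<lambda>s. norm (Q (X n) (f s) - f' s)) t) \<longlonglongrightarrow> Iint (\<lambda>s. 0) t"
    proof (rule Iint_dominated(1)[where h="\<lambda>s. 2 * norm (f' s)"])
      fix n s
      show "\<bar>norm (Q (X n) (f s) - f' s)\<bar> \<le> 2 * norm (f' s)"
        using norm_triangle_ineq4[of "Q (X n) (f s)" "f' s"] Qbound[OF gf, of "X n" s] by simp
      show "(\<lambda>n. norm (Q (X n) (f s) - f' s)) \<longlonglongrightarrow> 0"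
        using Qlim[OF gf, of s] by (simp add: tendsto_norm_zero_iff LIM_zero_iff)
    qed (intro continuous_intros bounded_linear.continuous_on[OF Qbl] cf cf')+
    then have "(\<lambda>n. norm (Q (X n) (v 0) - v') + (\<Sum>i<N. norm (Q (X n) (p i 0) - p' i)) +
       \<bar>Iint (\<lambda>s. norm (Q (X n) (f s) - f' s)) t\<bar>) \<longlonglongrightarrow> norm (v' - v') + (\<Sum>i<N. norm (p' i - p' i)) + \<bar>Iint (\<lambda>s. 0) t\<bar>"
      by (intro tendsto_add tendsto_sum tendsto_norm tendsto_diff tendsto_const tendsto_rabs Qlim gv gp) auto
    then have *: "(\<lambda>n. norm (Q (X n) (v 0) - v') + (\<Sum>i<N. norm (Q (X n) (p i 0) - p' i)) +
       \<bar>Iint (\<lambda>s. norm (Q (X n) (f s) - f' s)) t\<bar>) \<longlonglongrightarrow> 0" by (simp add: Iint_const)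
    show "((\<lambda>h. sqrt (energy N (\<lambda>i t. Q h (p i t) - P i t) (\<lambda>t. Q h (v t) - V t) t)) \<circ> X) \<longlonglongrightarrow> 0"
      unfolding o_def
      by (rule tendsto_sandwich[OF _ _ tendsto_const *]) (auto intro!: always_eventually b energy_nonneg)
  qed
  have "gen j (v t) (V t)" for t
  proof -
    have "((\<lambda>h. Q h (v t) - V t) \<longlongrightarrow> 0) (at 0)"
      by (rule Lim_null_comparison[OF always_eventually lim[of t]]) (simp add: norm_le_energy(1)[of "\<lambda>t. Q _ (v t) - V t"])
    then show ?thesis unfolding gen_quotient by (simp add: Q_def LIM_zero_iff)
  qed
  moreover have "gen j (p i t) (P i t)" if "i < N" for i t
  proof -
    have "((\<lambda>h. Q h (p i t) - P i t) \<longlongrightarrow> 0) (at 0)"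
      by (rule Lim_null_comparison[OF always_eventually lim[of t]])
        (simp add: norm_le_energy(2)[OF that, of "\<lambda>i t. Q _ (p i t) - P i t"])
    then show ?thesis unfolding gen_quotient by (simp add: Q_def LIM_zero_iff)
  qed
  ultimately show ?thesis using PV(1) by blast
qed

text \<open>Once each p i is differentiable in its own direction, the weak divergence of the
  integrated equation is a genuine time integral, and v becomes differentiable in time.\<close>

lemma wave_deriv:
  assumes w: "wave N p v f" and g: "\<And>i t. i < N \<Longrightarrow> gen i (p i t) (P i t)"
    and cP: "\<And>i. i < N \<Longrightarrow> continuous_on UNIV (P i)"
  shows "(v has_vector_derivative f t + (\<Sum>i<N. P i t)) (at t)"
proof -
  note W = waveD[OF w]
  have eq: "v t - v 0 - Iint f t = (\<Sum>i<N. Iint (P i) t)" for t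
  proof -
    have "wdiv {..<N} (\<lambda>i. Iint (p i) t) (\<Sum>i<N. Iint (P i) t)"
      unfolding wdiv_def
    proof
      fix \<psi> assume \<psi>: "\<psi> \<in> core"
      have "inner (Iint (P i) t) \<psi> = - inner (Iint (p i) t) (D i \<psi>)" if i: "i < N" for i
      proof -
        have "inner (P i s) \<psi> = inner (- p i s) (D i \<psi>)" for s
          using gen_skew[OF g[OF i] core_gen[OF \<psi>]] by simp
        then have "inner (Iint (P i) t) \<psi> = Iint (\<lambda>s. inner (- p i s) (D i \<psi>)) t"
          by (simp add: bounded_linear_Iint[OF bounded_linear_inner_left cP[OF i]])
        also have "\<dots> = inner (Iint (\<lambda>s. - p i s) t) (D i \<psi>)"
          by (rule bounded_linear_Iint[OF bounded_linear_inner_left, symmetric]) (intro continuous_intros W i)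
        also have "Iint (\<lambda>s. - p i s) t = - Iint (p i) t"
          by (rule bounded_linear_Iint[OF bounded_linear_minus[OF bounded_linear_ident] W(1)[OF i], symmetric])
        finally show ?thesis by simp
      qed
      then show "inner (\<Sum>i<N. Iint (P i) t) \<psi> = - (\<Sum>i<N. inner (Iint (p i) t) (D i \<psi>))"
        by (simp add: inner_sum_left sum_negf)
    qed
    with W(5)[of t] have "\<forall>\<psi>\<in>core. inner (v t - v 0 - Iint f t) \<psi> = inner (\<Sum>i<N. Iint (P i) t) \<psi>"
      by (simp add: wdiv_def)
    then have "(v t - v 0 - Iint f t) - (\<Sum>i<N. Iint (P i) t) = 0"
      by (intro core_total) (simp add: inner_diff_left)
    then show ?thesis by simp
  qed
  have "v t = v 0 + (Iint f t + (\<Sum>i<N. Iint (P i) t))" for t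
    using eq[of t] by (simp add: algebra_simps)
  then have "v = (\<lambda>t. v 0 + (Iint f t + (\<Sum>i<N. Iint (P i) t)))" by (rule ext)
  moreover have "((\<lambda>t. v 0 + (Iint f t + (\<Sum>i<N. Iint (P i) t))) has_vector_derivative
      0 + (f t + (\<Sum>i<N. P i t))) (at t)"
    by (intro has_vector_derivative_add has_vector_derivative_const has_vector_derivative_sum Iint_deriv W cP) auto
  ultimately show ?thesis by (metis add_0)
qed

end

section \<open>Square-integrable functions\<close>

text \<open>Over an arbitrary measure, because it is needed on each R^n and on the disjoint union of
  all of them.\<close>

definition sqint :: "'a measure \<Rightarrow> ('a \<Rightarrow> real) set" where
  "sqint M = {f \<in> borel_measurable M. integrable M (\<lambda>x. (f x)\<^sup>2)}"

lemma L2_eq_sqint: "L2 N = sqint (RN N)"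
  by (simp add: L2_def sqint_def)

lemma sqintD: "f \<in> sqint M \<Longrightarrow> f \<in> borel_measurable M" "f \<in> sqint M \<Longrightarrow> integrable M (\<lambda>x. (f x)\<^sup>2)"
  by (auto simp: sqint_def)

lemma sqint_mult:
  assumes "f \<in> sqint M" "g \<in> sqint M"
  shows "integrable M (\<lambda>x. f x * g x)"
proof (rule Bochner_Integration.integrable_bound)
  show "integrable M (\<lambda>x. (f x)\<^sup>2 + (g x)\<^sup>2)" using assms by (auto simp: sqint_def)
  show "(\<lambda>x. f x * g x) \<in> borel_measurable M"
    using sqintD(1)[OF assms(1)] sqintD(1)[OF assms(2)] by simp
  have "\<bar>f x * g x\<bar> \<le> (f x)\<^sup>2 + (g x)\<^sup>2" for x
  proof -
    have "2 * (\<bar>f x\<bar> * \<bar>g x\<bar>) \<le> \<bar>f x\<bar>\<^sup>2 + \<bar>g x\<bar>\<^sup>2"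
      using sum_squares_bound[of "\<bar>f x\<bar>" "\<bar>g x\<bar>"] by simp
    then have "2 * \<bar>f x * g x\<bar> \<le> (f x)\<^sup>2 + (g x)\<^sup>2" by (simp add: abs_mult)
    then show ?thesis by (smt (verit) abs_ge_zero)
  qed
  then show "AE x in M. norm (f x * g x) \<le> norm ((f x)\<^sup>2 + (g x)\<^sup>2)" by auto
qed

lemma sqint_add: "f \<in> sqint M \<Longrightarrow> g \<in> sqint M \<Longrightarrow> (\<lambda>x. f x + g x) \<in> sqint M"
  using sqint_mult[of f M g] by (auto simp: sqint_def power2_sum mult.assoc)

lemma sqint_scale: "f \<in> sqint M \<Longrightarrow> (\<lambda>x. c * f x) \<in> sqint M"
  by (auto simp: sqint_def power_mult_distrib)

lemma sqint_minus: "f \<in> sqint M \<Longrightarrow> (\<lambda>x. - f x) \<in> sqint M"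
  by (auto simp: sqint_def)

lemma sqint_diff: "f \<in> sqint M \<Longrightarrow> g \<in> sqint M \<Longrightarrow> (\<lambda>x. f x - g x) \<in> sqint M"
  using sqint_add[OF _ sqint_minus, of f M g] by simp

lemma sqint_zero: "(\<lambda>x. 0) \<in> sqint M"
  by (auto simp: sqint_def)

lemma sqint_bound:
  assumes g: "g \<in> sqint M" and f: "f \<in> borel_measurable M"
    and le: "\<And>x. x \<in> space M \<Longrightarrow> \<bar>f x\<bar> \<le> \<bar>g x\<bar>"
  shows "f \<in> sqint M"
proof -
  have "integrable M (\<lambda>x. (f x)\<^sup>2)"
    by (rule Bochner_Integration.integrable_bound[OF sqintD(2)[OF g]])
      (use f le in \<open>auto simp: abs_le_square_iff\<close>)
  then show ?thesis using f by (simp add: sqint_def)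
qed

lemma sqint_AE:
  assumes "f \<in> sqint M" "g \<in> borel_measurable M" "AE x in M. g x = f x"
  shows "g \<in> sqint M"
proof -
  have "integrable M (\<lambda>x. (g x)\<^sup>2) \<longleftrightarrow> integrable M (\<lambda>x. (f x)\<^sup>2)"
    by (rule integrable_cong_AE) (use assms sqintD(1)[OF assms(1)] in auto)
  then show ?thesis using assms by (simp add: sqint_def)
qed

text \<open>Riesz-Fischer: a fast subsequence converges almost everywhere, and Fatou's lemma makes
  its limit the mean square limit of the whole sequence.\<close>

lemma sqint_complete:
  fixes f :: "nat \<Rightarrow> 'a \<Rightarrow> real"
  assumes f: "\<And>n. f n \<in> sqint M"
    and cauchy: "\<And>e. e > 0 \<Longrightarrow> \<exists>N. \<forall>m\<ge>N. \<forall>n\<ge>N. (LINT x|M. (f m x - f n x)\<^sup>2) < e"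
  shows "\<exists>g\<in>sqint M. \<forall>e>0. \<exists>N. \<forall>n\<ge>N. (LINT x|M. (f n x - g x)\<^sup>2) \<le> e"
proof -
  have [measurable]: "f n \<in> borel_measurable M" for n using sqintD(1)[OF f] .
  have "\<exists>N. \<forall>m\<ge>N. \<forall>n\<ge>N. (LINT x|M. (f m x - f n x)\<^sup>2) < (1/16)^k" for k :: nat
    by (rule cauchy) simp
  then obtain N where N: "\<And>k m n. m \<ge> N k \<Longrightarrow> n \<ge> N k \<Longrightarrow> (LINT x|M. (f m x - f n x)\<^sup>2) < (1/16)^k"
    by metis
  have nn: "(\<integral>\<^sup>+x. ennreal ((f m x - f n x)\<^sup>2) \<partial>M) \<le> ennreal ((1/16)^k)" if "m \<ge> N k" "n \<ge> N k" for k m n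
    using N[OF that] nn_integral_eq_integral[OF sqintD(2)[OF sqint_diff[OF f f]], of m n]
    by (simp add: ennreal_leI)
  \<comment> \<open>A sum of naturals dominates each of its terms, so \<open>r k\<close> lies beyond
    \<open>N j\<close> for every j \<le> k.\<close>
  define r where "r k = (\<Sum>j\<le>k. N j)" for k
  have rN: "N j \<le> r k" if "j \<le> k" for j k
    unfolding r_def using that by (intro member_le_sum) auto
  define h where "h k x = f (r (Suc k)) x - f (r k) x" for k x
  have [measurable]: "h k \<in> borel_measurable M" for k unfolding h_def[abs_def] by measurable
  define g where "g x = lim (\<lambda>k. f (r k) x)" for x
  have g[measurable]: "g \<in> borel_measurable M" unfolding g_def[abs_def] by measurable
  \<comment> \<open>The weight 4^k turns the bounds (1/16)^k into a convergent series. Finiteness of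
    the weighted sum at a point makes the increments there of size (1/2)^k, hence summable.\<close>
  have "(\<integral>\<^sup>+x. (\<Sum>k. ennreal (4^k * (h k x)\<^sup>2)) \<partial>M) = (\<Sum>k. \<integral>\<^sup>+x. ennreal (4^k * (h k x)\<^sup>2) \<partial>M)"
    by (rule nn_integral_suminf) measurable
  also have "\<dots> \<le> (\<Sum>k. ennreal ((1/4)^k))"
  proof (rule suminf_le[OF _ summableI summableI])
    fix k
    have "(\<integral>\<^sup>+x. ennreal (4^k * (h k x)\<^sup>2) \<partial>M) = ennreal (4^k) * (\<integral>\<^sup>+x. ennreal ((h k x)\<^sup>2) \<partial>M)"
      by (simp add: ennreal_mult nn_integral_cmult)
    also have "\<dots> \<le> ennreal (4^k) * ennreal ((1/16)^k)"
      unfolding h_def by (intro mult_left_mono nn rN) auto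
    also have "\<dots> = ennreal ((1/4)^k)"
      by (simp flip: ennreal_mult power_mult_distrib)
    finally show "(\<integral>\<^sup>+x. ennreal (4^k * (h k x)\<^sup>2) \<partial>M) \<le> ennreal ((1/4)^k)" .
  qed
  also have "\<dots> = ennreal (\<Sum>k. (1/4)^k)" by (intro suminf_ennreal2 summable_geometric) auto
  also have "\<dots> < \<infinity>" by simp
  finally have "AE x in M. (\<Sum>k. ennreal (4^k * (h k x)\<^sup>2)) \<noteq> \<infinity>"
    by (intro nn_integral_PInf_AE) auto
  then have lim: "AE x in M. (\<lambda>k. f (r k) x) \<longlonglongrightarrow> g x"
  proof (rule AE_mp, intro AE_I2 impI)
    fix x assume fin: "(\<Sum>k. ennreal (4^k * (h k x)\<^sup>2)) \<noteq> \<infinity>"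
    have "summable (\<lambda>k. 4^k * (h k x)\<^sup>2)"
      by (rule summable_suminf_not_top) (use fin in auto)
    from summable_LIMSEQ_zero[OF this] have "Bseq (\<lambda>k. 4^k * (h k x)\<^sup>2)"
      by (intro convergent_imp_Bseq convergentI)
    then obtain c where c: "c > 0" "\<And>k. \<bar>4^k * (h k x)\<^sup>2\<bar> \<le> c" by (auto simp: Bseq_def)
    have hb: "\<bar>h k x\<bar> \<le> sqrt c * (1/2)^k" for k
    proof -
      have "((2::real)^k)\<^sup>2 = 4^k" by (simp add: power2_eq_square flip: power_mult_distrib)
      then have "(2^k * \<bar>h k x\<bar>)\<^sup>2 = 4^k * (h k x)\<^sup>2" by (simp add: power_mult_distrib)
      also have "\<dots> \<le> c" using c(2)[of k] by simp
      finally have "2^k * \<bar>h k x\<bar> \<le> sqrt c" by (rule real_le_rsqrt)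
      then show ?thesis by (simp add: power_one_over field_simps)
    qed
    have "summable (\<lambda>k. sqrt c * (1/2)^k)" by (intro summable_mult summable_geometric) simp
    then have "summable (\<lambda>k. h k x)"
      by (rule summable_comparison_test'[where N=0]) (simp only: real_norm_def hb)
    then have "convergent (\<lambda>n. f (r 0) x + (\<Sum>k<n. h k x))"
      by (intro convergent_add convergent_const) (simp add: summable_iff_convergent)
    moreover have "f (r 0) x + (\<Sum>k<n. h k x) = f (r n) x" for n
      by (induction n) (auto simp: h_def)
    ultimately show "(\<lambda>k. f (r k) x) \<longlonglongrightarrow> g x"
      by (simp add: g_def convergent_LIMSEQ_iff)
  qed
  have fatou: "(\<integral>\<^sup>+x. ennreal ((f m x - g x)\<^sup>2) \<partial>M) \<le> ennreal ((1/16)^k)" if m: "m \<ge> N k" for k m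
  proof -
    have "(\<integral>\<^sup>+x. ennreal ((f m x - g x)\<^sup>2) \<partial>M) = (\<integral>\<^sup>+x. liminf (\<lambda>j. ennreal ((f m x - f (r j) x)\<^sup>2)) \<partial>M)"
    proof (rule nn_integral_cong_AE, use lim in eventually_elim)
      fix x assume "(\<lambda>k. f (r k) x) \<longlonglongrightarrow> g x"
      then have "(\<lambda>j. ennreal ((f m x - f (r j) x)\<^sup>2)) \<longlonglongrightarrow> ennreal ((f m x - g x)\<^sup>2)"
        by (intro tendsto_ennrealI tendsto_intros)
      then show "ennreal ((f m x - g x)\<^sup>2) = liminf (\<lambda>j. ennreal ((f m x - f (r j) x)\<^sup>2))"
        by (rule lim_imp_Liminf[OF sequentially_bot, symmetric])
    qed
    also have "\<dots> \<le> liminf (\<lambda>j. \<integral>\<^sup>+x. ennreal ((f m x - f (r j) x)\<^sup>2) \<partial>M)"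
      by (rule nn_integral_liminf) measurable
    also have "\<dots> \<le> limsup (\<lambda>j. \<integral>\<^sup>+x. ennreal ((f m x - f (r j) x)\<^sup>2) \<partial>M)"
      by (rule Liminf_le_Limsup) simp
    also have "\<dots> \<le> ennreal ((1/16)^k)"
    proof (rule Limsup_bounded)
      show "\<forall>\<^sub>F j in sequentially. (\<integral>\<^sup>+x. ennreal ((f m x - f (r j) x)\<^sup>2) \<partial>M) \<le> ennreal ((1/16)^k)"
        unfolding eventually_sequentially by (intro exI[of _ k] allI impI nn[OF m rN])
    qed
    finally show ?thesis .
  qed
  have d: "(\<lambda>x. f m x - g x) \<in> sqint M" if "m \<ge> N k" for m k
  proof -
    have "integrable M (\<lambda>x. (f m x - g x)\<^sup>2)"
      by (rule integrableI_nonneg) (use fatou[OF that] le_less_trans in \<open>auto simp: top.not_eq_extremum[symmetric] top_unique\<close>)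
    then show ?thesis by (simp add: sqint_def)
  qed
  have "(\<lambda>x. f (N 0) x - (f (N 0) x - g x)) \<in> sqint M" by (rule sqint_diff[OF f d[of 0]]) simp
  then have gs: "g \<in> sqint M" by simp
  have "\<exists>N. \<forall>n\<ge>N. (LINT x|M. (f n x - g x)\<^sup>2) \<le> e" if e0: "e > 0" for e :: real
  proof -
    obtain k where k: "(1/16)^k < e" using real_arch_pow_inv[of e "1/16"] e0 by auto
    have "(LINT x|M. (f n x - g x)\<^sup>2) \<le> e" if "n \<ge> N k" for n
    proof -
      have "ennreal (LINT x|M. (f n x - g x)\<^sup>2) \<le> ennreal ((1/16)^k)"
        using fatou[OF that] nn_integral_eq_integral[OF sqintD(2)[OF d[OF that]]] by simp
      then have "(LINT x|M. (f n x - g x)\<^sup>2) \<le> (1/16)^k" by (simp add: ennreal_le_iff)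
      then show ?thesis using k by simp
    qed
    then show ?thesis by blast
  qed
  with gs show ?thesis by blast
qed

section \<open>Disjoint unions of measure spaces\<close>

text \<open>The sum over the slices is an integral against counting measure, so that countable
  additivity reduces to \<open>nn_integral_suminf\<close>.\<close>

definition dsum :: "(nat \<Rightarrow> 'a measure) \<Rightarrow> (nat \<times> 'a) measure" where
  "dsum M = measure_of (SIGMA n:UNIV. space (M n))
     {A. A \<subseteq> (SIGMA n:UNIV. space (M n)) \<and> (\<forall>n. Pair n -` A \<in> sets (M n))}
     (\<lambda>A. \<integral>\<^sup>+n. emeasure (M n) (Pair n -` A) \<partial>count_space UNIV)"

lemma dsum_sigma_algebra:
  "sigma_algebra (SIGMA n:UNIV. space (M n))
     {A. A \<subseteq> (SIGMA n:UNIV. space (M n)) \<and> (\<forall>n. Pair n -` A \<in> sets (M n))}"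
  unfolding sigma_algebra_iff2
proof (intro conjI ballI allI impI)
  fix A assume A: "A \<in> {A. A \<subseteq> (SIGMA n:UNIV. space (M n)) \<and> (\<forall>n. Pair n -` A \<in> sets (M n))}"
  have "Pair n -` ((SIGMA n:UNIV. space (M n)) - A) = space (M n) - Pair n -` A" for n by auto
  then show "(SIGMA n:UNIV. space (M n)) - A \<in> {A. A \<subseteq> (SIGMA n:UNIV. space (M n)) \<and> (\<forall>n. Pair n -` A \<in> sets (M n))}"
    using A by auto
next
  fix A :: "nat \<Rightarrow> _"
  assume A: "range A \<subseteq> {A. A \<subseteq> (SIGMA n:UNIV. space (M n)) \<and> (\<forall>n. Pair n -` A \<in> sets (M n))}"
  have "Pair n -` (\<Union>i. A i) = (\<Union>i. Pair n -` A i)" for n by auto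
  then show "(\<Union>i. A i) \<in> {A. A \<subseteq> (SIGMA n:UNIV. space (M n)) \<and> (\<forall>n. Pair n -` A \<in> sets (M n))}"
    using A by (auto intro!: sets.countable_UN)
qed auto

lemma space_dsum: "space (dsum M) = (SIGMA n:UNIV. space (M n))"
  by (auto simp: dsum_def intro!: space_measure_of)

lemma sets_dsum: "A \<in> sets (dsum M) \<longleftrightarrow>
    A \<subseteq> (SIGMA n:UNIV. space (M n)) \<and> (\<forall>n. Pair n -` A \<in> sets (M n))"
  unfolding dsum_def sigma_algebra.sets_measure_of_eq[OF dsum_sigma_algebra] by simp

lemma emeasure_dsum:
  assumes A: "A \<in> sets (dsum M)"
  shows "emeasure (dsum M) A = (\<integral>\<^sup>+n. emeasure (M n) (Pair n -` A) \<partial>count_space UNIV)"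
proof (rule emeasure_measure_of[OF dsum_def])
  show "countably_additive (sets (dsum M)) (\<lambda>A. \<integral>\<^sup>+n. emeasure (M n) (Pair n -` A) \<partial>count_space UNIV)"
  proof (rule countably_additiveI)
    fix A :: "nat \<Rightarrow> _" assume A: "range A \<subseteq> sets (dsum M)" "disjoint_family A"
    have "(\<Sum>i. emeasure (M n) (Pair n -` A i)) = emeasure (M n) (Pair n -` (\<Union>i. A i))" for n
    proof -
      have "Pair n -` (\<Union>i. A i) = (\<Union>i. Pair n -` A i)" by auto
      moreover have "(\<Sum>i. emeasure (M n) (Pair n -` A i)) = emeasure (M n) (\<Union>i. Pair n -` A i)"
        using A by (intro suminf_emeasure) (auto simp: sets_dsum disjoint_family_on_def)
      ultimately show ?thesis by simp
    qed
    then show "(\<Sum>i. \<integral>\<^sup>+n. emeasure (M n) (Pair n -` A i) \<partial>count_space UNIV) =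
      (\<integral>\<^sup>+n. emeasure (M n) (Pair n -` (\<Union>i. A i)) \<partial>count_space UNIV)"
      by (subst nn_integral_suminf[symmetric]) auto
  qed
qed (use A in \<open>auto simp: positive_def\<close>)

lemma measurable_dsum:
  "f \<in> measurable (dsum M) L \<longleftrightarrow> (\<forall>n. (\<lambda>x. f (n, x)) \<in> measurable (M n) L)"
proof -
  have eq: "Pair n -` (f -` B \<inter> space (dsum M)) = (\<lambda>x. f (n, x)) -` B \<inter> space (M n)" for n B
    by (auto simp: space_dsum)
  show ?thesis
    by (auto simp: measurable_def sets_dsum eq simp del: vimage_Int) (auto simp: space_dsum)
qed

lemma measurable_Pair_dsum: "Pair n \<in> measurable (M n) (dsum M)"
  by (auto simp: measurable_def sets_dsum space_dsum)

lemma AE_dsum: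
  assumes "{z \<in> space (dsum M). \<not> P z} \<in> sets (dsum M)"
  shows "(AE z in dsum M. P z) \<longleftrightarrow> (\<forall>n. AE x in M n. P (n, x))"
proof -
  have eq: "Pair n -` {z \<in> space (dsum M). \<not> P z} = {x \<in> space (M n). \<not> P (n, x)}" for n
    by (auto simp: space_dsum)
  have s: "{x \<in> space (M n). \<not> P (n, x)} \<in> sets (M n)" for n
    using assms unfolding sets_dsum eq[symmetric] by blast
  have "(AE z in dsum M. P z) \<longleftrightarrow> emeasure (dsum M) {z \<in> space (dsum M). \<not> P z} = 0"
    by (rule AE_iff_measurable[OF assms refl])
  also have "\<dots> \<longleftrightarrow> (\<forall>n. emeasure (M n) {x \<in> space (M n). \<not> P (n, x)} = 0)"
    unfolding emeasure_dsum[OF assms] eq by (simp add: nn_integral_0_iff_AE AE_count_space)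
  also have "\<dots> \<longleftrightarrow> (\<forall>n. AE x in M n. P (n, x))"
    by (intro all_cong1) (simp add: AE_iff_measurable[OF s refl])
  finally show ?thesis .
qed

text \<open>Realises a slice as a restriction of the total measure, which reduces integrals over it
  to the rules for densities.\<close>

lemma distr_Pair_dsum: "distr (M n) (dsum M) (Pair n) = density (dsum M) (indicator ({n} \<times> UNIV))"
proof (rule measure_eqI)
  fix A assume "A \<in> sets (distr (M n) (dsum M) (Pair n))"
  then have A: "A \<in> sets (dsum M)" by simp
  have S: "({n} \<times> UNIV) \<inter> A \<in> sets (dsum M)"
  proof -
    have "Pair m -` (({n} \<times> UNIV) \<inter> A) = (if m = n then Pair n -` A else {})" for m by auto
    then show ?thesis using A by (auto simp: sets_dsum)
  qed
  have "emeasure (density (dsum M) (indicator ({n} \<times> UNIV))) A = (\<integral>\<^sup>+z. indicator ({n} \<times> UNIV) z * indicator A z \<partial>dsum M)"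
    by (rule emeasure_density[OF _ A]) (auto simp: measurable_dsum indicator_def)
  also have "\<dots> = (\<integral>\<^sup>+z. indicator (({n} \<times> UNIV) \<inter> A) z \<partial>dsum M)"
    by (intro nn_integral_cong) (auto simp: indicator_def)
  also have "\<dots> = (\<integral>\<^sup>+m. emeasure (M m) (Pair m -` (({n} \<times> UNIV) \<inter> A)) \<partial>count_space UNIV)"
    by (simp add: emeasure_dsum[OF S] S)
  also have "\<dots> = (\<Sum>m\<in>{n}. emeasure (M m) (Pair m -` (({n} \<times> UNIV) \<inter> A)))"
    by (rule nn_integral_count_space') (auto simp: vimage_def)
  also have "Pair n -` (({n} \<times> UNIV) \<inter> A) = Pair n -` A" by auto
  then have "(\<Sum>m\<in>{n}. emeasure (M m) (Pair m -` (({n} \<times> UNIV) \<inter> A))) = emeasure (M n) (Pair n -` A)" by simp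
  also have "Pair n -` A = Pair n -` A \<inter> space (M n)" using A by (auto simp: sets_dsum)
  finally show "emeasure (distr (M n) (dsum M) (Pair n)) A = emeasure (density (dsum M) (indicator ({n} \<times> UNIV))) A"
    by (simp add: emeasure_distr[OF measurable_Pair_dsum A])
qed simp

lemma integral_slice:
  fixes g :: "nat \<times> 'a \<Rightarrow> real"
  assumes g: "g \<in> borel_measurable (dsum M)"
  shows "integrable (dsum M) (\<lambda>z. indicator ({n} \<times> UNIV) z * g z) \<longleftrightarrow> integrable (M n) (\<lambda>x. g (n, x))"
    and "(LINT z|dsum M. indicator ({n} \<times> UNIV) z * g z) = (LINT x|M n. g (n, x))"
proof -
  have ind: "(indicator ({n} \<times> UNIV) :: _ \<Rightarrow> real) \<in> borel_measurable (dsum M)"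
    by (auto simp: measurable_dsum indicator_def)
  have e: "density (dsum M) (indicator ({n} \<times> UNIV)) = density (dsum M) (\<lambda>z. ennreal (indicator ({n} \<times> UNIV) z))"
    by (intro arg_cong2[of _ _ _ _ density]) (auto simp: indicator_def fun_eq_iff)
  show "integrable (dsum M) (\<lambda>z. indicator ({n} \<times> UNIV) z * g z) \<longleftrightarrow> integrable (M n) (\<lambda>x. g (n, x))"
  proof -
    have "integrable (distr (M n) (dsum M) (Pair n)) g \<longleftrightarrow> integrable (M n) (\<lambda>x. g (n, x))"
      by (rule integrable_distr_eq[OF measurable_Pair_dsum g])
    moreover have "integrable (distr (M n) (dsum M) (Pair n)) g \<longleftrightarrow>
        integrable (dsum M) (\<lambda>z. indicator ({n} \<times> UNIV) z *\<^sub>R g z)"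
      unfolding distr_Pair_dsum e by (rule integrable_density[OF g ind]) simp
    ultimately show ?thesis by simp
  qed
  show "(LINT z|dsum M. indicator ({n} \<times> UNIV) z * g z) = (LINT x|M n. g (n, x))"
  proof -
    have "integral\<^sup>L (distr (M n) (dsum M) (Pair n)) g = (LINT x|M n. g (n, x))"
      by (rule integral_distr[OF measurable_Pair_dsum g])
    moreover have "integral\<^sup>L (distr (M n) (dsum M) (Pair n)) g =
        (LINT z|dsum M. indicator ({n} \<times> UNIV) z *\<^sub>R g z)"
      unfolding distr_Pair_dsum e by (rule integral_density[OF g ind]) simp
    ultimately show ?thesis by simp
  qed
qed

lemma distr_dsum:
  assumes T: "\<And>n. T n \<in> measurable (M n) (M n)" and inv: "\<And>n. distr (M n) (M n) (T n) = M n"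
  shows "(\<lambda>(n, x). (n, T n x)) \<in> measurable (dsum M) (dsum M)"
    and "distr (dsum M) (dsum M) (\<lambda>(n, x). (n, T n x)) = dsum M"
proof -
  have eq: "Pair n -` ((\<lambda>(n, x). (n, T n x)) -` A \<inter> space (dsum M)) = T n -` (Pair n -` A) \<inter> space (M n)" for A n
    by (auto simp: space_dsum)
  show m: "(\<lambda>(n, x). (n, T n x)) \<in> measurable (dsum M) (dsum M)"
    using T by (auto simp: measurable_def sets_dsum eq simp del: vimage_Int) (auto simp: space_dsum)
  show "distr (dsum M) (dsum M) (\<lambda>(n, x). (n, T n x)) = dsum M"
  proof (rule measure_eqI)
    fix A assume "A \<in> sets (distr (dsum M) (dsum M) (\<lambda>(n, x). (n, T n x)))"
    then have A: "A \<in> sets (dsum M)" by simp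
    have "emeasure (M n) (T n -` (Pair n -` A) \<inter> space (M n)) = emeasure (M n) (Pair n -` A)" for n
      using A emeasure_distr[OF T, of "Pair n -` A" n] by (simp add: inv sets_dsum)
    then show "emeasure (distr (dsum M) (dsum M) (\<lambda>(n, x). (n, T n x))) A = emeasure (dsum M) A"
      using measurable_sets[OF m A] by (simp add: emeasure_distr[OF m A] emeasure_dsum A eq del: vimage_Int)
  qed simp
qed

section \<open>The Hilbert space\<close>

abbreviation RNs :: "(nat \<times> point) measure" where "RNs \<equiv> dsum RN"

text \<open>Only square-integrable functions are related to themselves, so the quotient by this
  partial equivalence contains exactly the L^2 classes.\<close>

definition hil_rel :: "(nat \<times> point \<Rightarrow> real) \<Rightarrow> (nat \<times> point \<Rightarrow> real) \<Rightarrow> bool" where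
  "hil_rel f g \<longleftrightarrow> f \<in> sqint RNs \<and> g \<in> sqint RNs \<and> (AE z in RNs. f z = g z)"

text \<open>
  The dimension is not a type, so \<open>L\<^sup>2(R\<^sup>N)\<close> is not one either. All the \<open>L\<^sup>2(R\<^sup>n)\<close> are embedded in
  a single Hilbert space, the \<open>L\<^sup>2\<close> space of the disjoint union of the \<open>R\<^sup>n\<close>.
\<close>

quotient_type hil = "nat \<times> point \<Rightarrow> real" / partial: hil_rel
proof (rule part_equivpI)
  show "\<exists>f. hil_rel f f" by (rule exI[of _ "\<lambda>_. 0"]) (simp add: hil_rel_def sqint_zero)
  show "symp hil_rel" by (auto simp: symp_def hil_rel_def)
  show "transp hil_rel" by (auto simp: transp_def hil_rel_def)
qed

lemma hil_relI: "f \<in> sqint RNs \<Longrightarrow> g \<in> sqint RNs \<Longrightarrow> (AE z in RNs. f z = g z) \<Longrightarrow> hil_rel f g"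
  by (simp add: hil_rel_def)

lemma integral_cong_hil_rel:
  assumes "hil_rel f f'" "hil_rel g g'"
  shows "(LINT z|RNs. f z * g z) = (LINT z|RNs. f' z * g' z)"
  by (rule integral_cong_AE) (use assms in \<open>auto simp: hil_rel_def sqint_def\<close>)

instantiation hil :: real_vector
begin
lift_definition zero_hil :: hil is "\<lambda>_. 0" by (simp add: hil_rel_def sqint_zero)
lift_definition plus_hil :: "hil \<Rightarrow> hil \<Rightarrow> hil" is "\<lambda>f g z. f z + g z"
  by (auto simp: hil_rel_def intro: sqint_add)
lift_definition minus_hil :: "hil \<Rightarrow> hil \<Rightarrow> hil" is "\<lambda>f g z. f z - g z"
  by (auto simp: hil_rel_def intro: sqint_diff)
lift_definition uminus_hil :: "hil \<Rightarrow> hil" is "\<lambda>f z. - f z"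
  by (auto simp: hil_rel_def intro: sqint_minus)
lift_definition scaleR_hil :: "real \<Rightarrow> hil \<Rightarrow> hil" is "\<lambda>c f z. c * f z"
  by (auto simp: hil_rel_def intro: sqint_scale)
instance
  by standard (transfer, auto simp: hil_rel_def algebra_simps intro!: sqint_add sqint_scale sqint_minus sqint_diff sqint_zero)+
end

instantiation hil :: real_inner
begin
lift_definition inner_hil :: "hil \<Rightarrow> hil \<Rightarrow> real" is "\<lambda>f g. LINT z|RNs. f z * g z"
  by (rule integral_cong_hil_rel)
definition norm_hil :: "hil \<Rightarrow> real" where "norm_hil x = sqrt (inner x x)"
definition dist_hil :: "hil \<Rightarrow> hil \<Rightarrow> real" where "dist_hil x y = norm (x - y)"
definition sgn_hil :: "hil \<Rightarrow> hil" where "sgn_hil x = x /\<^sub>R norm x"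
definition uniformity_hil :: "(hil \<times> hil) filter" where
  "uniformity_hil = (INF e\<in>{0<..}. principal {(x, y). dist x y < e})"
definition open_hil :: "hil set \<Rightarrow> bool" where
  "open_hil U \<longleftrightarrow> (\<forall>x\<in>U. eventually (\<lambda>(x', y). x' = x \<longrightarrow> y \<in> U) uniformity)"
instance
proof
  fix x y z :: hil and r :: real and U :: "hil set"
  show "dist x y = norm (x - y)" by (rule dist_hil_def)
  show "sgn x = x /\<^sub>R norm x" by (rule sgn_hil_def)
  show "(uniformity :: (hil \<times> hil) filter) = (INF e\<in>{0<..}. principal {(x, y). dist x y < e})"
    by (rule uniformity_hil_def)
  show "open U \<longleftrightarrow> (\<forall>x\<in>U. eventually (\<lambda>(x', y). x' = x \<longrightarrow> y \<in> U) uniformity)"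
    by (rule open_hil_def)
  show "inner x y = inner y x" by transfer (simp add: mult.commute)
  show "inner (x + y) z = inner x z + inner y z"
    by transfer (auto simp: hil_rel_def distrib_right intro!: Bochner_Integration.integral_add sqint_mult)
  show "inner (r *\<^sub>R x) y = r * inner x y" by transfer (simp add: mult.assoc)
  show "0 \<le> inner x x" by transfer simp
  show "inner x x = 0 \<longleftrightarrow> x = 0"
  proof transfer
    fix f assume "hil_rel f f"
    then have f: "f \<in> sqint RNs" by (simp add: hil_rel_def)
    have "(LINT z|RNs. f z * f z) = 0 \<longleftrightarrow> (AE z in RNs. f z * f z = 0)"
      by (rule integral_nonneg_eq_0_iff_AE) (auto intro: sqint_mult f)
    then show "((LINT z|RNs. f z * f z) = 0) = hil_rel f (\<lambda>_. 0)"
      using f by (simp add: hil_rel_def sqint_zero)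
  qed
  show "norm x = sqrt (inner x x)" by (rule norm_hil_def)
qed
end

lemma rep_hil_sqint: "rep_hil x \<in> sqint RNs"
  using Quotient3_rep_reflp[OF Quotient3_hil, of x] by (simp add: hil_rel_def)

lemma abs_rep_hil [simp]: "abs_hil (rep_hil x) = x"
  by (rule Quotient3_abs_rep[OF Quotient3_hil])

lemma abs_hil_eq_iff: "f \<in> sqint RNs \<Longrightarrow> g \<in> sqint RNs \<Longrightarrow> abs_hil f = abs_hil g \<longleftrightarrow> (AE z in RNs. f z = g z)"
  using Quotient3_rel[OF Quotient3_hil, of f g] by (auto simp: hil_rel_def)

lemma rep_abs_hil: "f \<in> sqint RNs \<Longrightarrow> AE z in RNs. rep_hil (abs_hil f) z = f z"
  using abs_hil_eq_iff[OF rep_hil_sqint, of f "abs_hil f"] by simp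

lemma abs_hil_ops:
  assumes "f \<in> sqint RNs" "g \<in> sqint RNs"
  shows "abs_hil f + abs_hil g = abs_hil (\<lambda>z. f z + g z)"
    "abs_hil f - abs_hil g = abs_hil (\<lambda>z. f z - g z)"
    "c *\<^sub>R abs_hil f = abs_hil (\<lambda>z. c * f z)"
    "inner (abs_hil f) (abs_hil g) = (LINT z|RNs. f z * g z)"
  using assms by (simp_all add: plus_hil.abs_eq minus_hil.abs_eq scaleR_hil.abs_eq inner_hil.abs_eq hil_rel_def)

instance hil :: banach
proof
  fix X :: "nat \<Rightarrow> hil" assume X: "Cauchy X"
  define f where "f n = rep_hil (X n)" for n
  have f: "f n \<in> sqint RNs" for n by (simp add: f_def rep_hil_sqint)
  have Xf: "X n = abs_hil (f n)" for n by (simp add: f_def)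
  have nrm: "(norm (abs_hil a - abs_hil b))\<^sup>2 = (LINT z|RNs. (a z - b z)\<^sup>2)" if "a \<in> sqint RNs" "b \<in> sqint RNs" for a b
    unfolding abs_hil_ops(2)[OF that] power2_norm_eq_inner abs_hil_ops(4)[OF sqint_diff[OF that] sqint_diff[OF that]]
    by (simp add: power2_eq_square)
  have "\<exists>g\<in>sqint RNs. \<forall>e>0. \<exists>N. \<forall>n\<ge>N. (LINT z|RNs. (f n z - g z)\<^sup>2) \<le> e"
  proof (rule sqint_complete[OF f])
    fix e :: real assume "e > 0"
    then obtain N where N: "\<And>m n. m \<ge> N \<Longrightarrow> n \<ge> N \<Longrightarrow> norm (X m - X n) < sqrt e"
      using X unfolding Cauchy_iff by (metis real_sqrt_gt_0_iff)
    have "(LINT z|RNs. (f m z - f n z)\<^sup>2) < e" if "m \<ge> N" "n \<ge> N" for m n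
    proof -
      have "(norm (X m - X n))\<^sup>2 < (sqrt e)\<^sup>2" by (intro power_strict_mono N that) auto
      then show ?thesis using \<open>e > 0\<close> by (simp add: Xf nrm f)
    qed
    then show "\<exists>N. \<forall>m\<ge>N. \<forall>n\<ge>N. (LINT z|RNs. (f m z - f n z)\<^sup>2) < e" by blast
  qed
  then obtain g where g: "g \<in> sqint RNs" "\<And>e. e > 0 \<Longrightarrow> \<exists>N. \<forall>n\<ge>N. (LINT z|RNs. (f n z - g z)\<^sup>2) \<le> e"
    by blast
  have "X \<longlonglongrightarrow> abs_hil g"
  proof (rule LIMSEQ_I)
    fix e :: real assume "e > 0"
    then obtain N where N: "\<And>n. n \<ge> N \<Longrightarrow> (LINT z|RNs. (f n z - g z)\<^sup>2) \<le> (e / 2)\<^sup>2"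
      using g(2)[of "(e / 2)\<^sup>2"] by auto
    have "norm (X n - abs_hil g) < e" if "n \<ge> N" for n
    proof -
      have "(norm (X n - abs_hil g))\<^sup>2 \<le> (e / 2)\<^sup>2" using N[OF that] by (simp add: Xf nrm f g)
      then have "norm (X n - abs_hil g) \<le> e / 2" by (rule power2_le_imp_le) (use \<open>e > 0\<close> in simp)
      then show ?thesis using \<open>e > 0\<close> by simp
    qed
    then show "\<exists>N. \<forall>n\<ge>N. norm (X n - abs_hil g) < e" by blast
  qed
  then show "convergent X" by (rule convergentI)
qed

section \<open>Translations of the slices\<close>

lemma space_RN: "space (RN N) = extensional {..<N}"
  by (simp add: RN_def space_PiM PiE_def)

lemma fun_upd_in_RN: "x \<in> space (RN N) \<Longrightarrow> i < N \<Longrightarrow> x(i := s) \<in> space (RN N)"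
  by (auto simp: space_RN extensional_def)

text \<open>The identity on slices without a coordinate i, so that one group per index acts on all
  slices at once and the corresponding derivative vanishes there.\<close>

definition shift :: "nat \<Rightarrow> real \<Rightarrow> nat \<Rightarrow> point \<Rightarrow> point" where
  "shift i s n x = (if i < n then x(i := x i + s) else x)"

lemma shift_0 [simp]: "shift i 0 n x = x"
  by (simp add: shift_def)

lemma shift_add: "shift i s n (shift i t n x) = shift i (t + s) n x"
  by (simp add: shift_def add.assoc)

lemma shift_commute: "shift i s n (shift j t n x) = shift j t n (shift i s n x)"
  by (cases "i = j") (auto simp: shift_def fun_upd_twist)

lemma shift_space: "x \<in> space (RN n) \<Longrightarrow> shift i s n x \<in> space (RN n)"
  by (simp add: shift_def fun_upd_in_RN)

lemma measurable_shift: "shift i s n \<in> measurable (RN n) (RN n)"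
proof (cases "i < n")
  case True
  then have "(\<lambda>x. x(i := x i + s)) \<in> measurable (RN n) (RN n)"
    unfolding RN_def by (intro measurable_fun_upd[where J="{..<n}"]) auto
  then show ?thesis using True by (simp add: shift_def[abs_def])
qed (simp add: shift_def[abs_def])

text \<open>A product measure is determined by its values on rectangles, and only the side i of a
  rectangle moves; one-dimensional translation invariance does the rest.\<close>

lemma distr_shift: "distr (RN n) (RN n) (shift i s n) = RN n"
proof (cases "i < n")
  case True
  interpret product_sigma_finite "\<lambda>_::nat. lborel :: real measure" by standard
  have "distr (RN n) (RN n) (shift i s n) = PiM {..<n} (\<lambda>_. lborel)"
  proof (rule PiM_eqI)
    fix A assume A: "\<And>j. j \<in> {..<n} \<Longrightarrow> A j \<in> sets (lborel :: real measure)"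
    define B where "B = A(i := (+) s -` A i)"
    have Ai: "A i \<in> sets borel" using A True by auto
    then have Bi: "(+) s -` A i \<in> sets borel" using measurable_sets[of "(+) s" borel borel "A i"] by simp
    then have B: "B j \<in> sets lborel" if "j < n" for j using A that by (auto simp: B_def)
    have "emeasure lborel ((+) s -` A i) = emeasure lborel (A i)"
      using emeasure_distr[of "(+) s" lborel borel "A i"] Ai by (simp add: lborel_distr_plus)
    then have e: "emeasure lborel (B j) = emeasure lborel (A j)" for j by (simp add: B_def)
    have "shift i s n -` (Pi\<^sub>E {..<n} A) \<inter> space (RN n) = Pi\<^sub>E {..<n} B"
      using True by (auto simp: shift_def B_def space_RN PiE_def Pi_def extensional_def add.commute split: if_splits)
    moreover have "Pi\<^sub>E {..<n} A \<in> sets (RN n)"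
      unfolding RN_def using A by (intro sets_PiM_I_finite) auto
    moreover have "emeasure (PiM {..<n} (\<lambda>_. lborel)) (Pi\<^sub>E {..<n} B) = (\<Prod>j\<in>{..<n}. emeasure lborel (B j))"
      by (rule emeasure_PiM) (use B in auto)
    ultimately show "emeasure (distr (RN n) (RN n) (shift i s n)) (Pi\<^sub>E {..<n} A) = (\<Prod>j\<in>{..<n}. emeasure lborel (A j))"
      by (simp add: emeasure_distr[OF measurable_shift] e) (simp add: RN_def e)
  qed (auto simp: RN_def)
  then show ?thesis by (simp add: RN_def)
qed (simp add: shift_def[abs_def] distr_id2)

definition shifts :: "nat \<Rightarrow> real \<Rightarrow> nat \<times> point \<Rightarrow> nat \<times> point" where
  "shifts i s = (\<lambda>(n, x). (n, shift i s n x))"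

lemma shifts_simps:
  "shifts i 0 z = z" "shifts i s (shifts i t z) = shifts i (t + s) z"
  "shifts i s (shifts j t z) = shifts j t (shifts i s z)"
  by (cases z; simp add: shifts_def shift_add; rule shift_commute)+

lemma shifts_measurable: "shifts i s \<in> measurable RNs RNs"
  unfolding shifts_def by (rule distr_dsum) (simp_all add: measurable_shift distr_shift)

lemma distr_shifts: "distr RNs RNs (shifts i s) = RNs"
  unfolding shifts_def by (rule distr_dsum) (simp_all add: measurable_shift distr_shift)

lemma sqint_shifts: 
  assumes f: "f \<in> sqint RNs"
  shows "(\<lambda>z. f (shifts i s z)) \<in> sqint RNs"
proof -
  note m = measurable_compose[OF shifts_measurable]
  have "integrable (distr RNs RNs (shifts i s)) (\<lambda>z. (f z)\<^sup>2)" using f by (simp add: distr_shifts sqint_def)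
  then have "integrable RNs (\<lambda>z. (f (shifts i s z))\<^sup>2)"
    using sqintD(1)[OF f] by (subst (asm) integrable_distr_eq[OF shifts_measurable]) auto
  then show ?thesis using m[OF sqintD(1)[OF f]] by (simp add: sqint_def)
qed

lift_definition tau :: "nat \<Rightarrow> real \<Rightarrow> hil \<Rightarrow> hil" is "\<lambda>i s f z. f (shifts i s z)"
proof -
  fix i s f g assume "hil_rel f g"
  then have f: "f \<in> sqint RNs" and g: "g \<in> sqint RNs" and ae: "AE z in RNs. f z = g z"
    by (auto simp: hil_rel_def)
  have "AE z in distr RNs RNs (shifts i s). f z = g z" unfolding distr_shifts by (rule ae)
  then have "AE z in RNs. f (shifts i s z) = g (shifts i s z)"
    by (rule AE_distrD[OF shifts_measurable])
  then show "hil_rel (\<lambda>z. f (shifts i s z)) (\<lambda>z. g (shifts i s z))"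
    by (intro hil_relI sqint_shifts f g)
qed

lemma tau_abs: "f \<in> sqint RNs \<Longrightarrow> tau i s (abs_hil f) = abs_hil (\<lambda>z. f (shifts i s z))"
  by (simp add: tau.abs_eq hil_rel_def)

lemma inner_tau: "inner (tau i s x) (tau i s y) = inner x y"
proof -
  have "(\<lambda>z. rep_hil x z * rep_hil y z) \<in> borel_measurable RNs"
    using sqintD(1)[OF rep_hil_sqint, of x] sqintD(1)[OF rep_hil_sqint, of y] by simp
  from integral_distr[OF shifts_measurable this]
  have "(LINT z|RNs. rep_hil x z * rep_hil y z) = (LINT z|RNs. rep_hil x (shifts i s z) * rep_hil y (shifts i s z))"
    by (simp add: distr_shifts)
  then have "inner (tau i s (abs_hil (rep_hil x))) (tau i s (abs_hil (rep_hil y))) = inner (abs_hil (rep_hil x)) (abs_hil (rep_hil y))"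
    by (simp only: tau_abs rep_hil_sqint abs_hil_ops sqint_shifts)
  then show ?thesis by simp
qed

lemma tau_linear: "linear (tau i s)"
  by (rule linearI; transfer) (auto simp: hil_rel_def intro!: sqint_add sqint_scale sqint_shifts)

lemma tau_norm: "norm (tau i s x) = norm x"
  by (simp add: norm_hil_def inner_tau)

lemma tau_0: "tau i 0 x = x"
  by transfer (simp add: shifts_simps(1))

lemma tau_add: "tau i s (tau i t x) = tau i (s + t) x"
  by transfer (simp add: shifts_simps(2) hil_rel_def sqint_shifts)

lemma tau_commute: "tau i s (tau j t x) = tau j t (tau i s x)"
proof transfer
  fix i s j t f assume "hil_rel f f"
  then have f: "f \<in> sqint RNs" by (simp add: hil_rel_def)
  have "(\<lambda>z. f (shifts i s (shifts j t z))) = (\<lambda>z. f (shifts j t (shifts i s z)))"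
    by (simp add: shifts_simps(3)[of i s j t])
  then show "hil_rel (\<lambda>z. f (shifts j t (shifts i s z))) (\<lambda>z. f (shifts i s (shifts j t z)))"
    using sqint_shifts[OF sqint_shifts[OF f], of j t i s] by (simp add: hil_rel_def)
qed

section \<open>The spaces L^2(R^N) as slices of the Hilbert space\<close>

definition ext :: "nat \<Rightarrow> (point \<Rightarrow> real) \<Rightarrow> nat \<times> point \<Rightarrow> real" where
  "ext N f = (\<lambda>(n, x). if n = N then f x else 0)"

text \<open>An isometric embedding of L^2(R^N) (\<open>norm_cls\<close>). \<open>rep\<close> inverts
  it up to null sets (\<open>rep_cls\<close>).\<close>

definition cls :: "nat \<Rightarrow> (point \<Rightarrow> real) \<Rightarrow> hil" where
  "cls N f = abs_hil (ext N f)"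

definition rep :: "nat \<Rightarrow> hil \<Rightarrow> point \<Rightarrow> real" where
  "rep N u x = rep_hil u (N, x)"

lemma ext_measurable: "f \<in> borel_measurable (RN N) \<Longrightarrow> ext N f \<in> borel_measurable RNs"
proof -
  assume f: "f \<in> borel_measurable (RN N)"
  have "(\<lambda>x. if n = N then f x else 0) \<in> borel_measurable (RN n)" for n
    using f by (cases "n = N") simp_all
  then show ?thesis by (simp add: measurable_dsum ext_def)
qed

lemma integral_ext:
  assumes "f \<in> borel_measurable (RN N)"
  shows "integrable RNs (ext N f) \<longleftrightarrow> integrable (RN N) f" "(LINT z|RNs. ext N f z) = (LINT x|RN N. f x)"
proof -
  have e: "ext N f = (\<lambda>z. indicator ({N} \<times> UNIV) z * ext N f z)"
    by (auto simp: ext_def indicator_def fun_eq_iff)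
  have s: "(\<lambda>x. ext N f (N, x)) = f" by (simp add: ext_def)
  show "integrable RNs (ext N f) \<longleftrightarrow> integrable (RN N) f"
    by (subst e) (simp only: integral_slice[OF ext_measurable[OF assms]] s)
  show "(LINT z|RNs. ext N f z) = (LINT x|RN N. f x)"
    by (subst e) (simp only: integral_slice[OF ext_measurable[OF assms]] s)
qed

lemma ext_sqint: "f \<in> L2 N \<Longrightarrow> ext N f \<in> sqint RNs"
proof -
  assume f: "f \<in> L2 N"
  have "(\<lambda>z. (ext N f z)\<^sup>2) = ext N (\<lambda>x. (f x)\<^sup>2)" by (auto simp: ext_def fun_eq_iff)
  then show ?thesis
    using f integral_ext(1)[of "\<lambda>x. (f x)\<^sup>2" N] borel_measurable_power[of f "RN N" 2]
    by (simp add: sqint_def L2_def ext_measurable)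
qed

lemma rep_L2: "rep N u \<in> L2 N"
proof -
  note m = sqintD(1)[OF rep_hil_sqint, of u]
  have "integrable RNs (\<lambda>z. indicator ({N} \<times> UNIV) z * (rep_hil u z)\<^sup>2)"
  proof (rule Bochner_Integration.integrable_bound[OF sqintD(2)[OF rep_hil_sqint, of u]])
    have "(indicator ({N} \<times> UNIV) :: _ \<Rightarrow> real) \<in> borel_measurable RNs"
      by (auto simp: measurable_dsum indicator_def)
    then show "(\<lambda>z. indicator ({N} \<times> UNIV) z * (rep_hil u z)\<^sup>2) \<in> borel_measurable RNs" using m by simp
  qed (auto simp: indicator_def)
  then have "integrable (RN N) (\<lambda>x. (rep_hil u (N, x))\<^sup>2)"
    using integral_slice(1)[of "\<lambda>z. (rep_hil u z)\<^sup>2" RN N] m by simp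
  then show ?thesis using m by (auto simp: L2_def rep_def[abs_def] measurable_dsum)
qed

lemma cls_eq_iff: "f \<in> L2 N \<Longrightarrow> g \<in> L2 N \<Longrightarrow> cls N f = cls N g \<longleftrightarrow> (AE x in RN N. f x = g x)"
proof -
  assume f: "f \<in> L2 N" and g: "g \<in> L2 N"
  have [measurable]: "ext N f \<in> borel_measurable RNs" "ext N g \<in> borel_measurable RNs"
    using ext_sqint[OF f] ext_sqint[OF g] by (auto dest: sqintD)
  have "cls N f = cls N g \<longleftrightarrow> (AE z in RNs. ext N f z = ext N g z)"
    unfolding cls_def by (rule abs_hil_eq_iff[OF ext_sqint[OF f] ext_sqint[OF g]])
  also have "\<dots> \<longleftrightarrow> (\<forall>n. AE x in RN n. ext N f (n, x) = ext N g (n, x))"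
    by (rule AE_dsum) measurable
  also have "\<dots> \<longleftrightarrow> (AE x in RN N. f x = g x)" by (auto simp: ext_def)
  finally show ?thesis .
qed

lemma cls_ops:
  assumes "f \<in> L2 N" "g \<in> L2 N"
  shows cls_add: "cls N (\<lambda>x. f x + g x) = cls N f + cls N g"
    and cls_diff: "cls N (\<lambda>x. f x - g x) = cls N f - cls N g"
    and cls_scale: "cls N (\<lambda>x. c * f x) = c *\<^sub>R cls N f"
    and inner_cls: "inner (cls N f) (cls N g) = (LINT x|RN N. f x * g x)"
proof -
  note o = abs_hil_ops[OF ext_sqint[OF assms(1)] ext_sqint[OF assms(2)]]
  have "(\<lambda>z. ext N f z + ext N g z) = ext N (\<lambda>x. f x + g x)" "(\<lambda>z. ext N f z - ext N g z) = ext N (\<lambda>x. f x - g x)"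
    "(\<lambda>z. c * ext N f z) = ext N (\<lambda>x. c * f x)" and m: "(\<lambda>z. ext N f z * ext N g z) = ext N (\<lambda>x. f x * g x)"
    by (auto simp: ext_def fun_eq_iff)
  then show "cls N (\<lambda>x. f x + g x) = cls N f + cls N g" "cls N (\<lambda>x. f x - g x) = cls N f - cls N g"
    "cls N (\<lambda>x. c * f x) = c *\<^sub>R cls N f"
    by (simp_all add: cls_def o)
  have "(\<lambda>x. f x * g x) \<in> borel_measurable (RN N)" using assms by (auto simp: L2_def)
  from integral_ext(2)[OF this] show "inner (cls N f) (cls N g) = (LINT x|RN N. f x * g x)"
    by (simp add: cls_def o m)
qed

lemma norm_cls: "f \<in> L2 N \<Longrightarrow> norm (cls N f) = L2_norm N f"
  by (simp add: norm_eq_sqrt_inner inner_cls L2_norm_def power2_eq_square)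

lemma inner_cls_right: "f \<in> L2 N \<Longrightarrow> inner u (cls N f) = (LINT x|RN N. rep N u x * f x)"
proof -
  assume f: "f \<in> L2 N"
  have m: "(\<lambda>x. rep N u x * f x) \<in> borel_measurable (RN N)"
    using f rep_L2[of N u] by (auto simp: L2_def)
  have "(\<lambda>z. rep_hil u z * ext N f z) = ext N (\<lambda>x. rep N u x * f x)"
    by (auto simp: ext_def rep_def fun_eq_iff)
  then have "inner (abs_hil (rep_hil u)) (cls N f) = (LINT x|RN N. rep N u x * f x)"
    unfolding cls_def by (simp only: abs_hil_ops[OF rep_hil_sqint ext_sqint[OF f]] integral_ext(2)[OF m])
  then show ?thesis by simp
qed

lemma hil_eq_0: "(\<And>n. AE x in RN n. rep n u x = 0) \<Longrightarrow> u = 0"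
proof -
  assume ae: "\<And>n. AE x in RN n. rep n u x = 0"
  note [measurable] = sqintD(1)[OF rep_hil_sqint, of u]
  have "AE z in RNs. rep_hil u z = 0"
    using ae by (subst AE_dsum) (measurable, simp add: rep_def)
  then have "abs_hil (rep_hil u) = abs_hil (\<lambda>_. 0)"
    by (subst abs_hil_eq_iff) (auto simp: rep_hil_sqint sqint_zero)
  then show ?thesis by (simp add: zero_hil_def)
qed

lemma rep_cls: "f \<in> L2 N \<Longrightarrow> AE x in RN N. rep N (cls N f) x = f x"
proof -
  assume f: "f \<in> L2 N"
  note [measurable] = sqintD(1)[OF rep_hil_sqint] sqintD(1)[OF ext_sqint[OF f]]
  have "AE z in RNs. rep_hil (cls N f) z = ext N f z"
    unfolding cls_def by (rule rep_abs_hil[OF ext_sqint[OF f]])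
  then have "\<forall>n. AE x in RN n. rep_hil (cls N f) (n, x) = ext N f (n, x)"
    by (subst (asm) AE_dsum) (measurable)
  then have "AE x in RN N. rep_hil (cls N f) (N, x) = ext N f (N, x)" by blast
  then show ?thesis by (simp add: rep_def ext_def)
qed

lemma tau_cls: "f \<in> L2 n \<Longrightarrow> tau i s (cls n f) = cls n (\<lambda>x. f (shift i s n x))"
proof -
  assume f: "f \<in> L2 n"
  have "(\<lambda>z. ext n f (shifts i s z)) = ext n (\<lambda>x. f (shift i s n x))"
    by (auto simp: ext_def shifts_def fun_eq_iff)
  then show ?thesis by (simp add: cls_def tau_abs[OF ext_sqint[OF f]])
qed

section \<open>Test functions\<close>

text \<open>The projection theorem in the form used for density: x minus its nearest point in V is
  orthogonal to V, hence zero.\<close>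

lemma closed_subspace_eq_UNIV:
  fixes V :: "'a::{real_inner,banach} set"
  assumes V: "subspace V" "closed V" and orth: "\<And>x. (\<And>v. v \<in> V \<Longrightarrow> inner x v = 0) \<Longrightarrow> x = 0"
  shows "V = UNIV"
proof -
  have "x \<in> V" for x
  proof -
    have ne: "V \<noteq> {}" using subspace_0[OF V(1)] by auto
    define d where "d = infdist x V"
    have d0: "0 \<le> d" by (simp add: d_def infdist_nonneg)
    have dle: "d \<le> norm (x - v)" if "v \<in> V" for v
      using infdist_le[OF that, of x] by (simp add: d_def dist_norm)
    have "\<exists>v\<in>V. norm (x - v) < d + 1 / real (Suc n)" for n
    proof (rule ccontr)
      assume "\<not> (\<exists>v\<in>V. norm (x - v) < d + 1 / real (Suc n))"
      then have "d + 1 / real (Suc n) \<le> (INF v\<in>V. dist x v)"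
        by (intro cINF_greatest[OF ne]) (auto simp: dist_norm not_less)
      then show False by (simp add: d_def infdist_notempty[OF ne])
    qed
    then obtain v where v: "\<And>n. v n \<in> V" "\<And>n. norm (x - v n) < d + 1 / real (Suc n)" by metis
    have lim: "(\<lambda>n. (d + 1 / real (Suc n))\<^sup>2) \<longlonglongrightarrow> d\<^sup>2"
    proof -
      have "(\<lambda>n. (d + 1 / real (Suc n))\<^sup>2) \<longlonglongrightarrow> (d + 0)\<^sup>2"
        using LIMSEQ_inverse_real_of_nat by (intro tendsto_intros) (simp add: inverse_eq_divide)
      then show ?thesis by simp
    qed
    \<comment> \<open>Parallelogram law: the midpoint of \<open>v m\<close> and \<open>v n\<close>
      lies in V and so has distance at least d from x.\<close>
    have par: "(norm (v m - v n))\<^sup>2 \<le> 2 * (d + 1 / real (Suc m))\<^sup>2 + 2 * (d + 1 / real (Suc n))\<^sup>2 - 4 * d\<^sup>2" for m n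
    proof -
      have "(1/2) *\<^sub>R (v m + v n) \<in> V" by (intro subspace_scale subspace_add V v)
      then have "d\<^sup>2 \<le> (norm (x - (1/2) *\<^sub>R (v m + v n)))\<^sup>2" using dle d0 by (intro power_mono) auto
      moreover have "(norm (v m - v n))\<^sup>2 + 4 * (norm (x - (1/2) *\<^sub>R (v m + v n)))\<^sup>2 =
          2 * (norm (x - v m))\<^sup>2 + 2 * (norm (x - v n))\<^sup>2"
        by (simp add: power2_norm_eq_inner inner_diff_left inner_diff_right inner_add_left inner_add_right
            inner_commute algebra_simps)
      moreover have "(norm (x - v k))\<^sup>2 \<le> (d + 1 / real (Suc k))\<^sup>2" for k
        using v(2)[of k] by (intro power_mono) auto
      ultimately show ?thesis by (smt (verit))
    qed
    have "Cauchy v"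
    proof (rule CauchyI)
      fix e :: real assume "e > 0"
      then have "eventually (\<lambda>n. (d + 1 / real (Suc n))\<^sup>2 < d\<^sup>2 + e\<^sup>2 / 4) sequentially"
        by (intro order_tendstoD(2)[OF lim]) simp
      then obtain M where M: "\<And>n. n \<ge> M \<Longrightarrow> (d + 1 / real (Suc n))\<^sup>2 < d\<^sup>2 + e\<^sup>2 / 4"
        by (auto simp: eventually_sequentially)
      have "norm (v m - v n) < e" if "m \<ge> M" "n \<ge> M" for m n
      proof -
        have "(norm (v m - v n))\<^sup>2 < e\<^sup>2" using par[of m n] M[OF that(1)] M[OF that(2)] by linarith
        then show ?thesis by (rule power2_less_imp_less) (use \<open>e > 0\<close> in simp)
      qed
      then show "\<exists>M. \<forall>m\<ge>M. \<forall>n\<ge>M. norm (v m - v n) < e" by blast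
    qed
    then obtain p where p: "v \<longlonglongrightarrow> p" using Cauchy_convergent_iff convergent_def by blast
    have pV: "p \<in> V" using closed_sequentially[OF V(2)] v(1) p by blast
    have "norm (x - p) \<le> d"
    proof (rule LIMSEQ_le[of "\<lambda>n. norm (x - v n)" _ "\<lambda>n. d + 1 / real (Suc n)"])
      show "(\<lambda>n. norm (x - v n)) \<longlonglongrightarrow> norm (x - p)" by (intro tendsto_intros p)
      have "(\<lambda>n. d + 1 / real (Suc n)) \<longlonglongrightarrow> d + 0"
        using LIMSEQ_inverse_real_of_nat by (intro tendsto_intros) (simp add: inverse_eq_divide)
      then show "(\<lambda>n. d + 1 / real (Suc n)) \<longlonglongrightarrow> d" by simp
    qed (use v(2) in \<open>auto intro!: exI[of _ 0] less_imp_le\<close>)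
    have "inner (x - p) w = 0" if w: "w \<in> V" for w
    proof (rule ccontr)
      assume ne: "inner (x - p) w \<noteq> 0"
      then have w0: "inner w w > 0" by auto
      \<comment> \<open>The parameter at which p + t w comes closest to x.\<close>
      define t where "t = inner (x - p) w / inner w w"
      have "p + t *\<^sub>R w \<in> V" by (intro subspace_add subspace_scale V pV w)
      then have "norm (x - p) \<le> norm (x - (p + t *\<^sub>R w))" using dle \<open>norm (x - p) \<le> d\<close> order_trans by blast
      then have "(norm (x - p))\<^sup>2 \<le> (norm ((x - p) - t *\<^sub>R w))\<^sup>2"
        by (intro power_mono) (simp_all add: diff_diff_eq)
      also have "\<dots> = (norm (x - p))\<^sup>2 - 2 * t * inner (x - p) w + t * t * inner w w"
        by (simp add: power2_norm_eq_inner inner_diff_left inner_diff_right inner_commute algebra_simps)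
      also have "t * t * inner w w = t * inner (x - p) w" using w0 by (simp add: t_def)
      finally have "t * inner (x - p) w \<le> 0" by simp
      moreover have "t * inner (x - p) w = (inner (x - p) w)\<^sup>2 / inner w w" by (simp add: t_def power2_eq_square)
      moreover have "(inner (x - p) w)\<^sup>2 / inner w w > 0" using ne w0 by simp
      ultimately show False by simp
    qed
    then have "x - p = 0" by (rule orth)
    then show ?thesis using pV by simp
  qed
  then show ?thesis by blast
qed

section \<open>Borel sets, compact sets and local integrability in R^N\<close>

lemma coord_measurable: "(\<lambda>x. x i) \<in> borel_measurable (RN N)"
proof (cases "i < N")
  case True
  then have "(\<lambda>x. x i) \<in> measurable (PiM {..<N} (\<lambda>_. lborel)) (lborel :: real measure)"
    by (intro measurable_component_singleton) simp
  then show ?thesis by (simp add: RN_def)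
next
  case False
  \<comment> \<open>Outside the index set an extensional function has the constant value
    \<open>undefined\<close>.\<close>
  have "(\<lambda>x. x i) \<in> borel_measurable (RN N) \<longleftrightarrow> (\<lambda>x. undefined :: real) \<in> borel_measurable (RN N)"
    by (rule measurable_cong) (use False in \<open>auto simp: space_RN extensional_def\<close>)
  then show ?thesis by simp
qed

text \<open>Links the product sigma-algebra of \<open>RN N\<close> with the Borel sets of the
  topology of pointwise convergence, to which continuity and compactness refer.\<close>

lemma id_measurable_RN: "(\<lambda>x. x) \<in> borel_measurable (RN N)"
  by (rule measurable_coordinatewise_then_product) (rule coord_measurable)

lemma continuous_measurable_RN:
  assumes "continuous_on (space (RN N)) f"
  shows "f \<in> borel_measurable (RN N)"
proof -
  have "(\<lambda>x. x) \<in> measurable (RN N) (restrict_space borel (space (RN N)))"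
    by (rule measurable_restrict_space2) (auto intro: id_measurable_RN)
  from measurable_compose[OF this borel_measurable_continuous_on_restrict[OF assms]] show ?thesis .
qed

lemma compact_sets_RN:
  assumes "compact K" "K \<subseteq> space (RN N)"
  shows "K \<in> sets (RN N)"
proof -
  have "K \<in> sets borel" using assms(1) by (simp add: compact_imp_closed)
  from measurable_sets[OF id_measurable_RN this] have "K \<inter> space (RN N) \<in> sets (RN N)" by simp
  moreover have "K \<inter> space (RN N) = K" using assms(2) by blast
  ultimately show ?thesis by simp
qed

text \<open>Cubes replace general compact sets: each cube is compact, and every compact subset of
  the space lies in one.\<close>

definition box_RN :: "nat \<Rightarrow> real \<Rightarrow> point set" where
  "box_RN N R = PiE {..<N} (\<lambda>_. {-R..R})"

lemma mem_box_RN: "x \<in> box_RN N R \<longleftrightarrow> x \<in> space (RN N) \<and> (\<forall>i<N. \<bar>x i\<bar> \<le> R)"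
  by (auto simp: box_RN_def space_RN PiE_iff abs_le_iff minus_le_iff)

lemma box_RN_sets: "box_RN N R \<in> sets (RN N)"
  unfolding box_RN_def RN_def by (intro sets_PiM_I_finite) auto

lemma box_RN_finite: "emeasure (RN N) (box_RN N R) < \<infinity>"
proof -
  interpret product_sigma_finite "\<lambda>_::nat. lborel :: real measure" by standard
  have "emeasure (RN N) (box_RN N R) = (\<Prod>i\<in>{..<N}. emeasure lborel {-R..R})"
    unfolding box_RN_def RN_def by (rule emeasure_PiM) auto
  also have "emeasure lborel {-R..R} = ennreal (max 0 (2 * R))"
    by (cases "0 \<le> R") simp_all
  also have "(\<Prod>i\<in>{..<N}. ennreal (max 0 (2 * R))) < \<infinity>"
    by (simp add: ennreal_power)
  finally show ?thesis .
qed

text \<open>Tychonoff's theorem in the space of all functions, with the coordinates from N on pinned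
  to the single value \<open>undefined\<close>.\<close>

lemma box_RN_compact: "compact (box_RN N R)"
proof -
  have "box_RN N R = PiE UNIV (\<lambda>i. if i < N then {-R..R} else {undefined})"
  proof (rule set_eqI)
    fix x
    have "x \<in> box_RN N R \<longleftrightarrow> (\<forall>i. (i < N \<longrightarrow> x i \<in> {-R..R}) \<and> (\<not> i < N \<longrightarrow> x i = undefined))"
      unfolding box_RN_def PiE_iff extensional_def by blast
    also have "\<dots> \<longleftrightarrow> (\<forall>i. x i \<in> (if i < N then {-R..R} else {undefined}))"
      by (intro all_cong1) simp
    finally show "x \<in> box_RN N R \<longleftrightarrow> x \<in> PiE UNIV (\<lambda>i. if i < N then {-R..R} else {undefined})"
      by (simp add: PiE_iff)
  qed
  moreover have "compactin (product_topology (\<lambda>_. euclidean) UNIV)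
      (PiE UNIV (\<lambda>i::nat. if i < N then {-R..R} else {undefined}))"
    unfolding compactin_PiE by (auto simp: compactin_euclidean_iff)
  ultimately show ?thesis by (simp add: euclidean_product_topology compactin_euclidean_iff)
qed

lemma compact_subset_box_RN:
  assumes "compact K" "K \<subseteq> space (RN N)"
  shows "\<exists>R. K \<subseteq> box_RN N R"
proof -
  have "\<exists>R. \<forall>x\<in>K. \<bar>x i\<bar> \<le> R" for i :: nat
  proof -
    have "compact ((\<lambda>x. x i) ` K)"
      by (rule compact_continuous_image[OF _ assms(1)]) (rule continuous_on_subset[OF continuous_on_product_coordinates], simp)
    then have "bounded ((\<lambda>x. x i) ` K)" by (rule compact_imp_bounded)
    then show ?thesis by (auto simp: bounded_iff)
  qed
  then obtain R where R: "\<And>i x. x \<in> K \<Longrightarrow> \<bar>x i\<bar> \<le> R i" by metis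
  have "K \<subseteq> box_RN N (\<Sum>i<N. \<bar>R i\<bar>)"
  proof
    fix x assume x: "x \<in> K"
    have "\<bar>x i\<bar> \<le> (\<Sum>i<N. \<bar>R i\<bar>)" if "i < N" for i
    proof -
      have "\<bar>R i\<bar> \<le> (\<Sum>i<N. \<bar>R i\<bar>)" by (rule member_le_sum) (use that in auto)
      then show ?thesis using R[OF x, of i] by linarith
    qed
    then show "x \<in> box_RN N (\<Sum>i<N. \<bar>R i\<bar>)" using x assms(2) by (auto simp: mem_box_RN)
  qed
  then show ?thesis by blast
qed

lemma L1_loc_iff:
  "f \<in> L1_loc N \<longleftrightarrow> f \<in> borel_measurable (RN N) \<and> (\<forall>R. integrable (RN N) (\<lambda>x. indicator (box_RN N R) x * f x))"
proof (intro iffI conjI allI)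
  assume f: "f \<in> L1_loc N"
  then show "f \<in> borel_measurable (RN N)" by (simp add: L1_loc_def)
  show "integrable (RN N) (\<lambda>x. indicator (box_RN N R) x * f x)" for R
    using f box_RN_compact[of N R] by (auto simp: L1_loc_def set_integrable_def mem_box_RN subset_iff)
next
  assume f: "f \<in> borel_measurable (RN N) \<and> (\<forall>R. integrable (RN N) (\<lambda>x. indicator (box_RN N R) x * f x))"
  have "set_integrable (RN N) K f" if K: "compact K" "K \<subseteq> space (RN N)" for K
  proof -
    obtain R where R: "K \<subseteq> box_RN N R" using compact_subset_box_RN[OF K] by blast
    have "set_integrable (RN N) (box_RN N R) f" using f by (simp add: set_integrable_def)
    then show ?thesis by (rule set_integrable_subset[OF _ compact_sets_RN[OF K] R])
  qed
  with f show "f \<in> L1_loc N" by (simp add: L1_loc_def)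
qed

lemma L1_locD: "f \<in> L1_loc N \<Longrightarrow> f \<in> borel_measurable (RN N)"
  by (simp add: L1_loc_def)

lemma L1_loc_integrable:
  assumes u: "u \<in> L1_loc N" and g: "g \<in> borel_measurable (RN N)"
    and b: "\<And>x. x \<in> space (RN N) \<Longrightarrow> \<bar>g x\<bar> \<le> M"
    and z: "\<And>x. x \<in> space (RN N) \<Longrightarrow> x \<notin> box_RN N R \<Longrightarrow> g x = 0"
  shows "integrable (RN N) (\<lambda>x. u x * g x)"
    and "\<bar>LINT x|RN N. u x * g x\<bar> \<le> M * (LINT x|RN N. indicator (box_RN N R) x * \<bar>u x\<bar>)"
proof -
  have i: "integrable (RN N) (\<lambda>x. indicator (box_RN N R) x * \<bar>u x\<bar>)"
    using integrable_abs[of "RN N" "\<lambda>x. indicator (box_RN N R) x * u x"] u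
    by (simp add: L1_loc_iff abs_mult)
  have le: "norm (u x * g x) \<le> M * (indicator (box_RN N R) x * \<bar>u x\<bar>)" if x: "x \<in> space (RN N)" for x
  proof (cases "x \<in> box_RN N R")
    case True
    have "\<bar>u x\<bar> * \<bar>g x\<bar> \<le> \<bar>u x\<bar> * M" using b[OF x] by (rule mult_left_mono) simp
    then show ?thesis using True by (simp add: abs_mult mult.commute)
  qed (simp add: z[OF x])
  have "integrable (RN N) (\<lambda>x. M * (indicator (box_RN N R) x * \<bar>u x\<bar>))" using i by simp
  then show "integrable (RN N) (\<lambda>x. u x * g x)"
    by (rule Bochner_Integration.integrable_bound) (use L1_locD[OF u] g in \<open>auto intro!: AE_I2 order_trans[OF le[unfolded real_norm_def] abs_ge_self]\<close>)
  then have "norm (LINT x|RN N. u x * g x) \<le> (LINT x|RN N. M * (indicator (box_RN N R) x * \<bar>u x\<bar>))"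
    using i le by (intro order_trans[OF integral_norm_bound] integral_mono integrable_norm) auto
  then show "\<bar>LINT x|RN N. u x * g x\<bar> \<le> M * (LINT x|RN N. indicator (box_RN N R) x * \<bar>u x\<bar>)" by simp
qed

lemma L1_loc_add: "f \<in> L1_loc N \<Longrightarrow> g \<in> L1_loc N \<Longrightarrow> (\<lambda>x. f x + g x) \<in> L1_loc N"
  by (auto simp: L1_loc_iff distrib_left)

lemma L1_loc_diff: "f \<in> L1_loc N \<Longrightarrow> g \<in> L1_loc N \<Longrightarrow> (\<lambda>x. f x - g x) \<in> L1_loc N"
  by (auto simp: L1_loc_iff right_diff_distrib)

lemma bounded_box_L2:
  assumes g: "g \<in> borel_measurable (RN N)"
    and b: "\<And>x. x \<in> space (RN N) \<Longrightarrow> \<bar>g x\<bar> \<le> M"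
    and z: "\<And>x. x \<in> space (RN N) \<Longrightarrow> x \<notin> box_RN N R \<Longrightarrow> g x = 0"
  shows "g \<in> L2 N" and "L2_norm N g \<le> M * sqrt (measure (RN N) (box_RN N R))"
proof -
  have i: "integrable (RN N) (\<lambda>x. indicator (box_RN N R) x :: real)"
    using box_RN_finite by (intro integrable_real_indicator box_RN_sets)
  have le: "(g x)\<^sup>2 \<le> M\<^sup>2 * indicator (box_RN N R) x" if x: "x \<in> space (RN N)" for x
    using b[OF x] z[OF x] by (cases "x \<in> box_RN N R") (auto simp: abs_le_square_iff[symmetric] abs_le_iff)
  have I: "integrable (RN N) (\<lambda>x. (g x)\<^sup>2)"
    by (rule Bochner_Integration.integrable_bound[of _ "\<lambda>x. M\<^sup>2 * indicator (box_RN N R) x"])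
      (use i g le in \<open>auto intro!: AE_I2\<close>)
  then show "g \<in> L2 N" using g by (simp add: L2_def)
  have M: "0 \<le> M \<or> space (RN N) = {}" using b abs_ge_zero order_trans by blast
  have "space (RN N) \<noteq> {}" by (auto simp: space_RN intro!: exI[of _ "\<lambda>_. undefined"])
  with M have M: "0 \<le> M" by simp
  have "(LINT x|RN N. (g x)\<^sup>2) \<le> (LINT x|RN N. M\<^sup>2 * indicator (box_RN N R) x)"
    using i le I by (intro integral_mono) auto
  also have "\<dots> = M\<^sup>2 * measure (RN N) (box_RN N R)"
    using sets.sets_into_space[OF box_RN_sets] by (simp add: Int_absorb2)
  finally have "L2_norm N g \<le> sqrt (M\<^sup>2 * measure (RN N) (box_RN N R))"
    by (simp add: L2_norm_def)
  then show "L2_norm N g \<le> M * sqrt (measure (RN N) (box_RN N R))"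
    using M by (simp add: real_sqrt_mult)
qed

lemma L2_L1_loc: "f \<in> L2 N \<Longrightarrow> f \<in> L1_loc N"
  unfolding L1_loc_iff
proof (intro conjI allI)
  assume f: "f \<in> L2 N"
  then show "f \<in> borel_measurable (RN N)" by (simp add: L2_def)
  fix R
  have "(\<lambda>x. indicator (box_RN N R) x :: real) \<in> L2 N"
    by (rule bounded_box_L2(1)[where M=1 and R=R]) (auto intro: borel_measurable_indicator[OF box_RN_sets] simp: indicator_def[abs_def, symmetric] split: split_indicator)
  from sqint_mult[OF this[unfolded L2_eq_sqint] f[unfolded L2_eq_sqint]]
  show "integrable (RN N) (\<lambda>x. indicator (box_RN N R) x * f x)" .
qed

section \<open>Smooth functions and their supports\<close>

lemma partials_append: "partials (is @ js) f = partials is (partials js f)"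
  by (induction "is") auto

lemma smooth_partial: "smooth N f \<Longrightarrow> i < N \<Longrightarrow> smooth N (partial i f)"
  unfolding smooth_def
proof (intro allI impI)
  fix "is"
  assume f: "\<forall>is. set is \<subseteq> {..<N} \<longrightarrow> continuous_on (space (RN N)) (partials is f) \<and>
        (\<forall>i<N. \<forall>x\<in>space (RN N). (\<lambda>s. partials is f (x(i := s))) differentiable (at (x i)))"
    and i: "i < N" and "is": "set is \<subseteq> {..<N}"
  have "partials (is @ [i]) f = partials is (partial i f)" by (simp add: partials_append)
  then show "continuous_on (space (RN N)) (partials is (partial i f)) \<and>
        (\<forall>ia<N. \<forall>x\<in>space (RN N). (\<lambda>s. partials is (partial i f) (x(ia := s))) differentiable (at (x ia)))"
    using f[rule_format, of "is @ [i]"] i "is" by auto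
qed

lemma smooth_continuous: "smooth N f \<Longrightarrow> continuous_on (space (RN N)) f"
  unfolding smooth_def by (metis empty_subsetI list.set(1) partials.simps(1))

lemma smooth_DERIV:
  assumes f: "smooth N f" and i: "i < N" and x: "x \<in> space (RN N)"
  shows "((\<lambda>s. f (x(i := s))) has_real_derivative partial i f (x(i := s))) (at s)"
proof -
  have "(\<lambda>r. partials [] f ((x(i := s))(i := r))) differentiable (at ((x(i := s)) i))"
    using f i fun_upd_in_RN[OF x i, of s] unfolding smooth_def by (metis empty_subsetI list.set(1))
  then have "(\<lambda>r. f (x(i := r))) differentiable (at s)" by simp
  then have "((\<lambda>r. f (x(i := r))) has_real_derivative deriv (\<lambda>r. f (x(i := r))) s) (at s)"
    using real_differentiable_def DERIV_deriv_iff_real_differentiable by blast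
  then show ?thesis by (simp add: partial_def)
qed

lemma test_fun_iff: "\<psi> \<in> test_fun N \<longleftrightarrow> smooth N \<psi> \<and> (\<exists>R. \<forall>x\<in>space (RN N). x \<notin> box_RN N R \<longrightarrow> \<psi> x = 0)"
proof
  assume p: "\<psi> \<in> test_fun N"
  then obtain K where K: "compact K" "K \<subseteq> space (RN N)" "\<forall>x\<in>space (RN N) - K. \<psi> x = 0"
    by (auto simp: test_fun_def)
  obtain R where "K \<subseteq> box_RN N R" using compact_subset_box_RN[OF K(1,2)] by blast
  then have "\<forall>x\<in>space (RN N). x \<notin> box_RN N R \<longrightarrow> \<psi> x = 0" using K(3) by blast
  then show "smooth N \<psi> \<and> (\<exists>R. \<forall>x\<in>space (RN N). x \<notin> box_RN N R \<longrightarrow> \<psi> x = 0)"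
    using p by (auto simp: test_fun_def)
next
  assume p: "smooth N \<psi> \<and> (\<exists>R. \<forall>x\<in>space (RN N). x \<notin> box_RN N R \<longrightarrow> \<psi> x = 0)"
  then obtain R where "\<forall>x\<in>space (RN N). x \<notin> box_RN N R \<longrightarrow> \<psi> x = 0" by blast
  then show "\<psi> \<in> test_fun N"
    using p box_RN_compact[of N R] by (auto simp: test_fun_def mem_box_RN intro!: exI[of _ "box_RN N R"])
qed

lemma test_fun_partial:
  assumes p: "\<psi> \<in> test_fun N" and i: "i < N"
  shows "partial i \<psi> \<in> test_fun N"
proof -
  obtain R where R: "\<And>x. x \<in> space (RN N) \<Longrightarrow> x \<notin> box_RN N R \<Longrightarrow> \<psi> x = 0"
    using p by (auto simp: test_fun_iff)
  have "partial i \<psi> x = 0" if x: "x \<in> space (RN N)" "x \<notin> box_RN N R" for x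
  proof -
    obtain j where j: "j < N" "\<bar>x j\<bar> > R" using x by (auto simp: mem_box_RN not_le)
    \<comment> \<open>Some coordinate j of x is too large. If j is the direction of differentiation,
      it remains so near x; otherwise the whole line in direction i stays outside the box.\<close>
    have ev: "eventually (\<lambda>s. \<psi> (x(i := s)) = 0) (nhds (x i))"
    proof (cases "j = i")
      case True
      have "open {s. \<bar>s\<bar> > R}" by (intro open_Collect_less continuous_intros)
      then have "eventually (\<lambda>s. s \<in> {s. \<bar>s\<bar> > R}) (nhds (x i))" using j True by (intro eventually_nhds_in_open) auto
      moreover have "\<psi> (x(i := s)) = 0" if "\<bar>s\<bar> > R" for s
      proof (rule R[OF fun_upd_in_RN[OF x(1) i]])
        show "x(i := s) \<notin> box_RN N R"
          using that i unfolding mem_box_RN by (metis fun_upd_same not_le)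
      qed
      ultimately show ?thesis by (rule eventually_mono) simp
    next
      case False
      have "\<psi> (x(i := s)) = 0" for s
        by (rule R[OF fun_upd_in_RN[OF x(1) i]]) (use j False in \<open>force simp: mem_box_RN\<close>)
      then show ?thesis by simp
    qed
    have "deriv (\<lambda>s. \<psi> (x(i := s))) (x i) = deriv (\<lambda>s. 0) (x i)"
      by (rule deriv_cong_ev[OF ev refl])
    then show ?thesis by (simp add: partial_def)
  qed
  then show ?thesis using p smooth_partial[of N \<psi> i] i by (auto simp: test_fun_iff)
qed

lemma test_fun_partials: "\<psi> \<in> test_fun N \<Longrightarrow> set is \<subseteq> {..<N} \<Longrightarrow> partials is \<psi> \<in> test_fun N"
  by (induction "is") (auto intro: test_fun_partial)

lemma test_fun_measurable: "\<psi> \<in> test_fun N \<Longrightarrow> \<psi> \<in> borel_measurable (RN N)"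
  by (auto simp: test_fun_iff intro: continuous_measurable_RN smooth_continuous)

lemma test_fun_bounded:
  assumes "\<psi> \<in> test_fun N"
  obtains M where "M \<ge> 0" "\<And>x. x \<in> space (RN N) \<Longrightarrow> \<bar>\<psi> x\<bar> \<le> M"
proof -
  obtain R where R: "\<And>x. x \<in> space (RN N) \<Longrightarrow> x \<notin> box_RN N R \<Longrightarrow> \<psi> x = 0"
    using assms by (auto simp: test_fun_iff)
  have "continuous_on (box_RN N R) \<psi>"
    by (rule continuous_on_subset[OF smooth_continuous]) (use assms in \<open>auto simp: test_fun_iff mem_box_RN\<close>)
  then have "bounded (\<psi> ` box_RN N R)"
    by (intro compact_imp_bounded compact_continuous_image box_RN_compact)
  then obtain M where M: "\<And>x. x \<in> box_RN N R \<Longrightarrow> \<bar>\<psi> x\<bar> \<le> M" by (auto simp: bounded_iff)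
  have "\<bar>\<psi> x\<bar> \<le> \<bar>M\<bar>" if "x \<in> space (RN N)" for x
    using M[of x] R[OF that] by (cases "x \<in> box_RN N R") auto
  then show ?thesis using that[of "\<bar>M\<bar>"] by auto
qed

lemma test_fun_L2: "\<psi> \<in> test_fun N \<Longrightarrow> \<psi> \<in> L2 N"
proof -
  assume p: "\<psi> \<in> test_fun N"
  obtain M where M: "M \<ge> 0" "\<And>x. x \<in> space (RN N) \<Longrightarrow> \<bar>\<psi> x\<bar> \<le> M" using test_fun_bounded[OF p] by blast
  obtain R where R: "\<And>x. x \<in> space (RN N) \<Longrightarrow> x \<notin> box_RN N R \<Longrightarrow> \<psi> x = 0"
    using p by (auto simp: test_fun_iff)
  show ?thesis by (rule bounded_box_L2(1)[OF test_fun_measurable[OF p] M(2) R])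
qed

lemma test_fun_integrable: "u \<in> L1_loc N \<Longrightarrow> \<psi> \<in> test_fun N \<Longrightarrow> integrable (RN N) (\<lambda>x. u x * \<psi> x)"
proof -
  assume u: "u \<in> L1_loc N" and p: "\<psi> \<in> test_fun N"
  obtain M where M: "M \<ge> 0" "\<And>x. x \<in> space (RN N) \<Longrightarrow> \<bar>\<psi> x\<bar> \<le> M" using test_fun_bounded[OF p] by blast
  obtain R where R: "\<And>x. x \<in> space (RN N) \<Longrightarrow> x \<notin> box_RN N R \<Longrightarrow> \<psi> x = 0"
    using p by (auto simp: test_fun_iff)
  show ?thesis by (rule L1_loc_integrable(1)[OF u test_fun_measurable[OF p] M(2) R])
qed

section \<open>Test functions on space-time\<close>

text \<open>The mean value inequality twice, first for g' and then for g minus its tangent; this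
  yields the constant M rather than the sharp M / 2.\<close>

lemma taylor2_bound:
  fixes g :: "real \<Rightarrow> real"
  assumes g: "\<And>s. (g has_real_derivative g' s) (at s)" and g': "\<And>s. (g' has_real_derivative g'' s) (at s)"
    and M: "\<And>s. \<bar>g'' s\<bar> \<le> M"
  shows "\<bar>g b - g a - (b - a) * g' a\<bar> \<le> M * (b - a)\<^sup>2"
proof -
  have M0: "0 \<le> M" using M[of 0] by linarith
  have lin: "((\<lambda>s. c * s) has_real_derivative c) (at s)" for c s :: real
    by (auto intro!: derivative_eq_intros)
  have sh: "((\<lambda>s. f (a + s)) has_real_derivative f' (a + s)) (at s)"
    if "\<And>s. (f has_real_derivative f' s) (at s)" for f f' and s :: real
    using that[of "a + s"] DERIV_shift[of f "f' (a + s)" s a] by (simp add: add.commute)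
  have 1: "\<bar>g' (a + s) - g' a\<bar> \<le> M * \<bar>s\<bar>" for s
  proof -
    have "norm (g' (a + s) - g' (a + 0)) \<le> \<bar>M * s - M * 0\<bar>"
      by (rule norm_diff_bound[where F="\<lambda>s. g' (a + s)" and G="\<lambda>s. M * s", OF _ lin])
        (use sh[OF g'] M in \<open>auto simp: has_real_derivative_iff_has_vector_derivative\<close>)
    then show ?thesis using M0 by (simp add: abs_mult)
  qed
  define t where "t = b - a"
  have "((\<lambda>s. g (a + s) - s * g' a) has_real_derivative g' (a + s) - g' a) (at s)" for s
    using sh[OF g] by (auto intro!: derivative_eq_intros)
  then have d: "((\<lambda>s. g (a + s) - s * g' a) has_vector_derivative g' (a + s) - g' a) (at s)" for s
    by (simp add: has_real_derivative_iff_has_vector_derivative)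
  have "norm (g (a + t) - t * g' a - (g (a + 0) - 0 * g' a)) \<le> \<bar>M * \<bar>t\<bar> * t - M * \<bar>t\<bar> * 0\<bar>"
  proof (rule norm_diff_bound[where F="\<lambda>s. g (a + s) - s * g' a", OF d lin])
    fix s assume "\<bar>s\<bar> \<le> \<bar>t\<bar>"
    then have "M * \<bar>s\<bar> \<le> M * \<bar>t\<bar>" using M0 by (rule mult_left_mono)
    then show "norm (g' (a + s) - g' a) \<le> M * \<bar>t\<bar>" using 1[of s] by simp
  qed
  moreover have "\<bar>M * \<bar>t\<bar> * t - M * \<bar>t\<bar> * 0\<bar> = M * t\<^sup>2"
    using M0 by (simp add: abs_mult power2_eq_square)
  moreover have "g (a + t) - t * g' a - (g (a + 0) - 0 * g' a) = g b - g a - (b - a) * g' a" by (simp add: t_def)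
  ultimately show ?thesis unfolding t_def by simp
qed

lemma quadratic_remainder_deriv:
  assumes "\<And>s. \<bar>s - t\<bar> \<le> 1 \<Longrightarrow> norm (F s - F t - (s - t) *\<^sub>R D) \<le> C * (s - t)\<^sup>2"
  shows "(F has_vector_derivative D) (at t)"
proof -
  have "((\<lambda>s. (F s - F t) /\<^sub>R (s - t) - D) \<longlongrightarrow> 0) (at t)"
  proof (rule Lim_null_comparison)
    have "norm ((F s - F t) /\<^sub>R (s - t) - D) \<le> C * \<bar>s - t\<bar>" if s: "s \<noteq> t" "\<bar>s - t\<bar> < 1" for s
    proof -
      have "(F s - F t) /\<^sub>R (s - t) - D = (F s - F t - (s - t) *\<^sub>R D) /\<^sub>R (s - t)"
        using s by (simp add: scaleR_diff_right)
      then have "norm ((F s - F t) /\<^sub>R (s - t) - D) = norm (F s - F t - (s - t) *\<^sub>R D) / \<bar>s - t\<bar>"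
        by (simp add: divide_inverse mult.commute)
      also have "\<dots> \<le> C * (s - t)\<^sup>2 / \<bar>s - t\<bar>" using assms[of s] s by (intro divide_right_mono) auto
      also have "\<dots> = C * \<bar>s - t\<bar>\<^sup>2 / \<bar>s - t\<bar>" by simp
      also have "\<dots> = C * \<bar>s - t\<bar>"
        using s by (simp only: power2_eq_square) (simp del: abs_mult_self_eq)
      finally show ?thesis .
    qed
    then show "\<forall>\<^sub>F s in at t. norm ((F s - F t) /\<^sub>R (s - t) - D) \<le> C * \<bar>s - t\<bar>"
      unfolding eventually_at dist_real_def by (intro exI[of _ 1]) auto
    have "((\<lambda>s. C * \<bar>s - t\<bar>) \<longlongrightarrow> C * \<bar>t - t\<bar>) (at t)" by (intro tendsto_intros)
    then show "((\<lambda>s. C * \<bar>s - t\<bar>) \<longlongrightarrow> 0) (at t)" by simp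
  qed
  then show ?thesis by (simp add: has_vector_derivative_iff_quotient LIM_zero_iff)
qed

text \<open>A quadratic remainder that is uniform on a common box gives differentiability both
  against a locally integrable u and in L^2. The two families it serves are the translates and the
  time sections of a test function.\<close>

lemma family_deriv:
  fixes G :: "real \<Rightarrow> point \<Rightarrow> real"
  assumes mG: "\<And>s. G s \<in> borel_measurable (RN N)" and mG': "G' \<in> borel_measurable (RN N)"
    and rem: "\<And>s x. \<bar>s - t\<bar> \<le> 1 \<Longrightarrow> x \<in> space (RN N) \<Longrightarrow> \<bar>G s x - G t x - (s - t) * G' x\<bar> \<le> M * (s - t)\<^sup>2"
    and van: "\<And>s x. \<bar>s - t\<bar> \<le> 1 \<Longrightarrow> x \<in> space (RN N) \<Longrightarrow> x \<notin> box_RN N R \<Longrightarrow> G s x = 0"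
    and van': "\<And>x. x \<in> space (RN N) \<Longrightarrow> x \<notin> box_RN N R \<Longrightarrow> G' x = 0"
    and bd: "\<And>s x. x \<in> space (RN N) \<Longrightarrow> \<bar>G s x\<bar> \<le> B" and bd': "\<And>x. x \<in> space (RN N) \<Longrightarrow> \<bar>G' x\<bar> \<le> B"
  shows "u \<in> L1_loc N \<Longrightarrow> ((\<lambda>s. LINT x|RN N. u x * G s x) has_real_derivative (LINT x|RN N. u x * G' x)) (at t)"
    and "((\<lambda>s. cls N (G s)) has_vector_derivative cls N G') (at t)"
proof -
  have t0: "\<bar>t - t\<bar> \<le> 1" by simp
  have mr: "(\<lambda>x. G s x - G t x - (s - t) * G' x) \<in> borel_measurable (RN N)" for s
    using mG mG' by (intro borel_measurable_diff borel_measurable_times) auto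
  {
    assume u: "u \<in> L1_loc N"
    define C where "C = (LINT x|RN N. indicator (box_RN N R) x * \<bar>u x\<bar>)"
    have iG: "integrable (RN N) (\<lambda>x. u x * G s x)" if "\<bar>s - t\<bar> \<le> 1" for s
      by (rule L1_loc_integrable(1)[OF u mG bd van[OF that]])
    have iG': "integrable (RN N) (\<lambda>x. u x * G' x)"
      by (rule L1_loc_integrable(1)[OF u mG' bd' van'])
    have "((\<lambda>s. LINT x|RN N. u x * G s x) has_vector_derivative (LINT x|RN N. u x * G' x)) (at t)"
    proof (rule quadratic_remainder_deriv)
      fix s assume s: "\<bar>s - t\<bar> \<le> 1"
      have "(LINT x|RN N. u x * G s x) - (LINT x|RN N. u x * G t x) - (s - t) * (LINT x|RN N. u x * G' x)
         = (LINT x|RN N. u x * G s x - u x * G t x - (s - t) * (u x * G' x))"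
        using iG[OF s] iG[OF t0] iG' by simp
      also have "\<dots> = (LINT x|RN N. u x * (G s x - G t x - (s - t) * G' x))"
        by (intro Bochner_Integration.integral_cong) (simp_all add: algebra_simps)
      also have "\<bar>\<dots>\<bar> \<le> M * (s - t)\<^sup>2 * C"
        unfolding C_def
        by (rule L1_loc_integrable(2)[OF u mr rem[OF s]]) (simp_all add: van[OF s] van[OF t0] van')
      finally show "norm ((LINT x|RN N. u x * G s x) - (LINT x|RN N. u x * G t x) - (s - t) *\<^sub>R (LINT x|RN N. u x * G' x))
        \<le> M * C * (s - t)\<^sup>2" by (simp add: mult_ac)
    qed
    then show "((\<lambda>s. LINT x|RN N. u x * G s x) has_real_derivative (LINT x|RN N. u x * G' x)) (at t)"
      by (simp add: has_real_derivative_iff_has_vector_derivative)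
  }
  have LG: "G s \<in> L2 N" if "\<bar>s - t\<bar> \<le> 1" for s by (rule bounded_box_L2(1)[OF mG bd van[OF that]])
  have LG': "G' \<in> L2 N" by (rule bounded_box_L2(1)[OF mG' bd' van'])
  show "((\<lambda>s. cls N (G s)) has_vector_derivative cls N G') (at t)"
  proof (rule quadratic_remainder_deriv)
    fix s assume s: "\<bar>s - t\<bar> \<le> 1"
    have L1: "(\<lambda>x. G s x - G t x) \<in> L2 N" "(\<lambda>x. (s - t) * G' x) \<in> L2 N"
      using sqint_diff[OF LG[OF s, unfolded L2_eq_sqint] LG[OF t0, unfolded L2_eq_sqint]]
        sqint_scale[OF LG'[unfolded L2_eq_sqint]] by (simp_all add: L2_eq_sqint)
    have "cls N (G s) - cls N (G t) - (s - t) *\<^sub>R cls N G' = cls N (\<lambda>x. G s x - G t x - (s - t) * G' x)"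
      by (simp add: cls_diff[OF L1] cls_diff[OF LG[OF s] LG[OF t0]] cls_scale[OF LG' LG'])
    also have "norm \<dots> = L2_norm N (\<lambda>x. G s x - G t x - (s - t) * G' x)"
      by (rule norm_cls) (use sqint_diff[OF L1[unfolded L2_eq_sqint]] in \<open>simp add: L2_eq_sqint\<close>)
    also have "\<dots> \<le> M * (s - t)\<^sup>2 * sqrt (measure (RN N) (box_RN N R))"
      by (rule bounded_box_L2(2)[OF mr rem[OF s]]) (simp_all add: van[OF s] van[OF t0] van')
    finally show "norm (cls N (G s) - cls N (G t) - (s - t) *\<^sub>R cls N G')
      \<le> M * sqrt (measure (RN N) (box_RN N R)) * (s - t)\<^sup>2" by (simp add: mult_ac)
  qed
qed

section \<open>Translates and time sections of test functions\<close>

lemma continuous_on_fun_upd: "continuous_on S (\<lambda>x::point. x(i := t))"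
proof (rule continuous_on_coordinatewise_then_product)
  show "continuous_on S (\<lambda>x. (x(i := t)) j)" for j
    by (cases "j = i") (simp_all add: continuous_on_subset[OF continuous_on_product_coordinates])
qed

lemma continuous_on_shift: "continuous_on S (shift i s N)"
proof (cases "i < N")
  case True
  have "continuous_on S (\<lambda>x::point. (x(i := x i + s)) j)" for j
    by (cases "j = i") (auto intro!: continuous_intros intro: continuous_on_subset[OF continuous_on_product_coordinates])
  then have "continuous_on S (\<lambda>x::point. x(i := x i + s))" by (rule continuous_on_coordinatewise_then_product)
  then show ?thesis using True by (simp add: shift_def[abs_def])
qed (simp add: shift_def[abs_def] continuous_on_id)

lemma deriv_shift_arg: "deriv (\<lambda>r. g (r + c)) a = deriv g (a + (c::real))"
  by (simp add: deriv_def DERIV_shift)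

lemma shift_upd: "i < N \<Longrightarrow> shift i s N (x(i := r)) = (shift i s N x)(i := r + s)"
  "i \<noteq> j \<Longrightarrow> shift i s N (x(j := r)) = (shift i s N x)(j := r)"
  "i \<noteq> j \<Longrightarrow> shift i s N x j = x j" "i < N \<Longrightarrow> shift i s N x i = x i + s"
  "\<not> i < N \<Longrightarrow> shift i s N x = x"
  by (auto simp: shift_def fun_upd_twist)

lemma partial_shift: "partial j (\<lambda>x. f (shift i s N x)) = (\<lambda>x. partial j f (shift i s N x))"
proof
  fix x
  consider "\<not> i < N" | "i \<noteq> j" | "i < N" "i = j" by blast
  then show "partial j (\<lambda>x. f (shift i s N x)) x = partial j f (shift i s N x)"
  proof cases
    case 3
    then show ?thesis
      using deriv_shift_arg[of "\<lambda>r. f ((shift i s N x)(i := r))" s "x i"] by (simp add: partial_def shift_upd)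
  qed (simp_all add: partial_def shift_upd)
qed

lemma partials_shift: "partials is (\<lambda>x. f (shift i s N x)) = (\<lambda>x. partials is f (shift i s N x))"
  by (induction "is") (simp_all add: partial_shift)

lemma test_fun_shift:
  assumes p: "\<psi> \<in> test_fun N"
  shows "(\<lambda>x. \<psi> (shift i s N x)) \<in> test_fun N"
proof -
  obtain R where R: "\<And>x. x \<in> space (RN N) \<Longrightarrow> x \<notin> box_RN N R \<Longrightarrow> \<psi> x = 0" and sm: "smooth N \<psi>"
    using p by (auto simp: test_fun_iff)
  have "continuous_on (space (RN N)) (\<lambda>x. partials is \<psi> (shift i s N x))" if "set is \<subseteq> {..<N}" for "is"
    by (rule continuous_on_compose2[OF _ continuous_on_shift]) (use sm that shift_space in \<open>auto simp: smooth_def\<close>)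
  moreover have "(\<lambda>r. partials is \<psi> (shift i s N (x(j := r)))) differentiable (at (x j))"
    if "is": "set is \<subseteq> {..<N}" and j: "j < N" and x: "x \<in> space (RN N)" for "is" j x
  proof -
    have sp: "smooth N (partials is \<psi>)" using test_fun_partials[OF p "is"] by (simp add: test_fun_iff)
    note D = smooth_DERIV[OF sp j shift_space[OF x, of i s]]
    show ?thesis
    proof (cases "i = j \<and> i < N")
      case True
      then show ?thesis using D[of "x j + s"]
        DERIV_shift[of "\<lambda>r. partials is \<psi> ((shift i s N x)(j := r))" _ "x j" s]
        by (auto simp: shift_upd real_differentiable_def)
    next
      case False
      then have "shift i s N (x(j := r)) = (shift i s N x)(j := r)" for r
        by (cases "i < N") (auto simp: shift_upd)
      then show ?thesis using D[of "x j"] by (auto simp: real_differentiable_def)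
    qed
  qed
  ultimately have "smooth N (\<lambda>x. \<psi> (shift i s N x))" by (simp add: smooth_def partials_shift)
  moreover have "\<psi> (shift i s N x) = 0" if x: "x \<in> space (RN N)" "x \<notin> box_RN N (R + \<bar>s\<bar>)" for x
  proof (rule R[OF shift_space[OF x(1)]])
    obtain j where j: "j < N" "\<bar>x j\<bar> > R + \<bar>s\<bar>" using x by (auto simp: mem_box_RN not_le)
    then have "\<bar>shift i s N x j\<bar> > R" by (auto simp: shift_def)
    then show "shift i s N x \<notin> box_RN N R" using j by (auto simp: mem_box_RN not_le)
  qed
  ultimately show ?thesis by (auto simp: test_fun_iff)
qed

lemma shift_deriv:
  assumes p: "\<psi> \<in> test_fun N" and i: "i < N"
  shows "u \<in> L1_loc N \<Longrightarrow> ((\<lambda>s. LINT x|RN N. u x * \<psi> (shift i s N x)) has_real_derivative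
      (LINT x|RN N. u x * partial i \<psi> (shift i t N x))) (at t)"
    and "((\<lambda>s. cls N (\<lambda>x. \<psi> (shift i s N x))) has_vector_derivative cls N (\<lambda>x. partial i \<psi> (shift i t N x))) (at t)"
proof -
  note p1 = test_fun_partial[OF p i] note p2 = test_fun_partial[OF p1 i]
  obtain B0 where B0: "\<And>x. x \<in> space (RN N) \<Longrightarrow> \<bar>\<psi> x\<bar> \<le> B0" using test_fun_bounded[OF p] by blast
  obtain B1 where B1: "\<And>x. x \<in> space (RN N) \<Longrightarrow> \<bar>partial i \<psi> x\<bar> \<le> B1" using test_fun_bounded[OF p1] by blast
  obtain M where M: "\<And>x. x \<in> space (RN N) \<Longrightarrow> \<bar>partial i (partial i \<psi>) x\<bar> \<le> M" using test_fun_bounded[OF p2] by blast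
  obtain R0 where R0: "\<And>x. x \<in> space (RN N) \<Longrightarrow> x \<notin> box_RN N R0 \<Longrightarrow> \<psi> x = 0"
    using p by (auto simp: test_fun_iff)
  obtain R1 where R1: "\<And>x. x \<in> space (RN N) \<Longrightarrow> x \<notin> box_RN N R1 \<Longrightarrow> partial i \<psi> x = 0"
    using p1 by (auto simp: test_fun_iff)
  \<comment> \<open>Large enough for the supports of all translates by s with |s - t| \<le>
    1.\<close>
  define R where "R = max R0 R1 + \<bar>t\<bar> + 1"
  have far: "shift i s N x \<notin> box_RN N R0 \<and> shift i s N x \<notin> box_RN N R1"
    if s: "\<bar>s - t\<bar> \<le> 1" and x: "x \<in> space (RN N)" "x \<notin> box_RN N R" for s x
  proof -
    obtain j where j: "j < N" "\<bar>x j\<bar> > R" using x by (auto simp: mem_box_RN not_le)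
    then have "\<bar>shift i s N x j\<bar> > max R0 R1" using s by (auto simp: shift_def R_def)
    then show ?thesis using j by (auto simp: mem_box_RN not_le)
  qed
  have rem: "\<bar>\<psi> (shift i s N x) - \<psi> (shift i t N x) - (s - t) * partial i \<psi> (shift i t N x)\<bar> \<le> M * (s - t)\<^sup>2"
    if x: "x \<in> space (RN N)" for s x
  proof -
    have sm: "smooth N \<psi>" "smooth N (partial i \<psi>)" using p p1 by (auto simp: test_fun_iff)
    have up: "x(i := r) \<in> space (RN N)" for r by (rule fun_upd_in_RN[OF x i])
    have "\<bar>(\<lambda>r. \<psi> (x(i := r))) (x i + s) - (\<lambda>r. \<psi> (x(i := r))) (x i + t)
      - ((x i + s) - (x i + t)) * (\<lambda>r. partial i \<psi> (x(i := r))) (x i + t)\<bar> \<le> M * ((x i + s) - (x i + t))\<^sup>2"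
      by (rule taylor2_bound[OF smooth_DERIV[OF sm(1) i x] smooth_DERIV[OF sm(2) i x] M[OF up]])
    then show ?thesis using i by (simp add: shift_def)
  qed
  note * = family_deriv[where G="\<lambda>s x. \<psi> (shift i s N x)" and G'="\<lambda>x. partial i \<psi> (shift i t N x)"
      and N=N and t=t and R=R and M=M and B="max B0 B1"]
  have c: "\<bar>\<psi> (shift i s N x)\<bar> \<le> max B0 B1" "\<bar>partial i \<psi> (shift i s N x)\<bar> \<le> max B0 B1"
    if "x \<in> space (RN N)" for x s
    using B0[OF shift_space[OF that]] B1[OF shift_space[OF that]] by (simp_all add: le_max_iff_disj)
  have m: "(\<lambda>x. \<psi> (shift i s N x)) \<in> borel_measurable (RN N)" "(\<lambda>x. partial i \<psi> (shift i s N x)) \<in> borel_measurable (RN N)" for s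
    by (intro test_fun_measurable test_fun_shift p p1)+
  have v: "\<psi> (shift i s N x) = 0" if "\<bar>s - t\<bar> \<le> 1" "x \<in> space (RN N)" "x \<notin> box_RN N R" for s x
    by (rule R0[OF shift_space[OF that(2)]]) (use far[OF that] in blast)
  have v': "partial i \<psi> (shift i t N x) = 0" if "x \<in> space (RN N)" "x \<notin> box_RN N R" for x
    by (rule R1[OF shift_space[OF that(1)]]) (use far[of t x] that in simp)
  show "u \<in> L1_loc N \<Longrightarrow> ((\<lambda>s. LINT x|RN N. u x * \<psi> (shift i s N x)) has_real_derivative
      (LINT x|RN N. u x * partial i \<psi> (shift i t N x))) (at t)"
    by (rule *(1)[OF m rem v v' c])
  show "((\<lambda>s. cls N (\<lambda>x. \<psi> (shift i s N x))) has_vector_derivative cls N (\<lambda>x. partial i \<psi> (shift i t N x))) (at t)"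
    by (rule *(2)[OF m rem v v' c])
qed

lemma fun_upd_Suc_RN: "x \<in> space (RN N) \<Longrightarrow> x(N := t) \<in> space (RN (Suc N))"
  by (auto simp: space_RN extensional_def)

lemma partials_section:
  assumes "set is \<subseteq> {..<N}"
  shows "partials is (\<lambda>x. \<zeta> (x(N := t))) = (\<lambda>x. partials is \<zeta> (x(N := t)))"
  using assms
proof (induction "is")
  case (Cons i "is")
  then have "i \<noteq> N" by auto
  then have "(x(i := s))(N := t) = (x(N := t))(i := s)" for x :: point and s
    by (rule fun_upd_twist)
  note tw = this
  have IH: "partials is (\<lambda>x. \<zeta> (x(N := t))) = (\<lambda>x. partials is \<zeta> (x(N := t)))" 
    by (rule Cons.IH) (use Cons.prems in auto)
  show ?case unfolding partials.simps IH partial_def tw using \<open>i \<noteq> N\<close> by simp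
qed simp

lemma test_fun_section:
  assumes z: "\<zeta> \<in> test_fun (Suc N)"
  shows "(\<lambda>x. \<zeta> (x(N := t))) \<in> test_fun N"
proof -
  obtain R where R: "\<And>x. x \<in> space (RN (Suc N)) \<Longrightarrow> x \<notin> box_RN (Suc N) R \<Longrightarrow> \<zeta> x = 0" and sm: "smooth (Suc N) \<zeta>"
    using z by (auto simp: test_fun_iff)
  have sub: "set is \<subseteq> {..<Suc N}" if "set is \<subseteq> {..<N}" for "is" :: "nat list" using that by auto
  have "continuous_on (space (RN N)) (\<lambda>x. partials is \<zeta> (x(N := t)))" if "set is \<subseteq> {..<N}" for "is"
    by (rule continuous_on_compose2[OF _ continuous_on_fun_upd])
      (use sm sub[OF that] fun_upd_Suc_RN in \<open>auto simp: smooth_def\<close>)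
  moreover have "(\<lambda>r. partials is \<zeta> ((x(j := r))(N := t))) differentiable (at (x j))"
    if "is": "set is \<subseteq> {..<N}" and j: "j < N" and x: "x \<in> space (RN N)" for "is" j x
  proof -
    have "smooth (Suc N) (partials is \<zeta>)" using test_fun_partials[OF z sub[OF "is"]] by (simp add: test_fun_iff)
    from smooth_DERIV[OF this _ fun_upd_Suc_RN[OF x], of j t "x j"] j show ?thesis
      by (auto simp: real_differentiable_def fun_upd_twist)
  qed
  ultimately have "smooth N (\<lambda>x. \<zeta> (x(N := t)))" by (simp add: smooth_def partials_section)
  moreover have "\<zeta> (x(N := t)) = 0" if x: "x \<in> space (RN N)" "x \<notin> box_RN N R" for x
  proof (rule R[OF fun_upd_Suc_RN[OF x(1)]])
    obtain j where j: "j < N" "\<bar>x j\<bar> > R" using x by (auto simp: mem_box_RN not_le)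
    then have "\<bar>(x(N := t)) j\<bar> > R" by simp
    then show "x(N := t) \<notin> box_RN (Suc N) R" using j by (auto simp: mem_box_RN not_le simp del: fun_upd_apply intro: exI[of _ j])
  qed
  ultimately show ?thesis by (auto simp: test_fun_iff)
qed

text \<open>As for translates, but here the box is independent of t: a spatial coordinate that is
  too large stays too large at every time.\<close>

lemma section_deriv:
  assumes p: "\<zeta> \<in> test_fun (Suc N)"
  shows "u \<in> L1_loc N \<Longrightarrow> ((\<lambda>s. LINT x|RN N. u x * \<zeta> (x(N := s))) has_real_derivative
      (LINT x|RN N. u x * partial N \<zeta> (x(N := t)))) (at t)"
    and "((\<lambda>s. cls N (\<lambda>x. \<zeta> (x(N := s)))) has_vector_derivative cls N (\<lambda>x. partial N \<zeta> (x(N := t)))) (at t)"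
proof -
  note p1 = test_fun_partial[OF p lessI] note p2 = test_fun_partial[OF p1 lessI]
  obtain B0 where B0: "\<And>x. x \<in> space (RN (Suc N)) \<Longrightarrow> \<bar>\<zeta> x\<bar> \<le> B0" using test_fun_bounded[OF p] by blast
  obtain B1 where B1: "\<And>x. x \<in> space (RN (Suc N)) \<Longrightarrow> \<bar>partial N \<zeta> x\<bar> \<le> B1" using test_fun_bounded[OF p1] by blast
  obtain M where M: "\<And>x. x \<in> space (RN (Suc N)) \<Longrightarrow> \<bar>partial N (partial N \<zeta>) x\<bar> \<le> M" using test_fun_bounded[OF p2] by blast
  obtain R0 where R0: "\<And>x. x \<in> space (RN (Suc N)) \<Longrightarrow> x \<notin> box_RN (Suc N) R0 \<Longrightarrow> \<zeta> x = 0"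
    using p by (auto simp: test_fun_iff)
  obtain R1 where R1: "\<And>x. x \<in> space (RN (Suc N)) \<Longrightarrow> x \<notin> box_RN (Suc N) R1 \<Longrightarrow> partial N \<zeta> x = 0"
    using p1 by (auto simp: test_fun_iff)
  define R where "R = max R0 R1"
  have far: "x(N := s) \<notin> box_RN (Suc N) R0 \<and> x(N := s) \<notin> box_RN (Suc N) R1"
    if x: "x \<in> space (RN N)" "x \<notin> box_RN N R" for s x
  proof -
    obtain j where j: "j < N" "\<bar>x j\<bar> > R" using x by (auto simp: mem_box_RN not_le)
    then have "\<bar>(x(N := s)) j\<bar> > max R0 R1" by (auto simp: R_def)
    then show ?thesis using j by (auto simp: mem_box_RN not_le simp del: fun_upd_apply intro!: exI[of _ j])
  qed
  have rem: "\<bar>\<zeta> (x(N := s)) - \<zeta> (x(N := t)) - (s - t) * partial N \<zeta> (x(N := t))\<bar> \<le> M * (s - t)\<^sup>2"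
    if x: "x \<in> space (RN N)" for s x
  proof -
    have sm: "smooth (Suc N) \<zeta>" "smooth (Suc N) (partial N \<zeta>)" using p p1 by (auto simp: test_fun_iff)
    have d: "((\<lambda>r. f (x(N := r))) has_real_derivative partial N f (x(N := r))) (at r)" if "smooth (Suc N) f" for f r
      using smooth_DERIV[OF that lessI fun_upd_Suc_RN[OF x, of 0], of r] by simp
    show ?thesis by (rule taylor2_bound[OF d[OF sm(1)] d[OF sm(2)] M[OF fun_upd_Suc_RN[OF x]]])
  qed
  note * = family_deriv[where G="\<lambda>s x. \<zeta> (x(N := s))" and G'="\<lambda>x. partial N \<zeta> (x(N := t))"
      and N=N and t=t and R=R and M=M and B="max B0 B1"]
  have c: "\<bar>\<zeta> (x(N := s))\<bar> \<le> max B0 B1" "\<bar>partial N \<zeta> (x(N := s))\<bar> \<le> max B0 B1"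
    if "x \<in> space (RN N)" for x s
    using B0[OF fun_upd_Suc_RN[OF that]] B1[OF fun_upd_Suc_RN[OF that]] by (simp_all add: le_max_iff_disj)
  have m: "(\<lambda>x. \<zeta> (x(N := s))) \<in> borel_measurable (RN N)" "(\<lambda>x. partial N \<zeta> (x(N := s))) \<in> borel_measurable (RN N)" for s
    by (intro test_fun_measurable test_fun_section p p1)+
  have v: "\<zeta> (x(N := s)) = 0" "partial N \<zeta> (x(N := s)) = 0" if "x \<in> space (RN N)" "x \<notin> box_RN N R" for s x
    using R0[OF fun_upd_Suc_RN[OF that(1)], of s] R1[OF fun_upd_Suc_RN[OF that(1)], of s] far[OF that, of s] by auto
  show "u \<in> L1_loc N \<Longrightarrow> ((\<lambda>s. LINT x|RN N. u x * \<zeta> (x(N := s))) has_real_derivative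
      (LINT x|RN N. u x * partial N \<zeta> (x(N := t)))) (at t)"
    by (rule *(1)[OF m rem v c])
  show "((\<lambda>s. cls N (\<lambda>x. \<zeta> (x(N := s)))) has_vector_derivative cls N (\<lambda>x. partial N \<zeta> (x(N := t)))) (at t)"
    by (rule *(2)[OF m rem v c])
qed

section \<open>Smooth bump functions of one variable\<close>

primrec Ck :: "nat \<Rightarrow> (real \<Rightarrow> real) \<Rightarrow> bool" where
  "Ck 0 f = True"
| "Ck (Suc k) f = (\<exists>f'. (\<forall>x. (f has_real_derivative f' x) (at x)) \<and> Ck k f')"

definition smooth1 :: "(real \<Rightarrow> real) \<Rightarrow> bool" where
  "smooth1 f \<longleftrightarrow> (\<forall>k. Ck k f)"

lemma Ck_Suc_imp: "Ck (Suc k) f \<Longrightarrow> Ck k f"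
  by (induction k arbitrary: f) auto

lemma Ck_add: "Ck k f \<Longrightarrow> Ck k g \<Longrightarrow> Ck k (\<lambda>x. f x + g x)"
proof (induction k arbitrary: f g)
  case (Suc k)
  then obtain f' g' where "\<And>x. (f has_real_derivative f' x) (at x)" "Ck k f'"
    "\<And>x. (g has_real_derivative g' x) (at x)" "Ck k g'" by auto
  with Suc.IH show ?case by (auto intro!: exI[of _ "\<lambda>x. f' x + g' x"] derivative_intros)
qed simp

lemma Ck_mult: "Ck k f \<Longrightarrow> Ck k g \<Longrightarrow> Ck k (\<lambda>x. f x * g x)"
proof (induction k arbitrary: f g)
  case (Suc k)
  then obtain f' g' where d: "\<And>x. (f has_real_derivative f' x) (at x)" "Ck k f'"
    "\<And>x. (g has_real_derivative g' x) (at x)" "Ck k g'" by auto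
  have "Ck k (\<lambda>x. f' x * g x + g' x * f x)"
    by (intro Ck_add Suc.IH d Ck_Suc_imp[OF Suc.prems(1)] Ck_Suc_imp[OF Suc.prems(2)])
  moreover have "((\<lambda>x. f x * g x) has_real_derivative f' x * g x + g' x * f x) (at x)" for x
    by (rule DERIV_mult[OF d(1) d(3)])
  ultimately show ?case unfolding Ck.simps by (intro exI[of _ "\<lambda>x. f' x * g x + g' x * f x"]) simp
qed simp

lemma Ck_const: "Ck k (\<lambda>x. c)"
proof (induction k arbitrary: c)
  case (Suc k)
  from Suc[of 0] show ?case unfolding Ck.simps by (intro exI[of _ "\<lambda>x. 0"]) simp
qed simp

lemma Ck_affine: "Ck k f \<Longrightarrow> Ck k (\<lambda>x. f (a * x + b))"
proof (induction k arbitrary: f)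
  case (Suc k)
  then obtain f' where d: "\<And>x. (f has_real_derivative f' x) (at x)" "Ck k f'" by auto
  have "((\<lambda>x. f (a * x + b)) has_real_derivative f' (a * x + b) * a) (at x)" for x
    by (rule DERIV_chain2[OF d(1)]) (auto intro!: derivative_eq_intros)
  moreover have "Ck k (\<lambda>x. f' (a * x + b) * a)" by (intro Ck_mult Ck_const Suc.IH d)
  ultimately show ?case unfolding Ck.simps by (intro exI[of _ "\<lambda>x. f' (a * x + b) * a"]) simp
qed simp

lemma smooth1_DERIV: "smooth1 f \<Longrightarrow> (f has_real_derivative deriv f x) (at x)"
proof -
  assume "smooth1 f"
  then have "Ck (Suc 0) f" unfolding smooth1_def by blast
  then obtain f' where "\<And>x. (f has_real_derivative f' x) (at x)" by auto
  from DERIV_imp_deriv[OF this] this show ?thesis by simp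
qed

lemma smooth1_deriv: "smooth1 f \<Longrightarrow> smooth1 (deriv f)"
  unfolding smooth1_def
proof
  fix k assume "\<forall>k. Ck k f"
  then have "Ck (Suc k) f" by blast
  then obtain f' where f': "\<And>x. (f has_real_derivative f' x) (at x)" "Ck k f'" by auto
  have "deriv f = f'" using DERIV_imp_deriv[OF f'(1)] by (simp add: fun_eq_iff)
  then show "Ck k (deriv f)" using f'(2) by simp
qed

lemma smooth1_primitive: "smooth1 f' \<Longrightarrow> (\<And>x. (f has_real_derivative f' x) (at x)) \<Longrightarrow> smooth1 f"
  unfolding smooth1_def by (metis Ck.simps not0_implies_Suc)

lemma smooth1_mult: "smooth1 f \<Longrightarrow> smooth1 g \<Longrightarrow> smooth1 (\<lambda>x. f x * g x)"
  by (simp add: smooth1_def Ck_mult)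

lemma smooth1_add: "smooth1 f \<Longrightarrow> smooth1 g \<Longrightarrow> smooth1 (\<lambda>x. f x + g x)"
  by (simp add: smooth1_def Ck_add)

lemma smooth1_affine: "smooth1 f \<Longrightarrow> smooth1 (\<lambda>x. f (a * x + b))"
  by (simp add: smooth1_def Ck_affine)

lemma smooth1_const: "smooth1 (\<lambda>x. c)"
  by (simp add: smooth1_def Ck_const)

text \<open>Polynomials in 1 / s times exp (- 1 / s), cut off at 0: a class closed under
  differentiation, which makes smoothness a plain induction.\<close>

definition flat :: "real poly \<Rightarrow> real \<Rightarrow> real" where
  "flat q s = (if 0 < s then poly q (1 / s) * exp (- (1 / s)) else 0)"

lemma flat_tendsto_0:
  fixes q :: "real poly"
  shows "((\<lambda>s. poly q (1 / s) * exp (- (1 / s))) \<longlongrightarrow> 0) (at_right 0)"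
proof -
  have "((\<lambda>y::real. \<Sum>i\<le>degree q. coeff q i * (y ^ i / exp y)) \<longlongrightarrow> (\<Sum>i\<le>degree q. coeff q i * 0)) at_top"
    by (intro tendsto_sum tendsto_mult tendsto_const) (rule tendsto_power_div_exp_0)
  moreover have "(\<Sum>i\<le>degree q. coeff q i * (y ^ i / exp y)) = poly q y * exp (- y)" for y :: real
    by (simp add: poly_altdef sum_distrib_right exp_minus divide_inverse mult.assoc)
  ultimately have *: "((\<lambda>y. poly q y * exp (- y)) \<longlongrightarrow> 0) at_top" by simp
  have "filterlim (\<lambda>s::real. 1 / s) at_top (at_right 0)"
    using filterlim_inverse_at_top_right by (simp add: inverse_eq_divide)
  from filterlim_compose[OF * this] show ?thesis .
qed

text \<open>With y = 1 / s the chain rule produces the polynomial y^2 (q - q'). At 0 the right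
  quotient flat q h / h is again of this kind, with the polynomial y q, and tends to 0.\<close>

lemma flat_DERIV: "(flat q has_real_derivative flat ([:0, 0, 1:] * (q - pderiv q)) s) (at s)"
proof -
  consider "s > 0" | "s < 0" | "s = 0" by linarith
  then show ?thesis
  proof cases
    case 1
    have "((\<lambda>s. poly q (1 / s) * exp (- (1 / s))) has_real_derivative flat ([:0, 0, 1:] * (q - pderiv q)) s) (at s)"
      unfolding flat_def using 1
      by (auto intro!: derivative_eq_intros DERIV_chain2[OF poly_DERIV] simp: field_simps power2_eq_square)
    then show ?thesis
      by (rule has_field_derivative_transform_within_open[of _ _ _ "{0<..}"]) (use 1 in \<open>auto simp: flat_def\<close>)
  next
    case 2
    have "((\<lambda>s. 0) has_real_derivative flat ([:0, 0, 1:] * (q - pderiv q)) s) (at s)"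
      using 2 by (simp add: flat_def)
    then show ?thesis
      by (rule has_field_derivative_transform_within_open[of _ _ _ "{..<0}"]) (use 2 in \<open>auto simp: flat_def\<close>)
  next
    case 3
    have "((\<lambda>h. flat q h / h) \<longlongrightarrow> 0) (at_right 0)"
    proof (rule Lim_transform_eventually[OF flat_tendsto_0[of "[:0, 1:] * q"]])
      show "\<forall>\<^sub>F s in at_right 0. poly ([:0, 1:] * q) (1 / s) * exp (- (1 / s)) = flat q s / s"
        by (auto simp: eventually_at_filter flat_def)
    qed
    moreover have "((\<lambda>h. flat q h / h) \<longlongrightarrow> 0) (at_left 0)"
      by (rule Lim_transform_eventually[OF tendsto_const]) (auto simp: eventually_at_filter flat_def)
    ultimately have "((\<lambda>h. flat q h / h) \<longlongrightarrow> 0) (at 0)" by (simp add: filterlim_at_split)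
    then show ?thesis using 3 by (simp add: DERIV_def flat_def)
  qed
qed

lemma smooth1_flat: "smooth1 (flat q)"
proof -
  have "Ck k (flat q)" for k by (induction k arbitrary: q) (use flat_DERIV in auto)
  then show ?thesis by (simp add: smooth1_def)
qed

text \<open>The first factor cuts off at a, the second at b. For large k both factors approach 1
  inside, so the bumps converge to the indicator of the open interval.\<close>

definition bump :: "real \<Rightarrow> real \<Rightarrow> real \<Rightarrow> real \<Rightarrow> real" where
  "bump k a b s = flat 1 (k * s + - k * a) * flat 1 (- k * s + k * b)"

lemma smooth1_bump: "smooth1 (bump k a b)"
  unfolding bump_def[abs_def] by (intro smooth1_mult smooth1_affine smooth1_flat)

lemma flat_1_bounds: "0 \<le> flat 1 s" "flat 1 s \<le> 1"
  by (auto simp: flat_def)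

lemma bump_bounds: "0 \<le> bump k a b s" "bump k a b s \<le> 1"
  by (simp_all add: bump_def flat_1_bounds mult_le_one)

lemma bump_outside: "k > 0 \<Longrightarrow> s \<notin> {a<..<b} \<Longrightarrow> bump k a b s = 0"
  using mult_left_mono[of s a k] mult_left_mono[of b s k] by (auto simp: bump_def flat_def not_less)

lemma bump_tendsto: "(\<lambda>n. bump (real (Suc n)) a b s) \<longlonglongrightarrow> indicator {a<..<b} s"
proof (cases "s \<in> {a<..<b}")
  case True
  have *: "(\<lambda>n. flat 1 (real (Suc n) * c)) \<longlonglongrightarrow> 1" if "c > 0" for c
  proof -
    have "(\<lambda>n. exp (- (1 / c * (1 / real (Suc n))))) \<longlonglongrightarrow> exp (- (1 / c * 0))"
      using LIMSEQ_inverse_real_of_nat by (intro tendsto_intros) (simp add: inverse_eq_divide)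
    then show ?thesis using that by (simp add: flat_def mult.commute)
  qed
  have "(\<lambda>n. flat 1 (real (Suc n) * (s - a)) * flat 1 (real (Suc n) * (b - s))) \<longlonglongrightarrow> 1 * 1"
    using True by (intro tendsto_mult *) auto
  then show ?thesis using True by (simp add: bump_def algebra_simps)
next
  case False
  then show ?thesis by (simp add: bump_outside)
qed

section \<open>Tensor products of test functions\<close>

text \<open>\<open>restrict\<close> is needed because the first N coordinates form a point of R^N
  only as an extensional function.\<close>

definition tens :: "nat \<Rightarrow> (point \<Rightarrow> real) \<Rightarrow> (real \<Rightarrow> real) \<Rightarrow> point \<Rightarrow> real" where
  "tens N \<psi> \<theta> y = \<psi> (restrict y {..<N}) * \<theta> (y N)"

lemma restrict_in_RN: "restrict y {..<N} \<in> space (RN N)"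
  by (simp add: space_RN)

lemma tens_section: "x \<in> space (RN N) \<Longrightarrow> tens N \<psi> \<theta> (x(N := t)) = \<psi> x * \<theta> t"
proof -
  assume x: "x \<in> space (RN N)"
  have "restrict (x(N := t)) {..<N} = x" using x by (auto simp: space_RN extensional_def restrict_def fun_eq_iff)
  then show ?thesis by (simp add: tens_def)
qed

lemma restrict_upd:
  fixes y :: point
  shows "j < N \<Longrightarrow> restrict (y(j := s)) {..<N} = (restrict y {..<N})(j := s)"
  "restrict (y(N := s)) {..<N} = restrict y {..<N}"
  by (auto simp: restrict_def fun_eq_iff)

lemma partial_tens:
  assumes "smooth N \<psi>" "smooth1 \<theta>"
  shows "j < N \<Longrightarrow> partial j (tens N \<psi> \<theta>) = tens N (partial j \<psi>) \<theta>"
    and "partial N (tens N \<psi> \<theta>) = tens N \<psi> (deriv \<theta>)"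
    and "j < N \<Longrightarrow> ((\<lambda>s. tens N \<psi> \<theta> (y(j := s))) has_real_derivative tens N (partial j \<psi>) \<theta> (y(j := s))) (at s)"
    and "((\<lambda>s. tens N \<psi> \<theta> (y(N := s))) has_real_derivative tens N \<psi> (deriv \<theta>) (y(N := s))) (at s)"
proof -
  show d1: "((\<lambda>s. tens N \<psi> \<theta> (y(j := s))) has_real_derivative tens N (partial j \<psi>) \<theta> (y(j := s))) (at s)"
    if j: "j < N" for y j s
    using DERIV_cmult_right[OF smooth_DERIV[OF assms(1) j restrict_in_RN[of y]], where c="\<theta> (y N)"] j less_imp_neq[OF j]
    by (simp add: tens_def restrict_upd)
  show d2: "((\<lambda>s. tens N \<psi> \<theta> (y(N := s))) has_real_derivative tens N \<psi> (deriv \<theta>) (y(N := s))) (at s)" for y s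
    using DERIV_cmult[OF smooth1_DERIV[OF assms(2)], of "\<psi> (restrict y {..<N})" s]
    by (simp add: tens_def restrict_upd)
  show "partial j (tens N \<psi> \<theta>) = tens N (partial j \<psi>) \<theta>" if "j < N" for j
    using DERIV_imp_deriv[OF d1[OF that]] by (auto simp: partial_def fun_eq_iff)
  show "partial N (tens N \<psi> \<theta>) = tens N \<psi> (deriv \<theta>)"
    using DERIV_imp_deriv[OF d2] by (auto simp: partial_def fun_eq_iff)
qed

text \<open>The invariant behind \<open>smooth_tens\<close>: every iterated partial derivative is
  again a tensor product, so only first derivatives of tensor products have to be computed.\<close>

lemma partials_tens:
  assumes "smooth N \<psi>" "smooth1 \<theta>" "set is \<subseteq> {..<Suc N}"
  shows "\<exists>\<psi>' \<theta>'. smooth N \<psi>' \<and> smooth1 \<theta>' \<and> partials is (tens N \<psi> \<theta>) = tens N \<psi>' \<theta>'"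
  using assms(3)
proof (induction "is")
  case Nil
  then show ?case using assms by auto
next
  case (Cons i "is")
  then obtain \<psi>' \<theta>' where *: "smooth N \<psi>'" "smooth1 \<theta>'" "partials is (tens N \<psi> \<theta>) = tens N \<psi>' \<theta>'" by auto
  show ?case
  proof (cases "i < N")
    case True
    then show ?thesis using * partial_tens(1)[OF *(1,2)] smooth_partial[OF *(1)] by auto
  next
    case False
    then have "i = N" using Cons by auto
    then show ?thesis using * partial_tens(2)[OF *(1,2)] smooth1_deriv[OF *(2)] by auto
  qed
qed

lemma smooth_tens:
  assumes "smooth N \<psi>" "smooth1 \<theta>"
  shows "smooth (Suc N) (tens N \<psi> \<theta>)"
  unfolding smooth_def
proof (intro allI impI conjI ballI)
  fix "is" assume "is": "set is \<subseteq> {..<Suc N}"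
  obtain \<psi>' \<theta>' where *: "smooth N \<psi>'" "smooth1 \<theta>'" "partials is (tens N \<psi> \<theta>) = tens N \<psi>' \<theta>'"
    using partials_tens[OF assms "is"] by blast
  have cr: "continuous_on S (\<lambda>y::point. restrict y {..<N})" for S
  proof (rule continuous_on_coordinatewise_then_product)
    show "continuous_on S (\<lambda>y. restrict y {..<N} j)" for j
      by (cases "j < N") (simp_all add: continuous_on_subset[OF continuous_on_product_coordinates])
  qed
  have ct: "continuous_on S (\<lambda>y::point. \<theta>' (y N))" for S
  proof (rule continuous_on_compose2[where t=UNIV and g=\<theta>'])
    show "continuous_on UNIV \<theta>'"
      by (rule continuous_at_imp_continuous_on) (simp add: DERIV_isCont[OF smooth1_DERIV[OF *(2)]])
    show "continuous_on S (\<lambda>y::point. y N)" by (rule continuous_on_subset[OF continuous_on_product_coordinates]) simp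
  qed simp
  show "continuous_on (space (RN (Suc N))) (partials is (tens N \<psi> \<theta>))"
    unfolding *(3) unfolding tens_def[abs_def]
    by (intro continuous_on_mult ct continuous_on_compose2[OF smooth_continuous[OF *(1)] cr]) (auto simp: restrict_in_RN)
  fix i x assume "i < Suc N"
  then show "(\<lambda>s. partials is (tens N \<psi> \<theta>) (x(i := s))) differentiable (at (x i))"
    unfolding *(3) real_differentiable_def
    using partial_tens(3)[OF *(1,2), of i x "x i"] partial_tens(4)[OF *(1,2), of x "x i"]
    by (cases "i < N") (auto simp only: less_Suc_eq)
qed

lemma test_fun_tens:
  assumes p: "\<psi> \<in> test_fun N" and t: "smooth1 \<theta>" "\<And>s. \<bar>s\<bar> > S \<Longrightarrow> \<theta> s = 0"
  shows "tens N \<psi> \<theta> \<in> test_fun (Suc N)"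
proof -
  obtain R where R: "\<And>x. x \<in> space (RN N) \<Longrightarrow> x \<notin> box_RN N R \<Longrightarrow> \<psi> x = 0"
    using p by (auto simp: test_fun_iff)
  have "tens N \<psi> \<theta> y = 0" if y: "y \<in> space (RN (Suc N))" "y \<notin> box_RN (Suc N) (max R S)" for y
  proof -
    obtain j where j: "j < Suc N" "\<bar>y j\<bar> > max R S" using y by (auto simp: mem_box_RN not_le)
    show ?thesis
    proof (cases "j = N")
      case True
      then show ?thesis using j t(2)[of "y N"] by (simp add: tens_def)
    next
      case False
      then have "restrict y {..<N} \<notin> box_RN N R" using j by (auto simp: mem_box_RN not_le intro!: exI[of _ j])
      then show ?thesis by (simp add: tens_def R[OF restrict_in_RN])
    qed
  qed
  then show ?thesis using p t(1) by (auto simp: test_fun_iff intro!: smooth_tens)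
qed

primrec tensor :: "nat \<Rightarrow> (nat \<Rightarrow> real \<Rightarrow> real) \<Rightarrow> point \<Rightarrow> real" where
  "tensor 0 \<beta> = (\<lambda>_. 1)"
| "tensor (Suc n) \<beta> = tens n (tensor n \<beta>) (\<beta> n)"

lemma tensor_eq: "tensor n \<beta> y = (\<Prod>i<n. \<beta> i (y i))"
  by (induction n arbitrary: y) (simp_all add: tens_def)

lemma smooth_const_0: "smooth 0 (\<lambda>_. c)"
  by (simp add: smooth_def)

lemma test_fun_tensor:
  assumes "\<And>i. smooth1 (\<beta> i)" "\<And>i s. \<bar>s\<bar> > S i \<Longrightarrow> \<beta> i s = 0"
  shows "tensor n \<beta> \<in> test_fun n"
proof (induction n)
  case 0
  have "x \<in> box_RN 0 0" if "x \<in> space (RN 0)" for x using that by (simp add: mem_box_RN)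
  then show ?case by (auto simp: test_fun_iff smooth_const_0)
next
  case (Suc n)
  then show ?case using test_fun_tens[OF Suc assms(1) assms(2)] by simp
qed

section \<open>The fundamental lemma\<close>

text \<open>Open boxes are used because their indicators are limits of tensor bumps and because they
  form an intersection-stable generator of the sigma-algebra.\<close>

definition open_boxes :: "nat \<Rightarrow> point set set" where
  "open_boxes N = {PiE {..<N} (\<lambda>i. {a i<..<b i}) | a b :: nat \<Rightarrow> real. True}"

lemma open_boxesI: "PiE {..<N} (\<lambda>i. {a i<..<b i}) \<in> open_boxes N"
  unfolding open_boxes_def by blast

lemma sets_RN_open_boxes: "sets (RN N) = sigma_sets (space (RN N)) (open_boxes N)"
proof -
  let ?E = "range (\<lambda>(a, b). {a<..<b::real})"
  let ?P = "{{f \<in> PiE {..<N} (\<lambda>_. UNIV). \<forall>i\<in>j. f i \<in> A i} | A j. j \<in> {{..<N}} \<and> A \<in> Pi j (\<lambda>_. ?E)}"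
  have bs: "sets borel = sets (sigma UNIV ?E)"
  proof -
    have "(\<lambda>(a, b). box a b) = (\<lambda>(a, b). {a<..<b::real})" by (auto simp: fun_eq_iff)
    then show ?thesis using borel_eq_box[where 'a=real] by simp
  qed
  have "sets (RN N) = sets (PiM {..<N} (\<lambda>_. sigma UNIV ?E))"
    unfolding RN_def by (intro sets_PiM_cong refl) (simp only: sets_lborel bs)
  also have "\<dots> = sets (sigma (PiE {..<N} (\<lambda>_. UNIV)) ?P)"
  proof (rule sets_PiM_sigma)
    have "UNIV = (\<Union>n::nat. {-real n<..<real n})"
    proof safe
      fix x :: real
      obtain n :: nat where "\<bar>x\<bar> < n" using reals_Archimedean2 by blast
      then show "x \<in> (\<Union>n::nat. {-real n<..<real n})" by (auto intro!: exI[of _ n])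
    qed auto
    then show "\<exists>S\<subseteq>?E. countable S \<and> UNIV = \<Union>S"
      by (intro exI[of _ "range (\<lambda>n::nat. {-real n<..<real n})"]) auto
  qed auto
  also have "?P = open_boxes N"
  proof (intro set_eqI iffI)
    fix X assume "X \<in> ?P"
    then obtain A j where "X = {f \<in> PiE {..<N} (\<lambda>_. UNIV). \<forall>i\<in>j. f i \<in> A i}" and "j \<in> {{..<N}}" and A': "A \<in> Pi j (\<lambda>_. ?E)"
      unfolding mem_Collect_eq by (elim exE conjE)
    then have X: "X = {f \<in> PiE {..<N} (\<lambda>_. UNIV). \<forall>i\<in>{..<N}. f i \<in> A i}" and A: "A \<in> Pi {..<N} (\<lambda>_. ?E)"
      by simp_all
    have "\<forall>i. \<exists>a b. i < N \<longrightarrow> A i = {a<..<b}" using A by (fastforce simp: Pi_iff)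
    then obtain a b where ab: "\<And>i. i < N \<Longrightarrow> A i = {a i<..<b i}" by metis
    have "X = PiE {..<N} A" unfolding X PiE_iff PiE_def Pi_def by blast
    also have "\<dots> = PiE {..<N} (\<lambda>i. {a i<..<b i})" by (rule PiE_cong) (simp add: ab)
    finally have "X = PiE {..<N} (\<lambda>i. {a i<..<b i})" .
    then show "X \<in> open_boxes N" by (auto simp: open_boxes_def)
  next
    fix X assume "X \<in> open_boxes N"
    then obtain a b where X: "X = PiE {..<N} (\<lambda>i. {a i<..<b i})" by (auto simp: open_boxes_def)
    have 1: "X = {f \<in> PiE {..<N} (\<lambda>_. UNIV). \<forall>i\<in>{..<N}. f i \<in> {a i<..<b i}}"
      unfolding X PiE_def Pi_def by blast
    have 2: "(\<lambda>i. {a i<..<b i}) \<in> Pi {..<N} (\<lambda>_. ?E)" by auto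
    show "X \<in> ?P"
      unfolding mem_Collect_eq
      by (rule exI[of _ "\<lambda>i. {a i<..<b i}"], rule exI[of _ "{..<N}"]) (intro conjI 1 2 singletonI)
  qed
  also have "sets (sigma (PiE {..<N} (\<lambda>_. UNIV)) (open_boxes N)) = sigma_sets (space (RN N)) (open_boxes N)"
    by (subst sets_measure_of) (auto simp: open_boxes_def RN_def space_PiM PiE_iff)
  finally show ?thesis .
qed

lemma open_boxes_sets: "X \<in> open_boxes N \<Longrightarrow> X \<in> sets (RN N)"
  unfolding sets_RN_open_boxes by (rule sigma_sets.Basic)

lemma open_box_bounded:
  "\<exists>R. PiE {..<N} (\<lambda>i. {a i<..<b i}) \<subseteq> box_RN N R \<and> (\<forall>i<N. \<bar>a i\<bar> \<le> R \<and> \<bar>b i\<bar> \<le> R)"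
proof -
  define R where "R = (\<Sum>i<N. \<bar>a i\<bar> + \<bar>b i\<bar>)"
  have R: "\<bar>a i\<bar> + \<bar>b i\<bar> \<le> R" if "i < N" for i
    unfolding R_def by (rule member_le_sum) (use that in auto)
  have "\<bar>x\<bar> \<le> R" if "i < N" "x \<in> {a i<..<b i}" for x i
    using R[OF that(1)] that(2) by (auto simp: abs_le_iff)
  then have "PiE {..<N} (\<lambda>i. {a i<..<b i}) \<subseteq> box_RN N R"
    by (auto simp: mem_box_RN space_RN PiE_def Pi_iff)
  moreover have "\<forall>i<N. \<bar>a i\<bar> \<le> R \<and> \<bar>b i\<bar> \<le> R" using R by fastforce
  ultimately show ?thesis by blast
qed

lemma L1_loc_integrable_box:
  assumes g: "g \<in> L1_loc N" and X: "X \<in> open_boxes N"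
  shows "integrable (RN N) (\<lambda>x. indicator X x * g x)"
proof -
  obtain a b where ab: "X = PiE {..<N} (\<lambda>i. {a i<..<b i})" using X unfolding open_boxes_def by blast
  obtain R where R: "X \<subseteq> box_RN N R" using open_box_bounded[of N a b] unfolding ab by blast
  have "integrable (RN N) (\<lambda>x. g x * indicator X x)"
  proof (rule L1_loc_integrable(1)[OF g, of _ 1 R])
    show "(indicator X :: point \<Rightarrow> real) \<in> borel_measurable (RN N)"
      by (rule borel_measurable_indicator[OF open_boxes_sets[OF X]])
  qed (use R in \<open>auto simp: indicator_def\<close>)
  then show ?thesis by (simp add: mult.commute)
qed

lemma integral_open_box_0:
  assumes g: "g \<in> L1_loc N" and orth: "\<And>\<psi>. \<psi> \<in> test_fun N \<Longrightarrow> (LINT x|RN N. g x * \<psi> x) = 0"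
    and X: "X \<in> open_boxes N"
  shows "(LINT x|RN N. indicator X x * g x) = 0"
proof -
  obtain a b where X: "X = PiE {..<N} (\<lambda>i. {a i<..<b i})" using X by (auto simp: open_boxes_def)
  obtain R where R: "X \<subseteq> box_RN N R" using open_box_bounded[of N a b] X by blast
  define \<psi> where "\<psi> n = tensor N (\<lambda>i. bump (real (Suc n)) (a i) (b i))" for n
  have test: "\<psi> n \<in> test_fun N" for n
    unfolding \<psi>_def
  proof (rule test_fun_tensor[OF smooth1_bump])
    show "bump (real (Suc n)) (a i) (b i) s = 0" if "\<bar>s\<bar> > \<bar>a i\<bar> + \<bar>b i\<bar>" for i s
      by (rule bump_outside) (use that in auto)
  qed
  have lim: "(\<lambda>n. g x * \<psi> n x) \<longlonglongrightarrow> g x * indicator X x" if x: "x \<in> space (RN N)" for x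
  proof -
    have "(\<lambda>n. \<Prod>i<N. bump (real (Suc n)) (a i) (b i) (x i)) \<longlonglongrightarrow> (\<Prod>i<N. indicator {a i<..<b i} (x i))"
      by (intro tendsto_prod bump_tendsto)
    moreover have "(\<Prod>i<N. indicator {a i<..<b i} (x i) :: real) = indicator X x"
    proof (cases "x \<in> X")
      case True
      then have "\<And>i. i < N \<Longrightarrow> x i \<in> {a i<..<b i}" by (auto simp: X PiE_iff)
      then show ?thesis using True by simp
    next
      case False
      then obtain i where "i < N" "x i \<notin> {a i<..<b i}" using x by (auto simp: X PiE_iff space_RN)
      then have "(\<Prod>i<N. indicator {a i<..<b i} (x i) :: real) = 0"
        by (intro prod_zero bexI[of _ i]) (simp_all add: indicator_def)
      then show ?thesis using False by simp
    qed
    ultimately show ?thesis by (intro tendsto_mult tendsto_const) (simp add: \<psi>_def tensor_eq)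
  qed
  \<comment> \<open>The bumps are bounded by 1 and vanish outside X, so |g| on a surrounding cube is
    a majorant.\<close>
  have "(\<lambda>n. LINT x|RN N. g x * \<psi> n x) \<longlonglongrightarrow> (LINT x|RN N. g x * indicator X x)"
  proof (rule integral_dominated_convergence[where w="\<lambda>x. indicator (box_RN N R) x * \<bar>g x\<bar>"])
    show "(\<lambda>x. g x * indicator X x) \<in> borel_measurable (RN N)"
      using L1_locD[OF g] borel_measurable_indicator[OF open_boxes_sets[OF assms(3)], where 'b=real] by simp
    show "(\<lambda>x. g x * \<psi> n x) \<in> borel_measurable (RN N)" for n
      using L1_locD[OF g] test_fun_measurable[OF test] by simp
    show "integrable (RN N) (\<lambda>x. indicator (box_RN N R) x * \<bar>g x\<bar>)"
      using g integrable_abs[of "RN N" "\<lambda>x. indicator (box_RN N R) x * g x"] by (simp add: L1_loc_iff abs_mult)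
    show "AE x in RN N. norm (g x * \<psi> n x) \<le> indicator (box_RN N R) x * \<bar>g x\<bar>" for n
    proof (rule AE_I2)
      fix x assume x: "x \<in> space (RN N)"
      have b: "0 \<le> \<psi> n x" "\<psi> n x \<le> 1"
        unfolding \<psi>_def tensor_eq by (intro prod_nonneg prod_le_1 ballI conjI bump_bounds)+
      show "norm (g x * \<psi> n x) \<le> indicator (box_RN N R) x * \<bar>g x\<bar>"
      proof (cases "x \<in> X")
        case True
        then show ?thesis using b R mult_left_le[of "\<psi> n x" "\<bar>g x\<bar>"] by (auto simp: abs_mult)
      next
        case False
        then obtain i where "i < N" "x i \<notin> {a i<..<b i}" using x by (auto simp: X PiE_iff space_RN)
        then have "\<psi> n x = 0" unfolding \<psi>_def tensor_eq by (intro prod_zero) (auto intro!: bexI[of _ i] bump_outside)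
        then show ?thesis by simp
      qed
    qed
    show "AE x in RN N. (\<lambda>n. g x * \<psi> n x) \<longlonglongrightarrow> g x * indicator X x" by (rule AE_I2) (rule lim)
  qed
  then have "(\<lambda>n. 0) \<longlonglongrightarrow> (LINT x|RN N. g x * indicator X x)" by (simp add: orth[OF test])
  then show ?thesis by (simp add: LIMSEQ_const_iff mult.commute)
qed

text \<open>By \<open>integral_open_box_0\<close> the measures with densities g^+ and g^- agree on
  open boxes, hence on all measurable sets; so g^+ = g^- almost everywhere, which forces g =
  0.\<close>

theorem fundamental_lemma:
  assumes g: "g \<in> L1_loc N" and orth: "\<And>\<psi>. \<psi> \<in> test_fun N \<Longrightarrow> (LINT x|RN N. g x * \<psi> x) = 0"
  shows "AE x in RN N. g x = 0"
proof -
  interpret product_sigma_finite "\<lambda>_::nat. lborel :: real measure" by standard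
  interpret F: finite_product_sigma_finite "\<lambda>_::nat. lborel :: real measure" "{..<N}" by standard simp
  interpret S: sigma_finite_measure "RN N" unfolding RN_def by (rule F.sigma_finite_measure_axioms)
  have [measurable]: "g \<in> borel_measurable (RN N)" by (rule L1_locD[OF g])
  have dens: "emeasure (density (RN N) (\<lambda>x. ennreal (s * g x))) X = (\<integral>\<^sup>+x. ennreal (s * (indicator X x * g x)) \<partial>RN N)"
    if X: "X \<in> open_boxes N" for X and s :: real
  proof -
    have "emeasure (density (RN N) (\<lambda>x. ennreal (s * g x))) X = (\<integral>\<^sup>+x. ennreal (s * g x) * indicator X x \<partial>RN N)"
      by (rule emeasure_density[OF _ open_boxes_sets[OF X]]) measurable
    also have "\<dots> = (\<integral>\<^sup>+x. ennreal (s * (indicator X x * g x)) \<partial>RN N)"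
      by (intro nn_integral_cong) (auto split: split_indicator)
    finally show ?thesis .
  qed
  have fin: "(\<integral>\<^sup>+x. ennreal (s * (indicator X x * g x)) \<partial>RN N) \<noteq> \<infinity>" if X: "X \<in> open_boxes N" for X and s :: real
  proof -
    have "integrable (RN N) (\<lambda>x. s * (indicator X x * g x))" using L1_loc_integrable_box[OF g X] by simp
    then show ?thesis unfolding real_integrable_def by blast
  qed
  \<comment> \<open>\<open>ennreal\<close> cuts negative values off at 0, so these densities are the
    positive and the negative part of g.\<close>
  have "density (RN N) (\<lambda>x. ennreal (1 * g x)) = density (RN N) (\<lambda>x. ennreal ((-1) * g x))"
  proof (rule measure_eqI_generator_eq[where E="open_boxes N" and \<Omega>="space (RN N)"
        and A="\<lambda>n. PiE {..<N} (\<lambda>i. {-real n<..<real n})"])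
    show "Int_stable (open_boxes N)"
    proof (rule Int_stableI)
      fix X Y assume "X \<in> open_boxes N" "Y \<in> open_boxes N"
      then obtain a b c d where XY: "X = PiE {..<N} (\<lambda>i. {a i<..<b i})" "Y = PiE {..<N} (\<lambda>i. {c i<..<d i})"
        unfolding open_boxes_def by blast
      have "X \<inter> Y = PiE {..<N} (\<lambda>i. {max (a i) (c i)<..<min (b i) (d i)})"
        unfolding XY PiE_Int by (rule PiE_cong) auto
      then show "X \<inter> Y \<in> open_boxes N"
        using open_boxesI[of N "\<lambda>i. max (a i) (c i)" "\<lambda>i. min (b i) (d i)"] by simp
    qed
    show "open_boxes N \<subseteq> Pow (space (RN N))" using open_boxes_sets sets.sets_into_space by blast
    show "range (\<lambda>n. PiE {..<N} (\<lambda>i. {-real n<..<real n})) \<subseteq> open_boxes N"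
      using open_boxesI[of N "\<lambda>i. - real _" "\<lambda>i. real _"] by blast
    show "(\<Union>n. PiE {..<N} (\<lambda>i. {-real n<..<real n})) = space (RN N)"
    proof (intro set_eqI iffI)
      fix x assume x: "x \<in> space (RN N)"
      obtain n :: nat where n: "(\<Sum>i<N. \<bar>x i\<bar>) < n" using reals_Archimedean2 by blast
      have "\<bar>x i\<bar> < n" if "i < N" for i
        using member_le_sum[of i "{..<N}" "\<lambda>i. \<bar>x i\<bar>"] that n by simp
      then have "x \<in> PiE {..<N} (\<lambda>i. {-real n<..<real n})"
        using x by (auto simp: PiE_iff space_RN abs_less_iff minus_less_iff)
      then show "x \<in> (\<Union>n. PiE {..<N} (\<lambda>i. {-real n<..<real n}))" by blast
    qed (auto simp: space_RN PiE_iff)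
    fix X assume X: "X \<in> open_boxes N"
    note i = L1_loc_integrable_box[OF g X]
    have *: "enn2real (\<integral>\<^sup>+x. ennreal (indicator X x * g x) \<partial>RN N) = enn2real (\<integral>\<^sup>+x. ennreal (- (indicator X x * g x)) \<partial>RN N)"
      using real_lebesgue_integral_def[OF i] integral_open_box_0[OF g orth X] by simp
    show "emeasure (density (RN N) (\<lambda>x. ennreal (1 * g x))) X = emeasure (density (RN N) (\<lambda>x. ennreal ((-1) * g x))) X"
      unfolding dens[OF X]
    proof -
      have eq: "x = y" if "enn2real x = enn2real y" "x \<noteq> \<infinity>" "y \<noteq> \<infinity>" for x y :: ennreal
        using that by (metis ennreal_enn2real infinity_ennreal_def less_top)
      show "(\<integral>\<^sup>+x. ennreal (1 * (indicator X x * g x)) \<partial>RN N) = (\<integral>\<^sup>+x. ennreal ((-1) * (indicator X x * g x)) \<partial>RN N)"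
        by (rule eq[OF _ fin[OF X] fin[OF X]]) (use * in simp)
    qed
  next
    fix n
    have "PiE {..<N} (\<lambda>i. {-real n<..<real n}) \<in> open_boxes N"
      by (rule open_boxesI)
    from dens[OF this, of 1] fin[OF this, of 1]
    show "emeasure (density (RN N) (\<lambda>x. ennreal (1 * g x))) (PiE {..<N} (\<lambda>i. {-real n<..<real n})) \<noteq> \<infinity>" by simp
  qed (simp_all add: sets_RN_open_boxes)
  then have "AE x in RN N. ennreal (1 * g x) = ennreal ((-1) * g x)"
    by (intro S.density_unique) measurable
  then show ?thesis
  proof (rule AE_mp, intro AE_I2 impI)
    fix x assume "ennreal (1 * g x) = ennreal (- 1 * g x)"
    then show "g x = 0" by (cases "0 \<le> g x") (auto simp: ennreal_neg ennreal_eq_0_iff)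
  qed
qed

section \<open>The translation groups on the Hilbert space\<close>

text \<open>Test functions of every dimension, since the core has to detect vectors supported on any
  slice.\<close>

definition test_core :: "hil set" where
  "test_core = {cls n \<psi> | n \<psi>. \<psi> \<in> test_fun n}"

definition Dop :: "nat \<Rightarrow> hil \<Rightarrow> hil" where
  "Dop i u = vector_derivative (\<lambda>s. tau i s u) (at 0)"

lemma zero_L2: "(\<lambda>x. 0) \<in> L2 N"
  by (simp add: L2_eq_sqint sqint_zero)

lemma cls_0: "cls N (\<lambda>x. 0) = 0"
  using cls_diff[OF zero_L2 zero_L2, of N] by simp

lemma tau_cls_deriv:
  assumes p: "\<psi> \<in> test_fun n"
  shows "((\<lambda>s. tau i s (cls n \<psi>)) has_vector_derivative (if i < n then cls n (partial i \<psi>) else 0)) (at 0)"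
proof (cases "i < n")
  case True
  then show ?thesis using shift_deriv(2)[OF p True, of 0] by (simp add: tau_cls[OF test_fun_L2[OF p]])
next
  case False
  then show ?thesis by (simp add: tau_cls[OF test_fun_L2[OF p]] shift_def)
qed

lemma Dop_cls: "\<psi> \<in> test_fun n \<Longrightarrow> Dop i (cls n \<psi>) = (if i < n then cls n (partial i \<psi>) else 0)"
  unfolding Dop_def by (rule vector_derivative_at[OF tau_cls_deriv])

lemma test_core_total:
  assumes "\<And>\<psi>. \<psi> \<in> test_core \<Longrightarrow> inner x \<psi> = 0"
  shows "x = 0"
proof (rule hil_eq_0)
  fix n
  show "AE y in RN n. rep n x y = 0"
  proof (rule fundamental_lemma[OF L2_L1_loc[OF rep_L2]])
    fix \<psi> assume "\<psi> \<in> test_fun n"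
    then show "(LINT y|RN n. rep n x y * \<psi> y) = 0"
      using assms[of "cls n \<psi>"] inner_cls_right[OF test_fun_L2, of \<psi> n x] by (auto simp: test_core_def)
  qed
qed

lemma tau_bounded_linear: "bounded_linear (tau i s)"
proof (rule bounded_linear_intro[where K=1])
  show "tau i s (x + y) = tau i s x + tau i s y" for x y by (rule linear_add[OF tau_linear])
  show "tau i s (r *\<^sub>R x) = r *\<^sub>R tau i s x" for r x by (rule linear_scale[OF tau_linear])
qed (simp add: tau_norm)

text \<open>The vectors whose orbit is continuous at 0 form a subspace, closed because translations
  are isometries. It contains the test functions, whose orthogonal complement is trivial.\<close>

lemma tau_tendsto_0: "((\<lambda>s. tau i s x) \<longlongrightarrow> x) (at 0)"
proof -
  define V where "V = {x. ((\<lambda>s. tau i s x) \<longlongrightarrow> x) (at 0)}"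
  have "V = UNIV"
  proof (rule closed_subspace_eq_UNIV)
    show "subspace V"
      unfolding subspace_def V_def
      by (auto simp: linear_0[OF tau_linear] linear_add[OF tau_linear] linear_scale[OF tau_linear] intro!: tendsto_intros)
    show "closed V"
    proof (rule closed_sequential_limits[THEN iffD2], intro allI impI, elim conjE)
      fix X x assume X: "\<forall>n. X n \<in> V" "X \<longlonglongrightarrow> x"
      show "x \<in> V"
        unfolding V_def mem_Collect_eq
      proof (rule tendstoI)
        fix e :: real assume "e > 0"
        then obtain n where n: "norm (X n - x) < e / 3" using LIMSEQ_D[OF X(2), of "e / 3"] by auto
        have "((\<lambda>s. tau i s (X n)) \<longlongrightarrow> X n) (at 0)" using X(1) by (simp add: V_def)
        then have "\<forall>\<^sub>F s in at 0. dist (tau i s (X n)) (X n) < e / 3" using \<open>e > 0\<close> by (intro tendstoD) auto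
        then show "\<forall>\<^sub>F s in at 0. dist (tau i s x) x < e"
        proof (rule eventually_mono)
          fix s assume s: "dist (tau i s (X n)) (X n) < e / 3"
          have "dist (tau i s x) (tau i s (X n)) = norm (X n - x)"
            by (simp add: dist_norm tau_norm norm_minus_commute flip: linear_diff[OF tau_linear])
          then show "dist (tau i s x) x < e"
            using dist_triangle[of "tau i s x" x "tau i s (X n)"] dist_triangle[of "tau i s (X n)" x "X n"] s n
            by (simp add: dist_norm)
        qed
      qed
    qed
    fix x assume x: "\<And>v. v \<in> V \<Longrightarrow> inner x v = 0"
    show "x = 0"
    proof (rule test_core_total, rule x)
      fix \<psi> assume "\<psi> \<in> test_core"
      then obtain n f where f: "\<psi> = cls n f" "f \<in> test_fun n" by (auto simp: test_core_def)
      have "isCont (\<lambda>s. tau i s \<psi>) 0"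
        unfolding f(1) by (rule has_vector_derivative_continuous[OF tau_cls_deriv[OF f(2)]])
      then show "\<psi> \<in> V" by (simp add: V_def isCont_def tau_0)
    qed
  qed
  then show ?thesis by (auto simp: V_def)
qed

lemma tau_continuous: "continuous_on UNIV (\<lambda>s. tau i s x)"
proof (rule continuous_at_imp_continuous_on, rule ballI)
  fix t :: real
  have "((\<lambda>h. tau i t (tau i h x)) \<longlongrightarrow> tau i t x) (at 0)"
    by (rule bounded_linear.tendsto[OF tau_bounded_linear tau_tendsto_0])
  then show "isCont (\<lambda>s. tau i s x) t" by (simp add: isCont_iff tau_add)
qed

interpretation H: transl_core tau test_core Dop
proof
  show "tau i s (tau j t x) = tau j t (tau i s x)" for i j s t x by (rule tau_commute)
  show "continuous_on UNIV (\<lambda>s. tau i s x)" for i x by (rule tau_continuous)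
  have T: "transl tau"
    by (rule transl.intro) (rule tau_linear tau_norm tau_0 tau_add tau_commute tau_continuous)+
  fix \<psi> i s assume "\<psi> \<in> test_core"
  then obtain n f where f: "\<psi> = cls n f" "f \<in> test_fun n" by (auto simp: test_core_def)
  show "transl.gen tau i \<psi> (Dop i \<psi>)"
    using tau_cls_deriv[OF f(2), of i] by (simp add: transl.gen_def[OF T] f Dop_cls)
  show "tau i s \<psi> \<in> test_core"
    using test_fun_shift[OF f(2), of i s] by (auto simp: test_core_def f(1) tau_cls[OF test_fun_L2[OF f(2)]])
next
  show "x = 0" if "\<And>\<psi>. \<psi> \<in> test_core \<Longrightarrow> inner x \<psi> = 0" for x by (rule test_core_total[OF that])
qed (simp_all add: linear_add[OF tau_linear] linear_scale[OF tau_linear] tau_norm tau_0 tau_add)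

section \<open>Weak derivatives and superposition operators\<close>

lemma L2_ops:
  assumes "f \<in> L2 N" "g \<in> L2 N"
  shows L2_add: "(\<lambda>x. f x + g x) \<in> L2 N" and L2_diff: "(\<lambda>x. f x - g x) \<in> L2 N"
    and L2_integrable_mult: "integrable (RN N) (\<lambda>x. f x * g x)"
  using assms by (simp_all add: L2_eq_sqint sqint_add sqint_diff sqint_mult)

lemma L2_scale: "f \<in> L2 N \<Longrightarrow> (\<lambda>x. c * f x) \<in> L2 N"
  by (simp add: L2_eq_sqint sqint_scale)

lemma L2_measurable: "f \<in> L2 N \<Longrightarrow> f \<in> borel_measurable (RN N)"
  by (simp add: L2_def)

lemma L2_bound:
  "g \<in> L2 N \<Longrightarrow> f \<in> borel_measurable (RN N) \<Longrightarrow> (\<And>x. x \<in> space (RN N) \<Longrightarrow> \<bar>f x\<bar> \<le> \<bar>g x\<bar>) \<Longrightarrow> f \<in> L2 N"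
  unfolding L2_eq_sqint by (rule sqint_bound)

lemma L2_mult_bounded:
  assumes "f \<in> L2 N" "m \<in> borel_measurable (RN N)" "\<And>x. \<bar>m x\<bar> \<le> B"
  shows "(\<lambda>x. m x * f x) \<in> L2 N"
proof (rule L2_bound[OF L2_scale[OF assms(1), of B]])
  show "(\<lambda>x. m x * f x) \<in> borel_measurable (RN N)" using assms(2) L2_measurable[OF assms(1)] by simp
  show "\<bar>m x * f x\<bar> \<le> \<bar>B * f x\<bar>" for x
    using assms(3)[of x] by (simp add: abs_mult mult_right_mono)
qed

lemma norm_cls_mono:
  assumes "f \<in> L2 N" "g \<in> L2 N" "0 \<le> C" "\<And>x. x \<in> space (RN N) \<Longrightarrow> \<bar>f x\<bar> \<le> C * \<bar>g x\<bar>"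
  shows "norm (cls N f) \<le> C * norm (cls N g)"
proof -
  have "(LINT x|RN N. (f x)\<^sup>2) \<le> (LINT x|RN N. C\<^sup>2 * (g x)\<^sup>2)"
  proof (rule integral_mono)
    fix x assume "x \<in> space (RN N)"
    then have "\<bar>f x\<bar>\<^sup>2 \<le> (C * \<bar>g x\<bar>)\<^sup>2" using assms(4) by (intro power_mono) auto
    then show "(f x)\<^sup>2 \<le> C\<^sup>2 * (g x)\<^sup>2" by (simp add: power_mult_distrib)
  qed (use assms in \<open>auto simp: L2_def\<close>)
  then have "sqrt (LINT x|RN N. (f x)\<^sup>2) \<le> sqrt (C\<^sup>2 * (LINT x|RN N. (g x)\<^sup>2))" by simp
  also have "\<dots> = C * sqrt (LINT x|RN N. (g x)\<^sup>2)" using assms(3) by (simp add: real_sqrt_mult)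
  finally show ?thesis by (simp add: norm_cls assms L2_norm_def)
qed

lemma cls_cong: "f \<in> L2 N \<Longrightarrow> g \<in> borel_measurable (RN N) \<Longrightarrow> (AE x in RN N. g x = f x) \<Longrightarrow> g \<in> L2 N \<and> cls N g = cls N f"
  using sqint_AE[of f "RN N" g] cls_eq_iff[of g N f] by (auto simp: L2_eq_sqint)

lemma inner_cls_other: "f \<in> L2 N \<Longrightarrow> g \<in> L2 n \<Longrightarrow> n \<noteq> N \<Longrightarrow> inner (cls N f) (cls n g) = 0"
proof -
  assume f: "f \<in> L2 N" and g: "g \<in> L2 n" and n: "n \<noteq> N"
  have "(\<lambda>z. ext N f z * ext n g z) = (\<lambda>z. 0)" using n by (auto simp: ext_def fun_eq_iff)
  then show ?thesis by (simp add: cls_def abs_hil_ops(4)[OF ext_sqint[OF f] ext_sqint[OF g]])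
qed

text \<open>The orthogonal projection onto the slice of dimension N. Abstract solutions live in the
  whole Hilbert space and return to functions on R^N through it.\<close>

definition prj :: "nat \<Rightarrow> hil \<Rightarrow> hil" where
  "prj N u = cls N (rep N u)"

lemma inner_prj: "f \<in> L2 N \<Longrightarrow> inner (prj N u) (cls N f) = inner u (cls N f)"
proof -
  assume f: "f \<in> L2 N"
  show ?thesis unfolding prj_def inner_cls_right[OF f, of u] by (rule inner_cls[OF rep_L2 f])
qed

lemma prj_cls: "f \<in> L2 N \<Longrightarrow> prj N (cls N f) = cls N f"
  unfolding prj_def using cls_cong[OF _ L2_measurable[OF rep_L2] rep_cls] by blast

text \<open>Representatives are chosen, so \<open>rep\<close> is linear only up to null sets;
  identities for \<open>prj\<close> are therefore verified through inner products.\<close>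

lemma prj_eqI:
  assumes "f \<in> L2 N" and "\<And>g. g \<in> L2 N \<Longrightarrow> inner u (cls N g) = inner (cls N f) (cls N g)"
  shows "prj N u = cls N f"
proof -
  have d: "prj N u - cls N f = cls N (\<lambda>x. rep N u x - f x)" by (simp add: prj_def cls_diff rep_L2 assms)
  have "inner (prj N u - cls N f) (cls N (\<lambda>x. rep N u x - f x)) = 0"
    using assms(2)[OF L2_diff[OF rep_L2 assms(1)], of u] inner_prj[OF L2_diff[OF rep_L2 assms(1)], of u u]
    by (simp add: inner_diff_left)
  then have "inner (prj N u - cls N f) (prj N u - cls N f) = 0" by (simp only: d)
  then show ?thesis by simp
qed

lemma prj_bl: "bounded_linear (prj N)"
proof (rule bounded_linear_intro[where K=1])
  fix u w :: hil and r :: real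
  have "prj N (u + w) = cls N (\<lambda>x. rep N u x + rep N w x)"
    by (rule prj_eqI) (simp_all add: L2_add rep_L2 cls_add inner_add_left inner_prj flip: prj_def)
  then show "prj N (u + w) = prj N u + prj N w" by (simp add: prj_def cls_add rep_L2)
  have "prj N (r *\<^sub>R u) = cls N (\<lambda>x. r * rep N u x)"
    by (rule prj_eqI) (simp_all add: L2_scale rep_L2 cls_scale[OF rep_L2 rep_L2] inner_prj flip: prj_def)
  then show "prj N (r *\<^sub>R u) = r *\<^sub>R prj N u" by (simp add: prj_def cls_scale[OF rep_L2 rep_L2])
  have "norm (prj N u) * norm (prj N u) = inner u (prj N u)"
    using inner_prj[OF rep_L2[of N u], of u] by (simp add: prj_def norm_cauchy_schwarz flip: power2_norm_eq_inner power2_eq_square)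
  also have "\<dots> \<le> norm u * norm (prj N u)" by (rule norm_cauchy_schwarz)
  finally have "norm (prj N u) \<le> norm u" by (cases "norm (prj N u) = 0") auto
  then show "norm (prj N u) \<le> norm u * 1" by simp
qed

lemma has_weak_derivI:
  "u \<in> L1_loc N \<Longrightarrow> g \<in> L1_loc N \<Longrightarrow>
   (\<And>\<psi>. \<psi> \<in> test_fun N \<Longrightarrow> (LINT x|RN N. u x * partials is \<psi> x) = (-1) ^ length is * (LINT x|RN N. g x * \<psi> x)) \<Longrightarrow>
   has_weak_deriv N is u g"
  by (simp add: has_weak_deriv_def)

lemma has_weak_derivD:
  assumes "has_weak_deriv N is u g"
  shows "u \<in> L1_loc N" "g \<in> L1_loc N"
    "\<psi> \<in> test_fun N \<Longrightarrow> (LINT x|RN N. u x * partials is \<psi> x) = (-1) ^ length is * (LINT x|RN N. g x * \<psi> x)"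
  using assms by (auto simp: has_weak_deriv_def)

lemma has_weak_deriv_unique:
  assumes "has_weak_deriv N is u g" "has_weak_deriv N is u g'"
  shows "AE x in RN N. g x = g' x"
proof -
  note D = has_weak_derivD[OF assms(1)] and D' = has_weak_derivD[OF assms(2)]
  have "AE x in RN N. g x - g' x = 0"
  proof (rule fundamental_lemma[OF L1_loc_diff[OF D(2) D'(2)]])
    fix \<psi> assume p: "\<psi> \<in> test_fun N"
    have "(-1) ^ length is * (LINT x|RN N. g x * \<psi> x) = (-1) ^ length is * (LINT x|RN N. g' x * \<psi> x)"
      using D(3)[OF p] D'(3)[OF p] by simp
    then have "(LINT x|RN N. g x * \<psi> x) = (LINT x|RN N. g' x * \<psi> x)" by simp
    then show "(LINT x|RN N. (g x - g' x) * \<psi> x) = 0"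
      by (simp add: left_diff_distrib test_fun_integrable D D' p)
  qed
  then show ?thesis by simp
qed

lemma has_weak_deriv_nil: "u \<in> L1_loc N \<Longrightarrow> has_weak_deriv N [] u u"
  by (simp add: has_weak_deriv_def)

lemma weak_deriv_spec:
  assumes "has_weak_deriv N is u g"
  shows "has_weak_deriv N is u (weak_deriv N is u)"
proof (cases "is = []")
  case True
  then show ?thesis using has_weak_deriv_nil[OF has_weak_derivD(1)[OF assms]] by (simp add: weak_deriv_def)
next
  case False
  then show ?thesis using someI[of "has_weak_deriv N is u" g, OF assms] by (simp add: weak_deriv_def)
qed

lemma weak_deriv_cls:
  assumes w: "has_weak_deriv N is u g" and g: "g \<in> L2 N"
  shows "weak_deriv N is u \<in> L2 N" "cls N (weak_deriv N is u) = cls N g"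
  using cls_cong[OF g L1_locD[OF has_weak_derivD(2)[OF weak_deriv_spec[OF w]]] has_weak_deriv_unique[OF weak_deriv_spec[OF w] w]]
  by auto

lemma has_weak_deriv_diff:
  assumes "is = [] \<or> set is \<subseteq> {..<N}" "has_weak_deriv N is u g" "has_weak_deriv N is u' g'"
  shows "has_weak_deriv N is (\<lambda>x. u x - u' x) (\<lambda>x. g x - g' x)"
proof -
  note D = has_weak_derivD[OF assms(2)] and D' = has_weak_derivD[OF assms(3)]
  show ?thesis
  proof (rule has_weak_derivI[OF L1_loc_diff[OF D(1) D'(1)] L1_loc_diff[OF D(2) D'(2)]])
    fix \<psi> assume p: "\<psi> \<in> test_fun N"
    have ps: "partials is \<psi> \<in> test_fun N" using assms(1) test_fun_partials[OF p] p by auto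
    show "(LINT x|RN N. (u x - u' x) * partials is \<psi> x) = (-1) ^ length is * (LINT x|RN N. (g x - g' x) * \<psi> x)"
      using D(3)[OF p] D'(3)[OF p]
      by (simp add: left_diff_distrib test_fun_integrable D(1,2) D'(1,2) p ps right_diff_distrib)
  qed
qed

lemma has_weak_deriv_add:
  assumes "set is \<subseteq> {..<N}" "has_weak_deriv N is u g" "has_weak_deriv N is u' g'"
  shows "has_weak_deriv N is (\<lambda>x. u x + u' x) (\<lambda>x. g x + g' x)"
proof -
  note D = has_weak_derivD[OF assms(2)] and D' = has_weak_derivD[OF assms(3)]
  show ?thesis
  proof (rule has_weak_derivI[OF L1_loc_add[OF D(1) D'(1)] L1_loc_add[OF D(2) D'(2)]])
    fix \<psi> assume p: "\<psi> \<in> test_fun N"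
    have ps: "partials is \<psi> \<in> test_fun N" by (rule test_fun_partials[OF p assms(1)])
    show "(LINT x|RN N. (u x + u' x) * partials is \<psi> x) = (-1) ^ length is * (LINT x|RN N. (g x + g' x) * \<psi> x)"
      using D(3)[OF p] D'(3)[OF p]
      by (simp add: distrib_right test_fun_integrable D(1,2) D'(1,2) p ps distrib_left)
  qed
qed

lemma has_weak_deriv_AE:
  assumes "has_weak_deriv N is u g" "u' \<in> L1_loc N" "AE x in RN N. u' x = u x" "set is \<subseteq> {..<N}"
  shows "has_weak_deriv N is u' g"
proof -
  note D = has_weak_derivD[OF assms(1)]
  show ?thesis
  proof (rule has_weak_derivI[OF assms(2) D(2)])
    fix \<psi> assume p: "\<psi> \<in> test_fun N"
    note [measurable] = test_fun_measurable[OF test_fun_partials[OF p assms(4)]] L1_locD[OF assms(2)] L1_locD[OF D(1)]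
    have "(LINT x|RN N. u' x * partials is \<psi> x) = (LINT x|RN N. u x * partials is \<psi> x)"
      by (rule integral_cong_AE) (use assms(3) in auto)
    then show "(LINT x|RN N. u' x * partials is \<psi> x) = (-1) ^ length is * (LINT x|RN N. g x * \<psi> x)"
      using D(3)[OF p] by simp
  qed
qed

text \<open>The dictionary between the abstract and the concrete weak derivative. Core vectors from
  other slices contribute 0 to both sides.\<close>

lemma wdiv_single_iff:
  assumes "f \<in> L2 N" "g \<in> L2 N" "i < N"
  shows "H.wdiv {i} (\<lambda>_. cls N f) (cls N g) \<longleftrightarrow> has_weak_deriv N [i] f g"
proof
  assume w: "H.wdiv {i} (\<lambda>_. cls N f) (cls N g)"
  show "has_weak_deriv N [i] f g"
  proof (rule has_weak_derivI[OF L2_L1_loc[OF assms(1)] L2_L1_loc[OF assms(2)]])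
    fix \<psi> assume p: "\<psi> \<in> test_fun N"
    have "inner (cls N g) (cls N \<psi>) = - inner (cls N f) (Dop i (cls N \<psi>))"
    proof -
      have "cls N \<psi> \<in> test_core" using p by (auto simp: test_core_def)
      from w[unfolded H.wdiv_def, rule_format, OF this] show ?thesis by simp
    qed
    then show "(LINT x|RN N. f x * partials [i] \<psi> x) = (-1) ^ length [i] * (LINT x|RN N. g x * \<psi> x)"
      using p assms by (simp add: Dop_cls inner_cls test_fun_L2 test_fun_partial)
  qed
next
  assume w: "has_weak_deriv N [i] f g"
  show "H.wdiv {i} (\<lambda>_. cls N f) (cls N g)"
    unfolding H.wdiv_def
  proof
    fix \<psi> assume "\<psi> \<in> test_core"
    then obtain n \<psi>' where p: "\<psi> = cls n \<psi>'" "\<psi>' \<in> test_fun n" by (auto simp: test_core_def)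
    show "inner (cls N g) \<psi> = - (\<Sum>i\<in>{i}. inner (cls N f) (Dop i \<psi>))"
    proof (cases "n = N")
      case True
      then show ?thesis using has_weak_derivD(3)[OF w, of \<psi>'] p assms
        by (simp add: Dop_cls inner_cls test_fun_L2 test_fun_partial)
    next
      case False
      then show ?thesis using p assms by (simp add: Dop_cls inner_cls_other test_fun_L2 test_fun_partial)
    qed
  qed
qed

lemma gen_imp_weak_deriv:
  assumes f: "f \<in> L2 N" and i: "i < N" and g: "H.gen i (cls N f) y"
  shows "has_weak_deriv N [i] f (rep N y)"
proof (rule has_weak_derivI[OF L2_L1_loc[OF f] L2_L1_loc[OF rep_L2]])
  fix \<psi> assume p: "\<psi> \<in> test_fun N"
  have "cls N \<psi> \<in> test_core" using p by (auto simp: test_core_def)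
  from H.gen_skew[OF g H.core_gen[OF this]]
  have "inner y (cls N \<psi>) = - inner (cls N f) (cls N (partial i \<psi>))" using p i by (simp add: Dop_cls)
  then show "(LINT x|RN N. f x * partials [i] \<psi> x) = (-1) ^ length [i] * (LINT x|RN N. rep N y x * \<psi> x)"
    unfolding inner_cls[OF f test_fun_L2[OF test_fun_partial[OF p i]]] inner_cls_right[OF test_fun_L2[OF p]] by simp
qed

section \<open>Superposition operators\<close>

lemma measurable_tail:
  fixes c :: real
  assumes "P \<in> borel_measurable M"
  shows "(\<lambda>x. if c < \<bar>P x\<bar> then P x else 0) \<in> borel_measurable M"
proof -
  have "{r::real. c < \<bar>r\<bar>} \<in> sets borel" by (intro borel_open open_Collect_less continuous_intros)
  then have "(\<lambda>r::real. if r \<in> {r. c < \<bar>r\<bar>} then r else 0) \<in> borel_measurable borel"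
    by (intro measurable_If_set) auto
  from measurable_compose[OF assms this] show ?thesis by simp
qed

lemma L2_tail:
  assumes "P \<in> L2 N"
  shows "(\<lambda>n. norm (cls N (\<lambda>x. if \<bar>P x\<bar> > real n then P x else 0))) \<longlonglongrightarrow> 0"
proof -
  have [measurable]: "P \<in> borel_measurable (RN N)" by (rule L2_measurable[OF assms])
  have L: "(\<lambda>x. if \<bar>P x\<bar> > real n then P x else 0) \<in> L2 N" for n
    by (rule L2_bound[OF assms measurable_tail[OF L2_measurable[OF assms]]]) simp
  have "(\<lambda>n. LINT x|RN N. (if \<bar>P x\<bar> > real n then P x else 0)\<^sup>2) \<longlonglongrightarrow> (LINT x|RN N. 0)"
  proof (rule integral_dominated_convergence[where w="\<lambda>x. (P x)\<^sup>2"])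
    show "integrable (RN N) (\<lambda>x. (P x)\<^sup>2)" using assms by (simp add: L2_def)
    show "AE x in RN N. (\<lambda>n. (if \<bar>P x\<bar> > real n then P x else 0)\<^sup>2) \<longlonglongrightarrow> 0"
    proof (rule AE_I2, rule tendsto_eventually)
      fix x
      obtain n :: nat where "\<bar>P x\<bar> < real n" using reals_Archimedean2 by blast
      then show "\<forall>\<^sub>F n in sequentially. (if \<bar>P x\<bar> > real n then P x else 0)\<^sup>2 = 0"
        unfolding eventually_sequentially by (intro exI[of _ n]) auto
    qed
  qed auto
  then have "(\<lambda>n. sqrt (LINT x|RN N. (if \<bar>P x\<bar> > real n then P x else 0)\<^sup>2)) \<longlonglongrightarrow> sqrt 0"
    by (intro tendsto_real_sqrt) simp
  then show ?thesis by (simp add: norm_cls[OF L] L2_norm_def)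
qed

text \<open>The large values of P are cut off and estimated with the uniform bound on m; where |P|
  is at most n, the bound of m by d applies. The argument works for any filter, without almost
  everywhere convergence.\<close>

lemma mult_L2_tendsto_0:
  assumes P: "P \<in> L2 N" and m: "\<And>s. m s \<in> borel_measurable (RN N)" and d: "\<And>s. d s \<in> L2 N"
    and B: "\<And>s x. \<bar>m s x\<bar> \<le> B" "\<And>s x. \<bar>m s x\<bar> \<le> B * \<bar>d s x\<bar>"
    and lim: "((\<lambda>s. norm (cls N (d s))) \<longlongrightarrow> 0) F"
  shows "((\<lambda>s. norm (cls N (\<lambda>x. m s x * P x))) \<longlongrightarrow> 0) F"
proof (rule tendstoI)
  fix e :: real assume e: "e > 0"
  have B0: "0 \<le> B" using order_trans[OF abs_ge_zero B(1)] .
  have [measurable]: "P \<in> borel_measurable (RN N)" by (rule L2_measurable[OF P])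
  define tl where "tl n x = (if \<bar>P x\<bar> > real n then P x else 0)" for n :: nat and x
  have tl: "tl n \<in> L2 N" for n unfolding tl_def by (rule L2_bound[OF P measurable_tail[OF L2_measurable[OF P]]]) simp
  have "(\<lambda>n. B * norm (cls N (tl n))) \<longlonglongrightarrow> B * 0"
    unfolding tl_def by (intro tendsto_mult tendsto_const L2_tail P)
  then have "\<forall>\<^sub>F n in sequentially. B * norm (cls N (tl n)) < e / 2"
    using e by (intro order_tendstoD(2)) auto
  then obtain n where n: "B * norm (cls N (tl n)) < e / 2" by (auto simp: eventually_sequentially)
  have "((\<lambda>s. B * real n * norm (cls N (d s))) \<longlongrightarrow> B * real n * 0) F" by (intro tendsto_mult tendsto_const lim)
  then have "\<forall>\<^sub>F s in F. B * real n * norm (cls N (d s)) < e / 2" using e by (intro order_tendstoD(2)) auto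
  then show "\<forall>\<^sub>F s in F. dist (norm (cls N (\<lambda>x. m s x * P x))) 0 < e"
  proof (rule eventually_mono)
    fix s assume s: "B * real n * norm (cls N (d s)) < e / 2"
    note [measurable] = m[of s]
    have split: "m s x * P x = m s x * (P x - tl n x) + m s x * tl n x" for x by (simp add: algebra_simps)
    have L1: "(\<lambda>x. m s x * (P x - tl n x)) \<in> L2 N" by (rule L2_mult_bounded[OF L2_diff[OF P tl] m B(1)])
    have L2: "(\<lambda>x. m s x * tl n x) \<in> L2 N" by (rule L2_mult_bounded[OF tl m B(1)])
    have "norm (cls N (\<lambda>x. m s x * P x)) \<le> norm (cls N (\<lambda>x. m s x * (P x - tl n x))) + norm (cls N (\<lambda>x. m s x * tl n x))"
      unfolding split cls_add[OF L1 L2] by (rule norm_triangle_ineq)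
    also have "norm (cls N (\<lambda>x. m s x * (P x - tl n x))) \<le> (B * real n) * norm (cls N (d s))"
    proof (rule norm_cls_mono[OF L1 d])
      fix x
      have "\<bar>P x - tl n x\<bar> \<le> real n" by (simp add: tl_def)
      then have "\<bar>m s x\<bar> * \<bar>P x - tl n x\<bar> \<le> (B * \<bar>d s x\<bar>) * real n" using B(2)[of s x] B0 by (intro mult_mono) auto
      then show "\<bar>m s x * (P x - tl n x)\<bar> \<le> B * real n * \<bar>d s x\<bar>" by (simp add: abs_mult mult_ac)
    qed (use B0 in simp)
    also have "norm (cls N (\<lambda>x. m s x * tl n x)) \<le> B * norm (cls N (tl n))"
      by (rule norm_cls_mono[OF L2 tl B0]) (use B(1) in \<open>simp add: abs_mult mult_right_mono\<close>)
    finally show "dist (norm (cls N (\<lambda>x. m s x * P x))) 0 < e" using s n by simp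
  qed
qed

lemma MVT_between:
  fixes g :: "real \<Rightarrow> real"
  assumes g: "\<And>r. (g has_real_derivative g' r) (at r)"
  shows "\<exists>\<xi>. g b - g a = g' \<xi> * (b - a) \<and> min a b \<le> \<xi> \<and> \<xi> \<le> max a b"
proof -
  consider "a < b" | "a = b" | "b < a" by linarith
  then show ?thesis
  proof cases
    case 1
    then obtain z where "a < z" "z < b" "g b - g a = (b - a) * g' z" using MVT2[of a b g g'] g by blast
    then show ?thesis by (intro exI[of _ z]) (auto simp: mult.commute)
  next
    case 3
    then obtain z where "b < z" "z < a" "g a - g b = (a - b) * g' z" using MVT2[of b a g g'] g by blast
    then show ?thesis by (intro exI[of _ z]) (auto simp: algebra_simps)
  qed auto
qed

text \<open>Chain rule in L^2 along a curve of which only the increments are square-integrable. By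
  the mean value theorem the increment of g is (m + g') times that of y, with a defect m that is
  bounded and also dominated by the increment, as \<open>mult_L2_tendsto_0\<close> requires.\<close>

lemma Nemytskii_deriv:
  fixes y :: "real \<Rightarrow> point \<Rightarrow> real"
  assumes y: "\<And>s. y s \<in> borel_measurable (RN N)" and d: "\<And>s. (\<lambda>x. y s x - y t x) \<in> L2 N"
    and p: "p \<in> L2 N" and dy: "((\<lambda>s. cls N (\<lambda>x. y s x - y t x)) has_vector_derivative cls N p) (at t)"
    and g: "\<And>r. (g has_real_derivative g' r) (at r)" and mg: "g \<in> borel_measurable borel" "g' \<in> borel_measurable borel"
    and B: "\<And>r. \<bar>g' r\<bar> \<le> B" "\<And>a b. \<bar>g' a - g' b\<bar> \<le> B * \<bar>a - b\<bar>"
  shows "((\<lambda>s. cls N (\<lambda>x. g (y s x) - g (y t x))) has_vector_derivative cls N (\<lambda>x. g' (y t x) * p x)) (at t)"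
    and "(\<lambda>x. g (y s x) - g (y t x)) \<in> L2 N"
proof -
  have B0: "0 \<le> B" using order_trans[OF abs_ge_zero B(1)] .
  note [measurable] = y mg
  have mvt: "\<exists>\<xi>. g b - g a = g' \<xi> * (b - a) \<and> \<bar>\<xi> - a\<bar> \<le> \<bar>b - a\<bar>" for a b
    using MVT_between[OF g, of b a] by (elim exE, intro exI conjI) (auto simp: min_def max_def split: if_splits)
  have glip: "\<bar>g b - g a\<bar> \<le> B * \<bar>b - a\<bar>" for a b
    using mvt[of b a] B(1) by (auto simp: abs_mult intro!: mult_right_mono)
  have gd: "(\<lambda>x. g (y s x) - g (y t x)) \<in> L2 N" for s
    by (rule L2_bound[OF L2_scale[OF d[of s], of B]]) (use glip B0 in \<open>auto simp: abs_mult\<close>)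
  then show "(\<lambda>x. g (y s x) - g (y t x)) \<in> L2 N" .
  \<comment> \<open>The value 0 at coinciding arguments respects the bound by the increment, and the
    factorisation \<open>gm\<close> holds there because its second factor is 0.\<close>
  define m where "m s x = (if y s x = y t x then 0 else (g (y s x) - g (y t x)) / (y s x - y t x) - g' (y t x))" for s x
  have mm: "m s \<in> borel_measurable (RN N)" for s unfolding m_def[abs_def] by measurable
  have mb: "\<bar>m s x\<bar> \<le> 2 * B \<and> \<bar>m s x\<bar> \<le> B * \<bar>y s x - y t x\<bar>" for s x
  proof (cases "y s x = y t x")
    case False
    obtain \<xi> where \<xi>: "g (y s x) - g (y t x) = g' \<xi> * (y s x - y t x)" "\<bar>\<xi> - y t x\<bar> \<le> \<bar>y s x - y t x\<bar>"
      using mvt by blast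
    have "m s x = g' \<xi> - g' (y t x)" using False \<xi>(1) by (simp add: m_def)
    moreover have "\<bar>g' \<xi> - g' (y t x)\<bar> \<le> B * \<bar>y s x - y t x\<bar>"
      using order_trans[OF B(2) mult_left_mono[OF \<xi>(2) B0]] .
    ultimately show ?thesis using B(1)[of \<xi>] B(1)[of "y t x"] by linarith
  qed (use B0 in \<open>simp add: m_def\<close>)
  have gm: "g (y s x) - g (y t x) = (m s x + g' (y t x)) * (y s x - y t x)" for s x by (simp add: m_def)
  have m2: "\<bar>m s x\<bar> \<le> 2 * B" "\<bar>m s x\<bar> \<le> 2 * B * \<bar>y s x - y t x\<bar>" for s x
  proof -
    show "\<bar>m s x\<bar> \<le> 2 * B" using mb by blast
    have "B * \<bar>y s x - y t x\<bar> \<le> 2 * B * \<bar>y s x - y t x\<bar>" using B0 by (intro mult_right_mono) auto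
    then show "\<bar>m s x\<bar> \<le> 2 * B * \<bar>y s x - y t x\<bar>" using mb[of s x] by linarith
  qed
  have z: "cls N (\<lambda>x. y t x - y t x) = 0" by (simp add: cls_0)
  have lim0: "((\<lambda>s. norm (cls N (\<lambda>x. y s x - y t x))) \<longlongrightarrow> 0) (at t)"
    using has_vector_derivative_continuous[OF dy] by (simp add: isCont_def z tendsto_norm_zero_iff cls_0)
  have q: "((\<lambda>s. cls N (\<lambda>x. y s x - y t x) /\<^sub>R (s - t)) \<longlongrightarrow> cls N p) (at t)"
    using dy by (simp add: has_vector_derivative_iff_quotient cls_0)
  have r1: "((\<lambda>s. 3 * B * norm (cls N (\<lambda>x. y s x - y t x) /\<^sub>R (s - t) - cls N p)) \<longlongrightarrow> 3 * B * 0) (at t)"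
    using q by (intro tendsto_mult tendsto_const) (simp add: tendsto_norm_zero_iff LIM_zero_iff)
  have r2: "((\<lambda>s. norm (cls N (\<lambda>x. m s x * p x))) \<longlongrightarrow> 0) (at t)"
    by (rule mult_L2_tendsto_0[OF p mm d m2 lim0])
  have gp: "(\<lambda>x. g' (y t x) * p x) \<in> L2 N" by (rule L2_mult_bounded[OF p _ B(1)]) measurable
  have le: "norm (cls N (\<lambda>x. g (y s x) - g (y t x)) /\<^sub>R (s - t) - cls N (\<lambda>x. g' (y t x) * p x))
      \<le> 3 * B * norm (cls N (\<lambda>x. y s x - y t x) /\<^sub>R (s - t) - cls N p) + norm (cls N (\<lambda>x. m s x * p x))" for s
  proof -
    let ?c = "inverse (s - t)"
    let ?q = "\<lambda>x. ?c * (y s x - y t x) - p x"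
    have Lq: "?q \<in> L2 N" by (rule L2_diff[OF L2_scale[OF d] p])
    \<comment> \<open>2 B for the defect plus B for g'.\<close>
    have b3: "\<bar>m s x + g' (y t x)\<bar> \<le> 3 * B" for x using m2(1)[of s x] B(1)[of "y t x"] by linarith
    have mg': "(\<lambda>x. m s x + g' (y t x)) \<in> borel_measurable (RN N)" using mm[of s] by measurable
    have L1: "(\<lambda>x. (m s x + g' (y t x)) * ?q x) \<in> L2 N" by (rule L2_mult_bounded[OF Lq mg' b3])
    have L2: "(\<lambda>x. m s x * p x) \<in> L2 N" by (rule L2_mult_bounded[OF p mm m2(1)])
    have "cls N (\<lambda>x. g (y s x) - g (y t x)) /\<^sub>R (s - t) - cls N (\<lambda>x. g' (y t x) * p x)
      = cls N (\<lambda>x. ?c * (g (y s x) - g (y t x)) - g' (y t x) * p x)"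
      by (simp only: cls_diff[OF L2_scale[OF gd] gp] cls_scale[OF gd gd])
    also have "\<dots> = cls N (\<lambda>x. (m s x + g' (y t x)) * ?q x + m s x * p x)"
      by (rule arg_cong[where f="cls N"], rule ext) (simp add: gm algebra_simps)
    also have "\<dots> = cls N (\<lambda>x. (m s x + g' (y t x)) * ?q x) + cls N (\<lambda>x. m s x * p x)" by (rule cls_add[OF L1 L2])
    finally have eq: "cls N (\<lambda>x. g (y s x) - g (y t x)) /\<^sub>R (s - t) - cls N (\<lambda>x. g' (y t x) * p x)
      = cls N (\<lambda>x. (m s x + g' (y t x)) * ?q x) + cls N (\<lambda>x. m s x * p x)" .
    have "norm (cls N (\<lambda>x. (m s x + g' (y t x)) * ?q x)) \<le> 3 * B * norm (cls N ?q)"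
    proof (rule norm_cls_mono[OF L1 Lq])
      show "\<bar>(m s x + g' (y t x)) * ?q x\<bar> \<le> 3 * B * \<bar>?q x\<bar>" for x
        unfolding abs_mult by (rule mult_right_mono[OF b3]) simp
    qed (use B0 in simp)
    moreover have "cls N ?q = cls N (\<lambda>x. y s x - y t x) /\<^sub>R (s - t) - cls N p"
      by (simp only: cls_diff[OF L2_scale[OF d] p] cls_scale[OF d d])
    ultimately have "norm (cls N (\<lambda>x. (m s x + g' (y t x)) * ?q x))
      \<le> 3 * B * norm (cls N (\<lambda>x. y s x - y t x) /\<^sub>R (s - t) - cls N p)" by simp
    then show ?thesis unfolding eq by (intro order_trans[OF norm_triangle_ineq] add_right_mono)
  qed
  have "((\<lambda>s. cls N (\<lambda>x. g (y s x) - g (y t x)) /\<^sub>R (s - t) - cls N (\<lambda>x. g' (y t x) * p x)) \<longlongrightarrow> 0) (at t)"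
    by (rule Lim_null_comparison[OF always_eventually[OF allI[OF le]]]) (use tendsto_add[OF r1 r2] in simp)
  then have q': "((\<lambda>s. cls N (\<lambda>x. g (y s x) - g (y t x)) /\<^sub>R (s - t)) \<longlongrightarrow> cls N (\<lambda>x. g' (y t x) * p x)) (at t)"
    by (rule LIM_zero_cancel)
  then show "((\<lambda>s. cls N (\<lambda>x. g (y s x) - g (y t x))) has_vector_derivative cls N (\<lambda>x. g' (y t x) * p x)) (at t)"
    by (simp add: has_vector_derivative_iff_quotient cls_0)
qed

section \<open>Translation increments of weakly differentiable functions\<close>

lemma L1_loc_shift:
  assumes u: "u \<in> L1_loc N"
  shows "(\<lambda>x. u (shift i s N x)) \<in> L1_loc N"
  unfolding L1_loc_iff
proof (intro conjI allI)
  show m: "(\<lambda>x. u (shift i s N x)) \<in> borel_measurable (RN N)"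
    by (rule measurable_compose[OF measurable_shift L1_locD[OF u]])
  fix R
  have "integrable (distr (RN N) (RN N) (shift i s N)) (\<lambda>x. indicator (box_RN N (R + \<bar>s\<bar>)) x * u x)"
    using u by (simp add: distr_shift L1_loc_iff)
  then have i: "integrable (RN N) (\<lambda>x. indicator (box_RN N (R + \<bar>s\<bar>)) (shift i s N x) * u (shift i s N x))"
    by (rule integrable_distr[OF measurable_shift])
  show "integrable (RN N) (\<lambda>x. indicator (box_RN N R) x * u (shift i s N x))"
  proof (rule Bochner_Integration.integrable_bound[OF i])
    show "(\<lambda>x. indicator (box_RN N R) x * u (shift i s N x)) \<in> borel_measurable (RN N)"
      using m borel_measurable_indicator[OF box_RN_sets, where 'b=real] by simp
    have "shift i s N x \<in> box_RN N (R + \<bar>s\<bar>)" if "x \<in> box_RN N R" for x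
      using that shift_space[of x N i s] by (fastforce simp: mem_box_RN shift_def)
    then show "AE x in RN N. norm (indicator (box_RN N R) x * u (shift i s N x))
        \<le> norm (indicator (box_RN N (R + \<bar>s\<bar>)) (shift i s N x) * u (shift i s N x))"
      by (auto simp: indicator_def)
  qed
qed

lemma integral_shift_RN:
  fixes f :: "point \<Rightarrow> real"
  assumes "f \<in> borel_measurable (RN N)"
  shows "(LINT x|RN N. f (shift i s N x)) = (LINT x|RN N. f x)"
  using integral_distr[OF measurable_shift[of i s N] assms] by (simp add: distr_shift)

text \<open>The translation increment of u is the integral of the translated weak derivative, hence
  in L^2 even though u is only locally integrable: pairings of both with a test function have the
  same derivative in s and vanish at s = 0.\<close>

lemma translate_weak_deriv:
  assumes w: "has_weak_deriv N [j] u h" and h: "h \<in> L2 N" and j: "j < N"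
  shows "(\<lambda>x. u (shift j s N x) - u x) \<in> L2 N"
    and "((\<lambda>s. cls N (\<lambda>x. u (shift j s N x) - u x)) has_vector_derivative cls N h) (at 0)"
proof -
  note W = has_weak_derivD[OF w]
  define J where "J = Iint (\<lambda>r. tau j r (cls N h))"
  have ae: "AE x in RN N. u (shift j s N x) - u x = rep N (J s) x" for s
  proof -
    have "AE x in RN N. u (shift j s N x) - u x - rep N (J s) x = 0"
    proof (rule fundamental_lemma[OF L1_loc_diff[OF L1_loc_diff[OF L1_loc_shift[OF W(1)] W(1)] L2_L1_loc[OF rep_L2]]])
      fix \<psi> assume p: "\<psi> \<in> test_fun N"
      \<comment> \<open>The translation is moved onto the smooth factor, where it can be
        differentiated.\<close>
      have eqA: "(LINT x|RN N. u (shift j s N x) * \<psi> x) = (LINT x|RN N. u x * \<psi> (shift j (- s) N x))" for s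
      proof -
        have "(\<lambda>x. u x * \<psi> (shift j (- s) N x)) \<in> borel_measurable (RN N)"
          using L1_locD[OF W(1)] test_fun_measurable[OF test_fun_shift[OF p]] by simp
        from integral_shift_RN[OF this, of j s] show ?thesis by (simp add: shift_add)
      qed
      have dA: "((\<lambda>s. LINT x|RN N. u x * \<psi> (shift j (- s) N x)) has_real_derivative
          inner (tau j s (cls N h)) (cls N \<psi>)) (at s)" for s
      proof -
        have "((\<lambda>s. LINT x|RN N. u x * \<psi> (shift j (- s) N x)) has_real_derivative
          (LINT x|RN N. u x * partial j \<psi> (shift j (- s) N x)) * (-1)) (at s)"
          by (rule DERIV_chain2[OF shift_deriv(1)[OF p j W(1)]]) (auto intro!: derivative_eq_intros)
        moreover have "(LINT x|RN N. u x * partial j \<psi> (shift j (- s) N x)) = - (LINT x|RN N. h x * \<psi> (shift j (- s) N x))"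
          using W(3)[OF test_fun_shift[OF p, of j "- s"]] by (simp add: partial_shift)
        moreover have "inner (tau j s (cls N h)) (cls N \<psi>) = (LINT x|RN N. h x * \<psi> (shift j (- s) N x))"
          unfolding H.tau_adjoint tau_cls[OF test_fun_L2[OF p]] by (rule inner_cls[OF h test_fun_L2[OF test_fun_shift[OF p]]])
        ultimately show ?thesis by simp
      qed
      have "continuous_on UNIV (\<lambda>r. inner (tau j r (cls N h)) (cls N \<psi>))"
        by (intro continuous_intros tau_continuous)
      then have "(\<lambda>s. LINT x|RN N. u x * \<psi> (shift j (- s) N x)) s - (\<lambda>s. LINT x|RN N. u x * \<psi> (shift j (- s) N x)) 0
          = Iint (\<lambda>r. inner (tau j r (cls N h)) (cls N \<psi>)) s"
        by (rule Iint_unique) (use dA in \<open>simp add: has_real_derivative_iff_has_vector_derivative\<close>)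
      also have "\<dots> = inner (J s) (cls N \<psi>)"
        unfolding J_def by (rule bounded_linear_Iint[OF bounded_linear_inner_left tau_continuous, symmetric])
      also have "\<dots> = (LINT x|RN N. rep N (J s) x * \<psi> x)" by (rule inner_cls_right[OF test_fun_L2[OF p]])
      finally have "(LINT x|RN N. u (shift j s N x) * \<psi> x) - (LINT x|RN N. u x * \<psi> x) = (LINT x|RN N. rep N (J s) x * \<psi> x)"
        by (simp add: eqA)
      then show "(LINT x|RN N. (u (shift j s N x) - u x - rep N (J s) x) * \<psi> x) = 0"
        by (simp add: left_diff_distrib test_fun_integrable L1_loc_shift W(1) p L2_L1_loc rep_L2)
    qed
    then show ?thesis by simp
  qed
  have c: "(\<lambda>x. u (shift j s N x) - u x) \<in> L2 N \<and> cls N (\<lambda>x. u (shift j s N x) - u x) = prj N (J s)" for s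
    unfolding prj_def
    by (rule cls_cong[OF rep_L2 L1_locD[OF L1_loc_diff[OF L1_loc_shift[OF W(1)] W(1)]] ae])
  then show "(\<lambda>x. u (shift j s N x) - u x) \<in> L2 N" by blast
  have "(J has_vector_derivative tau j 0 (cls N h)) (at 0)"
    unfolding J_def by (rule Iint_deriv[OF tau_continuous])
  from bounded_linear.has_vector_derivative[OF prj_bl[of N] this]
  show "((\<lambda>s. cls N (\<lambda>x. u (shift j s N x) - u x)) has_vector_derivative cls N h) (at 0)"
    using c by (simp add: tau_0 prj_cls h)
qed

text \<open>Together with \<open>gen_imp_weak_deriv\<close> this identifies square-integrable weak
  derivatives of L^2 functions with values of the translation generators.\<close>

lemma weak_deriv_imp_gen:
  assumes w: "has_weak_deriv N [j] f h" and f: "f \<in> L2 N" and h: "h \<in> L2 N" and j: "j < N"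
  shows "H.gen j (cls N f) (cls N h)"
proof -
  have sL: "(\<lambda>x. f (shift j s N x)) \<in> L2 N" for s
    using L2_add[OF translate_weak_deriv(1)[OF w h j] f] by simp
  have "tau j s (cls N f) = cls N (\<lambda>x. f (shift j s N x) - f x) + cls N f" for s
    by (simp add: tau_cls f cls_diff[OF sL f])
  then show ?thesis
    using has_vector_derivative_add[OF translate_weak_deriv(2)[OF w h j] has_vector_derivative_const[of "cls N f"]]
    by (simp add: H.gen_def)
qed

section \<open>The wave system of a solution\<close>

lemma continuous_on_iff_norm:
  "continuous_on UNIV (f :: real \<Rightarrow> 'a::real_normed_vector) \<longleftrightarrow> (\<forall>t. ((\<lambda>s. norm (f s - f t)) \<longlongrightarrow> 0) (at t))"
  by (simp add: continuous_on_eq_continuous_at isCont_def tendsto_norm_zero_iff LIM_zero_iff)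

lemma C0_L2_iff: "C0_L2 N u \<longleftrightarrow> (\<forall>t. u t \<in> L2 N) \<and> continuous_on UNIV (\<lambda>t. cls N (u t))"
proof -
  have "L2_norm N (\<lambda>x. u s x - u t x) = norm (cls N (u s) - cls N (u t))" if "\<forall>t. u t \<in> L2 N" for s t
    using that by (simp add: norm_cls[symmetric] L2_diff cls_diff)
  then show ?thesis by (auto simp: C0_L2_def continuous_on_iff_norm)
qed

lemma finite_multi_indices: "finite (multi_indices N k)"
proof (rule finite_subset)
  show "multi_indices N k \<subseteq> {xs. set xs \<subseteq> {..<N} \<and> length xs \<le> k}" by (auto simp: multi_indices_def)
qed (rule finite_lists_length_le, simp)

lemma multi_indices_set: "is \<in> multi_indices N k \<Longrightarrow> set is \<subseteq> {..<N}"
  by (simp add: multi_indices_def)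

lemma L2_norm_weak_deriv_diff:
  assumes "set is \<subseteq> {..<N}" "has_weak_deriv N is u G" "has_weak_deriv N is u' G'" "G \<in> L2 N" "G' \<in> L2 N"
  shows "L2_norm N (weak_deriv N is (\<lambda>x. u x - u' x)) = norm (cls N G - cls N G')"
proof -
  have w: "has_weak_deriv N is (\<lambda>x. u x - u' x) (\<lambda>x. G x - G' x)"
    using has_weak_deriv_diff assms by blast
  note c = weak_deriv_cls[OF w L2_diff[OF assms(4,5)]]
  show ?thesis using norm_cls[OF c(1)] c(2) by (simp add: cls_diff assms)
qed

text \<open>Continuity in the Sobolev norm is reduced to continuity in the Hilbert space of the
  classes of finitely many derivatives; \<open>C0_SobD\<close> is the way back.\<close>

lemma C0_SobI:
  assumes u: "\<And>t. u t \<in> L2 N"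
    and G: "\<And>is. is \<in> multi_indices N k \<Longrightarrow>
      \<exists>G. (\<forall>t. G t \<in> L2 N \<and> has_weak_deriv N is (u t) (G t)) \<and> continuous_on UNIV (\<lambda>t. cls N (G t))"
  shows "C0_Sob N k u"
  unfolding C0_Sob_def
proof (intro conjI allI)
  show "u t \<in> Sob N k" for t using u G unfolding Sob_def by blast
  fix t
  have "((\<lambda>s. sqrt (\<Sum>is\<in>multi_indices N k. (L2_norm N (weak_deriv N is (\<lambda>x. u s x - u t x)))\<^sup>2)) \<longlongrightarrow>
      sqrt (\<Sum>is\<in>multi_indices N k. 0\<^sup>2)) (at t)"
  proof (intro tendsto_real_sqrt tendsto_sum tendsto_power)
    fix "is" assume "is": "is \<in> multi_indices N k"
    then obtain H where H: "\<And>t. H t \<in> L2 N" "\<And>t. has_weak_deriv N is (u t) (H t)"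
      and c: "continuous_on UNIV (\<lambda>t. cls N (H t))"
      using G by blast
    show "((\<lambda>s. L2_norm N (weak_deriv N is (\<lambda>x. u s x - u t x))) \<longlongrightarrow> 0) (at t)"
      unfolding L2_norm_weak_deriv_diff[OF multi_indices_set[OF "is"] H(2) H(2) H(1) H(1)]
      using c by (simp add: continuous_on_iff_norm)
  qed
  then show "((\<lambda>s. Sob_norm N k (\<lambda>x. u s x - u t x)) \<longlongrightarrow> 0) (at t)" by (simp add: Sob_norm_def)
qed

lemma C0_SobD:
  assumes u: "C0_Sob N k u" and "is": "is \<in> multi_indices N k"
    and G: "\<And>t. G t \<in> L2 N" "\<And>t. has_weak_deriv N is (u t) (G t)"
  shows "continuous_on UNIV (\<lambda>t. cls N (G t))"
  unfolding continuous_on_iff_norm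
proof
  fix t
  have le: "norm (norm (cls N (G s) - cls N (G t))) \<le> Sob_norm N k (\<lambda>x. u s x - u t x)" for s
  proof -
    have "norm (cls N (G s) - cls N (G t)) = L2_norm N (weak_deriv N is (\<lambda>x. u s x - u t x))"
      by (rule L2_norm_weak_deriv_diff[OF multi_indices_set[OF "is"] G(2) G(2) G(1) G(1), symmetric])
    also have "\<dots> = sqrt ((L2_norm N (weak_deriv N is (\<lambda>x. u s x - u t x)))\<^sup>2)"
      by (simp add: L2_norm_def)
    also have "\<dots> \<le> Sob_norm N k (\<lambda>x. u s x - u t x)"
      unfolding Sob_norm_def
      by (intro real_sqrt_le_mono member_le_sum "is" finite_multi_indices) simp
    finally show ?thesis by simp
  qed
  have lim: "((\<lambda>s. Sob_norm N k (\<lambda>x. u s x - u t x)) \<longlongrightarrow> 0) (at t)" using u by (simp add: C0_Sob_def)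
  show "((\<lambda>s. norm (cls N (G s) - cls N (G t))) \<longlongrightarrow> 0) (at t)"
    by (rule Lim_null_comparison[OF always_eventually[OF allI[OF le]] lim])
qed

lemma L2_difference_quotient:
  assumes d: "\<And>s t. (\<lambda>x. u s x - u t x) \<in> L2 N" and u': "u' \<in> L2 N"
  shows "norm ((cls N (\<lambda>x. u s x - u r x) - cls N (\<lambda>x. u t x - u r x)) /\<^sub>R (s - t) - cls N u')
     = L2_norm N (\<lambda>x. (u s x - u t x) / (s - t) - u' x)"
proof -
  have "cls N (\<lambda>x. u s x - u r x) - cls N (\<lambda>x. u t x - u r x) = cls N (\<lambda>x. u s x - u t x)"
    unfolding cls_diff[OF d d, symmetric] by simp
  moreover have "cls N (\<lambda>x. u s x - u t x) /\<^sub>R (s - t) - cls N u' = cls N (\<lambda>x. inverse (s - t) * (u s x - u t x) - u' x)"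
    by (simp only: cls_diff[OF L2_scale[OF d] u'] cls_scale[OF d d])
  ultimately show ?thesis
    by (simp add: norm_cls[OF L2_diff[OF L2_scale[OF d] u']] divide_inverse mult.commute)
qed

text \<open>Subtracting the state at a fixed time r yields a curve in L^2 and leaves the quotients
  unchanged, so the time derivative becomes an ordinary vector derivative.\<close>

lemma has_time_deriv_iff:
  "has_time_deriv N u u' \<longleftrightarrow> (\<forall>s t. (\<lambda>x. u s x - u t x) \<in> L2 N) \<and> (\<forall>t. u' t \<in> L2 N) \<and>
     (\<forall>t. ((\<lambda>s. cls N (\<lambda>x. u s x - u r x)) has_vector_derivative cls N (u' t)) (at t))"
  unfolding has_time_deriv_def
proof (intro conj_cong refl)
  assume "\<forall>s t. (\<lambda>x. u s x - u t x) \<in> L2 N" "\<forall>t. u' t \<in> L2 N"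
  then have d: "(\<lambda>x. u s x - u t x) \<in> L2 N" and u': "u' t \<in> L2 N" for s t by auto
  have "((\<lambda>s. L2_norm N (\<lambda>x. (u s x - u t x) / (s - t) - u' t x)) \<longlongrightarrow> 0) (at t) \<longleftrightarrow>
      ((\<lambda>s. cls N (\<lambda>x. u s x - u r x)) has_vector_derivative cls N (u' t)) (at t)" for t
  proof -
    have e: "norm ((cls N (\<lambda>x. u s x - u r x) - cls N (\<lambda>x. u t x - u r x)) /\<^sub>R (s - t) - cls N (u' t))
      = L2_norm N (\<lambda>x. (u s x - u t x) / (s - t) - u' t x)" for s
      by (rule L2_difference_quotient[OF d u'])
    show ?thesis
      unfolding has_vector_derivative_iff_quotient e[symmetric] by (simp only: tendsto_norm_zero_iff LIM_zero_iff)
  qed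
  then show "(\<forall>t. ((\<lambda>s. L2_norm N (\<lambda>x. (u s x - u t x) / (s - t) - u' t x)) \<longlongrightarrow> 0) (at t)) \<longleftrightarrow>
      (\<forall>t. ((\<lambda>s. cls N (\<lambda>x. u s x - u r x)) has_vector_derivative cls N (u' t)) (at t))" by simp
qed

lemma has_time_derivD:
  assumes "has_time_deriv N u u'"
  shows "(\<lambda>x. u s x - u t x) \<in> L2 N" "u' t \<in> L2 N"
    "((\<lambda>s. cls N (\<lambda>x. u s x - u r x)) has_vector_derivative cls N (u' t)) (at t)"
  using assms by (simp_all add: has_time_deriv_iff[of N u u' r])

section \<open>Testing in the time variable\<close>

lemma deriv_zero_outside:
  fixes h :: "real \<Rightarrow> real"
  assumes h: "\<And>s. \<bar>s\<bar> > S \<Longrightarrow> h s = 0" and s: "\<bar>s\<bar> > S"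
  shows "deriv h s = 0"
proof -
  have "open {s. \<bar>s\<bar> > S}" by (intro open_Collect_less continuous_intros)
  then have "eventually (\<lambda>s. s \<in> {s. \<bar>s\<bar> > S}) (nhds s)" using s by (intro eventually_nhds_in_open) auto
  then have "eventually (\<lambda>s. h s = 0) (nhds s)" by (rule eventually_mono) (simp add: h)
  then have "deriv h s = deriv (\<lambda>_. 0) s" by (rule deriv_cong_ev) simp
  then show ?thesis by simp
qed

lemma compact_support_integral:
  fixes f :: "real \<Rightarrow> real"
  assumes f: "continuous_on UNIV f" and z: "\<And>t. \<bar>t\<bar> > R \<Longrightarrow> f t = 0"
  shows "integrable lborel f" and "\<bar>R\<bar> \<le> S \<Longrightarrow> (LINT t|lborel. f t) = integral {-S..S} f"
proof -
  have eq: "f = (\<lambda>x. indicator {-S..S} x *\<^sub>R f x)" if "\<bar>R\<bar> \<le> S" for S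
  proof
    show "f x = indicator {-S..S} x *\<^sub>R f x" for x
      using z[of x] that by (cases "\<bar>x\<bar> > R") (auto simp: indicator_def abs_le_iff)
  qed
  have si: "set_integrable lborel {-S..S} f" for S
    by (rule borel_integrable_atLeastAtMost'[OF continuous_on_subset[OF f]]) simp
  show "integrable lborel f" using si[of "\<bar>R\<bar>"] eq[of "\<bar>R\<bar>"] by (simp add: set_integrable_def)
  show "(LINT t|lborel. f t) = integral {-S..S} f" if "\<bar>R\<bar> \<le> S"
    using set_borel_integral_eq_integral(2)[OF si, of S] eq[OF that] by (simp add: set_lebesgue_integral_def)
qed

lemma compact_support_integral_deriv:
  fixes q :: "real \<Rightarrow> real"
  assumes q: "\<And>t. (q has_real_derivative q' t) (at t)" and c: "continuous_on UNIV q'"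
    and z: "\<And>t. \<bar>t\<bar> > R \<Longrightarrow> q t = 0"
  shows "(LINT t|lborel. q' t) = 0"
proof -
  have z': "q' t = 0" if "\<bar>t\<bar> > R" for t
    using deriv_zero_outside[OF z that] DERIV_imp_deriv[OF q, of t] by simp
  define S where "S = \<bar>R\<bar> + 1"
  have "(q' has_integral (q S - q (- S))) {-S..S}"
  proof (rule fundamental_theorem_of_calculus)
    show "(q has_vector_derivative q' x) (at x within {-S..S})" for x
      using q[of x] by (auto simp: has_real_derivative_iff_has_vector_derivative intro: has_vector_derivative_at_within)
  qed (simp add: S_def)
  then have "integral {-S..S} q' = q S - q (- S)" by (rule integral_unique)
  moreover have "\<bar>S\<bar> > R" "\<bar>- S\<bar> > R" unfolding S_def by (simp_all add: abs_if)
  then have "q S = 0" "q (- S) = 0" using z[of S] z[of "- S"] by (simp_all del: abs_minus_cancel)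
  moreover have "(LINT t|lborel. q' t) = integral {-S..S} q'"
    by (rule compact_support_integral(2)[OF c z']) (assumption, unfold S_def, linarith)
  ultimately show ?thesis by simp
qed

lemma bump_pos: "s \<in> {a<..<b} \<Longrightarrow> bump 1 a b s > 0"
  by (simp add: bump_def flat_def)

lemma smooth1_continuous: "smooth1 f \<Longrightarrow> continuous_on A f"
  by (rule continuous_at_imp_continuous_on) (simp add: DERIV_isCont[OF smooth1_DERIV])

text \<open>An antiderivative of a bump minus its translate by r has compact support. Testing with
  it shows that m and its translate have equal integrals against the bump, which by continuity
  forces them to agree.\<close>

lemma du_Bois_Reymond:
  fixes m :: "real \<Rightarrow> real"
  assumes m: "continuous_on UNIV m"
    and orth: "\<And>\<theta> S. smooth1 \<theta> \<Longrightarrow> (\<And>s. \<bar>s\<bar> > S \<Longrightarrow> \<theta> s = 0) \<Longrightarrow> (LINT t|lborel. deriv \<theta> t * m t) = 0"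
  shows "m t = m 0"
proof -
  have "m c = m (c + r)" for c r
  proof (rule ccontr)
    define k where "k t = m t - m (t + r)" for t
    have ck: "continuous_on UNIV k"
      unfolding k_def by (intro continuous_intros m continuous_on_compose2[OF m]) auto
    assume "m c \<noteq> m (c + r)"
    then have kc: "k c \<noteq> 0" by (simp add: k_def)
    \<comment> \<open>The sign makes e k positive near c, so a bump concentrated there would have a
      positive integral against it.\<close>
    define e where "e = sgn (k c)"
    have "e * k c > 0" using kc by (simp add: e_def sgn_mult_self_eq abs_sgn[symmetric] mult.commute)
    moreover have "isCont (\<lambda>t. e * k t) c"
      using ck by (intro isCont_mult continuous_const) (simp add: continuous_on_eq_continuous_at)
    ultimately have "eventually (\<lambda>t. e * k t > 0) (at c)"
      by (auto simp: isCont_def intro: order_tendstoD)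
    then obtain \<delta> where \<delta>: "\<delta> > 0" "\<And>t. t \<noteq> c \<Longrightarrow> dist t c < \<delta> \<Longrightarrow> e * k t > 0"
      unfolding eventually_at by auto
    have kpos: "e * k t > 0" if "t \<in> {c - \<delta><..<c + \<delta>}" for t
      using \<delta>(2)[of t] \<open>e * k c > 0\<close> that by (cases "t = c") (auto simp: dist_real_def)
    define \<rho> where "\<rho> = bump 1 (c - \<delta>) (c + \<delta>)"
    have \<rho>: "smooth1 \<rho>" "continuous_on A \<rho>" for A 
    proof -
      show "smooth1 \<rho>" unfolding \<rho>_def by (rule smooth1_bump)
      then show "continuous_on A \<rho>" by (rule smooth1_continuous)
    qed
    have \<rho>0: "\<rho> t = 0" if "t \<notin> {c - \<delta><..<c + \<delta>}" for t unfolding \<rho>_def by (rule bump_outside) (use that in auto)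
    define \<theta> where "\<theta> t = Iint \<rho> t - Iint \<rho> (t - r)" for t
    have d: "(\<theta> has_real_derivative \<rho> t - \<rho> (t - r)) (at t)" for t
      unfolding \<theta>_def
    proof (rule DERIV_diff[OF Iint_deriv_real[OF \<rho>(2)]])
      have "((\<lambda>t. Iint \<rho> (t - r)) has_real_derivative \<rho> (t - r) * 1) (at t)"
        by (rule DERIV_chain2[OF Iint_deriv_real[OF \<rho>(2)]]) (auto intro!: derivative_eq_intros)
      then show "((\<lambda>t. Iint \<rho> (t - r)) has_real_derivative \<rho> (t - r)) (at t)" by simp
    qed
    have dt: "deriv \<theta> t = \<rho> t - \<rho> (t - r)" for t by (rule DERIV_imp_deriv[OF d])
    have "smooth1 (\<lambda>t. \<rho> t + (- 1) * \<rho> (1 * t + (- r)))"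
      by (intro smooth1_add smooth1_mult smooth1_const smooth1_affine \<rho>)
    then have "smooth1 (\<lambda>t. \<rho> t - \<rho> (t - r))" by simp
    then have sm: "smooth1 \<theta>" by (rule smooth1_primitive) (rule d)
    \<comment> \<open>By the mean value theorem \<open>\<theta> t\<close> is r times a value of
      \<open>\<rho>\<close> between t - r and t, where \<open>\<rho>\<close> vanishes.\<close>
    have van: "\<theta> t = 0" if t: "\<bar>t\<bar> > \<bar>c\<bar> + \<delta> + \<bar>r\<bar>" for t
    proof -
      obtain \<xi> where \<xi>: "Iint \<rho> t - Iint \<rho> (t - r) = \<rho> \<xi> * (t - (t - r))" "min (t - r) t \<le> \<xi>" "\<xi> \<le> max (t - r) t"
        using MVT_between[OF Iint_deriv_real[OF \<rho>(2)], of t "t - r"] by blast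
      have "\<bar>\<xi> - c\<bar> \<ge> \<delta>" using \<xi>(2,3) t by (auto simp: min_def max_def abs_if split: if_splits)
      then have "\<rho> \<xi> = 0" by (intro \<rho>0) (auto simp: abs_if split: if_splits)
      then show ?thesis using \<xi>(1) by (simp add: \<theta>_def)
    qed
    have c1: "continuous_on UNIV (\<lambda>t. \<rho> t * m t)" "continuous_on UNIV (\<lambda>t. \<rho> (t - r) * m t)"
      "continuous_on UNIV (\<lambda>t. \<rho> t * (e * k t))" "continuous_on UNIV (\<lambda>t. \<rho> t * m (t + r))"
    proof -
      have "continuous_on UNIV (\<lambda>t. \<rho> (t - r))"
        by (rule continuous_on_compose2[OF \<rho>(2)[of UNIV]]) (auto intro!: continuous_intros)
      moreover have "continuous_on UNIV (\<lambda>t. m (t + r))"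
        by (rule continuous_on_compose2[OF m]) (auto intro!: continuous_intros)
      ultimately show "continuous_on UNIV (\<lambda>t. \<rho> t * m t)" "continuous_on UNIV (\<lambda>t. \<rho> (t - r) * m t)"
        "continuous_on UNIV (\<lambda>t. \<rho> t * (e * k t))" "continuous_on UNIV (\<lambda>t. \<rho> t * m (t + r))"
        using \<rho>(2)[of UNIV] m ck by (auto intro!: continuous_on_mult continuous_on_const)
    qed
    have far: "\<rho> t = 0" "\<rho> (t - r) = 0" if "\<bar>t\<bar> > \<bar>c\<bar> + \<delta> + \<bar>r\<bar>" for t
      using that by (auto intro!: \<rho>0 simp: abs_if split: if_splits)
    note i1 = compact_support_integral(1)[OF c1(1), of "\<bar>c\<bar> + \<delta> + \<bar>r\<bar>"]
    note i2 = compact_support_integral(1)[OF c1(2), of "\<bar>c\<bar> + \<delta> + \<bar>r\<bar>"]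
    note i3 = compact_support_integral(1)[OF c1(3), of "\<bar>c\<bar> + \<delta> + \<bar>r\<bar>"]
    note i4 = compact_support_integral(1)[OF c1(4), of "\<bar>c\<bar> + \<delta> + \<bar>r\<bar>"]
    have "(LINT t|lborel. deriv \<theta> t * m t) = (LINT t|lborel. \<rho> t * m t) - (LINT t|lborel. \<rho> (t - r) * m t)"
      unfolding dt left_diff_distrib by (rule Bochner_Integration.integral_diff[OF i1 i2]) (simp_all add: far)
    also have "(LINT t|lborel. \<rho> (t - r) * m t) = (LINT t|lborel. \<rho> t * m (t + r))"
      using lborel_integral_real_affine[of 1 "\<lambda>t. \<rho> (t - r) * m t" r] by (simp add: add.commute)
    also have "(LINT t|lborel. \<rho> t * m t) - (LINT t|lborel. \<rho> t * m (t + r)) = (LINT t|lborel. \<rho> t * k t)"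
      unfolding k_def right_diff_distrib
      by (rule Bochner_Integration.integral_diff[symmetric, OF i1 i4]) (simp_all add: far)
    finally have "(LINT t|lborel. \<rho> t * k t) = 0" using orth[OF sm van] by simp
    then have "(LINT t|lborel. e * (\<rho> t * k t)) = 0" by simp
    then have z: "(LINT t|lborel. \<rho> t * (e * k t)) = 0" by (simp add: mult.left_commute)
    have nn: "0 \<le> \<rho> t * (e * k t)" for t
      using kpos[of t] \<rho>0[of t] bump_bounds(1)[of 1 "c - \<delta>" "c + \<delta>" t] unfolding \<rho>_def
      by (cases "t \<in> {c - \<delta><..<c + \<delta>}") auto
    have "AE t in lborel. \<rho> t * (e * k t) = 0"
      using integral_nonneg_eq_0_iff_AE[OF i3] nn z far by auto
    then have "AE t in lborel. t \<notin> {c - \<delta><..<c + \<delta>}"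
    proof (rule AE_mp, intro AE_I2 impI notI)
      fix t assume "\<rho> t * (e * k t) = 0" "t \<in> {c - \<delta><..<c + \<delta>}"
      then show False using kpos[of t] bump_pos[of t "c - \<delta>" "c + \<delta>"] by (auto simp: \<rho>_def)
    qed
    then have "emeasure lborel {c - \<delta><..<c + \<delta>} = 0"
      by (subst (asm) AE_iff_measurable[where N="{c - \<delta><..<c + \<delta>}"]) auto
    then show False using \<delta>(1) by simp
  qed
  from this[of t "- t"] show ?thesis by simp
qed

lemma Sob_0_L2: "Sob N 0 \<subseteq> L2 N" "Sob N k \<subseteq> L2 N"
  by (auto simp: Sob_def)

lemma Sob_deriv:
  assumes "g \<in> Sob N (Suc k)" "i < N"
  obtains h where "h \<in> L2 N" "has_weak_deriv N [i] g h"
proof -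
  have "[i] \<in> multi_indices N (Suc k)" using assms(2) by (simp add: multi_indices_def)
  then show ?thesis using assms(1) that unfolding Sob_def by blast
qed

lemma abs_sin_diff_le: "\<bar>sin a - sin b\<bar> \<le> \<bar>a - b :: real\<bar>"
proof -
  obtain \<xi> where "sin a - sin b = cos \<xi> * (a - b)" using MVT_between[of sin cos a b] DERIV_sin by blast
  then show ?thesis using mult_right_mono[OF abs_cos_le_one abs_ge_zero, of \<xi> "a - b"] by (simp add: abs_mult)
qed

lemma abs_cos_diff_le: "\<bar>cos a - cos b\<bar> \<le> \<bar>a - b :: real\<bar>"
proof -
  obtain \<xi> where "cos a - cos b = - sin \<xi> * (a - b)" using MVT_between[of cos "\<lambda>x. - sin x" a b] DERIV_cos by blast
  then show ?thesis using mult_right_mono[OF abs_sin_le_one abs_ge_zero, of \<xi> "a - b"] by (simp add: abs_mult)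
qed

lemma L2_sin_perturbed:
  assumes s: "(\<lambda>x. sin (\<phi>0 x)) \<in> L2 N" and m: "\<phi>0 \<in> borel_measurable (RN N)" "u \<in> borel_measurable (RN N)"
    and d: "(\<lambda>x. u x - \<phi>0 x) \<in> L2 N"
  shows "(\<lambda>x. sin (u x)) \<in> L2 N"
proof (rule L2_bound[OF L2_add[OF _ _]])
  show "(\<lambda>x. \<bar>sin (\<phi>0 x)\<bar>) \<in> L2 N" by (rule L2_bound[OF s]) (use m in auto)
  show "(\<lambda>x. \<bar>u x - \<phi>0 x\<bar>) \<in> L2 N" by (rule L2_bound[OF d]) (use m in auto)
  show "(\<lambda>x. sin (u x)) \<in> borel_measurable (RN N)" using m by measurable
  show "\<bar>sin (u x)\<bar> \<le> \<bar>\<bar>sin (\<phi>0 x)\<bar> + \<bar>u x - \<phi>0 x\<bar>\<bar>" for x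
    using abs_sin_diff_le[of "u x" "\<phi>0 x"] by linarith
qed

text \<open>sin (2 u) = 2 sin u cos u is at most 2 |sin u| in absolute value.\<close>

lemma L2_sin_double:
  assumes s: "(\<lambda>x. sin (u x)) \<in> L2 N" and m: "u \<in> borel_measurable (RN N)"
  shows "(\<lambda>x. - \<sigma> / 2 * sin (2 * u x)) \<in> L2 N"
proof (rule L2_bound[OF L2_scale[OF s, of "\<sigma>"]])
  show "(\<lambda>x. - \<sigma> / 2 * sin (2 * u x)) \<in> borel_measurable (RN N)" using m by measurable
  show "\<bar>- \<sigma> / 2 * sin (2 * u x)\<bar> \<le> \<bar>\<sigma> * sin (u x)\<bar>" for x
  proof -
    have "\<bar>\<sigma> * sin (u x)\<bar> * \<bar>cos (u x)\<bar> \<le> \<bar>\<sigma> * sin (u x)\<bar> * 1" by (intro mult_left_mono) auto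
    then show ?thesis by (simp add: sin_double abs_mult mult.assoc)
  qed
qed

lemma Hsin_weak_deriv:
  assumes "\<phi>0 \<in> Hsin N 1" "i < N"
  shows "weak_deriv N [i] \<phi>0 \<in> L2 N" "has_weak_deriv N [i] \<phi>0 (weak_deriv N [i] \<phi>0)"
proof -
  obtain g where g: "g \<in> L2 N" "has_weak_deriv N [i] \<phi>0 g"
    using assms Sob_0_L2(1) by (fastforce simp: Hsin_def)
  show "weak_deriv N [i] \<phi>0 \<in> L2 N" "has_weak_deriv N [i] \<phi>0 (weak_deriv N [i] \<phi>0)"
    using weak_deriv_cls[OF g(2,1)] weak_deriv_spec[OF g(2)] by auto
qed

section \<open>The first-order system of a given solution\<close>

locale SG =
  fixes N :: nat and \<sigma> :: real and \<phi>0 \<phi>1 :: "point \<Rightarrow> real" and \<phi> \<phi>t :: "real \<Rightarrow> point \<Rightarrow> real"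
  assumes sol: "SG_solution N \<sigma> \<phi>0 \<phi>1 \<phi> \<phi>t" and d0: "\<phi>0 \<in> Hsin N 1" and d1: "\<phi>1 \<in> L2 N"
begin

lemma sol_parts:
  "C0_Sob N 1 (\<lambda>t x. \<phi> t x - \<phi>0 x)" "has_time_deriv N \<phi> \<phi>t" "C0_L2 N \<phi>t" "sine_Gordon N \<sigma> \<phi>"
  "AE x in RN N. \<phi> 0 x = \<phi>0 x" "AE x in RN N. \<phi>t 0 x = \<phi>1 x"
  using sol by (auto simp: SG_solution_def)

lemma D_Sob: "(\<lambda>x. \<phi> t x - \<phi>0 x) \<in> Sob N 1"
  using sol_parts(1) by (simp add: C0_Sob_def)

lemma D_L2: "(\<lambda>x. \<phi> t x - \<phi>0 x) \<in> L2 N"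
  using D_Sob Sob_0_L2 by blast

lemma phi0: "\<phi>0 \<in> L1_loc N" "(\<lambda>x. sin (\<phi>0 x)) \<in> L2 N"
  using d0 by (auto simp: Hsin_def)

definition G0 where "G0 i = weak_deriv N [i] \<phi>0"

lemma G0: "i < N \<Longrightarrow> G0 i \<in> L2 N" "i < N \<Longrightarrow> has_weak_deriv N [i] \<phi>0 (G0 i)"
  by (simp_all add: G0_def Hsin_weak_deriv[OF d0])

lemma phi_L1: "\<phi> t \<in> L1_loc N"
  using L1_loc_add[OF L2_L1_loc[OF D_L2] phi0(1), of t] by simp

definition P where "P i t = weak_deriv N [i] (\<phi> t)"

lemma P:
  assumes i: "i < N"
  shows P_L2: "P i t \<in> L2 N" and P_wd: "has_weak_deriv N [i] (\<phi> t) (P i t)"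
proof -
  obtain h where h: "h \<in> L2 N" "has_weak_deriv N [i] (\<lambda>x. \<phi> t x - \<phi>0 x) h"
    using Sob_deriv[of "\<lambda>x. \<phi> t x - \<phi>0 x" N 0 i] D_Sob i by auto
  have "has_weak_deriv N [i] (\<lambda>x. \<phi> t x - \<phi>0 x + \<phi>0 x) (\<lambda>x. h x + G0 i x)"
    by (rule has_weak_deriv_add[OF _ h(2) G0(2)[OF i]]) (use i in simp)
  then have w: "has_weak_deriv N [i] (\<phi> t) (\<lambda>x. h x + G0 i x)" by simp
  show "P i t \<in> L2 N" "has_weak_deriv N [i] (\<phi> t) (P i t)"
    unfolding P_def using weak_deriv_cls[OF w L2_add[OF h(1) G0(1)[OF i]]] weak_deriv_spec[OF w] by auto
qed

definition p where "p i t = cls N (P i t)"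
definition v where "v t = cls N (\<phi>t t)"
definition w where "w t = cls N (\<lambda>x. \<phi> t x - \<phi> 0 x)"

lemma phit_L2: "\<phi>t t \<in> L2 N"
  by (rule has_time_derivD(2)[OF sol_parts(2)])

lemma dphi_L2: "(\<lambda>x. \<phi> s x - \<phi> t x) \<in> L2 N"
  by (rule has_time_derivD(1)[OF sol_parts(2)])

lemma phi_measurable: "\<phi> t \<in> borel_measurable (RN N)"
  by (rule L1_locD[OF phi_L1])

lemma dphi_deriv: "((\<lambda>s. cls N (\<lambda>x. \<phi> s x - \<phi> r x)) has_vector_derivative v t) (at t)"
  unfolding v_def by (rule has_time_derivD(3)[OF sol_parts(2)])

lemma v_cont: "continuous_on UNIV v"
  using sol_parts(3) unfolding C0_L2_iff v_def by blast

lemma w_deriv: "(w has_vector_derivative v t) (at t)"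
  unfolding w_def by (rule dphi_deriv)

lemma w_eq: "w t = Iint v t"
proof -
  have "w t - w 0 = Iint v t" by (rule Iint_unique[OF v_cont w_deriv])
  then show ?thesis by (simp add: w_def cls_0)
qed

lemma p_cont:
  assumes i: "i < N"
  shows "continuous_on UNIV (p i)"
proof -
  have "continuous_on UNIV (\<lambda>t. cls N (\<lambda>x. P i t x - G0 i x))"
    by (rule C0_SobD[OF sol_parts(1), of "[i]"])
      (use i in \<open>auto simp: multi_indices_def intro!: L2_diff P_L2 G0 has_weak_deriv_diff P_wd\<close>)
  then have "continuous_on UNIV (\<lambda>t. cls N (\<lambda>x. P i t x - G0 i x) + cls N (G0 i))"
    by (intro continuous_on_add continuous_on_const)
  then show ?thesis by (simp add: p_def[abs_def] cls_diff P_L2 G0 i)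
qed

lemma sin_phi_L2: "(\<lambda>x. sin (\<phi> t x)) \<in> L2 N"
  by (rule L2_sin_perturbed[OF phi0(2) L1_locD[OF phi0(1)] phi_measurable D_L2])

definition Fn where "Fn t x = - \<sigma> / 2 * sin (2 * \<phi> t x)"
definition f where "f t = cls N (Fn t)"

lemma Fn_L2: "Fn t \<in> L2 N"
  unfolding Fn_def[abs_def] by (rule L2_sin_double[OF sin_phi_L2 phi_measurable])

text \<open>Adding the fixed vector for g (\<phi> t) back to the increments of
  \<open>Nemytskii_deriv\<close> gives the derivative of the curve itself.\<close>

lemma Nem:
  assumes "\<And>r. (g has_real_derivative g' r) (at r)" "g \<in> borel_measurable borel" "g' \<in> borel_measurable borel"
    "\<And>r. \<bar>g' r\<bar> \<le> B" "\<And>a b. \<bar>g' a - g' b\<bar> \<le> B * \<bar>a - b\<bar>" and L: "\<And>t. (\<lambda>x. g (\<phi> t x)) \<in> L2 N"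
  shows "((\<lambda>s. cls N (\<lambda>x. g (\<phi> s x))) has_vector_derivative cls N (\<lambda>x. g' (\<phi> t x) * \<phi>t t x)) (at t)"
proof -
  have "((\<lambda>s. cls N (\<lambda>x. g (\<phi> s x) - g (\<phi> t x)) + cls N (\<lambda>x. g (\<phi> t x))) has_vector_derivative
      cls N (\<lambda>x. g' (\<phi> t x) * \<phi>t t x) + 0) (at t)"
    by (intro has_vector_derivative_add has_vector_derivative_const
        Nemytskii_deriv(1)[OF phi_measurable dphi_L2 phit_L2 dphi_deriv[unfolded v_def] assms(1-5)])
  then show ?thesis by (simp add: cls_diff[OF L L])
qed

text \<open>A single constant serves as bound and as Lipschitz constant of the derivative, the form
  in which \<open>Nemytskii_deriv\<close> takes it.\<close>

lemma sin_deriv_facts: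
  fixes c k :: real
  shows "((\<lambda>r. c * sin (k * r)) has_real_derivative c * k * cos (k * r)) (at r)"
    "\<bar>c * k * cos (k * r)\<bar> \<le> (\<bar>c * k\<bar> + \<bar>c * k * k\<bar>)"
    "\<bar>c * k * cos (k * a) - c * k * cos (k * b)\<bar> \<le> (\<bar>c * k\<bar> + \<bar>c * k * k\<bar>) * \<bar>a - b\<bar>"
proof -
  show "((\<lambda>r. c * sin (k * r)) has_real_derivative c * k * cos (k * r)) (at r)"
    by (auto intro!: derivative_eq_intros)
  have "\<bar>c * k\<bar> * \<bar>cos (k * r)\<bar> \<le> \<bar>c * k\<bar> * 1" by (intro mult_left_mono) auto
  moreover have "\<bar>c * k * cos (k * r)\<bar> = \<bar>c * k\<bar> * \<bar>cos (k * r)\<bar>" by (rule abs_mult)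
  ultimately show "\<bar>c * k * cos (k * r)\<bar> \<le> (\<bar>c * k\<bar> + \<bar>c * k * k\<bar>)" by linarith
  have d: "((\<lambda>r. c * k * cos (k * r)) has_real_derivative - (c * k * k * sin (k * r))) (at r)" for r
    by (auto intro!: derivative_eq_intros)
  obtain \<xi> where "c * k * cos (k * a) - c * k * cos (k * b) = - (c * k * k * sin (k * \<xi>)) * (a - b)"
    using MVT_between[OF d, of a b] by blast
  then have "\<bar>c * k * cos (k * a) - c * k * cos (k * b)\<bar> = \<bar>c * k * k\<bar> * \<bar>sin (k * \<xi>)\<bar> * \<bar>a - b\<bar>" by (simp add: abs_mult)
  also have "\<dots> \<le> (\<bar>c * k\<bar> + \<bar>c * k * k\<bar>) * \<bar>a - b\<bar>"
  proof (rule mult_right_mono)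
    have "\<bar>c * k * k\<bar> * \<bar>sin (k * \<xi>)\<bar> \<le> \<bar>c * k * k\<bar> * 1" by (intro mult_left_mono) auto
    then show "\<bar>c * k * k\<bar> * \<bar>sin (k * \<xi>)\<bar> \<le> \<bar>c * k\<bar> + \<bar>c * k * k\<bar>" by linarith
  qed simp
  finally show "\<bar>c * k * cos (k * a) - c * k * cos (k * b)\<bar> \<le> (\<bar>c * k\<bar> + \<bar>c * k * k\<bar>) * \<bar>a - b\<bar>" .
qed

lemma f_deriv: "(f has_vector_derivative cls N (\<lambda>x. - \<sigma> * cos (2 * \<phi> t x) * \<phi>t t x)) (at t)"
proof -
  note s = sin_deriv_facts[of "- \<sigma> / 2" 2]
  have "((\<lambda>s. cls N (\<lambda>x. - \<sigma> / 2 * sin (2 * \<phi> s x))) has_vector_derivative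
      cls N (\<lambda>x. - \<sigma> / 2 * 2 * cos (2 * \<phi> t x) * \<phi>t t x)) (at t)"
    by (rule Nem[OF s(1) _ _ s(2,3)]) (measurable, use Fn_L2 in \<open>simp add: Fn_def[abs_def]\<close>)
  then show ?thesis by (simp add: f_def[abs_def] Fn_def[abs_def])
qed

lemma f_cont: "continuous_on UNIV f"
  by (rule deriv_imp_continuous[OF f_deriv])

lemma phi_test_deriv:
  assumes "\<psi> \<in> test_fun N"
  shows "((\<lambda>t. LINT x|RN N. \<phi> t x * \<psi> x) has_real_derivative inner (v t) (cls N \<psi>)) (at t)"
proof -
  have "(LINT x|RN N. \<phi> s x * \<psi> x) = inner (w s) (cls N \<psi>) + (LINT x|RN N. \<phi> 0 x * \<psi> x)" for s
    by (simp add: w_def inner_cls dphi_L2 test_fun_L2 assms left_diff_distrib test_fun_integrable phi_L1)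
  then have e: "(\<lambda>s. LINT x|RN N. \<phi> s x * \<psi> x) = (\<lambda>s. inner (w s) (cls N \<psi>) + (LINT x|RN N. \<phi> 0 x * \<psi> x))"
    by (rule ext)
  have "((\<lambda>s. inner (w s) (cls N \<psi>) + (LINT x|RN N. \<phi> 0 x * \<psi> x)) has_vector_derivative inner (v t) (cls N \<psi>) + 0) (at t)"
    by (intro has_vector_derivative_add has_vector_derivative_const
        bounded_linear.has_vector_derivative[OF bounded_linear_inner_left] w_deriv)
  then show ?thesis unfolding e has_real_derivative_iff_has_vector_derivative by simp
qed

text \<open>Testing with tensor products of \<open>\<psi>\<close> and a function of time turns the
  equation into a'' = B in the sense of distributions, where a is the pairing of \<phi> with \<psi>;
  \<open>du_Bois_Reymond\<close> integrates this once.\<close>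

lemma weak_equation:
  assumes \<psi>: "\<psi> \<in> test_fun N"
  shows "inner (v t) (cls N \<psi>) - inner (v 0) (cls N \<psi>) =
    Iint (\<lambda>s. inner (f s) (cls N \<psi>) - (\<Sum>i<N. inner (p i s) (cls N (partial i \<psi>)))) t"
proof -
  define a where "a t = (LINT x|RN N. \<phi> t x * \<psi> x)" for t
  define B where "B t = inner (f t) (cls N \<psi>) - (\<Sum>i<N. inner (p i t) (cls N (partial i \<psi>)))" for t
  define a' where "a' t = inner (v t) (cls N \<psi>)" for t
  have da: "(a has_real_derivative a' t) (at t)" for t unfolding a_def a'_def by (rule phi_test_deriv[OF \<psi>])
  have ca': "continuous_on UNIV a'" unfolding a'_def by (intro continuous_intros v_cont)
  have cB: "continuous_on UNIV B" unfolding B_def by (intro continuous_intros f_cont p_cont) auto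
  have ca: "continuous_on UNIV a"
    by (rule deriv_imp_continuous) (use da in \<open>simp add: has_real_derivative_iff_has_vector_derivative\<close>)
  note dB = Iint_deriv_real[OF cB] note cIB = continuous_on_Iint[OF cB]
  have "a' t - Iint B t = a' 0 - Iint B 0"
  proof (rule du_Bois_Reymond[of "\<lambda>t. a' t - Iint B t"])
    show "continuous_on UNIV (\<lambda>t. a' t - Iint B t)" by (intro continuous_intros ca' cIB)
    fix \<theta> :: "real \<Rightarrow> real" and S assume \<theta>: "smooth1 \<theta>" and S: "\<And>s. \<bar>s\<bar> > S \<Longrightarrow> \<theta> s = 0"
    note \<theta>1 = smooth1_deriv[OF \<theta>] note \<theta>2 = smooth1_deriv[OF \<theta>1]
    note S1 = deriv_zero_outside[OF S] note S2 = deriv_zero_outside[OF S1]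
    define \<eta> where "\<eta> = tens N \<psi> \<theta>"
    have \<eta>: "\<eta> \<in> test_fun (Suc N)" unfolding \<eta>_def by (rule test_fun_tens[OF \<psi> \<theta> S])
    have sm: "smooth N \<psi>" "\<And>i. i < N \<Longrightarrow> smooth N (partial i \<psi>)"
      using \<psi> smooth_partial by (auto simp: test_fun_iff)
    have pNN: "partials [N, N] \<eta> (x(N := t)) = \<psi> x * deriv (deriv \<theta>) t" if "x \<in> space (RN N)" for x t
      unfolding \<eta>_def by (simp add: partial_tens(2)[OF sm(1) \<theta>] partial_tens(2)[OF sm(1) \<theta>1] tens_section that del: fun_upd_apply)
    have pii: "partials [i, i] \<eta> (x(N := t)) = partial i (partial i \<psi>) x * \<theta> t" if "x \<in> space (RN N)" "i < N" for x t i
      unfolding \<eta>_def by (simp add: partial_tens(1)[OF sm(1) \<theta>] partial_tens(1)[OF sm(2) \<theta>] tens_section that del: fun_upd_apply)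
    have e0: "\<eta> (x(N := t)) = \<psi> x * \<theta> t" if "x \<in> space (RN N)" for x t
      unfolding \<eta>_def by (rule tens_section[OF that])
    have iF: "(LINT x|RN N. \<sigma> / 2 * sin (2 * \<phi> t x) * \<psi> x) = - inner (f t) (cls N \<psi>)"
      "integrable (RN N) (\<lambda>x. \<sigma> / 2 * sin (2 * \<phi> t x) * \<psi> x)" for t
    proof -
      have e: "(\<lambda>x. \<sigma> / 2 * sin (2 * \<phi> t x) * \<psi> x) = (\<lambda>x. - (Fn t x * \<psi> x))" by (simp add: Fn_def fun_eq_iff)
      have i: "integrable (RN N) (\<lambda>x. Fn t x * \<psi> x)" by (rule L2_integrable_mult[OF Fn_L2 test_fun_L2[OF \<psi>]])
      then show "integrable (RN N) (\<lambda>x. \<sigma> / 2 * sin (2 * \<phi> t x) * \<psi> x)" unfolding e by simp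
      show "(LINT x|RN N. \<sigma> / 2 * sin (2 * \<phi> t x) * \<psi> x) = - inner (f t) (cls N \<psi>)"
        unfolding e by (simp add: f_def inner_cls[OF Fn_L2 test_fun_L2[OF \<psi>]])
    qed
    have iP: "(LINT x|RN N. \<phi> t x * partial i (partial i \<psi>) x) = - inner (p i t) (cls N (partial i \<psi>))" if i: "i < N" for i t
      using has_weak_derivD(3)[OF P_wd[OF i] test_fun_partial[OF \<psi> i], of t]
      by (simp add: p_def inner_cls P_L2 i test_fun_L2 test_fun_partial \<psi>)
    have I: "(LINT x|RN N. \<phi> t x * (partials [N, N] \<eta> (x(N := t)) - (\<Sum>i<N. partials [i, i] \<eta> (x(N := t)))) +
           \<sigma> / 2 * sin (2 * \<phi> t x) * \<eta> (x(N := t))) = deriv (deriv \<theta>) t * a t - \<theta> t * B t" for t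
    proof -
      have i2: "integrable (RN N) (\<lambda>x. \<phi> t x * partial i (partial i \<psi>) x)" if "i < N" for i
        by (intro test_fun_integrable phi_L1 test_fun_partial \<psi> that)
      have lin: "(LINT x|RN N. a * A x - b * (\<Sum>i<N. B i x) + b * C x)
          = a * (LINT x|RN N. A x) - b * (\<Sum>i<N. LINT x|RN N. B i x) + b * (LINT x|RN N. C x)"
        if "integrable (RN N) A" "\<And>i. i < N \<Longrightarrow> integrable (RN N) (B i)" "integrable (RN N) C" for a b :: real and A B C
      proof -
        have "integrable (RN N) (\<lambda>x. \<Sum>i<N. B i x)" using that(2) by (intro Bochner_Integration.integrable_sum) simp
        moreover have "(LINT x|RN N. (\<Sum>i<N. B i x)) = (\<Sum>i<N. LINT x|RN N. B i x)"
          using that(2) by (intro Bochner_Integration.integral_sum) simp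
        ultimately show ?thesis using that(1,3) by simp
      qed
      have i1: "integrable (RN N) (\<lambda>x. \<phi> t x * \<psi> x)" by (intro test_fun_integrable phi_L1 \<psi>)
      have "(LINT x|RN N. \<phi> t x * (partials [N, N] \<eta> (x(N := t)) - (\<Sum>i<N. partials [i, i] \<eta> (x(N := t)))) +
           \<sigma> / 2 * sin (2 * \<phi> t x) * \<eta> (x(N := t)))
        = (LINT x|RN N. deriv (deriv \<theta>) t * (\<phi> t x * \<psi> x) - \<theta> t * (\<Sum>i<N. \<phi> t x * partial i (partial i \<psi>) x) +
           \<theta> t * (\<sigma> / 2 * sin (2 * \<phi> t x) * \<psi> x))"
      proof (rule Bochner_Integration.integral_cong[OF refl])
        fix x assume x: "x \<in> space (RN N)"
        have "(\<Sum>i<N. partials [i, i] \<eta> (x(N := t))) = (\<Sum>i<N. partial i (partial i \<psi>) x) * \<theta> t"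
          unfolding sum_distrib_right by (intro sum.cong refl pii x) simp
        then show "\<phi> t x * (partials [N, N] \<eta> (x(N := t)) - (\<Sum>i<N. partials [i, i] \<eta> (x(N := t)))) +
           \<sigma> / 2 * sin (2 * \<phi> t x) * \<eta> (x(N := t))
           = deriv (deriv \<theta>) t * (\<phi> t x * \<psi> x) - \<theta> t * (\<Sum>i<N. \<phi> t x * partial i (partial i \<psi>) x) +
           \<theta> t * (\<sigma> / 2 * sin (2 * \<phi> t x) * \<psi> x)"
          unfolding pNN[OF x] e0[OF x] sum_distrib_left[symmetric] by (simp only:) (simp add: algebra_simps)
      qed
      also have "\<dots> = deriv (deriv \<theta>) t * (LINT x|RN N. \<phi> t x * \<psi> x)
          - \<theta> t * (\<Sum>i<N. LINT x|RN N. \<phi> t x * partial i (partial i \<psi>) x)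
          + \<theta> t * (LINT x|RN N. \<sigma> / 2 * sin (2 * \<phi> t x) * \<psi> x)"
        by (rule lin[OF i1 i2 iF(2)])
      also have "\<dots> = deriv (deriv \<theta>) t * a t - \<theta> t * B t"
        unfolding iF(1) by (simp add: a_def B_def iP sum_negf algebra_simps)
      finally show ?thesis .
    qed
    have eq: "(LINT t|lborel. deriv (deriv \<theta>) t * a t - \<theta> t * B t) = 0"
      using sol_parts(4) \<eta> unfolding sine_Gordon_def I[symmetric] by blast
    have cq: "continuous_on UNIV (\<lambda>t. deriv (deriv \<theta>) t * a t - \<theta> t * B t)" "continuous_on UNIV (\<lambda>t. deriv \<theta> t * (a' t - Iint B t))"
      using smooth1_continuous[OF \<theta>] smooth1_continuous[OF \<theta>1] smooth1_continuous[OF \<theta>2] ca cB ca' cIB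
      by (auto intro!: continuous_on_mult continuous_on_diff)
    \<comment> \<open>The integrand of the equation plus \<theta>' (a' - Iint B) is the derivative
      of the compactly supported function \<theta>' a - \<theta> Iint B.\<close>
    have "(LINT t|lborel. (deriv (deriv \<theta>) t * a t - \<theta> t * B t) + deriv \<theta> t * (a' t - Iint B t)) = 0"
    proof (rule compact_support_integral_deriv[where q="\<lambda>t. deriv \<theta> t * a t - \<theta> t * Iint B t" and R=S])
      fix t
      show "((\<lambda>t. deriv \<theta> t * a t - \<theta> t * Iint B t) has_real_derivative
          (deriv (deriv \<theta>) t * a t - \<theta> t * B t) + deriv \<theta> t * (a' t - Iint B t)) (at t)"
        by (rule DERIV_cong[OF DERIV_diff[OF DERIV_mult[OF smooth1_DERIV[OF \<theta>1] da] DERIV_mult[OF smooth1_DERIV[OF \<theta>] dB]]])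
          (simp add: algebra_simps)
    qed (use S S1 S2 in \<open>auto intro!: continuous_on_add cq\<close>)
    moreover have "integrable lborel (\<lambda>t. deriv (deriv \<theta>) t * a t - \<theta> t * B t)"
      by (rule compact_support_integral(1)[OF cq(1), of S]) (simp add: S S2)
    moreover have "integrable lborel (\<lambda>t. deriv \<theta> t * (a' t - Iint B t))"
      by (rule compact_support_integral(1)[OF cq(2), of S]) (simp add: S1)
    ultimately show "(LINT t|lborel. deriv \<theta> t * (a' t - Iint B t)) = 0" using eq by simp
  qed
  moreover have "B = (\<lambda>s. inner (f s) (cls N \<psi>) - (\<Sum>i<N. inner (p i s) (cls N (partial i \<psi>))))"
    by (rule ext) (rule B_def)
  ultimately show ?thesis by (simp add: a'_def)
qed

text \<open>The first equation is linearity of weak derivatives, the second is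
  \<open>weak_equation\<close>. Core vectors of other dimensions are orthogonal to p, v and
  f.\<close>

theorem wave: "H.wave N p v f"
  unfolding H.wave_def
proof (intro conjI allI impI)
  show "continuous_on UNIV (p i)" if "i < N" for i by (rule p_cont[OF that])
  show "continuous_on UNIV v" "continuous_on UNIV f" by (simp_all add: v_cont f_cont)
  show "H.wdiv {i} (\<lambda>_. Iint v t) (p i t - p i 0)" if i: "i < N" for i t
  proof -
    have "has_weak_deriv N [i] (\<lambda>x. \<phi> t x - \<phi> 0 x) (\<lambda>x. P i t x - P i 0 x)"
      by (rule has_weak_deriv_diff[OF _ P_wd[OF i] P_wd[OF i]]) (use i in simp)
    then have "H.wdiv {i} (\<lambda>_. cls N (\<lambda>x. \<phi> t x - \<phi> 0 x)) (cls N (\<lambda>x. P i t x - P i 0 x))"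
      by (simp add: wdiv_single_iff[OF dphi_L2 L2_diff[OF P_L2[OF i] P_L2[OF i]] i])
    then show ?thesis by (simp add: cls_diff[OF P_L2[OF i] P_L2[OF i]] flip: w_eq w_def p_def)
  qed
  show "H.wdiv {..<N} (\<lambda>i. Iint (p i) t) (v t - v 0 - Iint f t)" for t
    unfolding H.wdiv_def
  proof
    fix y assume "y \<in> test_core"
    then obtain n \<psi> where y: "y = cls n \<psi>" "\<psi> \<in> test_fun n" by (auto simp: test_core_def)
    have If: "inner (Iint f t) z = Iint (\<lambda>s. inner (f s) z) t" for z
      by (rule bounded_linear_Iint[OF bounded_linear_inner_left f_cont])
    have Ip: "inner (Iint (p i) t) z = Iint (\<lambda>s. inner (p i s) z) t" if "i < N" for z i
      by (rule bounded_linear_Iint[OF bounded_linear_inner_left p_cont[OF that]])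
    show "inner (v t - v 0 - Iint f t) y = - (\<Sum>i<N. inner (Iint (p i) t) (Dop i y))"
    proof (cases "n = N")
      case True
      have cc: "continuous_on UNIV (\<lambda>s. inner (p i s) z)" if "i < N" for i z
        by (intro continuous_intros p_cont that)
      have "Iint (\<lambda>s. inner (f s) (cls N \<psi>) - (\<Sum>i<N. inner (p i s) (cls N (partial i \<psi>)))) t
        = Iint (\<lambda>s. inner (f s) (cls N \<psi>)) t - (\<Sum>i<N. Iint (\<lambda>s. inner (p i s) (cls N (partial i \<psi>))) t)"
      proof -
        have "Iint (\<lambda>s. \<Sum>i<N. inner (p i s) (cls N (partial i \<psi>))) t = (\<Sum>i<N. Iint (\<lambda>s. inner (p i s) (cls N (partial i \<psi>))) t)"
          by (rule Iint_sum) (simp add: cc)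
        then show ?thesis by (subst Iint_diff) (auto intro!: continuous_intros f_cont cc)
      qed
      then show ?thesis using weak_equation[of \<psi> t] y True
        by (simp add: inner_diff_left If Ip Dop_cls)
    next
      case False
      have z: "inner (cls N h) (cls n \<psi>') = 0" if "h \<in> L2 N" "\<psi>' \<in> test_fun n" for h \<psi>'
        by (rule inner_cls_other[OF that(1) test_fun_L2[OF that(2)] False])
      have "inner (Iint (p i) t) (Dop i y) = 0" if i: "i < N" for i
      proof -
        have "inner (p i s) (Dop i y) = 0" for s
          using z[OF P_L2[OF i] test_fun_partial[OF y(2)]] by (simp add: p_def y Dop_cls)
        then show ?thesis by (simp add: Ip[OF i] Iint_const)
      qed
      moreover have "inner (v s) y = 0" "inner (f s) y = 0" for s
        using z[OF phit_L2 y(2)] z[OF Fn_L2 y(2)] by (simp_all add: v_def f_def y)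
      then have "inner (v t - v 0 - Iint f t) y = 0" by (simp add: inner_diff_left If Iint_const)
      ultimately show ?thesis by simp
    qed
  qed
qed

end

section \<open>Existence\<close>

lemma norm_prj_le: "norm (prj N u) \<le> norm u"
proof -
  have "norm (prj N u) * norm (prj N u) = inner u (prj N u)"
    using inner_prj[OF rep_L2[of N u], of u] by (simp add: prj_def flip: power2_norm_eq_inner power2_eq_square)
  also have "\<dots> \<le> norm u * norm (prj N u)" by (rule norm_cauchy_schwarz)
  finally show ?thesis by (cases "norm (prj N u) = 0") auto
qed

lemma cls_rep_diff: "cls N (\<lambda>x. rep N u x - rep N w x) = prj N (u - w)"
proof -
  have "prj N (u - w) = prj N u - prj N w" by (rule linear_diff[OF bounded_linear.linear[OF prj_bl]])
  then show ?thesis by (simp add: prj_def cls_diff[OF rep_L2 rep_L2])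
qed

text \<open>The Lipschitz constant 2 of sin (2 r) and the factor \<sigma> / 2 give |\<sigma>|. A
  difference of representatives represents only the projection of u - w, which is no longer than u -
  w.\<close>

lemma sine_superposition_lipschitz:
  assumes m: "\<phi>0 \<in> borel_measurable (RN N)" "(\<lambda>x. sin (\<phi>0 x)) \<in> L2 N"
  shows "(\<lambda>x. - \<sigma> / 2 * sin (2 * (\<phi>0 x + rep N u x))) \<in> L2 N"
    and "norm (cls N (\<lambda>x. - \<sigma> / 2 * sin (2 * (\<phi>0 x + rep N u x))) - cls N (\<lambda>x. - \<sigma> / 2 * sin (2 * (\<phi>0 x + rep N w x))))
      \<le> \<bar>\<sigma>\<bar> * norm (u - w)"
proof -
  have mr: "rep N u \<in> borel_measurable (RN N)" for u by (rule L2_measurable[OF rep_L2])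
  have ms: "(\<lambda>x. \<phi>0 x + rep N u x) \<in> borel_measurable (RN N)" for u using mr m(1) by simp
  show L: "(\<lambda>x. - \<sigma> / 2 * sin (2 * (\<phi>0 x + rep N u x))) \<in> L2 N" for u
    by (rule L2_sin_double[OF L2_sin_perturbed[OF m(2,1) ms] ms]) (simp add: rep_L2)
  have "norm (cls N (\<lambda>x. - \<sigma> / 2 * sin (2 * (\<phi>0 x + rep N u x)) - - \<sigma> / 2 * sin (2 * (\<phi>0 x + rep N w x))))
    \<le> \<bar>\<sigma>\<bar> * norm (cls N (\<lambda>x. rep N u x - rep N w x))"
  proof (rule norm_cls_mono[OF L2_diff[OF L L] L2_diff[OF rep_L2 rep_L2] abs_ge_zero])
    fix x
    have "\<bar>\<sigma> / 2\<bar> * \<bar>sin (2 * (\<phi>0 x + rep N u x)) - sin (2 * (\<phi>0 x + rep N w x))\<bar>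
      \<le> \<bar>\<sigma> / 2\<bar> * \<bar>2 * (\<phi>0 x + rep N u x) - 2 * (\<phi>0 x + rep N w x)\<bar>"
      by (intro mult_left_mono abs_sin_diff_le) simp
    moreover have "- \<sigma> / 2 * sin (2 * (\<phi>0 x + rep N u x)) - - \<sigma> / 2 * sin (2 * (\<phi>0 x + rep N w x))
      = - ((\<sigma> / 2) * (sin (2 * (\<phi>0 x + rep N u x)) - sin (2 * (\<phi>0 x + rep N w x))))" by (simp add: algebra_simps)
    then have "\<bar>- \<sigma> / 2 * sin (2 * (\<phi>0 x + rep N u x)) - - \<sigma> / 2 * sin (2 * (\<phi>0 x + rep N w x))\<bar>
      = \<bar>\<sigma> / 2\<bar> * \<bar>sin (2 * (\<phi>0 x + rep N u x)) - sin (2 * (\<phi>0 x + rep N w x))\<bar>"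
      by (simp only: abs_minus_cancel abs_mult)
    moreover have "\<bar>2 * (\<phi>0 x + rep N u x) - 2 * (\<phi>0 x + rep N w x)\<bar> = 2 * \<bar>rep N u x - rep N w x\<bar>"
    proof -
      have "2 * (\<phi>0 x + rep N u x) - 2 * (\<phi>0 x + rep N w x) = 2 * (rep N u x - rep N w x)" by simp
      then show ?thesis by (simp only: abs_mult abs_numeral)
    qed
    moreover have "\<bar>\<sigma> / 2\<bar> * (2 * \<bar>rep N u x - rep N w x\<bar>) = \<bar>\<sigma>\<bar> * \<bar>rep N u x - rep N w x\<bar>" by simp
    ultimately show "\<bar>- \<sigma> / 2 * sin (2 * (\<phi>0 x + rep N u x)) - - \<sigma> / 2 * sin (2 * (\<phi>0 x + rep N w x))\<bar>
      \<le> \<bar>\<sigma>\<bar> * \<bar>rep N u x - rep N w x\<bar>" by simp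
  qed
  then show "norm (cls N (\<lambda>x. - \<sigma> / 2 * sin (2 * (\<phi>0 x + rep N u x))) - cls N (\<lambda>x. - \<sigma> / 2 * sin (2 * (\<phi>0 x + rep N w x))))
      \<le> \<bar>\<sigma>\<bar> * norm (u - w)"
    unfolding cls_diff[OF L L] cls_rep_diff
    using mult_left_mono[OF norm_prj_le abs_ge_zero, of \<sigma> N "u - w"] by linarith
qed

lemma multi_indices_1: "is \<in> multi_indices N 1 \<Longrightarrow> is = [] \<or> (\<exists>i<N. is = [i])"
  by (cases "is") (auto simp: multi_indices_def)

text \<open>Symmetry of the mixed derivative, from the skew-adjointness of the translation generators.\<close>

lemma section_partial_commute:
  assumes p: "\<zeta> \<in> test_fun (Suc N)" and i: "i < N"
  shows "cls N (\<lambda>x. partial N (partial i \<zeta>) (x(N := t))) = cls N (\<lambda>x. partial i (partial N \<zeta>) (x(N := t)))"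
proof -
  have i': "i < Suc N" using i by simp
  note pN = test_fun_partial[OF p lessI] and pi = test_fun_partial[OF p i']
  have g: "H.gen i (cls N (\<lambda>x. \<eta> (x(N := s)))) (cls N (\<lambda>x. partial i \<eta> (x(N := s))))" if \<eta>: "\<eta> \<in> test_fun (Suc N)" for \<eta> s
  proof -
    have t: "(\<lambda>x. \<eta> (x(N := s))) \<in> test_fun N" by (rule test_fun_section[OF \<eta>])
    have "cls N (\<lambda>x. \<eta> (x(N := s))) \<in> test_core" using t by (auto simp: test_core_def)
    moreover have "partial i (\<lambda>x. \<eta> (x(N := s))) = (\<lambda>x. partial i \<eta> (x(N := s)))"
      using partials_section[of "[i]" N \<eta> s] i by simp
    ultimately show ?thesis using H.core_gen[of "cls N (\<lambda>x. \<eta> (x(N := s)))" i] by (simp add: Dop_cls[OF t] i)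
  qed
  have "cls N (\<lambda>x. partial N (partial i \<zeta>) (x(N := t))) - cls N (\<lambda>x. partial i (partial N \<zeta>) (x(N := t))) = 0"
  proof (rule H.core_total)
    fix z assume z: "z \<in> test_core"
    note gz = H.core_gen[OF z]
    have e: "inner (cls N (\<lambda>x. partial i \<zeta> (x(N := s)))) z = - inner (cls N (\<lambda>x. \<zeta> (x(N := s)))) (Dop i z)" for s
      by (rule H.gen_skew[OF g[OF p] gz])
    have "((\<lambda>s. - inner (cls N (\<lambda>x. \<zeta> (x(N := s)))) (Dop i z)) has_vector_derivative
        - inner (cls N (\<lambda>x. partial N \<zeta> (x(N := t)))) (Dop i z)) (at t)"
      by (intro has_vector_derivative_minus bounded_linear.has_vector_derivative[OF bounded_linear_inner_left]
          section_deriv(2)[OF p])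
    moreover have "((\<lambda>s. inner (cls N (\<lambda>x. partial i \<zeta> (x(N := s)))) z) has_vector_derivative
        inner (cls N (\<lambda>x. partial N (partial i \<zeta>) (x(N := t)))) z) (at t)"
      by (intro bounded_linear.has_vector_derivative[OF bounded_linear_inner_left] section_deriv(2)[OF pi])
    ultimately have "inner (cls N (\<lambda>x. partial N (partial i \<zeta>) (x(N := t)))) z
        = - inner (cls N (\<lambda>x. partial N \<zeta> (x(N := t)))) (Dop i z)"
      unfolding e by (rule vector_derivative_unique_at[rotated])
    also have "\<dots> = inner (cls N (\<lambda>x. partial i (partial N \<zeta>) (x(N := t)))) z"
      by (rule H.gen_skew[OF g[OF pN] gz, symmetric])
    finally show "inner (cls N (\<lambda>x. partial N (partial i \<zeta>) (x(N := t))) - cls N (\<lambda>x. partial i (partial N \<zeta>) (x(N := t)))) z = 0"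
      by (simp add: inner_diff_left)
  qed
  then show ?thesis by simp
qed

lemma integral_test_fun_combination:
  assumes u: "u \<in> L1_loc N" and h: "h \<in> L1_loc N" and a: "a \<in> test_fun N" and c: "c \<in> test_fun N"
    and b: "\<And>i. i < N \<Longrightarrow> b i \<in> test_fun N"
  shows "(LINT x|RN N. u x * (a x - (\<Sum>i<N. b i x)) + h x * c x)
    = (LINT x|RN N. u x * a x) - (\<Sum>i<N. LINT x|RN N. u x * b i x) + (LINT x|RN N. h x * c x)"
proof -
  have ib: "integrable (RN N) (\<lambda>x. u x * b i x)" if "i < N" for i by (rule test_fun_integrable[OF u b[OF that]])
  have "integrable (RN N) (\<lambda>x. \<Sum>i<N. u x * b i x)" using ib by (intro Bochner_Integration.integrable_sum) simp
  moreover have "(LINT x|RN N. (\<Sum>i<N. u x * b i x)) = (\<Sum>i<N. LINT x|RN N. u x * b i x)"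
    using ib by (intro Bochner_Integration.integral_sum) simp
  ultimately show ?thesis
    by (simp add: right_diff_distrib sum_distrib_left test_fun_integrable[OF u a] test_fun_integrable[OF h c])
qed

lemma inner_deriv:
  fixes a b :: "real \<Rightarrow> hil"
  assumes "(a has_vector_derivative a') (at t)" "(b has_vector_derivative b') (at t)"
  shows "((\<lambda>s. inner (a s) (b s)) has_real_derivative inner (a t) b' + inner a' (b t)) (at t)"
  using bounded_bilinear.has_vector_derivative[OF bounded_bilinear_inner assms]
  by (simp add: has_real_derivative_iff_has_vector_derivative)

section \<open>From a wave system back to a solution\<close>

locale SG_construction =
  fixes N :: nat and \<sigma> :: real and \<phi>0 \<phi>1 :: "point \<Rightarrow> real" and p :: "nat \<Rightarrow> real \<Rightarrow> hil" and v :: "real \<Rightarrow> hil"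
  assumes d0: "\<phi>0 \<in> Hsin N 1" and d1: "\<phi>1 \<in> L2 N"
    and wave: "H.wave N p v (\<lambda>t. cls N (\<lambda>x. - \<sigma> / 2 * sin (2 * (\<phi>0 x + rep N (Iint v t) x))))"
    and p0: "\<And>i. i < N \<Longrightarrow> p i 0 = cls N (weak_deriv N [i] \<phi>0)" and v0: "v 0 = cls N \<phi>1"
begin

definition \<phi> where "\<phi> t x = \<phi>0 x + rep N (Iint v t) x"
definition Fn where "Fn t x = - \<sigma> / 2 * sin (2 * \<phi> t x)"
definition f where "f t = cls N (Fn t)"

lemma phi0: "\<phi>0 \<in> L1_loc N" "(\<lambda>x. sin (\<phi>0 x)) \<in> L2 N"
  using d0 by (auto simp: Hsin_def)

lemma Fn_L2: "Fn t \<in> L2 N"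
  unfolding Fn_def[abs_def] \<phi>_def by (rule sine_superposition_lipschitz(1)[OF L1_locD[OF phi0(1)] phi0(2)])

lemma phi_L1: "\<phi> t \<in> L1_loc N"
  unfolding \<phi>_def[abs_def] by (rule L1_loc_add[OF phi0(1) L2_L1_loc[OF rep_L2]])

lemma wave_f: "H.wave N p v f"
  using wave unfolding f_def[abs_def] Fn_def[abs_def] \<phi>_def .

lemmas W = H.waveD[OF wave_f]

lemma core_test: "\<psi> \<in> test_fun N \<Longrightarrow> cls N \<psi> \<in> test_core"
  by (auto simp: test_core_def)

lemma p_increment:
  assumes i: "i < N" and \<psi>: "\<psi> \<in> test_fun N"
  shows "inner (p i t - p i 0) (cls N \<psi>) = - inner (Iint v t) (cls N (partial i \<psi>))"
  using W(4)[OF i, of t] core_test[OF \<psi>] i by (simp add: H.wdiv_def Dop_cls[OF \<psi>])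

lemma v_weak:
  assumes \<psi>: "\<psi> \<in> test_fun N"
  shows "inner (v t) (cls N \<psi>) = inner (v 0) (cls N \<psi>) + inner (Iint f t) (cls N \<psi>)
    - (\<Sum>i<N. inner (Iint (p i) t) (cls N (partial i \<psi>)))"
proof -
  have "inner (v t - v 0 - Iint f t) (cls N \<psi>) = - (\<Sum>i<N. inner (Iint (p i) t) (Dop i (cls N \<psi>)))"
    by (rule W(5)[unfolded H.wdiv_def, rule_format, OF core_test[OF \<psi>]])
  moreover have "(\<Sum>i<N. inner (Iint (p i) t) (Dop i (cls N \<psi>))) = (\<Sum>i<N. inner (Iint (p i) t) (cls N (partial i \<psi>)))"
    by (rule sum.cong) (simp_all add: Dop_cls[OF \<psi>])
  ultimately show ?thesis by (simp add: inner_diff_left)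
qed

text \<open>At time 0 this is the weak derivative of \<open>\<phi>0\<close>, and
  \<open>p_increment\<close> carries it to time t; so p is the weak gradient of
  \<open>\<phi> t\<close>, which itself may lie outside L^2.\<close>

lemma p_weak:
  assumes i: "i < N" and \<psi>: "\<psi> \<in> test_fun N"
  shows "inner (p i t) (cls N \<psi>) = - (LINT x|RN N. \<phi> t x * partial i \<psi> x)"
proof -
  note \<psi>' = test_fun_partial[OF \<psi> i]
  have "inner (p i 0) (cls N \<psi>) = - (LINT x|RN N. \<phi>0 x * partial i \<psi> x)"
    using has_weak_derivD(3)[OF Hsin_weak_deriv(2)[OF d0 i] \<psi>]
    by (simp add: p0 i inner_cls[OF Hsin_weak_deriv(1)[OF d0 i] test_fun_L2[OF \<psi>]])
  moreover have "(LINT x|RN N. \<phi> t x * partial i \<psi> x) = (LINT x|RN N. \<phi>0 x * partial i \<psi> x) + inner (Iint v t) (cls N (partial i \<psi>))"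
    unfolding \<phi>_def inner_cls_right[OF test_fun_L2[OF \<psi>']]
    by (simp add: distrib_right test_fun_integrable[OF phi0(1) \<psi>'] test_fun_integrable[OF L2_L1_loc[OF rep_L2] \<psi>'])
  ultimately show ?thesis using p_increment[OF i \<psi>, of t] by (simp add: inner_diff_left)
qed

lemma C0_Sob: "C0_Sob N 1 (\<lambda>t x. \<phi> t x - \<phi>0 x)"
proof (rule C0_SobI)
  have e: "(\<lambda>x. \<phi> t x - \<phi>0 x) = rep N (Iint v t)" for t by (simp add: \<phi>_def)
  show "(\<lambda>x. \<phi> t x - \<phi>0 x) \<in> L2 N" for t unfolding e by (rule rep_L2)
  fix "is" assume "is \<in> multi_indices N 1"
  then consider "is = []" | i where "i < N" "is = [i]" using multi_indices_1 by blast
  then show "\<exists>G. (\<forall>t. G t \<in> L2 N \<and> has_weak_deriv N is (\<lambda>x. \<phi> t x - \<phi>0 x) (G t)) \<and> continuous_on UNIV (\<lambda>t. cls N (G t))"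
    unfolding e
  proof cases
    case 1
    have "continuous_on UNIV (\<lambda>t. cls N (rep N (Iint v t)))"
      unfolding prj_def[symmetric] by (rule bounded_linear.continuous_on[OF prj_bl continuous_on_Iint[OF W(2)]])
    then show "\<exists>G. (\<forall>t. G t \<in> L2 N \<and> has_weak_deriv N is (rep N (Iint v t)) (G t)) \<and> continuous_on UNIV (\<lambda>t. cls N (G t))"
      unfolding 1 by (intro exI[of _ "\<lambda>t. rep N (Iint v t)"] conjI allI rep_L2 has_weak_deriv_nil L2_L1_loc)
  next
    case 2
    have "continuous_on UNIV (\<lambda>t. cls N (rep N (p i t - p i 0)))"
      unfolding prj_def[symmetric]
      by (rule bounded_linear.continuous_on[OF prj_bl continuous_on_diff[OF W(1)[OF 2(1)] continuous_on_const]])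
    moreover have "has_weak_deriv N is (rep N (Iint v t)) (rep N (p i t - p i 0))" for t
    proof (rule has_weak_derivI[OF L2_L1_loc[OF rep_L2] L2_L1_loc[OF rep_L2]])
      fix \<psi> assume \<psi>: "\<psi> \<in> test_fun N"
      show "(LINT x|RN N. rep N (Iint v t) x * partials is \<psi> x) = (-1) ^ length is * (LINT x|RN N. rep N (p i t - p i 0) x * \<psi> x)"
        using p_increment[OF 2(1) \<psi>, of t] 2(2)
        by (simp add: inner_cls_right[OF test_fun_L2[OF \<psi>]] inner_cls_right[OF test_fun_L2[OF test_fun_partial[OF \<psi> 2(1)]]])
    qed
    ultimately show "\<exists>G. (\<forall>t. G t \<in> L2 N \<and> has_weak_deriv N is (rep N (Iint v t)) (G t)) \<and> continuous_on UNIV (\<lambda>t. cls N (G t))"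
      by (intro exI[of _ "\<lambda>t. rep N (p i t - p i 0)"] conjI allI rep_L2)
  qed
qed

lemma time_deriv: "has_time_deriv N \<phi> (\<lambda>t. rep N (v t))"
  unfolding has_time_deriv_iff[where r=0]
proof (intro conjI allI rep_L2)
  have e: "(\<lambda>x. \<phi> s x - \<phi> t x) = (\<lambda>x. rep N (Iint v s) x - rep N (Iint v t) x)" for s t by (simp add: \<phi>_def)
  show "(\<lambda>x. \<phi> s x - \<phi> t x) \<in> L2 N" for s t unfolding e by (rule L2_diff[OF rep_L2 rep_L2])
  have "((\<lambda>s. prj N (Iint v s - Iint v 0)) has_vector_derivative prj N (v t - 0)) (at t)" for t
    by (intro bounded_linear.has_vector_derivative[OF prj_bl] has_vector_derivative_diff has_vector_derivative_const Iint_deriv W(2))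
  then show "((\<lambda>s. cls N (\<lambda>x. \<phi> s x - \<phi> 0 x)) has_vector_derivative cls N (rep N (v t))) (at t)" for t
    unfolding e cls_rep_diff by (simp add: prj_def)
qed

lemma C0_L2: "C0_L2 N (\<lambda>t. rep N (v t))"
  unfolding C0_L2_iff prj_def[symmetric]
  by (intro conjI allI rep_L2 bounded_linear.continuous_on[OF prj_bl W(2)])

text \<open>A general space-time test function is not a tensor product, so its time sections are
  treated as a curve \<open>e \<eta> t\<close> in L^2. The integrand of the equation is the time
  derivative of a compactly supported function, the pairing of \<phi> with the time derivative of
  \<eta> minus that of v with \<eta>.\<close>

lemma equation: "sine_Gordon N \<sigma> \<phi>"
  unfolding sine_Gordon_def
proof
  fix \<eta> assume \<eta>: "\<eta> \<in> test_fun (Suc N)"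
  note \<eta>1 = test_fun_partial[OF \<eta> lessI] note \<eta>2 = test_fun_partial[OF \<eta>1 lessI]
  have \<eta>i: "partial i \<eta> \<in> test_fun (Suc N)" "partial i (partial i \<eta>) \<in> test_fun (Suc N)" if "i < N" for i
    using that by (auto intro!: test_fun_partial \<eta>)
  have pse: "partial i (\<lambda>x. \<zeta> (x(N := t))) = (\<lambda>x. partial i \<zeta> (x(N := t)))" if "i < N" for i \<zeta> t
    using partials_section[of "[i]" N \<zeta> t] that by simp
  define e where "e \<zeta> t = cls N (\<lambda>x. \<zeta> (x(N := t)))" for \<zeta> t
  have de: "(e \<zeta> has_vector_derivative e (partial N \<zeta>) t) (at t)" if "\<zeta> \<in> test_fun (Suc N)" for \<zeta> t
    unfolding e_def[abs_def] by (rule section_deriv(2)[OF that])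
  define A where "A t = (LINT x|RN N. \<phi>0 x * partial N \<eta> (x(N := t))) + inner (Iint v t) (e (partial N \<eta>) t)" for t
  \<comment> \<open>The pairing of v with \<open>\<eta>\<close>, rewritten by \<open>v_weak\<close>:
    v need not be differentiable in time, whereas every factor occurring here is.\<close>
  define B where "B t = inner (v 0) (e \<eta> t) + inner (Iint f t) (e \<eta> t) - (\<Sum>i<N. inner (Iint (p i) t) (e (partial i \<eta>) t))" for t
  define A2 where "A2 t = (LINT x|RN N. \<phi>0 x * partial N (partial N \<eta>) (x(N := t)))" for t
  define q' where "q' t = A2 t + inner (Iint v t) (e (partial N (partial N \<eta>)) t) - inner (f t) (e \<eta> t)
    + (\<Sum>i<N. inner (p i t) (e (partial i \<eta>) t))" for t
  have vB: "inner (v t) (e \<eta> t) = B t" for t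
    unfolding e_def B_def v_weak[OF test_fun_section[OF \<eta>], of t]
    by (simp add: pse)
  have dA: "(A has_real_derivative A2 t + (inner (Iint v t) (e (partial N (partial N \<eta>)) t) + inner (v t) (e (partial N \<eta>) t))) (at t)" for t
    unfolding A_def A2_def
    by (intro DERIV_add section_deriv(1)[OF \<eta>1 phi0(1)] inner_deriv Iint_deriv W(2) de \<eta>1)
  have dB: "(B has_real_derivative inner (v 0) (e (partial N \<eta>) t) + (inner (Iint f t) (e (partial N \<eta>) t) + inner (f t) (e \<eta> t))
     - (\<Sum>i<N. inner (Iint (p i) t) (e (partial N (partial i \<eta>)) t) + inner (p i t) (e (partial i \<eta>) t))) (at t)" for t
    unfolding B_def
  proof (intro DERIV_add DERIV_diff DERIV_sum)
    show "((\<lambda>s. inner (v 0) (e \<eta> s)) has_real_derivative inner (v 0) (e (partial N \<eta>) t)) (at t)"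
      using inner_deriv[OF has_vector_derivative_const de[OF \<eta>], of "v 0" t] by simp
    show "((\<lambda>s. inner (Iint f s) (e \<eta> s)) has_real_derivative inner (Iint f t) (e (partial N \<eta>) t) + inner (f t) (e \<eta> t)) (at t)"
      by (rule inner_deriv[OF Iint_deriv[OF W(3)] de[OF \<eta>]])
    fix i assume "i \<in> {..<N}"
    then show "((\<lambda>s. inner (Iint (p i) s) (e (partial i \<eta>) s)) has_real_derivative
        inner (Iint (p i) t) (e (partial N (partial i \<eta>)) t) + inner (p i t) (e (partial i \<eta>) t)) (at t)"
      by (intro inner_deriv Iint_deriv W(1) de \<eta>i) simp_all
  qed
  \<comment> \<open>With the mixed derivatives exchanged, these terms of the derivative of B equal
    the last term of the derivative of A and cancel in \<open>dq\<close>.\<close>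
  have vB': "inner (v t) (e (partial N \<eta>) t) = inner (v 0) (e (partial N \<eta>) t) + inner (Iint f t) (e (partial N \<eta>) t)
      - (\<Sum>i<N. inner (Iint (p i) t) (e (partial N (partial i \<eta>)) t))" for t
    unfolding e_def v_weak[OF test_fun_section[OF \<eta>1], of t]
    by (simp add: pse section_partial_commute[OF \<eta>])
  have dq: "((\<lambda>t. A t - B t) has_real_derivative q' t) (at t)" for t
    by (rule DERIV_cong[OF DERIV_diff[OF dA dB]]) (simp add: q'_def vB' sum.distrib)
  have ce: "continuous_on UNIV (e \<zeta>)" if "\<zeta> \<in> test_fun (Suc N)" for \<zeta>
    by (rule deriv_imp_continuous[OF de[OF that]])
  have "continuous_on UNIV A2"
    by (rule deriv_imp_continuous)
      (unfold A2_def, rule section_deriv(1)[OF \<eta>2 phi0(1), unfolded has_real_derivative_iff_has_vector_derivative])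
  then have cq': "continuous_on UNIV q'"
    unfolding q'_def
    by (intro continuous_on_add continuous_on_diff continuous_on_sum continuous_on_inner continuous_on_Iint ce \<eta> \<eta>i \<eta>2 W) auto
  obtain R0 R1 where R0: "\<And>x. x \<in> space (RN (Suc N)) \<Longrightarrow> x \<notin> box_RN (Suc N) R0 \<Longrightarrow> \<eta> x = 0"
    and R1: "\<And>x. x \<in> space (RN (Suc N)) \<Longrightarrow> x \<notin> box_RN (Suc N) R1 \<Longrightarrow> partial N \<eta> x = 0"
    using \<eta> \<eta>1 by (auto simp: test_fun_iff)
  have van: "A t - B t = 0" if t: "\<bar>t\<bar> > max R0 R1" for t
  proof -
    have out: "x(N := t) \<notin> box_RN (Suc N) R" if "\<bar>t\<bar> > R" for x R
      using that by (auto simp: mem_box_RN)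
    have z: "\<eta> (x(N := t)) = 0" "partial N \<eta> (x(N := t)) = 0" if "x \<in> space (RN N)" for x
      using R0[OF fun_upd_Suc_RN[OF that, of t]] R1[OF fun_upd_Suc_RN[OF that, of t]] out t by simp_all
    have "norm (e \<zeta> t) = 0" if "\<zeta> \<in> test_fun (Suc N)" "\<And>x. x \<in> space (RN N) \<Longrightarrow> \<zeta> (x(N := t)) = 0" for \<zeta>
      using norm_cls_mono[OF test_fun_L2[OF test_fun_section[OF that(1)]] zero_L2, of 0 t] that(2) by (simp add: e_def)
    then have "e \<eta> t = 0" "e (partial N \<eta>) t = 0" using z \<eta> \<eta>1 by simp_all
    moreover have "(LINT x|RN N. \<phi>0 x * partial N \<eta> (x(N := t))) = (LINT x|RN N. 0)"
      by (rule Bochner_Integration.integral_cong) (simp_all add: z)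
    ultimately show ?thesis unfolding vB[symmetric] A_def by simp
  qed
  have qe: "(LINT x|RN N. \<phi> t x * (partials [N, N] \<eta> (x(N := t)) - (\<Sum>i<N. partials [i, i] \<eta> (x(N := t)))) +
           \<sigma> / 2 * sin (2 * \<phi> t x) * \<eta> (x(N := t))) = q' t" for t
  proof -
    have s: "(\<lambda>x. \<zeta> (x(N := t))) \<in> test_fun N" if "\<zeta> \<in> test_fun (Suc N)" for \<zeta> by (rule test_fun_section[OF that])
    have h: "(\<lambda>x. - Fn t x) \<in> L1_loc N" using L1_loc_diff[OF L2_L1_loc[OF zero_L2] L2_L1_loc[OF Fn_L2], of t] by simp
    have eF: "\<sigma> / 2 * sin (2 * \<phi> t x) = - Fn t x" for x by (simp add: Fn_def)
    have "(LINT x|RN N. \<phi> t x * (partials [N, N] \<eta> (x(N := t)) - (\<Sum>i<N. partials [i, i] \<eta> (x(N := t)))) +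
           \<sigma> / 2 * sin (2 * \<phi> t x) * \<eta> (x(N := t)))
      = (LINT x|RN N. \<phi> t x * partial N (partial N \<eta>) (x(N := t)))
        - (\<Sum>i<N. LINT x|RN N. \<phi> t x * partial i (partial i \<eta>) (x(N := t)))
        + (LINT x|RN N. - Fn t x * \<eta> (x(N := t)))"
      unfolding eF partials.simps
      by (rule integral_test_fun_combination[OF phi_L1 h s[OF \<eta>2] s[OF \<eta>] s[OF \<eta>i(2)]])
    moreover have "(LINT x|RN N. \<phi> t x * partial N (partial N \<eta>) (x(N := t))) = A2 t + inner (Iint v t) (e (partial N (partial N \<eta>)) t)"
      unfolding \<phi>_def A2_def e_def inner_cls_right[OF test_fun_L2[OF s[OF \<eta>2]]]
      by (simp add: distrib_right test_fun_integrable[OF phi0(1) s[OF \<eta>2]] test_fun_integrable[OF L2_L1_loc[OF rep_L2] s[OF \<eta>2]])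
    moreover have "(LINT x|RN N. - Fn t x * \<eta> (x(N := t))) = - inner (f t) (e \<eta> t)"
      unfolding f_def e_def inner_cls[OF Fn_L2 test_fun_L2[OF s[OF \<eta>]]] by simp
    moreover have "(LINT x|RN N. \<phi> t x * partial i (partial i \<eta>) (x(N := t))) = - inner (p i t) (e (partial i \<eta>) t)" if i: "i < N" for i
      using p_weak[OF i s[OF \<eta>i(1)[OF i]], of t] unfolding pse[OF i] e_def by simp
    ultimately show ?thesis by (simp add: q'_def sum_negf)
  qed
  show "(LINT t|lborel. LINT x|RN N.
           \<phi> t x * (partials [N, N] \<eta> (x(N := t)) - (\<Sum>i<N. partials [i, i] \<eta> (x(N := t)))) +
           \<sigma> / 2 * sin (2 * \<phi> t x) * \<eta> (x(N := t))) = 0"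
    unfolding qe by (rule compact_support_integral_deriv[OF dq cq' van])
qed

theorem solution: "SG_solution N \<sigma> \<phi>0 \<phi>1 \<phi> (\<lambda>t. rep N (v t))"
  unfolding SG_solution_def
proof (intro conjI C0_Sob time_deriv C0_L2 equation)
  show "AE x in RN N. \<phi> 0 x = \<phi>0 x"
    using rep_cls[OF zero_L2, of N] by (simp add: \<phi>_def cls_0 Iint_0)
  show "AE x in RN N. rep N (v 0) x = \<phi>1 x"
    unfolding v0 by (rule rep_cls[OF d1])
qed

end

theorem SG_exists:
  assumes d0: "\<phi>0 \<in> Hsin N 1" and d1: "\<phi>1 \<in> L2 N"
  shows "\<exists>\<phi> \<phi>t. SG_solution N \<sigma> \<phi>0 \<phi>1 \<phi> \<phi>t"
proof -
  have phi0: "\<phi>0 \<in> borel_measurable (RN N)" "(\<lambda>x. sin (\<phi>0 x)) \<in> L2 N"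
    using d0 L1_locD by (auto simp: Hsin_def)
  define F where "F u = cls N (\<lambda>x. - \<sigma> / 2 * sin (2 * (\<phi>0 x + rep N u x)))" for u
  \<comment> \<open>The added 1 makes the constant positive, as
    \<open>H.wave_nonlinear_exists\<close> demands.\<close>
  have "norm (F x - F y) \<le> (\<bar>\<sigma>\<bar> + 1) * norm (x - y)" for x y
    using sine_superposition_lipschitz(2)[OF phi0, of \<sigma> x y] by (simp add: F_def distrib_right add_increasing2)
  then obtain p v where w: "H.wave N p v (\<lambda>t. F (Iint v t))" "\<And>i. i < N \<Longrightarrow> p i 0 = cls N (weak_deriv N [i] \<phi>0)" "v 0 = cls N \<phi>1"
    using H.wave_nonlinear_exists[of "\<bar>\<sigma>\<bar> + 1" F N "\<lambda>i. cls N (weak_deriv N [i] \<phi>0)" "cls N \<phi>1"] by fastforce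
  interpret SG_construction N \<sigma> \<phi>0 \<phi>1 p v
    by standard (use d0 d1 w in \<open>simp_all add: F_def\<close>)
  show ?thesis using solution by blast
qed

section \<open>Stability and conservation of energy\<close>

lemma Sob_norm_0: "Sob_norm N 0 u = L2_norm N u"
proof -
  have "multi_indices N 0 = {[]}" by (auto simp: multi_indices_def)
  then show ?thesis by (simp add: Sob_norm_def weak_deriv_def L2_norm_def)
qed

lemma d_sin_1:
  assumes s: "(\<lambda>x. sin (v1 x - v2 x)) \<in> L2 N"
    and w: "\<And>i. i < N \<Longrightarrow> weak_deriv N [i] v1 \<in> L2 N" "\<And>i. i < N \<Longrightarrow> weak_deriv N [i] v2 \<in> L2 N"
  shows "d_sin N 1 v1 v2 = sqrt ((norm (cls N (\<lambda>x. sin (v1 x - v2 x))))\<^sup>2 +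
    (\<Sum>i<N. (norm (cls N (weak_deriv N [i] v1) - cls N (weak_deriv N [i] v2)))\<^sup>2))"
proof -
  have "(Sob_norm N (1 - 1) (\<lambda>x. weak_deriv N [i] v1 x - weak_deriv N [i] v2 x))\<^sup>2
      = (norm (cls N (weak_deriv N [i] v1) - cls N (weak_deriv N [i] v2)))\<^sup>2" if "i < N" for i
    using norm_cls[OF L2_diff[OF w(1)[OF that] w(2)[OF that]]]
    by (simp add: Sob_norm_0 cls_diff[OF w(1)[OF that] w(2)[OF that]])
  then show ?thesis unfolding d_sin_def norm_cls[OF s] by simp
qed

text \<open>The addition formula gives |sin (a - b)| \<le> |sin a| + |sin b|.\<close>

lemma sin_diff_L2:
  assumes "(\<lambda>x. sin (a x)) \<in> L2 N" "(\<lambda>x. sin (b x)) \<in> L2 N" "a \<in> borel_measurable (RN N)" "b \<in> borel_measurable (RN N)"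
  shows "(\<lambda>x. sin (a x - b x)) \<in> L2 N"
proof (rule L2_bound[OF L2_add[OF _ _]])
  show "(\<lambda>x. \<bar>sin (a x)\<bar>) \<in> L2 N" by (rule L2_bound[OF assms(1)]) (use assms in auto)
  show "(\<lambda>x. \<bar>sin (b x)\<bar>) \<in> L2 N" by (rule L2_bound[OF assms(2)]) (use assms in auto)
  show "(\<lambda>x. sin (a x - b x)) \<in> borel_measurable (RN N)" using assms(3,4) by measurable
  fix x
  have "\<bar>sin (a x)\<bar> * \<bar>cos (b x)\<bar> \<le> \<bar>sin (a x)\<bar> * 1" "\<bar>cos (a x)\<bar> * \<bar>sin (b x)\<bar> \<le> 1 * \<bar>sin (b x)\<bar>"
    using mult_left_mono[OF abs_cos_le_one abs_ge_zero, of "sin (a x)" "b x"]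
      mult_right_mono[OF abs_cos_le_one abs_ge_zero, of "a x" "sin (b x)"] by simp_all
  moreover have "\<bar>sin (a x - b x)\<bar> \<le> \<bar>sin (a x)\<bar> * \<bar>cos (b x)\<bar> + \<bar>cos (a x)\<bar> * \<bar>sin (b x)\<bar>"
    unfolding sin_diff abs_mult[symmetric] by (rule abs_triangle_ineq4)
  ultimately show "\<bar>sin (a x - b x)\<bar> \<le> \<bar>\<bar>sin (a x)\<bar> + \<bar>sin (b x)\<bar>\<bar>" by linarith
qed

context SG
begin

lemma p_0: "i < N \<Longrightarrow> p i 0 = cls N (weak_deriv N [i] \<phi>0)"
proof -
  assume i: "i < N"
  have "has_weak_deriv N [i] (\<phi> 0) (G0 i)"
    by (rule has_weak_deriv_AE[OF G0(2)[OF i] phi_L1 sol_parts(5)]) (use i in simp)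
  from weak_deriv_cls(2)[OF this G0(1)[OF i]] show ?thesis by (simp add: p_def P_def G0_def)
qed

lemma v_0: "v 0 = cls N \<phi>1"
  unfolding v_def using cls_cong[OF d1 L2_measurable[OF phit_L2] sol_parts(6)] by blast

text \<open>\<open>H.wave_energy\<close> contributes 2 <f, v>, and the potential term contributes 2
  \<sigma> <sin \<phi>, cos \<phi> \<phi>t>; they cancel because sin (2 \<phi>) = 2 sin \<phi> cos
  \<phi>.\<close>

theorem energy: "SG_energy N \<sigma> (\<phi> t) (\<phi>t t) = SG_energy N \<sigma> (\<phi> 0) (\<phi>t 0)"
proof -
  define S where "S t = cls N (\<lambda>x. sin (\<phi> t x))" for t
  define E where "E t = H.energy N p v t + \<sigma> * (norm (S t))\<^sup>2" for t
  have c: "(\<lambda>x. cos (\<phi> t x) * \<phi>t t x) \<in> L2 N" for t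
    by (rule L2_mult_bounded[OF phit_L2 _ abs_cos_le_one]) (use phi_measurable in measurable)
  have dS: "(S has_vector_derivative cls N (\<lambda>x. cos (\<phi> t x) * \<phi>t t x)) (at t)" for t
    unfolding S_def
    by (rule Nem[where B=1]) (auto intro: DERIV_sin sin_phi_L2 abs_cos_diff_le)
  have "(E has_real_derivative 2 * inner (f t) (v t) + \<sigma> * (2 * inner (S t) (cls N (\<lambda>x. cos (\<phi> t x) * \<phi>t t x)))) (at t)" for t
    unfolding E_def by (intro DERIV_add H.wave_energy[OF wave] DERIV_cmult H.inner_self_deriv dS)
  moreover have "2 * inner (f t) (v t) + \<sigma> * (2 * inner (S t) (cls N (\<lambda>x. cos (\<phi> t x) * \<phi>t t x))) = 0" for t
  proof -
    have "inner (f t) (v t) = (LINT x|RN N. (- \<sigma>) * (sin (\<phi> t x) * (cos (\<phi> t x) * \<phi>t t x)))"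
      unfolding f_def v_def inner_cls[OF Fn_L2 phit_L2]
      by (rule Bochner_Integration.integral_cong) (simp_all add: Fn_def sin_double)
    then show ?thesis unfolding S_def inner_cls[OF sin_phi_L2 c] by simp
  qed
  ultimately have "\<forall>t. (E has_real_derivative 0) (at t)" by simp
  then have E: "E t = E 0" by (rule DERIV_isconst_all)
  have "SG_energy N \<sigma> (\<phi> t) (\<phi>t t) = 1 / 2 * E t" for t
  proof -
    have sq: "integrable (RN N) (\<lambda>x. (g x)\<^sup>2)" "(norm (cls N g))\<^sup>2 = (LINT x|RN N. (g x)\<^sup>2)" if "g \<in> L2 N" for g
      using that by (simp_all add: L2_def norm_cls L2_norm_def)
    have "(\<Sum>i<N. (norm (p i t))\<^sup>2) = (LINT x|RN N. (\<Sum>i<N. (P i t x)\<^sup>2))"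
      unfolding p_def by (subst Bochner_Integration.integral_sum) (auto intro!: sum.cong simp: sq P_L2)
    moreover have "integrable (RN N) (\<lambda>x. \<Sum>i<N. (P i t x)\<^sup>2)"
      by (intro Bochner_Integration.integrable_sum sq P_L2) simp
    ultimately show ?thesis
      unfolding SG_energy_def E_def H.energy_def S_def v_def sq(2)[OF phit_L2] sq(2)[OF sin_phi_L2] P_def[symmetric]
      by (simp add: sq(1)[OF phit_L2] sq(1)[OF sin_phi_L2])
  qed
  from this[of t] this[of 0] E show ?thesis by metis
qed

end

section \<open>Comparison of two solutions\<close>

locale SG_pair = S1: SG N \<sigma> \<phi>0 \<phi>1 \<phi> \<phi>t + S2: SG N \<sigma> \<phi>0' \<phi>1' \<phi>' \<phi>t'
  for N \<sigma> \<phi>0 \<phi>1 \<phi> \<phi>t \<phi>0' \<phi>1' \<phi>' \<phi>t'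
begin

definition S where "S t = cls N (\<lambda>x. sin (\<phi> t x - \<phi>' t x))"
text \<open>The squared distance of the two states, as \<open>d_sin_X\<close> confirms. It uses the
  sine of the difference because the difference itself need not be square-integrable when the
  initial data differ.\<close>

definition X where "X t = H.energy N (\<lambda>i t. S1.p i t - S2.p i t) (\<lambda>t. S1.v t - S2.v t) t + (norm (S t))\<^sup>2"

lemma sin_L2: "(\<lambda>x. sin (\<phi> t x - \<phi>' t x)) \<in> L2 N"
  by (rule sin_diff_L2[OF S1.sin_phi_L2 S2.sin_phi_L2 S1.phi_measurable S2.phi_measurable])

lemma z_L2: "(\<lambda>x. \<phi>t t x - \<phi>t' t x) \<in> L2 N"
  by (rule L2_diff[OF S1.phit_L2 S2.phit_L2])

lemma z_cls: "cls N (\<lambda>x. \<phi>t t x - \<phi>t' t x) = S1.v t - S2.v t"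
  by (simp add: S1.v_def S2.v_def cls_diff[OF S1.phit_L2 S2.phit_L2])

lemma c_L2: "(\<lambda>x. cos (\<phi> t x - \<phi>' t x) * (\<phi>t t x - \<phi>t' t x)) \<in> L2 N"
  by (rule L2_mult_bounded[OF z_L2 _ abs_cos_le_one]) (use S1.phi_measurable S2.phi_measurable in measurable)

text \<open>\<open>Nemytskii_deriv\<close> for u = \<phi> - \<phi>', of which only the time
  increments are known to be in L^2.\<close>

lemma S_deriv: "(S has_vector_derivative cls N (\<lambda>x. cos (\<phi> t x - \<phi>' t x) * (\<phi>t t x - \<phi>t' t x))) (at t)"
proof -
  define u where "u s x = \<phi> s x - \<phi>' s x" for s x
  have e: "(\<lambda>x. u s x - u t x) = (\<lambda>x. (\<phi> s x - \<phi> t x) - (\<phi>' s x - \<phi>' t x))" for s by (auto simp: u_def)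
  have L: "(\<lambda>x. u s x - u t x) \<in> L2 N" for s unfolding e by (rule L2_diff[OF S1.dphi_L2 S2.dphi_L2])
  have d: "((\<lambda>s. cls N (\<lambda>x. u s x - u t x)) has_vector_derivative cls N (\<lambda>x. \<phi>t t x - \<phi>t' t x)) (at t)"
    unfolding e z_cls cls_diff[OF S1.dphi_L2 S2.dphi_L2]
    by (intro has_vector_derivative_diff S1.dphi_deriv S2.dphi_deriv)
  have m: "u s \<in> borel_measurable (RN N)" for s
    unfolding u_def[abs_def] using S1.phi_measurable S2.phi_measurable by measurable
  have cl: "\<bar>cos a - cos b\<bar> \<le> 1 * \<bar>a - b\<bar>" for a b :: real
    using abs_cos_diff_le by simp
  have su: "(\<lambda>x. sin (u s x)) \<in> L2 N" for s unfolding u_def by (rule sin_L2)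
  have "((\<lambda>s. cls N (\<lambda>x. sin (u s x) - sin (u t x))) has_vector_derivative cls N (\<lambda>x. cos (u t x) * (\<phi>t t x - \<phi>t' t x))) (at t)"
    by (rule Nemytskii_deriv(1)[OF m L z_L2 d DERIV_sin _ _ abs_cos_le_one cl]) measurable
  from has_vector_derivative_add[OF this[unfolded cls_diff[OF su su]] has_vector_derivative_const[of "cls N (\<lambda>x. sin (u t x))"]]
  show ?thesis by (simp add: u_def S_def[abs_def])
qed

text \<open>sin (2 a) - sin (2 b) = 2 sin (a - b) cos (a + b), and the cosine is at most 1.\<close>

lemma forcing_le: "norm (S1.f t - S2.f t) \<le> \<bar>\<sigma>\<bar> * norm (S t)"
  unfolding S1.f_def S2.f_def S_def cls_diff[OF S1.Fn_L2 S2.Fn_L2, symmetric]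
proof (rule norm_cls_mono[OF L2_diff[OF S1.Fn_L2 S2.Fn_L2] sin_L2 abs_ge_zero])
  fix x
  have "sin (2 * \<phi> t x) - sin (2 * \<phi>' t x) = 2 * sin (\<phi> t x - \<phi>' t x) * cos (\<phi> t x + \<phi>' t x)"
  proof -
    have "(2 * \<phi> t x - 2 * \<phi>' t x) / 2 = \<phi> t x - \<phi>' t x" "(2 * \<phi> t x + 2 * \<phi>' t x) / 2 = \<phi> t x + \<phi>' t x"
      by simp_all
    then show ?thesis by (simp only: sin_diff_sin)
  qed
  then have "S1.Fn t x - S2.Fn t x = - (\<sigma> * sin (\<phi> t x - \<phi>' t x)) * cos (\<phi> t x + \<phi>' t x)"
    by (simp add: S1.Fn_def S2.Fn_def field_simps)
  then have "\<bar>S1.Fn t x - S2.Fn t x\<bar> = \<bar>\<sigma> * sin (\<phi> t x - \<phi>' t x)\<bar> * \<bar>cos (\<phi> t x + \<phi>' t x)\<bar>"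
    by (simp add: abs_mult)
  also have "\<dots> \<le> \<bar>\<sigma> * sin (\<phi> t x - \<phi>' t x)\<bar> * 1" by (intro mult_left_mono) auto
  finally show "\<bar>S1.Fn t x - S2.Fn t x\<bar> \<le> \<bar>\<sigma>\<bar> * \<bar>sin (\<phi> t x - \<phi>' t x)\<bar>" by (simp add: abs_mult)
qed

text \<open>Writing z for the difference of the velocities, the forcing contributes at most 2
  |\<sigma>| |S| |z| to |X'| and the derivative of |S|^2 at most 2 |S| |z|; finally 2 |S| |z| \<le>
  X.\<close>

lemma X_bound: "X t \<le> X 0 * exp ((1 + \<bar>\<sigma>\<bar>) * \<bar>t\<bar>)"
proof (rule Gronwall_two_sided)
  fix t
  let ?D = "cls N (\<lambda>x. cos (\<phi> t x - \<phi>' t x) * (\<phi>t t x - \<phi>t' t x))" and ?V = "S1.v t - S2.v t"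
  show "(X has_real_derivative 2 * inner (S1.f t - S2.f t) ?V + 2 * inner (S t) ?D) (at t)"
    unfolding X_def
    by (intro DERIV_add H.wave_energy[OF H.wave_diff[OF S1.wave S2.wave]] H.inner_self_deriv S_deriv)
  have "norm ?D \<le> 1 * norm ?V"
    unfolding z_cls[symmetric]
  proof (rule norm_cls_mono[OF c_L2 z_L2])
    show "\<bar>cos (\<phi> t x - \<phi>' t x) * (\<phi>t t x - \<phi>t' t x)\<bar> \<le> 1 * \<bar>\<phi>t t x - \<phi>t' t x\<bar>" for x
      unfolding abs_mult by (rule mult_right_mono[OF abs_cos_le_one abs_ge_zero])
  qed simp
  then have 1: "norm (S t) * norm ?D \<le> norm (S t) * norm ?V" by (intro mult_left_mono) auto
  have 2: "norm (S1.f t - S2.f t) * norm ?V \<le> \<bar>\<sigma>\<bar> * norm (S t) * norm ?V"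
    by (rule mult_right_mono[OF forcing_le]) simp
  have "0 \<le> (norm (S t) - norm ?V)\<^sup>2" by simp
  then have 3: "2 * (norm (S t) * norm ?V) \<le> (norm (S t))\<^sup>2 + (norm ?V)\<^sup>2"
    by (simp add: power2_diff algebra_simps)
  have 4: "(norm (S t))\<^sup>2 + (norm ?V)\<^sup>2 \<le> X t" by (simp add: X_def H.energy_def sum_nonneg)
  have "\<bar>2 * inner (S1.f t - S2.f t) ?V + 2 * inner (S t) ?D\<bar>
      \<le> 2 * (norm (S1.f t - S2.f t) * norm ?V) + 2 * (norm (S t) * norm ?D)"
    using Cauchy_Schwarz_ineq2[of "S1.f t - S2.f t" ?V] Cauchy_Schwarz_ineq2[of "S t" ?D] by linarith
  also have "\<dots> \<le> 2 * (\<bar>\<sigma>\<bar> * norm (S t) * norm ?V) + 2 * (norm (S t) * norm ?V)" using 1 2 by linarith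
  also have "\<dots> = (1 + \<bar>\<sigma>\<bar>) * (2 * (norm (S t) * norm ?V))" by (simp add: algebra_simps)
  also have "\<dots> \<le> (1 + \<bar>\<sigma>\<bar>) * X t" using 3 4 by (intro mult_left_mono) auto
  finally show "\<bar>2 * inner (S1.f t - S2.f t) ?V + 2 * inner (S t) ?D\<bar> \<le> (1 + \<bar>\<sigma>\<bar>) * X t" .
qed

lemma d_sin_X: "(d_sin N 1 (\<phi> t) (\<phi>' t))\<^sup>2 + (L2_norm N (\<lambda>x. \<phi>t t x - \<phi>t' t x))\<^sup>2 = X t"
proof -
  have "d_sin N 1 (\<phi> t) (\<phi>' t) = sqrt ((norm (S t))\<^sup>2 + (\<Sum>i<N. (norm (S1.p i t - S2.p i t))\<^sup>2))"
    unfolding S_def S1.p_def S2.p_def S1.P_def S2.P_def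
    by (rule d_sin_1[OF sin_L2]) (simp_all add: S1.P_L2 S2.P_L2 flip: S1.P_def S2.P_def)
  then show ?thesis by (simp add: X_def H.energy_def sum_nonneg norm_cls[OF z_L2, symmetric] z_cls)
qed

lemma S_0: "(\<lambda>x. sin (\<phi>0 x - \<phi>0' x)) \<in> L2 N" "S 0 = cls N (\<lambda>x. sin (\<phi>0 x - \<phi>0' x))"
proof -
  show L: "(\<lambda>x. sin (\<phi>0 x - \<phi>0' x)) \<in> L2 N"
    by (rule sin_diff_L2[OF S1.phi0(2) S2.phi0(2) L1_locD[OF S1.phi0(1)] L1_locD[OF S2.phi0(1)]])
  have "AE x in RN N. sin (\<phi> 0 x - \<phi>' 0 x) = sin (\<phi>0 x - \<phi>0' x)"
    using S1.sol_parts(5) S2.sol_parts(5) by eventually_elim simp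
  then show "S 0 = cls N (\<lambda>x. sin (\<phi>0 x - \<phi>0' x))"
    unfolding S_def using cls_cong[OF L L2_measurable[OF sin_L2]] by blast
qed

lemma d_sin_X_0: "(d_sin N 1 \<phi>0 \<phi>0')\<^sup>2 + (L2_norm N (\<lambda>x. \<phi>1 x - \<phi>1' x))\<^sup>2 = X 0"
proof -
  have "d_sin N 1 \<phi>0 \<phi>0' = sqrt ((norm (S 0))\<^sup>2 +
      (\<Sum>i<N. (norm (cls N (weak_deriv N [i] \<phi>0) - cls N (weak_deriv N [i] \<phi>0')))\<^sup>2))"
    unfolding S_0(2) by (rule d_sin_1[OF S_0(1) Hsin_weak_deriv(1)[OF S1.d0] Hsin_weak_deriv(1)[OF S2.d0]])
  then show ?thesis
    by (simp add: X_def H.energy_def sum_nonneg norm_cls[OF L2_diff[OF S1.d1 S2.d1], symmetric]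
        cls_diff[OF S1.d1 S2.d1] S1.v_0 S2.v_0 S1.p_0 S2.p_0)
qed

text \<open>X is a sum of squares while the claim concerns a sum of norms: the factor 2 is from (a +
  b)^2 \<le> 2 (a^2 + b^2), the outer root from undoing the squares. The constant is independent of
  N.\<close>

theorem stability:
  assumes t: "\<bar>t\<bar> \<le> T"
  shows "d_sin N 1 (\<phi> t) (\<phi>' t) + L2_norm N (\<lambda>x. \<phi>t t x - \<phi>t' t x)
    \<le> sqrt (2 * exp ((1 + \<bar>\<sigma>\<bar>) * T)) * (d_sin N 1 \<phi>0 \<phi>0' + L2_norm N (\<lambda>x. \<phi>1 x - \<phi>1' x))"
proof -
  have sq: "(a + b)\<^sup>2 \<le> 2 * (a\<^sup>2 + b\<^sup>2)" for a b :: real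
    using zero_le_power2[of "a - b"] by (simp add: power2_eq_square algebra_simps)
  have sq': "a\<^sup>2 + b\<^sup>2 \<le> (a + b)\<^sup>2" if "0 \<le> a" "0 \<le> b" for a b :: real
    using that by (simp add: power2_sum)
  have nn: "0 \<le> d_sin N 1 a b" "0 \<le> L2_norm N c" for a b c
    by (simp_all add: d_sin_def L2_norm_def sum_nonneg)
  have "(d_sin N 1 (\<phi> t) (\<phi>' t) + L2_norm N (\<lambda>x. \<phi>t t x - \<phi>t' t x))\<^sup>2 \<le> 2 * X t"
    unfolding d_sin_X[symmetric] by (rule sq)
  also have "\<dots> \<le> 2 * (X 0 * exp ((1 + \<bar>\<sigma>\<bar>) * T))"
  proof -
    have "0 \<le> X 0" by (simp add: X_def H.energy_nonneg)
    moreover have "exp ((1 + \<bar>\<sigma>\<bar>) * \<bar>t\<bar>) \<le> exp ((1 + \<bar>\<sigma>\<bar>) * T)" using t by (simp add: mult_left_mono)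
    ultimately have "X 0 * exp ((1 + \<bar>\<sigma>\<bar>) * \<bar>t\<bar>) \<le> X 0 * exp ((1 + \<bar>\<sigma>\<bar>) * T)" by (rule mult_left_mono[rotated])
    then show ?thesis using X_bound[of t] by linarith
  qed
  also have "\<dots> = 2 * exp ((1 + \<bar>\<sigma>\<bar>) * T) * X 0" by simp
  also have "\<dots> \<le> 2 * exp ((1 + \<bar>\<sigma>\<bar>) * T) * (d_sin N 1 \<phi>0 \<phi>0' + L2_norm N (\<lambda>x. \<phi>1 x - \<phi>1' x))\<^sup>2"
    unfolding d_sin_X_0[symmetric] by (intro mult_left_mono sq' nn) simp
  also have "\<dots> = (sqrt (2 * exp ((1 + \<bar>\<sigma>\<bar>) * T)) * (d_sin N 1 \<phi>0 \<phi>0' + L2_norm N (\<lambda>x. \<phi>1 x - \<phi>1' x)))\<^sup>2"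
    unfolding power_mult_distrib by simp
  finally show ?thesis by (rule power2_le_imp_le) (intro mult_nonneg_nonneg add_nonneg_nonneg nn, simp)
qed

text \<open>Vanishing of sin (\<phi> - \<phi>') alone would leave multiples of pi undetermined.
  Equality is drawn from the velocities: they agree at all times, and the displacements are their
  time integrals.\<close>

lemma unique:
  assumes "\<phi>0 = \<phi>0'" "\<phi>1 = \<phi>1'"
  shows "AE x in RN N. \<phi>' t x = \<phi> t x" "AE x in RN N. \<phi>t' t x = \<phi>t t x"
proof -
  have "X 0 = 0" unfolding X_def H.energy_def S_0(2) using assms
    by (simp add: S1.v_0 S2.v_0 S1.p_0 S2.p_0 cls_0)
  then have "X s \<le> 0" for s using X_bound[of s] by simp
  moreover have "(norm (S1.v s - S2.v s))\<^sup>2 \<le> X s" for s by (simp add: X_def H.energy_def sum_nonneg)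
  ultimately have "(norm (S1.v s - S2.v s))\<^sup>2 \<le> 0" for s using order_trans by blast
  then have v: "S1.v s = S2.v s" for s by simp
  then show "AE x in RN N. \<phi>t' t x = \<phi>t t x"
    using cls_eq_iff[OF S2.phit_L2 S1.phit_L2, of t t] v[of t] by (simp add: S1.v_def S2.v_def)
  have "S1.v = S2.v" using v by (rule ext)
  then have "S2.w t = S1.w t" by (simp only: S1.w_eq S2.w_eq)
  then have "AE x in RN N. \<phi>' t x - \<phi>' 0 x = \<phi> t x - \<phi> 0 x"
    using cls_eq_iff[OF S2.dphi_L2 S1.dphi_L2, of t 0 t 0] by (simp add: S1.w_def S2.w_def)
  then show "AE x in RN N. \<phi>' t x = \<phi> t x"
    using S1.sol_parts(5) S2.sol_parts(5) by eventually_elim (use assms in simp)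
qed

end

section \<open>Regularity\<close>

lemma multi_indices_2:
  "is \<in> multi_indices N 2 \<Longrightarrow> is = [] \<or> (\<exists>i<N. is = [i]) \<or> (\<exists>i<N. \<exists>j<N. is = [i, j])"
  by (cases "is" rule: list.exhaust[case_product list.exhaust]; cases "tl is"; cases "tl (tl is)")
    (auto simp: multi_indices_def)

text \<open>The test function is first \<partial>_j \<psi>, which moves the direction i onto u, and
  then \<psi>, which moves the direction j onto g.\<close>

lemma has_weak_deriv_Cons:
  assumes w: "has_weak_deriv N [i] u g" "has_weak_deriv N [j] g h" and j: "j < N"
  shows "has_weak_deriv N [i, j] u h"
proof (rule has_weak_derivI[OF has_weak_derivD(1)[OF w(1)] has_weak_derivD(2)[OF w(2)]])
  fix \<psi> assume p: "\<psi> \<in> test_fun N"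
  show "(LINT x|RN N. u x * partials [i, j] \<psi> x) = (-1) ^ length [i, j] * (LINT x|RN N. h x * \<psi> x)"
    using has_weak_derivD(3)[OF w(1) test_fun_partial[OF p j]] has_weak_derivD(3)[OF w(2) p] by simp
qed

lemma continuous_on_prj: "continuous_on UNIV u \<Longrightarrow> continuous_on UNIV (\<lambda>t. cls N (rep N (u t)))"
  unfolding prj_def[symmetric] by (rule bounded_linear.continuous_on[OF prj_bl])

context SG
begin

text \<open>The derivative of the force - \<sigma> / 2 sin (2 r), left unsimplified to match
  \<open>sin_deriv_facts\<close>.\<close>

definition C where "C r = - \<sigma> / 2 * 2 * cos (2 * r)"
definition f' where "f' j t = cls N (\<lambda>x. C (\<phi> t x) * P j t x)"

lemma C_bounds:
  obtains B where "0 \<le> B" "\<And>r. \<bar>C r\<bar> \<le> B" "\<And>a b. \<bar>C a - C b\<bar> \<le> B * \<bar>a - b\<bar>"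
proof -
  note s = sin_deriv_facts(2,3)[of "- \<sigma> / 2" 2, folded C_def]
  show ?thesis by (rule that[OF _ s(1) s(2)]) simp
qed

lemma C_measurable: "u \<in> borel_measurable M \<Longrightarrow> (\<lambda>x. C (u x)) \<in> borel_measurable M"
  unfolding C_def by measurable

text \<open>The chain rule in space: \<open>Nemytskii_deriv\<close> with the translation parameter
  in the role of time. The translation increments of \<open>\<phi> t\<close> are in L^2 by
  \<open>translate_weak_deriv\<close>.\<close>

lemma gen_f:
  assumes j: "j < N"
  shows "H.gen j (f t) (f' j t)"
proof -
  obtain B where B: "\<And>r. \<bar>C r\<bar> \<le> B" "\<And>a b. \<bar>C a - C b\<bar> \<le> B * \<bar>a - b\<bar>" using C_bounds by metis
  define y where "y s x = \<phi> t (shift j s N x)" for s x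
  have y0: "y 0 = \<phi> t" by (simp add: y_def fun_eq_iff)
  note T = translate_weak_deriv[OF P_wd[OF j] P_L2[OF j] j, of t]
  have m: "y s \<in> borel_measurable (RN N)" for s
    unfolding y_def[abs_def] by (rule L1_locD[OF L1_loc_shift[OF phi_L1]])
  have d: "(\<lambda>x. y s x - y 0 x) \<in> L2 N" for s unfolding y0 by (unfold y_def, rule T(1))
  have dy: "((\<lambda>s. cls N (\<lambda>x. y s x - y 0 x)) has_vector_derivative cls N (P j t)) (at 0)"
    unfolding y0 by (unfold y_def, rule T(2))
  have g: "((\<lambda>r. - \<sigma> / 2 * sin (2 * r)) has_real_derivative C r) (at r)" for r
    unfolding C_def by (rule sin_deriv_facts(1))
  have mC: "C \<in> borel_measurable borel" unfolding C_def[abs_def] by measurable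
  have mg: "(\<lambda>r. - \<sigma> / 2 * sin (2 * r)) \<in> borel_measurable borel" by measurable
  note Nm = Nemytskii_deriv[OF m d P_L2[OF j] dy g mg mC B]
  have F: "- \<sigma> / 2 * sin (2 * y s x) = Fn t (shift j s N x)" for s x
    by (simp add: Fn_def y_def)
  have L: "(\<lambda>x. Fn t (shift j s N x)) \<in> L2 N" for s
    using L2_add[OF Nm(2)[of s, unfolded F shift_0] Fn_L2[of t]] by simp
  have tf: "tau j s (f t) = cls N (\<lambda>x. Fn t (shift j s N x))" for s
    unfolding f_def by (rule tau_cls[OF Fn_L2])
  have "cls N (\<lambda>x. Fn t (shift j s N x) - Fn t x) = tau j s (f t) - f t" for s
    unfolding tf unfolding f_def by (rule cls_diff[OF L Fn_L2])
  then have "((\<lambda>s. tau j s (f t) - f t) has_vector_derivative f' j t) (at 0)"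
    using Nm(1) unfolding F shift_0 f'_def by (simp add: y0)
  from has_vector_derivative_add[OF this has_vector_derivative_const[of "f t"]]
  show ?thesis by (simp add: H.gen_def)
qed

text \<open>The increment of the product C (\<phi>) P is C times an increment of P plus an increment
  of C times a fixed P. The first part is bounded by continuity of p, the second is a case of
  \<open>mult_L2_tendsto_0\<close>.\<close>

lemma f'_cont:
  assumes j: "j < N"
  shows "continuous_on UNIV (f' j)"
  unfolding continuous_on_iff_norm
proof
  fix t
  obtain B where B: "0 \<le> B" "\<And>r. \<bar>C r\<bar> \<le> B" "\<And>a b. \<bar>C a - C b\<bar> \<le> B * \<bar>a - b\<bar>" using C_bounds by metis
  have mC: "(\<lambda>x. C (\<phi> s x)) \<in> borel_measurable (RN N)" for s by (rule C_measurable[OF phi_measurable])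
  note P = P_L2[OF j]
  define m where "m s x = C (\<phi> s x) - C (\<phi> t x)" for s x
  have mm: "m s \<in> borel_measurable (RN N)" for s unfolding m_def[abs_def] using mC by measurable
  have m1: "\<bar>m s x\<bar> \<le> 2 * B" for s x using B(2)[of "\<phi> s x"] B(2)[of "\<phi> t x"] unfolding m_def by linarith
  have m2: "\<bar>m s x\<bar> \<le> 2 * B * \<bar>\<phi> s x - \<phi> t x\<bar>" for s x
    using B(3)[of "\<phi> s x" "\<phi> t x"] mult_nonneg_nonneg[OF B(1) abs_ge_zero, of "\<phi> s x - \<phi> t x"] unfolding m_def by linarith
  have "isCont (\<lambda>s. cls N (\<lambda>x. \<phi> s x - \<phi> t x)) t" by (rule has_vector_derivative_continuous[OF dphi_deriv])
  then have lim0: "((\<lambda>s. norm (cls N (\<lambda>x. \<phi> s x - \<phi> t x))) \<longlongrightarrow> 0) (at t)"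
    by (simp add: isCont_def tendsto_norm_zero_iff cls_0)
  have r2: "((\<lambda>s. norm (cls N (\<lambda>x. m s x * P j t x))) \<longlongrightarrow> 0) (at t)"
    by (rule mult_L2_tendsto_0[OF P mm dphi_L2 m1 m2 lim0])
  have "((\<lambda>s. norm (p j s - p j t)) \<longlongrightarrow> 0) (at t)"
    using p_cont[OF j] by (simp add: continuous_on_iff_norm)
  then have r1: "((\<lambda>s. B * norm (p j s - p j t)) \<longlongrightarrow> B * 0) (at t)" by (intro tendsto_mult tendsto_const)
  have le: "norm (norm (f' j s - f' j t)) \<le> B * norm (p j s - p j t) + norm (cls N (\<lambda>x. m s x * P j t x))" for s
  proof -
    have L1: "(\<lambda>x. C (\<phi> s x) * (P j s x - P j t x)) \<in> L2 N" by (rule L2_mult_bounded[OF L2_diff[OF P P] mC B(2)])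
    have L2: "(\<lambda>x. m s x * P j t x) \<in> L2 N" by (rule L2_mult_bounded[OF P mm m1])
    have L: "(\<lambda>x. C (\<phi> r x) * P j r x) \<in> L2 N" for r by (rule L2_mult_bounded[OF P mC B(2)])
    have "f' j s - f' j t = cls N (\<lambda>x. C (\<phi> s x) * P j s x - C (\<phi> t x) * P j t x)"
      unfolding f'_def by (rule cls_diff[OF L L, symmetric])
    also have "\<dots> = cls N (\<lambda>x. C (\<phi> s x) * (P j s x - P j t x) + m s x * P j t x)"
      by (rule arg_cong[where f="cls N"], rule ext) (simp add: m_def algebra_simps)
    also have "\<dots> = cls N (\<lambda>x. C (\<phi> s x) * (P j s x - P j t x)) + cls N (\<lambda>x. m s x * P j t x)"
      by (rule cls_add[OF L1 L2])
    finally have e: "f' j s - f' j t = cls N (\<lambda>x. C (\<phi> s x) * (P j s x - P j t x)) + cls N (\<lambda>x. m s x * P j t x)" .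
    have "norm (cls N (\<lambda>x. C (\<phi> s x) * (P j s x - P j t x))) \<le> B * norm (cls N (\<lambda>x. P j s x - P j t x))"
      by (rule norm_cls_mono[OF L1 L2_diff[OF P P] B(1)]) (unfold abs_mult, rule mult_right_mono[OF B(2) abs_ge_zero])
    then have "norm (cls N (\<lambda>x. C (\<phi> s x) * (P j s x - P j t x))) \<le> B * norm (p j s - p j t)"
      by (simp add: cls_diff[OF P P] p_def)
    then show ?thesis unfolding e real_norm_def abs_norm_cancel by (intro order_trans[OF norm_triangle_ineq] add_right_mono)
  qed
  show "((\<lambda>s. norm (f' j s - f' j t)) \<longlongrightarrow> 0) (at t)"
    by (rule Lim_null_comparison[OF always_eventually[OF allI[OF le]]]) (use tendsto_add[OF r1 r2] in simp)
qed

lemma Sob_gen: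
  assumes g: "g \<in> Sob N 1" and j: "j < N"
  shows "\<exists>y. H.gen j (cls N g) y"
proof -
  obtain h where "h \<in> L2 N" "has_weak_deriv N [j] g h" using Sob_deriv[of g N 0 j] g j by auto
  then show ?thesis using weak_deriv_imp_gen[of N j g h] g Sob_0_L2(2) j by blast
qed

lemma gen_p0:
  assumes h: "\<phi>0 \<in> Hsin N 2" and i: "i < N" and j: "j < N"
  shows "\<exists>y. H.gen j (p i 0) y"
proof -
  obtain g where g: "g \<in> Sob N 1" "has_weak_deriv N [i] \<phi>0 g" using h i by (auto simp: Hsin_def)
  have "p i 0 = cls N g" unfolding p_0[OF i] using weak_deriv_cls(2)[OF g(2)] g(1) Sob_0_L2(2) by blast
  then show ?thesis using Sob_gen[OF g(1) j] by simp
qed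

lemma gen_v0: "\<phi>1 \<in> Sob N 1 \<Longrightarrow> j < N \<Longrightarrow> \<exists>y. H.gen j (v 0) y"
  unfolding v_0 by (rule Sob_gen)

text \<open>The additional regularity puts the initial data into the domains of the generators, so
  \<open>H.wave_regular\<close> yields one differentiated system for each direction j.\<close>

lemma derived_waves:
  assumes h: "\<phi>0 \<in> Hsin N 2" "\<phi>1 \<in> Sob N 1"
  obtains Q U where "\<And>j. j < N \<Longrightarrow> H.wave N (Q j) (U j) (f' j)"
    "\<And>i j t. i < N \<Longrightarrow> j < N \<Longrightarrow> H.gen j (p i t) (Q j i t)" "\<And>j t. j < N \<Longrightarrow> H.gen j (v t) (U j t)"
proof -
  have "\<exists>Q U. H.wave N Q U (f' j) \<and> (\<forall>t. \<forall>i<N. H.gen j (p i t) (Q i t)) \<and> (\<forall>t. H.gen j (v t) (U t))" if j: "j < N" for j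
  proof -
    obtain p' where p': "\<And>i. i < N \<Longrightarrow> H.gen j (p i 0) (p' i)" using gen_p0[OF h(1) _ j] by metis
    obtain v' where v': "H.gen j (v 0) v'" using gen_v0[OF h(2) j] by blast
    show ?thesis by (rule H.wave_regular[OF wave p' v' gen_f[OF j] f'_cont[OF j]])
  qed
  then have "\<forall>j. \<exists>Q U. j < N \<longrightarrow> H.wave N Q U (f' j) \<and> (\<forall>t. \<forall>i<N. H.gen j (p i t) (Q i t)) \<and> (\<forall>t. H.gen j (v t) (U t))"
    by blast
  then obtain Q where "\<forall>j. \<exists>U. j < N \<longrightarrow> H.wave N (Q j) U (f' j) \<and> (\<forall>t. \<forall>i<N. H.gen j (p i t) (Q j i t)) \<and> (\<forall>t. H.gen j (v t) (U t))"
    by (rule choice[THEN exE])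
  then obtain U where "\<forall>j. j < N \<longrightarrow> H.wave N (Q j) (U j) (f' j) \<and> (\<forall>t. \<forall>i<N. H.gen j (p i t) (Q j i t)) \<and> (\<forall>t. H.gen j (v t) (U j t))"
    by (rule choice[THEN exE])
  then show ?thesis by (intro that[of Q U]) auto
qed

text \<open>Second spatial derivatives of \<phi> are generators applied to p, and their continuity
  in time is that of the differentiated systems.\<close>

theorem regularity:
  assumes h: "\<phi>0 \<in> Hsin N 2" "\<phi>1 \<in> Sob N 1"
  shows "C0_Sob N 2 (\<lambda>t x. \<phi> t x - \<phi>0 x)" "C0_Sob N 1 \<phi>t"
    "\<exists>\<phi>tt. has_time_deriv N \<phi>t \<phi>tt \<and> C0_L2 N \<phi>tt"
proof -
  obtain Q U where QU: "\<And>j. j < N \<Longrightarrow> H.wave N (Q j) (U j) (f' j)"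
    and gp: "\<And>i j t. i < N \<Longrightarrow> j < N \<Longrightarrow> H.gen j (p i t) (Q j i t)"
    and gv: "\<And>j t. j < N \<Longrightarrow> H.gen j (v t) (U j t)"
    using derived_waves[OF h] by metis
  note cQ = H.waveD(1)[OF QU] and cU = H.waveD(2)[OF QU]
  have D1: "has_weak_deriv N [i] (\<lambda>x. \<phi> t x - \<phi>0 x) (\<lambda>x. P i t x - G0 i x)" if "i < N" for i t
    by (rule has_weak_deriv_diff[OF _ P_wd[OF that] G0(2)[OF that]]) (use that in simp)
  have L1: "(\<lambda>x. P i t x - G0 i x) \<in> L2 N" if "i < N" for i t by (rule L2_diff[OF P_L2[OF that] G0(1)[OF that]])
  have c1: "cls N (\<lambda>x. P i t x - G0 i x) = p i t - p i 0" if "i < N" for i t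
    unfolding cls_diff[OF P_L2[OF that] G0(1)[OF that]] p_0[OF that] p_def[of i t] by (simp add: G0_def)
  show "C0_Sob N 2 (\<lambda>t x. \<phi> t x - \<phi>0 x)"
  proof (rule C0_SobI[OF D_L2])
    fix "is" assume "is \<in> multi_indices N 2"
    then consider "is = []" | i where "i < N" "is = [i]" | i j where "i < N" "j < N" "is = [i, j]"
      using multi_indices_2 by blast
    then show "\<exists>G. (\<forall>t. G t \<in> L2 N \<and> has_weak_deriv N is (\<lambda>x. \<phi> t x - \<phi>0 x) (G t)) \<and> continuous_on UNIV (\<lambda>t. cls N (G t))"
    proof cases
      case 1
      have n: "has_weak_deriv N [] (\<lambda>x. \<phi> t x - \<phi>0 x) (\<lambda>x. \<phi> t x - \<phi>0 x)" for t
        by (rule has_weak_deriv_nil[OF L2_L1_loc[OF D_L2]])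
      have "continuous_on UNIV (\<lambda>t. cls N (\<lambda>x. \<phi> t x - \<phi>0 x))"
        by (rule C0_SobD[OF sol_parts(1) _ D_L2 n]) (simp add: multi_indices_def)
      then show ?thesis unfolding 1 using D_L2 n by (intro exI[of _ "\<lambda>t x. \<phi> t x - \<phi>0 x"]) blast
    next
      case (2 i)
      have "continuous_on UNIV (\<lambda>t. cls N (\<lambda>x. P i t x - G0 i x))"
        unfolding c1[OF 2(1)] by (intro continuous_on_diff p_cont[OF 2(1)] continuous_on_const)
      then show ?thesis unfolding 2(2) using D1[OF 2(1)] L1[OF 2(1)]
        by (intro exI[of _ "\<lambda>t x. P i t x - G0 i x"]) blast
    next
      case (3 i j)
      have "has_weak_deriv N [j] (\<lambda>x. P i t x - G0 i x) (rep N (Q j i t - Q j i 0))" for t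
        by (rule gen_imp_weak_deriv[OF L1[OF 3(1)] 3(2)])
          (unfold c1[OF 3(1)], rule H.gen_diff[OF gp[OF 3(1,2)] gp[OF 3(1,2)]])
      then have "has_weak_deriv N is (\<lambda>x. \<phi> t x - \<phi>0 x) (rep N (Q j i t - Q j i 0))" for t
        unfolding 3(3) by (rule has_weak_deriv_Cons[OF D1[OF 3(1)] _ 3(2)])
      moreover have "continuous_on UNIV (\<lambda>t. cls N (rep N (Q j i t - Q j i 0)))"
        by (intro continuous_on_prj continuous_on_diff cQ[OF 3(2,1)] continuous_on_const)
      ultimately show ?thesis using rep_L2 by (intro exI[of _ "\<lambda>t. rep N (Q j i t - Q j i 0)"]) blast
    qed
  qed
  show "C0_Sob N 1 \<phi>t"
  proof (rule C0_SobI[OF phit_L2])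
    fix "is" assume "is \<in> multi_indices N 1"
    then consider "is = []" | j where "j < N" "is = [j]" using multi_indices_1 by blast
    then show "\<exists>G. (\<forall>t. G t \<in> L2 N \<and> has_weak_deriv N is (\<phi>t t) (G t)) \<and> continuous_on UNIV (\<lambda>t. cls N (G t))"
    proof cases
      case 1
      then show ?thesis
        using v_cont phit_L2 has_weak_deriv_nil[OF L2_L1_loc[OF phit_L2]] unfolding v_def[abs_def] by blast
    next
      case (2 j)
      have "has_weak_deriv N is (\<phi>t t) (rep N (U j t))" for t
        unfolding 2(2) by (rule gen_imp_weak_deriv[OF phit_L2 2(1)]) (use gv[OF 2(1)] in \<open>simp add: v_def\<close>)
      moreover have "continuous_on UNIV (\<lambda>t. cls N (rep N (U j t)))" by (rule continuous_on_prj[OF cU[OF 2(1)]])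
      ultimately show ?thesis using rep_L2 by (intro exI[of _ "\<lambda>t. rep N (U j t)"]) blast
    qed
  qed
  \<comment> \<open>The force plus the Laplacian of \<phi>, that is, the second time
    derivative.\<close>
  define a where "a t = f t + (\<Sum>i<N. Q i i t)" for t
  have dv: "(v has_vector_derivative a t) (at t)" for t
    unfolding a_def by (rule H.wave_deriv[OF wave]) (use gp cQ in auto)
  have ca: "continuous_on UNIV a"
    unfolding a_def by (intro continuous_on_add f_cont continuous_on_sum cQ) auto
  have "has_time_deriv N \<phi>t (\<lambda>t. rep N (a t))"
    unfolding has_time_deriv_iff[where r=0]
  proof (intro conjI allI rep_L2 L2_diff phit_L2)
    fix t
    have "((\<lambda>s. prj N (v s - v 0)) has_vector_derivative prj N (a t - 0)) (at t)"
      by (intro bounded_linear.has_vector_derivative[OF prj_bl] has_vector_derivative_diff has_vector_derivative_const dv)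
    moreover have "prj N (v s - v 0) = cls N (\<lambda>x. \<phi>t s x - \<phi>t 0 x)" for s
      unfolding v_def cls_diff[OF phit_L2 phit_L2, symmetric] by (rule prj_cls[OF L2_diff[OF phit_L2 phit_L2]])
    ultimately show "((\<lambda>s. cls N (\<lambda>x. \<phi>t s x - \<phi>t 0 x)) has_vector_derivative cls N (rep N (a t))) (at t)"
      by (simp add: prj_def)
  qed
  moreover have "C0_L2 N (\<lambda>t. rep N (a t))"
    unfolding C0_L2_iff by (intro conjI allI rep_L2 continuous_on_prj ca)
  ultimately show "\<exists>\<phi>tt. has_time_deriv N \<phi>t \<phi>tt \<and> C0_L2 N \<phi>tt" by blast
qed

end

text \<open>\<open>A\<close> is chosen before \<open>N\<close>, since it may depend on \<sigma> and
  T only. Stability, regularity and conservation of energy are stated for any solution with the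
  given data, which the first part shows to be the unique one.\<close>

theorem theorem3:
  fixes \<sigma> :: real
  assumes "\<sigma> \<noteq> 0"
  shows
    "(\<forall>N\<ge>1. \<forall>\<phi>0\<in>Hsin N 1. \<forall>\<phi>1\<in>L2 N.
        \<exists>\<phi> \<phi>t. SG_solution N \<sigma> \<phi>0 \<phi>1 \<phi> \<phi>t \<and>
          (\<forall>\<phi>' \<phi>t'. SG_solution N \<sigma> \<phi>0 \<phi>1 \<phi>' \<phi>t' \<longrightarrow>
             (\<forall>t. (AE x in RN N. \<phi>' t x = \<phi> t x) \<and> (AE x in RN N. \<phi>t' t x = \<phi>t t x)))) \<and>
     (\<forall>T>0. \<exists>A>0. \<forall>N\<ge>1.
        \<forall>\<phi>0\<in>Hsin N 1. \<forall>\<phi>1\<in>L2 N. \<forall>\<phi>0'\<in>Hsin N 1. \<forall>\<phi>1'\<in>L2 N. \<forall>\<phi> \<phi>t \<phi>' \<phi>t'.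
          SG_solution N \<sigma> \<phi>0 \<phi>1 \<phi> \<phi>t \<longrightarrow> SG_solution N \<sigma> \<phi>0' \<phi>1' \<phi>' \<phi>t' \<longrightarrow>
          (\<forall>t\<in>{-T..T}.
             d_sin N 1 (\<phi> t) (\<phi>' t) + L2_norm N (\<lambda>x. \<phi>t t x - \<phi>t' t x)
             \<le> A * (d_sin N 1 \<phi>0 \<phi>0' + L2_norm N (\<lambda>x. \<phi>1 x - \<phi>1' x)))) \<and>
     (\<forall>N\<ge>1. \<forall>\<phi>0\<in>Hsin N 1. \<forall>\<phi>1\<in>L2 N. \<forall>\<phi> \<phi>t.
        SG_solution N \<sigma> \<phi>0 \<phi>1 \<phi> \<phi>t \<longrightarrow> \<phi>0 \<in> Hsin N 2 \<longrightarrow> \<phi>1 \<in> Sob N 1 \<longrightarrow>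
          C0_Sob N 2 (\<lambda>t x. \<phi> t x - \<phi>0 x) \<and> C0_Sob N 1 \<phi>t \<and>
          (\<exists>\<phi>tt. has_time_deriv N \<phi>t \<phi>tt \<and> C0_L2 N \<phi>tt)) \<and>
     (\<forall>N\<ge>1. \<forall>\<phi>0\<in>Hsin N 1. \<forall>\<phi>1\<in>L2 N. \<forall>\<phi> \<phi>t.
        SG_solution N \<sigma> \<phi>0 \<phi>1 \<phi> \<phi>t \<longrightarrow>
          (\<forall>t. SG_energy N \<sigma> (\<phi> t) (\<phi>t t) = SG_energy N \<sigma> (\<phi> 0) (\<phi>t 0)))"
  (is "?existence \<and> ?stability \<and> ?regularity \<and> ?energy")
proof (intro conjI)
  show ?existence
  proof (intro allI impI ballI)
    fix N \<phi>0 \<phi>1 assume d: "\<phi>0 \<in> Hsin N 1" "\<phi>1 \<in> L2 N"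
    obtain \<phi> \<phi>t where s: "SG_solution N \<sigma> \<phi>0 \<phi>1 \<phi> \<phi>t" using SG_exists[OF d] by blast
    have "(AE x in RN N. \<phi>' t x = \<phi> t x) \<and> (AE x in RN N. \<phi>t' t x = \<phi>t t x)"
      if s': "SG_solution N \<sigma> \<phi>0 \<phi>1 \<phi>' \<phi>t'" for \<phi>' \<phi>t' t
    proof -
      interpret SG_pair N \<sigma> \<phi>0 \<phi>1 \<phi> \<phi>t \<phi>0 \<phi>1 \<phi>' \<phi>t'
        by (intro SG_pair.intro SG.intro s s' d)
      show ?thesis using unique by blast
    qed
    with s show "\<exists>\<phi> \<phi>t. SG_solution N \<sigma> \<phi>0 \<phi>1 \<phi> \<phi>t \<and>
          (\<forall>\<phi>' \<phi>t'. SG_solution N \<sigma> \<phi>0 \<phi>1 \<phi>' \<phi>t' \<longrightarrow>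
             (\<forall>t. (AE x in RN N. \<phi>' t x = \<phi> t x) \<and> (AE x in RN N. \<phi>t' t x = \<phi>t t x)))" by blast
  qed
  show ?stability
  proof (intro allI impI exI conjI ballI)
    fix T :: real
    show "0 < sqrt (2 * exp ((1 + \<bar>\<sigma>\<bar>) * T))" by simp
    fix N \<phi>0 \<phi>1 \<phi>0' \<phi>1' \<phi> \<phi>t \<phi>' \<phi>t' and t :: real
    assume d: "\<phi>0 \<in> Hsin N 1" "\<phi>1 \<in> L2 N" "\<phi>0' \<in> Hsin N 1" "\<phi>1' \<in> L2 N"
      and s: "SG_solution N \<sigma> \<phi>0 \<phi>1 \<phi> \<phi>t" "SG_solution N \<sigma> \<phi>0' \<phi>1' \<phi>' \<phi>t'" and t: "t \<in> {-T..T}"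
    interpret SG_pair N \<sigma> \<phi>0 \<phi>1 \<phi> \<phi>t \<phi>0' \<phi>1' \<phi>' \<phi>t'
      by (intro SG_pair.intro SG.intro s d)
    show "d_sin N 1 (\<phi> t) (\<phi>' t) + L2_norm N (\<lambda>x. \<phi>t t x - \<phi>t' t x)
        \<le> sqrt (2 * exp ((1 + \<bar>\<sigma>\<bar>) * T)) * (d_sin N 1 \<phi>0 \<phi>0' + L2_norm N (\<lambda>x. \<phi>1 x - \<phi>1' x))"
      by (rule stability) (use t in auto)
  qed
  show ?regularity
  proof (intro allI impI ballI)
    fix N \<phi>0 \<phi>1 \<phi> \<phi>t
    assume d: "\<phi>0 \<in> Hsin N 1" "\<phi>1 \<in> L2 N" and s: "SG_solution N \<sigma> \<phi>0 \<phi>1 \<phi> \<phi>t"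
      and h: "\<phi>0 \<in> Hsin N 2" "\<phi>1 \<in> Sob N 1"
    interpret SG N \<sigma> \<phi>0 \<phi>1 \<phi> \<phi>t by (intro SG.intro s d)
    show "C0_Sob N 2 (\<lambda>t x. \<phi> t x - \<phi>0 x) \<and> C0_Sob N 1 \<phi>t \<and> (\<exists>\<phi>tt. has_time_deriv N \<phi>t \<phi>tt \<and> C0_L2 N \<phi>tt)"
      using regularity[OF h] by blast
  qed
  show ?energy
  proof (intro allI impI ballI)
    fix N \<phi>0 \<phi>1 \<phi> \<phi>t and t :: real
    assume d: "\<phi>0 \<in> Hsin N 1" "\<phi>1 \<in> L2 N" and s: "SG_solution N \<sigma> \<phi>0 \<phi>1 \<phi> \<phi>t"
    interpret SG N \<sigma> \<phi>0 \<phi>1 \<phi> \<phi>t by (intro SG.intro s d)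
    show "SG_energy N \<sigma> (\<phi> t) (\<phi>t t) = SG_energy N \<sigma> (\<phi> 0) (\<phi>t 0)" by (rule energy)
  qed
qed

end
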